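(* Let $\{G^n\}$ be a sequence of high degree almost regular graphs. Let $\underline{p}=(p_k)_{k\ge 1}$ satisfy $p_k\ge 0$ for all $k\ge 1$ and $\sum_{k=1}^\infty p_k=1$. Fix $\hat t\in\mathbb{R}_+\cup\{+\infty\}$. Then the random degree constrained process graphs satisfy $$G^n_{\underline{p}}(\hat t)\longrightarrow \bigl(G^\infty_{\underline{p}}(\hat t),\varnothing\bigr)\quad\text{locally in probability as } n\to\infty .$$
   Context: **High degree almost regular.** A sequence of finite, simple, connected graphs $\{G^n\}$ is high degree almost regular if there exist non-negative sequences $r_n,a_n,b_n,c_n$ with $r_n\to\infty$ and $\max\{a_n,b_n,c_n\}\to 0$ as $n\to\infty$ such that for all sufficiently large $n$: (a) at least $(1-a_n)|V(G^n)|$ vertices of $G^n$ have degree in $[(1-b_n)r_n,(1+b_n)r_n]$, and (b) the sum of the degrees in $G^n$ lies in $[(1-c_n)r_n|V(G^n)|,(1+c_n)r_n|V(G^n)|]$. ($G^n$ need not have $n$ vertices; $r_n$ is called the typical degree.) **RDCP on $G^n$.** Each vertex $v\in V(G^n)$ independently gets a random degree constraint $d(v)\sim\underline{p}$, and independently each edge $e\in E(G^n)$ gets an independent activation time $X_e\sim \mathrm{EXP}(1/r_n)$ (exponential with rate $1/r_n$). Start at time $0$ with the empty graph on $V(G^n)$. An edge $e=vw$ is added at its activation time $X_e$ if and only if right before time $X_e$ the degrees of $v$ and $w$ in the current graph are strictly less than $d(v)$ and $d(w)$, respectively. $G^n_{\underline{p}}(t)$ is the graph of all edges added up to time $t$,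 and $G^n_{\underline{p}}(\infty)$ is the final graph, when no more edges can be added. **PWIT.** The Poisson weighted infinite tree is the infinite rooted tree whose vertices are all finite strings of positive integers; the root is the empty string $\varnothing$ and the children of the vertex $\mathbf{i}$ are $\mathbf{i}j$, $j=1,2,\dots$. Independently for each vertex $\mathbf{i}$, let $\tau^{\mathbf{i}1}<\tau^{\mathbf{i}2}<\cdots$ be the points of a unit intensity Poisson point process on $[0,\infty)$; $\tau^{\mathbf{i}j}$ is the label (activation time) of the edge $\{\mathbf{i},\mathbf{i}j\}$. **RDCP on the PWIT.** The vertices of the PWIT get i.i.d. degree constraints $d(\mathbf{i})\sim\underline{p}$, independent of the labels. Edges are tried in increasing order of their labels, and an edge is added at its activation time if and only if both its end-vertices then have degree strictly less than their degree constraint. (This is almost surely well-defined: almost surely there is exactly one set $A$ of edges such that an edge $e=\{v,w\}$ is in $A$ if and only if for each $u\in\{v,w\}$ fewer than $d(u)$ edges of $A$ incident to $u$ have label smaller than that of $e$; $A$ is the set of added edges.) For $t\in\mathbb{R}_+\cup\{+\infty\}$, $G^\infty_{\underline{p}}(t)$ is the connected component of the root $\varnothing$ in the subgraph consisting of the edges added by time $t$. **Local convergence in probability.** A sequence of random graphs $\mathcal{G}^n$ converges locally in probability to a random rooted graph $(\mathcal{G},u)$ if for every rooted graph $(H,v)$ and every integer $R\ge1$, $$\frac{1}{|V(\mathcal{G}^n)|}\sum_{w\in V(\mathcal{G}^n)}\mathbf{1}\{\mathcal{B}^{n,R}(w)\simeq(H,v)\}\ \to\ \mathbb{P}\bigl(\mathcal{B}^R(u)\simeq(H,v)\bigr)\quad\text{in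 probability as } n\to\infty,$$ where $\mathcal{B}^{n,R}(w)$ is the $R$-neighborhood of $w$ in $\mathcal{G}^n$ rooted at $w$, $\mathcal{B}^R(u)$ is the $R$-neighborhood of $u$ in $\mathcal{G}$ rooted at $u$ (both with respect to graph distance), and $\simeq$ is root-preserving isomorphism. *)

theory Defs
  imports "HOL-Probability.Probability"
begin

section \<open>Simple graphs\<close>

text \<open>A graph is a pair of a vertex set and a set of edges, each edge being the set of its two
  end-vertices. Graphs may be infinite unless finiteness is stated.\<close>

type_synonym 'v graph = "'v set \<times> 'v set set"

abbreviation verts :: "'v graph \<Rightarrow> 'v set" where "verts G \<equiv> fst G"
abbreviation edges :: "'v graph \<Rightarrow> 'v set set" where "edges G \<equiv> snd G"

definition simple_graph :: "'v graph \<Rightarrow> bool" where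
  "simple_graph G \<longleftrightarrow> (\<forall>e\<in>edges G. \<exists>u v. e = {u, v} \<and> u \<noteq> v \<and> u \<in> verts G \<and> v \<in> verts G)"

definition adj :: "'v graph \<Rightarrow> ('v \<times> 'v) set" where
  "adj G = {(u, v). {u, v} \<in> edges G}"

definition connected_graph :: "'v graph \<Rightarrow> bool" where
  "connected_graph G \<longleftrightarrow> verts G \<noteq> {} \<and> (\<forall>u\<in>verts G. \<forall>v\<in>verts G. (u, v) \<in> (adj G)\<^sup>*)"

definition graph_degree :: "'v graph \<Rightarrow> 'v \<Rightarrow> nat" where
  "graph_degree G v = card {e \<in> edges G. v \<in> e}"

definition component :: "'v graph \<Rightarrow> 'v \<Rightarrow> 'v graph" where
  "component G u = (let C = {w \<in> verts G. (u, w) \<in> (adj G)\<^sup>*} in (C, {e \<in> edges G. e \<subseteq> C}))"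

text \<open>The distance is \<open>\<infinity>\<close> between different components (infimum of the empty set).\<close>

definition graph_dist :: "'v graph \<Rightarrow> 'v \<Rightarrow> 'v \<Rightarrow> enat" where
  "graph_dist G u w = (INF k \<in> {k. (u, w) \<in> adj G ^^ k}. enat k)"

definition neighborhood :: "nat \<Rightarrow> 'v graph \<Rightarrow> 'v \<Rightarrow> 'v graph" where
  "neighborhood R G u =
     (let B = {w \<in> verts G. graph_dist G u w \<le> enat R} in (B, {e \<in> edges G. e \<subseteq> B}))"

definition rooted_iso :: "'v graph \<Rightarrow> 'v \<Rightarrow> 'u graph \<Rightarrow> 'u \<Rightarrow> bool" where
  "rooted_iso G u H v \<longleftrightarrow>
     (\<exists>f. bij_betw f (verts G) (verts H) \<and> f u = v \<and>
          (\<forall>x\<in>verts G. \<forall>y\<in>verts G. {x, y} \<in> edges G \<longleftrightarrow> {f x, f y} \<in> edges H))"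

definition high_degree_almost_regular :: "(nat \<Rightarrow> 'v graph) \<Rightarrow> (nat \<Rightarrow> real) \<Rightarrow> bool" where
  "high_degree_almost_regular G r \<longleftrightarrow>
     (\<forall>n. simple_graph (G n) \<and> finite (verts (G n)) \<and> connected_graph (G n)) \<and>
     (\<forall>n. 0 \<le> r n) \<and> filterlim r at_top sequentially \<and>
     (\<exists>a b c :: nat \<Rightarrow> real.
        (\<forall>n. 0 \<le> a n \<and> 0 \<le> b n \<and> 0 \<le> c n) \<and>
        (\<lambda>n. Max {a n, b n, c n}) \<longlonglongrightarrow> 0 \<and>
        (\<forall>\<^sub>F n in sequentially.
           (1 - a n) * real (card (verts (G n))) \<le>
             real (card {v \<in> verts (G n).
                real (graph_degree (G n) v) \<in> {(1 - b n) * r n .. (1 + b n) * r n}}) \<and>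
           real (\<Sum>v\<in>verts (G n). graph_degree (G n) v) \<in>
             {(1 - c n) * r n * real (card (verts (G n))) ..
              (1 + c n) * r n * real (card (verts (G n)))}))"

section \<open>The degree constrained process with given constraints and activation times\<close>

text \<open>The edge \<open>e\<close> is added iff right before its activation time \<open>X e\<close> each of its end-vertices
  \<open>u\<close> has degree less than \<open>d u\<close>; this degree is the number of added edges at \<open>u\<close> with activation
  time smaller than \<open>X e\<close>. The finiteness clause is needed because \<open>card\<close> of an infinite set is
  \<open>0\<close>.\<close>

definition is_rdcp_edge_set ::
  "'v set set \<Rightarrow> ('v \<Rightarrow> nat) \<Rightarrow> ('v set \<Rightarrow> real) \<Rightarrow> 'v set set \<Rightarrow> bool" where
  "is_rdcp_edge_set E d X A \<longleftrightarrow> A \<subseteq> E \<and>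
     (\<forall>e\<in>E. e \<in> A \<longleftrightarrow>
        (\<forall>u\<in>e. finite {f \<in> A. u \<in> f \<and> X f < X e} \<and> card {f \<in> A. u \<in> f \<and> X f < X e} < d u))"

text \<open>For random data on an infinite graph, existence and uniqueness may hold only almost surely. On
  the exceptional set the value below is arbitrary, so events about it should be measured in the
  completion of the underlying measure.\<close>

definition rdcp_edges :: "'v set set \<Rightarrow> ('v \<Rightarrow> nat) \<Rightarrow> ('v set \<Rightarrow> real) \<Rightarrow> 'v set set" where
  "rdcp_edges E d X = (THE A. is_rdcp_edge_set E d X A)"

definition rdcp_graph ::
  "'v graph \<Rightarrow> ('v \<Rightarrow> nat) \<Rightarrow> ('v set \<Rightarrow> real) \<Rightarrow> ereal \<Rightarrow> 'v graph" where
  "rdcp_graph G d X t = (verts G, {e \<in> rdcp_edges (edges G) d X. ereal (X e) \<le> t})"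

text \<open>On a finite graph the edge set is determined for all values of the data.\<close>

lemma rdcp_edge_set_unique:
  assumes "finite E" "is_rdcp_edge_set E d X A" "is_rdcp_edge_set E d X B"
  shows "A = B"
proof -
  have AE: "A \<subseteq> E" and BE: "B \<subseteq> E" using assms by (auto simp: is_rdcp_edge_set_def)
  have "e \<in> A \<longleftrightarrow> e \<in> B" if "e \<in> E" for e
    using that
  proof (induction "card {f \<in> E. X f < X e}" arbitrary: e rule: less_induct)
    case less
    have "f \<in> A \<longleftrightarrow> f \<in> B" if f: "f \<in> E" "X f < X e" for f
    proof (rule less.hyps[OF _ f(1)])
      show "card {g \<in> E. X g < X f} < card {g \<in> E. X g < X e}"
        using assms(1) f by (intro psubset_card_mono) (auto simp: psubset_eq intro: less_trans)
    qed
    then have "{f \<in> A. u \<in> f \<and> X f < X e} = {f \<in> B. u \<in> f \<and> X f < X e}" for u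
      using AE BE by blast
    then show ?case using assms(2,3) less.prems by (simp add: is_rdcp_edge_set_def)
  qed
  then show ?thesis using AE BE by blast
qed

lemma rdcp_edge_set_exists:
  assumes "finite E"
  shows "\<exists>A. is_rdcp_edge_set E d X A"
  using assms
proof (induction "card E" arbitrary: E)
  case 0
  then show ?case by (intro exI[of _ "{}"]) (auto simp: is_rdcp_edge_set_def)
next
  case (Suc n)
  have ne: "E \<noteq> {}" using Suc.hyps(2) by auto
  define m where "m = Max (X ` E)"
  have "m \<in> X ` E" unfolding m_def using Suc.prems ne by (intro Max_in) auto
  then obtain e where e: "e \<in> E" "X e = m" by auto
  have emax: "X f \<le> X e" if "f \<in> E" for f using that Suc.prems e by (simp add: m_def)
  have "n = card (E - {e})" using Suc.hyps(2) e Suc.prems by simp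
  from Suc.hyps(1)[OF this] Suc.prems obtain A where
    A: "is_rdcp_edge_set (E - {e}) d X A" by auto
  define B where "B = (if \<forall>u\<in>e. finite {f \<in> A. u \<in> f \<and> X f < X e} \<and>
      card {f \<in> A. u \<in> f \<and> X f < X e} < d u then insert e A else A)"
  have eA: "e \<notin> A" and AE: "A \<subseteq> E" using A by (auto simp: is_rdcp_edge_set_def)
  have eq: "{f \<in> B. u \<in> f \<and> X f < X g} = {f \<in> A. u \<in> f \<and> X f < X g}" if "g \<in> E" for u g
    using emax[OF that] by (auto simp: B_def)
  have "g \<in> B \<longleftrightarrow> (\<forall>u\<in>g. finite {f \<in> A. u \<in> f \<and> X f < X g} \<and>
      card {f \<in> A. u \<in> f \<and> X f < X g} < d u)" if "g \<in> E" for g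
  proof (cases "g = e")
    case True
    then show ?thesis using eA by (simp add: B_def)
  next
    case False
    then have "g \<in> B \<longleftrightarrow> g \<in> A" by (simp add: B_def)
    then show ?thesis using A False that by (simp add: is_rdcp_edge_set_def)
  qed
  moreover have "B \<subseteq> E" using AE e by (auto simp: B_def)
  ultimately have "is_rdcp_edge_set E d X B" by (simp add: is_rdcp_edge_set_def eq)
  then show ?case by blast
qed

lemma is_rdcp_edge_set_rdcp_edges:
  assumes "finite E"
  shows "is_rdcp_edge_set E d X (rdcp_edges E d X)"
  unfolding rdcp_edges_def
  using rdcp_edge_set_exists[OF assms] rdcp_edge_set_unique[OF assms] by (metis theI)

section \<open>Random constraints and activation times\<close>

definition iid_constraints :: "'w measure \<Rightarrow> nat pmf \<Rightarrow> 'v set \<Rightarrow> ('v \<Rightarrow> 'w \<Rightarrow> nat) \<Rightarrow> bool" where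
  "iid_constraints M p V d \<longleftrightarrow>
     prob_space.indep_vars M (\<lambda>_. count_space UNIV) d V \<and>
     (\<forall>v\<in>V. distr M (count_space UNIV) (d v) = measure_pmf p)"

text \<open>Joint independence of the two families: the sigma-algebras they generate are independent.
  (\<open>indep_var\<close> would need both families to have the same type.)\<close>

definition constraints_indep_of_times ::
  "'w measure \<Rightarrow> 'v graph \<Rightarrow> ('v \<Rightarrow> 'w \<Rightarrow> nat) \<Rightarrow> ('v set \<Rightarrow> 'w \<Rightarrow> real) \<Rightarrow> bool" where
  "constraints_indep_of_times M G d X \<longleftrightarrow>
     prob_space.indep_set M
       {(\<lambda>\<omega>. \<lambda>v\<in>verts G. d v \<omega>) -` S \<inter> space M | S.
          S \<in> sets (PiM (verts G) (\<lambda>_. count_space UNIV))}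
       {(\<lambda>\<omega>. \<lambda>e\<in>edges G. X e \<omega>) -` S \<inter> space M | S.
          S \<in> sets (PiM (edges G) (\<lambda>_. borel))}"

definition rdcp_input_exponential ::
  "'w measure \<Rightarrow> nat pmf \<Rightarrow> real \<Rightarrow> 'v graph \<Rightarrow>
   ('v \<Rightarrow> 'w \<Rightarrow> nat) \<Rightarrow> ('v set \<Rightarrow> 'w \<Rightarrow> real) \<Rightarrow> bool" where
  "rdcp_input_exponential M p l G d X \<longleftrightarrow>
     prob_space M \<and>
     iid_constraints M p (verts G) d \<and>
     prob_space.indep_vars M (\<lambda>_. borel) X (edges G) \<and>
     (\<forall>e\<in>edges G. distributed M lborel (X e) (exponential_density l)) \<and>
     constraints_indep_of_times M G d X"

text \<open>\<open>\<tau> 1 < \<tau> 2 < \<dots>\<close> are the points, in increasing order, of a Poisson point process of unit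
  intensity on \<open>[0,\<infinity>)\<close>: the numbers of points in disjoint Borel sets of finite measure are
  independent, and Poisson distributed with the measure of the set as parameter. The mass function
  is written out because \<open>poisson_pmf\<close> excludes the parameter \<open>0\<close>.\<close>

definition num_points :: "(nat \<Rightarrow> 'w \<Rightarrow> real) \<Rightarrow> real set \<Rightarrow> 'w \<Rightarrow> nat" where
  "num_points \<tau> B \<omega> = card {j. 1 \<le> j \<and> \<tau> j \<omega> \<in> B}"

definition unit_poisson_points :: "'w measure \<Rightarrow> (nat \<Rightarrow> 'w \<Rightarrow> real) \<Rightarrow> bool" where
  "unit_poisson_points M \<tau> \<longleftrightarrow>
     (\<forall>j\<ge>1. \<tau> j \<in> borel_measurable M) \<and>
     (AE \<omega> in M. 0 \<le> \<tau> 1 \<omega> \<and> (\<forall>j\<ge>1. \<tau> j \<omega> < \<tau> (Suc j) \<omega>) \<and>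
                 (\<forall>b. finite {j. 1 \<le> j \<and> \<tau> j \<omega> \<le> b})) \<and>
     (\<forall>B\<in>sets borel. B \<subseteq> {0..} \<and> emeasure lborel B < \<infinity> \<longrightarrow>
        (\<forall>k. measure M {\<omega> \<in> space M. num_points \<tau> B \<omega> = k} =
               measure lborel B ^ k / fact k * exp (- measure lborel B))) \<and>
     (\<forall>(I :: nat set) B. finite I \<and> disjoint_family_on B I \<and>
        (\<forall>k\<in>I. B k \<in> sets borel \<and> B k \<subseteq> {0..} \<and> emeasure lborel (B k) < \<infinity>) \<longrightarrow>
        prob_space.indep_vars M (\<lambda>_. count_space UNIV) (\<lambda>k. num_points \<tau> (B k)) I)"

text \<open>The infinite tree whose vertices are the finite strings of positive integers.\<close>

definition pwit :: "nat list graph" where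
  "pwit = (lists {1..}, {{i, i @ [j]} | i j. i \<in> lists {1..} \<and> 1 \<le> j})"

definition rdcp_input_pwit ::
  "'w measure \<Rightarrow> nat pmf \<Rightarrow> (nat list \<Rightarrow> 'w \<Rightarrow> nat) \<Rightarrow> (nat list set \<Rightarrow> 'w \<Rightarrow> real) \<Rightarrow> bool" where
  "rdcp_input_pwit M p d X \<longleftrightarrow>
     prob_space M \<and>
     iid_constraints M p (verts pwit) d \<and>
     (\<forall>i\<in>verts pwit. unit_poisson_points M (\<lambda>j. X {i, i @ [j]})) \<and>
     prob_space.indep_vars M (\<lambda>_. PiM {1..} (\<lambda>_. borel))
       (\<lambda>i \<omega>. \<lambda>j\<in>{1..}. X {i, i @ [j]} \<omega>) (verts pwit) \<and>
     constraints_indep_of_times M pwit d X"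

section \<open>Local convergence in probability\<close>

definition converges_in_probability_to_const ::
  "(nat \<Rightarrow> 'w measure) \<Rightarrow> (nat \<Rightarrow> 'w \<Rightarrow> real) \<Rightarrow> real \<Rightarrow> bool" where
  "converges_in_probability_to_const M Y c \<longleftrightarrow>
     (\<forall>\<epsilon>>0. (\<lambda>n. measure (M n) {\<omega> \<in> space (M n). \<bar>Y n \<omega> - c\<bar> > \<epsilon>}) \<longlonglongrightarrow> 0)"

text \<open>It suffices to test with graphs \<open>H\<close> on sets of natural numbers: the neighborhoods in
  countable graphs are countable, and any countable rooted graph has a copy of this form.\<close>

definition converges_locally_in_probability ::
  "(nat \<Rightarrow> 'w measure) \<Rightarrow> (nat \<Rightarrow> 'w \<Rightarrow> 'v graph) \<Rightarrow>
   'q measure \<Rightarrow> ('q \<Rightarrow> 'u graph) \<Rightarrow> ('q \<Rightarrow> 'u) \<Rightarrow> bool" where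
  "converges_locally_in_probability M \<G> Q \<G>lim \<rho> \<longleftrightarrow>
     (\<forall>(H :: nat graph) v R. simple_graph H \<and> v \<in> verts H \<and> 1 \<le> R \<longrightarrow>
        converges_in_probability_to_const M
          (\<lambda>n \<omega>. (\<Sum>w\<in>verts (\<G> n \<omega>). of_bool (rooted_iso (neighborhood R (\<G> n \<omega>) w) w H v))
                   / real (card (verts (\<G> n \<omega>))))
          (measure Q {\<omega> \<in> space Q.
             rooted_iso (neighborhood R (\<G>lim \<omega>) (\<rho> \<omega>)) (\<rho> \<omega>) H v}))"

end

theory Submission
  imports Defs "HOL-Library.Sublist"
begin

text \<open>Fix a time \<open>T\<close> and round the activation times in \<open>[0,T]\<close> to \<open>m\<close> cells. The depth \<open>K\<close>
  neighbourhood of a vertex in the graph of edges activated before \<open>T\<close> is then typically a finite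
  tree labelled with cells and constraints, a shape. The status of an edge depends only on the edges
  reached from it by paths with decreasing times, and such paths are short: the expected number of
  those of length \<open>k\<close> is \<open>T^k / k!\<close>. So with high probability the shape determines the ball of
  radius \<open>R\<close> in the process at time \<open>T\<close>. For \<open>t = \<infinity>\<close> one also asks that all vertices of this ball
  have reached their constraints by time \<open>T\<close>, which holds with high probability for large \<open>T\<close> as
  almost surely all vertices of the infinite tree become saturated.

  A shape has an explicit weight, its probability at the root of the infinite tree. In the finite
  graphs, injective embeddings of one or two shapes into the set of typical vertices can be counted
  up to a factor \<open>1 - o(1)\<close>, which bounds the first two moments of the frequencies of shapes from
  below by the weights and their products. Since frequencies sum up to at most \<open>1\<close> and weights to
  almost \<open>1\<close>, these lower bounds are sharp and the frequencies concentrate.\<close>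

section \<open>Graphs\<close>

text \<open>Atypical vertices may have huge degrees; only their total degree is controlled. Upper
  bounds for the number of trees through them are out of reach, which is why embeddings stay inside
  the typical vertices and only lower bounds are proved. Short cycles cause no trouble, even in
  dense graphs: a shape asks that no other edge at its vertices of depth less than \<open>K\<close>
  be activated by time \<open>T\<close>, and each of the about \<open>r\<close> edges at a vertex
  violates this with probability of order \<open>T / r\<close> only.

  Rounding leaves finitely many shapes once the constraints are bounded, with explicit
  probabilities. The process is not distorted as long as adjacent edges lie in different cells,
  because only the order of the labels at each vertex matters.

  The event about the limit graph involves a description operator over infinitely many edges, so its
  measurability is not evident. It is squeezed almost surely between shape events, which settles its
  measure in the completion. Saturation for \<open>t = \<infinity>\<close> is proved in the tree
  alone; the finite graphs inherit it through the frequencies of shapes.\<close>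

lemma simple_graphD:
  assumes "simple_graph G" "e \<in> edges G"
  obtains u v where "e = {u, v}" "u \<noteq> v" "u \<in> verts G" "v \<in> verts G"
  using assms unfolding simple_graph_def by blast

lemma graph_dist_le_iff:
  "graph_dist G u w \<le> enat R \<longleftrightarrow> (\<exists>k\<le>R. (u, w) \<in> adj G ^^ k)"
proof
  assume le: "graph_dist G u w \<le> enat R"
  let ?K = "{k. (u, w) \<in> adj G ^^ k}"
  have ne: "?K \<noteq> {}"
  proof
    assume "?K = {}"
    then have "graph_dist G u w = \<infinity>" by (simp add: graph_dist_def top_enat_def)
    then show False using le by simp
  qed
  then have "Inf (enat ` ?K) \<in> enat ` ?K"
    by (intro wellorder_InfI[of "enat (SOME k. k \<in> ?K)"] imageI) (auto intro: someI_ex)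
  then show "\<exists>k\<le>R. (u, w) \<in> adj G ^^ k"
    using le unfolding graph_dist_def by auto
next
  assume "\<exists>k\<le>R. (u, w) \<in> adj G ^^ k"
  then obtain k where k: "k \<le> R" "(u, w) \<in> adj G ^^ k" by blast
  have "graph_dist G u w \<le> enat k"
    unfolding graph_dist_def using k by (intro INF_lower) auto
  also have "\<dots> \<le> enat R" using k by simp
  finally show "graph_dist G u w \<le> enat R" .
qed

lemma verts_neighborhood:
  "verts (neighborhood R G u) = {w \<in> verts G. \<exists>k\<le>R. (u, w) \<in> adj G ^^ k}"
  by (simp add: neighborhood_def Let_def graph_dist_le_iff)

lemma edges_neighborhood:
  "edges (neighborhood R G u) = {e \<in> edges G. e \<subseteq> verts (neighborhood R G u)}"
  by (simp add: neighborhood_def Let_def)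

lemma adj_component:
  assumes "simple_graph G"
  shows "(x, y) \<in> adj (component G u) \<longleftrightarrow> (x, y) \<in> adj G \<and> (u, x) \<in> (adj G)\<^sup>*"
proof
  assume *: "(x, y) \<in> adj G \<and> (u, x) \<in> (adj G)\<^sup>*"
  then have "(u, y) \<in> (adj G)\<^sup>*" by (meson rtrancl.rtrancl_into_rtrancl)
  moreover have "x \<in> verts G" "y \<in> verts G"
    using * assms unfolding adj_def by (auto elim!: simple_graphD simp: doubleton_eq_iff)
  ultimately show "(x, y) \<in> adj (component G u)"
    using * by (auto simp: adj_def component_def Let_def)
qed (auto simp: adj_def component_def Let_def)

lemma relpow_adj_component:
  assumes "simple_graph G"
  shows "(u, x) \<in> adj (component G u) ^^ k \<longleftrightarrow> (u, x) \<in> adj G ^^ k"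
proof (induction k arbitrary: x)
  case (Suc k)
  show ?case
    using Suc.IH by (auto simp: relcomp_unfold adj_component[OF assms] intro: relpow_imp_rtrancl)
qed simp

lemma neighborhood_component:
  assumes "simple_graph G"
  shows "neighborhood R (component G u) u = neighborhood R G u"
proof -
  have v: "verts (neighborhood R (component G u) u) = verts (neighborhood R G u)"
    unfolding verts_neighborhood relpow_adj_component[OF assms]
    by (auto simp: component_def Let_def intro: relpow_imp_rtrancl)
  have sub: "verts (neighborhood R G u) \<subseteq> {w \<in> verts G. (u, w) \<in> (adj G)\<^sup>*}"
    unfolding verts_neighborhood by (auto intro: relpow_imp_rtrancl)
  have "edges (neighborhood R (component G u) u) = edges (neighborhood R G u)"
    unfolding edges_neighborhood v using sub by (auto simp: component_def Let_def)
  with v show ?thesis by (simp add: prod_eq_iff)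
qed

lemma rooted_iso_trans:
  assumes "rooted_iso G u H v" "rooted_iso H v K w"
  shows "rooted_iso G u K w"
proof -
  obtain f where f: "bij_betw f (verts G) (verts H)" "f u = v"
    "\<forall>x\<in>verts G. \<forall>y\<in>verts G. {x, y} \<in> edges G \<longleftrightarrow> {f x, f y} \<in> edges H"
    using assms(1) unfolding rooted_iso_def by blast
  obtain g where g: "bij_betw g (verts H) (verts K)" "g v = w"
    "\<forall>x\<in>verts H. \<forall>y\<in>verts H. {x, y} \<in> edges H \<longleftrightarrow> {g x, g y} \<in> edges K"
    using assms(2) unfolding rooted_iso_def by blast
  have "f x \<in> verts H" if "x \<in> verts G" for x using f(1) that by (auto simp: bij_betw_def)
  then show ?thesis
    unfolding rooted_iso_def
    by (intro exI[of _ "g \<circ> f"]) (use f g bij_betw_trans in auto)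
qed

lemma rooted_iso_sym:
  assumes "rooted_iso G u H v" "u \<in> verts G"
  shows "rooted_iso H v G u"
proof -
  obtain f where f: "bij_betw f (verts G) (verts H)" "f u = v"
    "\<forall>x\<in>verts G. \<forall>y\<in>verts G. {x, y} \<in> edges G \<longleftrightarrow> {f x, f y} \<in> edges H"
    using assms(1) unfolding rooted_iso_def by blast
  let ?g = "inv_into (verts G) f"
  have 1: "bij_betw ?g (verts H) (verts G)" using f(1) by (rule bij_betw_inv_into)
  have 2: "?g v = u" using f assms(2) by (metis bij_betw_inv_into_left)
  have "{x, y} \<in> edges H \<longleftrightarrow> {?g x, ?g y} \<in> edges G" if "x \<in> verts H" "y \<in> verts H" for x y
  proof -
    have "?g x \<in> verts G" "?g y \<in> verts G" using that 1 bij_betw_apply by fast+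
    moreover have "f (?g x) = x" "f (?g y) = y" using that f(1) bij_betw_inv_into_right by fast+
    ultimately show ?thesis using f(3) by force
  qed
  with 1 2 show ?thesis unfolding rooted_iso_def by blast
qed

section \<open>Existence of the process on infinite graphs\<close>

text \<open>Well-foundedness of this relation excludes infinite chains of adjacent edges going back
  in time, along which the status of an edge could be left undetermined.\<close>

definition earlier_adjacent :: "'v set set \<Rightarrow> ('v set \<Rightarrow> real) \<Rightarrow> ('v set \<times> 'v set) set" where
  "earlier_adjacent E X = {(f, e). f \<in> E \<and> e \<in> E \<and> f \<inter> e \<noteq> {} \<and> X f < X e}"

lemma is_rdcp_edge_set_unique_wf:
  assumes wf: "wf (earlier_adjacent E X)"
    and A: "is_rdcp_edge_set E d X A" and B: "is_rdcp_edge_set E d X B"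
  shows "A = B"
proof -
  have AE: "A \<subseteq> E" "B \<subseteq> E" using A B by (auto simp: is_rdcp_edge_set_def)
  have "e \<in> E \<longrightarrow> (e \<in> A \<longleftrightarrow> e \<in> B)" for e
    using wf
  proof (induction e rule: wf_induct_rule)
    case (less e)
    show ?case
    proof
      assume e: "e \<in> E"
      have "{f \<in> A. u \<in> f \<and> X f < X e} = {f \<in> B. u \<in> f \<and> X f < X e}" if "u \<in> e" for u
      proof (intro Collect_cong iffI; elim conjE)
        have *: "f \<in> A \<longleftrightarrow> f \<in> B" if "f \<in> E" "u \<in> f" "X f < X e" for f
        proof -
          have "(f, e) \<in> earlier_adjacent E X"
            using that \<open>u \<in> e\<close> e by (auto simp: earlier_adjacent_def)
          then show ?thesis using less.IH that(1) by blast
        qed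
        fix f
        show "f \<in> B \<and> u \<in> f \<and> X f < X e" if "f \<in> A" "u \<in> f" "X f < X e"
          using that * AE by blast
        show "f \<in> A \<and> u \<in> f \<and> X f < X e" if "f \<in> B" "u \<in> f" "X f < X e"
          using that * AE by blast
      qed
      then have "(\<forall>u\<in>e. finite {f \<in> A. u \<in> f \<and> X f < X e} \<and> card {f \<in> A. u \<in> f \<and> X f < X e} < d u) \<longleftrightarrow>
        (\<forall>u\<in>e. finite {f \<in> B. u \<in> f \<and> X f < X e} \<and> card {f \<in> B. u \<in> f \<and> X f < X e} < d u)"
        by simp
      then show "e \<in> A \<longleftrightarrow> e \<in> B"
        using A B e unfolding is_rdcp_edge_set_def by blast
    qed
  qed
  then show ?thesis using AE by blast
qed

text \<open>The rule for an edge refers only to earlier adjacent edges, hence it can be read as a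
  recursion. Local finiteness \<open>fin\<close> supplies the finiteness clause in
  \<open>is_rdcp_edge_set\<close>.\<close>

lemma is_rdcp_edge_set_exists_wf:
  assumes wf: "wf (earlier_adjacent E X)"
    and fin: "\<And>e u. e \<in> E \<Longrightarrow> u \<in> e \<Longrightarrow> finite {f \<in> E. u \<in> f \<and> X f < X e}"
  shows "\<exists>A. is_rdcp_edge_set E d X A"
proof -
  \<comment> \<open>The conjunct \<open>f \<in> E\<close> makes every counted \<open>f\<close> a
    predecessor of \<open>e\<close>, so the count sees \<open>cut\<close> only where it agrees with
    the function being defined.\<close>
  define F where "F = (\<lambda>(g :: 'a set \<Rightarrow> bool) e.
    e \<in> E \<and> (\<forall>u\<in>e. card {f. g f \<and> f \<in> E \<and> u \<in> f \<and> X f < X e} < d u))"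
  define a where "a = wfrec (earlier_adjacent E X) F"
  have a: "a e \<longleftrightarrow> e \<in> E \<and> (\<forall>u\<in>e. card {f. a f \<and> u \<in> f \<and> X f < X e} < d u)" for e
  proof -
    have aE: "a f \<Longrightarrow> f \<in> E" for f
      unfolding a_def by (subst (asm) wfrec[OF wf]) (simp add: F_def)
    have "a e \<longleftrightarrow> F (cut a (earlier_adjacent E X) e) e"
      unfolding a_def by (subst wfrec[OF wf]) simp
    also have "\<dots> \<longleftrightarrow> e \<in> E \<and> (\<forall>u\<in>e. card {f. a f \<and> u \<in> f \<and> X f < X e} < d u)"
      unfolding F_def
    proof (intro conj_cong refl ball_cong)
      fix u assume "e \<in> E" "u \<in> e"
      then have "{f. cut a (earlier_adjacent E X) e f \<and> f \<in> E \<and> u \<in> f \<and> X f < X e} =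
        {f. a f \<and> u \<in> f \<and> X f < X e}"
        using aE by (auto simp: cut_def earlier_adjacent_def)
      then show "(card {f. cut a (earlier_adjacent E X) e f \<and> f \<in> E \<and> u \<in> f \<and> X f < X e} < d u) =
        (card {f. a f \<and> u \<in> f \<and> X f < X e} < d u)" by simp
    qed
    finally show ?thesis .
  qed
  have sub: "Collect a \<subseteq> E" using a by auto
  have "finite {f \<in> Collect a. u \<in> f \<and> X f < X e}" if "e \<in> E" "u \<in> e" for e u
    by (rule finite_subset[OF _ fin[OF that]]) (use sub in auto)
  moreover have "e \<in> Collect a \<longleftrightarrow> (\<forall>u\<in>e. card {f \<in> Collect a. u \<in> f \<and> X f < X e} < d u)"
    if "e \<in> E" for e
    using a[of e] that by simp
  ultimately have "is_rdcp_edge_set E d X (Collect a)"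
    unfolding is_rdcp_edge_set_def using sub by blast
  then show ?thesis by blast
qed

lemma is_rdcp_edge_set_rdcp_edges_wf:
  assumes "wf (earlier_adjacent E X)"
    and "\<And>e u. e \<in> E \<Longrightarrow> u \<in> e \<Longrightarrow> finite {f \<in> E. u \<in> f \<and> X f < X e}"
  shows "is_rdcp_edge_set E d X (rdcp_edges E d X)"
proof -
  obtain A where A: "is_rdcp_edge_set E d X A" using is_rdcp_edge_set_exists_wf[OF assms] by blast
  show ?thesis
    unfolding rdcp_edges_def
    by (rule theI[of _ A]) (use A is_rdcp_edge_set_unique_wf[OF assms(1)] in blast)+
qed

section \<open>Explored neighbourhoods\<close>

text \<open>Cell \<open>0\<close> includes its left end-point, so that with
  \<open>\<delta> = T / m\<close> the first \<open>m\<close> cells partition the closed interval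
  \<open>[0,T]\<close>.\<close>

definition cell :: "real \<Rightarrow> nat \<Rightarrow> real set" where
  "cell \<delta> c = (if c = 0 then {0..\<delta>} else {real c * \<delta> <.. real (Suc c) * \<delta>})"

lemma cell_less:
  assumes "x \<in> cell \<delta> c" "y \<in> cell \<delta> c'" "c < c'" "0 \<le> \<delta>"
  shows "x < y"
proof -
  have "x \<le> real (Suc c) * \<delta>" using assms by (auto simp: cell_def split: if_splits)
  also have "\<dots> \<le> real c' * \<delta>" using assms by (intro mult_right_mono) auto
  also have "\<dots> < y" using assms by (auto simp: cell_def split: if_splits)
  finally show ?thesis .
qed

lemma cell_less_iff:
  assumes "x \<in> cell \<delta> c" "y \<in> cell \<delta> c'" "c \<noteq> c'" "0 \<le> \<delta>"
  shows "x < y \<longleftrightarrow> c < c'"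
  using cell_less[OF assms(1,2)] cell_less[OF assms(2,1)] assms(3,4) by fastforce

lemma cell_unique:
  assumes "x \<in> cell \<delta> c" "x \<in> cell \<delta> c'" "0 \<le> \<delta>"
  shows "c = c'"
  using cell_less[OF assms(1,2) _ assms(3)] cell_less[OF assms(2,1) _ assms(3)]
  by (metis linorder_neqE_nat order_less_irrefl)

lemma cell_le:
  assumes "x \<in> cell (T / real m) c" "c < m" "0 \<le> T"
  shows "x \<le> T"
proof -
  have "x \<le> real (Suc c) * (T / m)" using assms by (auto simp: cell_def split: if_splits)
  also have "\<dots> \<le> real m * (T / m)" using assms by (intro mult_right_mono) auto
  also have "\<dots> = T" using assms by auto
  finally show ?thesis .
qed

text \<open>A vertex of a cell tree is the list of the cells containing the labels on the path from the
  root. Siblings thus have distinct cells.\<close>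

definition cell_tree :: "nat \<Rightarrow> nat \<Rightarrow> nat list set \<Rightarrow> bool" where
  "cell_tree m K S \<longleftrightarrow> [] \<in> S \<and> (\<forall>i\<in>S. length i \<le> K \<and> set i \<subseteq> {..<m} \<and> (i \<noteq> [] \<longrightarrow> butlast i \<in> S))"

lemma finite_cell_tree: "cell_tree m K S \<Longrightarrow> finite S"
  by (rule finite_subset[OF _ finite_lists_length_le[of "{..<m}" K]]) (auto simp: cell_tree_def)

lemma cell_tree_last: "cell_tree m K S \<Longrightarrow> j \<in> S \<Longrightarrow> j \<noteq> [] \<Longrightarrow> last j < m"
  unfolding cell_tree_def by (metis in_mono last_in_set lessThan_iff)

lemma cell_tree_butlast: "cell_tree m K S \<Longrightarrow> j \<in> S \<Longrightarrow> j \<noteq> [] \<Longrightarrow> butlast j \<in> S"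
  unfolding cell_tree_def by blast

definition tree_edges :: "nat list set \<Rightarrow> nat list set set" where
  "tree_edges S = (\<lambda>j. {butlast j, j}) ` (S - {[]})"

lemma finite_tree_edges: "finite S \<Longrightarrow> finite (tree_edges S)"
  by (simp add: tree_edges_def)

lemma butlast_neq: "j \<noteq> [] \<Longrightarrow> butlast j \<noteq> j"
  by (metis append_butlast_last_id not_Cons_self2 self_append_conv)

lemma butlast_edge_inject:
  assumes "{butlast j, j} = {butlast k, k}" "j \<noteq> []" "k \<noteq> []"
  shows "j = k"
proof (rule ccontr)
  assume "j \<noteq> k"
  then have "j = butlast k" "k = butlast j" using assms(1) by (auto simp: doubleton_eq_iff)
  then have "length j = length j - 2" "length j > 0"
    using assms(2) by (metis One_nat_def Suc_1 diff_Suc_eq_diff_pred length_butlast plus_1_eq_Suc diff_diff_left, simp)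
  then show False by linarith
qed

text \<open>The process takes activation times as a function of edges, which are two-element sets.
  The set determines the child end of a tree edge, and the last entry of this list is the cell of
  the edge.\<close>

definition edge_cell :: "nat list set \<Rightarrow> real" where
  "edge_cell e = real (last (THE j. j \<noteq> [] \<and> e = {butlast j, j}))"

lemma edge_cell [simp]:
  assumes "j \<noteq> []"
  shows "edge_cell {butlast j, j} = real (last j)"
proof -
  have "(THE k. k \<noteq> [] \<and> {butlast j, j} = {butlast k, k}) = j"
    using assms butlast_edge_inject by (intro the_equality) blast+
  then show ?thesis by (simp add: edge_cell_def)
qed

definition cell_rdcp :: "nat list set \<Rightarrow> (nat list \<Rightarrow> nat) \<Rightarrow> nat list set set" where
  "cell_rdcp S D = rdcp_edges (tree_edges S) D edge_cell"

text \<open>The map \<open>\<phi>\<close> places the tree in the graph. Vertices of depth less than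
  \<open>K\<close> are fully explored: all their edges activated by time \<open>T\<close> are tree
  edges. Depth \<open>K\<close> is the unexplored boundary. With injectivity, the early edges at the
  explored vertices form a tree.\<close>

definition explored ::
  "real \<Rightarrow> nat \<Rightarrow> nat \<Rightarrow> 'v set set \<Rightarrow> ('v \<Rightarrow> nat) \<Rightarrow> ('v set \<Rightarrow> real) \<Rightarrow> 'v \<Rightarrow>
   nat list set \<Rightarrow> (nat list \<Rightarrow> nat) \<Rightarrow> (nat list \<Rightarrow> 'v) \<Rightarrow> bool" where
  "explored T m K E d X w S D \<phi> \<longleftrightarrow>
     \<phi> [] = w \<and> inj_on \<phi> S \<and> (\<forall>i\<in>S. d (\<phi> i) = D i) \<and>
     (\<forall>i\<in>S - {[]}. {\<phi> (butlast i), \<phi> i} \<in> E \<and> X {\<phi> (butlast i), \<phi> i} \<in> cell (T / real m) (last i)) \<and>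
     (\<forall>i\<in>S. length i < K \<longrightarrow> (\<forall>e\<in>E. \<phi> i \<in> e \<longrightarrow> X e \<le> T \<longrightarrow>
        (\<exists>j\<in>S - {[]}. e = {\<phi> (butlast j), \<phi> j})))"

text \<open>Siblings have distinct cells by their encoding. The second clause separates the cells of
  consecutive edges on a path, so that cells order adjacent edges as their labels do. The third
  clause keeps paths whose cells decrease after depth \<open>R\<close> away from the unexplored
  boundary.\<close>

definition good_tree :: "nat \<Rightarrow> nat \<Rightarrow> nat list set \<Rightarrow> bool" where
  "good_tree R K S \<longleftrightarrow> R < K \<and> (\<forall>i c. i @ [c, c] \<notin> S) \<and>
     (\<forall>j\<in>S. sorted_wrt (>) (drop R j) \<longrightarrow> length j < K)"

lemma good_tree_last_neq:
  assumes "good_tree R K S" "j \<in> S" "j \<noteq> []" "butlast j \<noteq> []"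
  shows "last (butlast j) \<noteq> last j"
proof
  assume "last (butlast j) = last j"
  then have "j = butlast (butlast j) @ [last j, last j]"
    using assms(3,4) by (metis append_butlast_last_id append_Cons append_assoc append_Nil)
  then show False using assms(1,2) unfolding good_tree_def by metis
qed

lemma edge_touching_cases:
  assumes "j \<noteq> []" "k \<noteq> []" "u \<in> {butlast j, j}" "u \<in> {butlast k, k}" "j \<noteq> k"
  obtains "butlast k = butlast j" "last j \<noteq> last k" | "k = butlast j" | "butlast k = j"
  using assms by (metis append_butlast_last_id insertE singletonD)

text \<open>An earlier edge touching the edge above \<open>j\<close> is a sibling edge, the parent
  edge or a child edge. It replaces the last cell by a smaller one, drops it, or appends a smaller
  one, and the part beyond depth \<open>R\<close> stays decreasing in each case. This is the
  invariant for tracing dependencies back in time.\<close>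

lemma sorted_drop_earlier:
  fixes j k :: "nat list"
  assumes "j \<noteq> []" "k \<noteq> []" "u \<in> {butlast j, j}" "u \<in> {butlast k, k}" "last k < last j"
    and "sorted_wrt (>) (drop R j)"
  shows "sorted_wrt (>) (drop R k)"
proof -
  have snoc: "sorted_wrt (>) (drop R (i @ [c]))"
    if "sorted_wrt (>) (drop R i)" "drop R i \<noteq> [] \<Longrightarrow> c < last i" for i :: "nat list" and c :: nat
  proof (cases "R \<le> length i")
    case True
    have "c < x" if x: "x \<in> set (drop R i)" for x
    proof -
      have "drop R i \<noteq> []" using x by auto
      then have l: "c < last (drop R i)" using \<open>_ \<Longrightarrow> c < last i\<close> by (metis last_drop drop_eq_Nil not_le)
      obtain ys y where "drop R i = ys @ [y]"
        using \<open>drop R i \<noteq> []\<close> by (metis append_butlast_last_id)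
      then have "x = y \<or> y < x" "c < y" using x l \<open>sorted_wrt (>) (drop R i)\<close> by (auto simp: sorted_wrt_append)
      then show ?thesis by auto
    qed
    then show ?thesis using True that(1) by (auto simp: sorted_wrt_append)
  qed auto
  have bl: "sorted_wrt (>) (drop R (butlast i))" if "sorted_wrt (>) (drop R i)" for i :: "nat list"
    using that by (metis append_butlast_last_id butlast.simps(1) drop_butlast sorted_wrt_append)
  have "j \<noteq> k" using assms(5) by blast
  from assms(1-4) this show ?thesis
  proof (cases rule: edge_touching_cases)
    case 1
    have "sorted_wrt (>) (drop R (butlast j @ [last k]))"
    proof (rule snoc)
      show "sorted_wrt (>) (drop R (butlast j))" by (rule bl) fact
      assume ne: "drop R (butlast j) \<noteq> []"
      have j: "j = butlast j @ [last j]" using assms(1) by simp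
      have "drop R j = drop R (butlast j) @ [last j]"
        using ne by (subst j, subst drop_append) simp
      then have "\<forall>x\<in>set (drop R (butlast j)). last j < x" using assms(6) by (simp add: sorted_wrt_append)
      moreover have "last (butlast j) \<in> set (drop R (butlast j))"
        using ne by (metis last_drop last_in_set drop_eq_Nil not_le)
      ultimately show "last k < last (butlast j)" using assms(5) by fastforce
    qed
    then show ?thesis using 1 assms(2) by (metis append_butlast_last_id)
  next
    case 2
    then show ?thesis using bl assms(6) by simp
  next
    case 3
    have "sorted_wrt (>) (drop R (j @ [last k]))"
      using assms(5,6) by (intro snoc)
    then show ?thesis using 3 assms(2) by (metis append_butlast_last_id)
  qed
qed


lemma edge_times_less_iff:
  assumes S: "cell_tree m K S" and g: "good_tree R K S" and ex: "explored T m K E d X w S D \<phi>"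
    and T: "0 \<le> T"
    and j: "j \<in> S - {[]}" and k: "k \<in> S - {[]}" and u: "u \<in> {butlast j, j}" "u \<in> {butlast k, k}"
  shows "X {\<phi> (butlast k), \<phi> k} < X {\<phi> (butlast j), \<phi> j} \<longleftrightarrow> last k < last j"
proof (cases "j = k")
  case False
  have cells: "X {\<phi> (butlast i), \<phi> i} \<in> cell (T / real m) (last i)" if "i \<in> S - {[]}" for i
    using ex that unfolding explored_def by blast
  have "j \<noteq> []" "k \<noteq> []" using j k by auto
  from this u False have "last k \<noteq> last j"
  proof (cases rule: edge_touching_cases)
    case 2
    then show ?thesis using good_tree_last_neq[OF g, of j] j k by fastforce
  next
    case 3
    then show ?thesis using good_tree_last_neq[OF g, of k] j k by fastforce
  qed auto
  then show ?thesis using cell_less_iff cells j k T by (metis divide_nonneg_nonneg of_nat_0_le_iff)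
qed simp

text \<open>The status of an edge of the graph only depends on edges reached from it by paths with
  decreasing labels. If such paths stay inside the explored neighbourhood, the process on the cell
  tree, with cells in place of labels, gives the same answer.\<close>

lemma cell_rdcp_edge_iff:
  assumes S: "cell_tree m K S" and g: "good_tree R K S" and ex: "explored T m K E d X w S D \<phi>"
    and T: "0 \<le> T" and A: "is_rdcp_edge_set E d X A"
    and "j \<in> S - {[]}" "sorted_wrt (>) (drop R j)"
  shows "{butlast j, j} \<in> cell_rdcp S D \<longleftrightarrow> {\<phi> (butlast j), \<phi> j} \<in> A"
  using assms(6,7)
proof (induction "last j" arbitrary: j rule: less_induct)
  case less
  let ?B = "cell_rdcp S D" and ?X = "\<lambda>j. X {\<phi> (butlast j), \<phi> j}"
  have fin: "finite S" using finite_cell_tree[OF S] .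
  have B: "is_rdcp_edge_set (tree_edges S) D edge_cell ?B"
    unfolding cell_rdcp_def by (intro is_rdcp_edge_set_rdcp_edges finite_tree_edges fin)
  have inj: "inj_on \<phi> S" using ex unfolding explored_def by blast
  have bl: "butlast i \<in> S" if "i \<in> S - {[]}" for i using cell_tree_butlast[OF S] that by blast
  have jS: "{butlast j, j} \<subseteq> S" using less.prems bl by auto
  \<comment> \<open>Both end-vertices of the edge have depth less than \<open>K\<close>, so every
    edge that could block it has been explored.\<close>
  have jK: "length j < K" using g less.prems unfolding good_tree_def by blast
  have Xj: "?X j \<le> T"
    using ex less.prems cell_le[OF _ cell_tree_last[OF S, of j] T] unfolding explored_def by blast
  \<comment> \<open>The earlier added edges at \<open>\<phi> u\<close> correspond under
    \<open>\<phi>\<close> to the earlier added tree edges at \<open>u\<close>. The induction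
    hypothesis applies to them since their cells are smaller.\<close>
  have img: "{f \<in> A. \<phi> u \<in> f \<and> X f < ?X j} = (`) \<phi> ` {f \<in> ?B. u \<in> f \<and> edge_cell f < real (last j)}"
    if u: "u \<in> {butlast j, j}" for u
  proof (intro equalityI subsetI)
    fix f assume f: "f \<in> {f \<in> A. \<phi> u \<in> f \<and> X f < ?X j}"
    have "f \<in> E" using f A unfolding is_rdcp_edge_set_def by blast
    moreover have "u \<in> S" "length u < K" using u jS jK by auto
    ultimately obtain k where k: "k \<in> S - {[]}" "f = {\<phi> (butlast k), \<phi> k}"
      using ex f Xj unfolding explored_def by fastforce
    have uk: "u \<in> {butlast k, k}"
      using f k inj bl[of k] \<open>u \<in> S\<close> by (auto dest: inj_onD)
    have lt: "last k < last j"
      using f k edge_times_less_iff[OF S g ex T less.prems(1) k(1) u uk] by simp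
    have "sorted_wrt (>) (drop R k)"
      using sorted_drop_earlier[OF _ _ u uk lt less.prems(2)] less.prems(1) k by blast
    then have "{butlast k, k} \<in> ?B" using less.hyps[OF lt k(1)] f k by simp
    then show "f \<in> (`) \<phi> ` {f \<in> ?B. u \<in> f \<and> edge_cell f < real (last j)}"
      using k uk lt by (intro image_eqI[of _ _ "{butlast k, k}"]) auto
  next
    fix f assume "f \<in> (`) \<phi> ` {f \<in> ?B. u \<in> f \<and> edge_cell f < real (last j)}"
    then obtain f' where f': "f = \<phi> ` f'" "f' \<in> ?B" "u \<in> f'" "edge_cell f' < real (last j)" by blast
    then obtain k where k: "k \<in> S - {[]}" "f' = {butlast k, k}"
      using B unfolding is_rdcp_edge_set_def tree_edges_def by blast
    have uk: "u \<in> {butlast k, k}" and lt: "last k < last j" using f' k by auto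
    have "sorted_wrt (>) (drop R k)"
      using sorted_drop_earlier[OF _ _ u uk lt less.prems(2)] less.prems(1) k by blast
    then have "{\<phi> (butlast k), \<phi> k} \<in> A" using less.hyps[OF lt k(1)] f' k by simp
    then show "f \<in> {f \<in> A. \<phi> u \<in> f \<and> X f < ?X j}"
      using f' k lt edge_times_less_iff[OF S g ex T less.prems(1) k(1) u uk] by auto
  qed
  have sub: "f \<subseteq> S" if "f \<in> ?B" for f
    using that B bl unfolding is_rdcp_edge_set_def tree_edges_def by blast
  have injB: "inj_on ((`) \<phi>) {f \<in> ?B. u \<in> f \<and> edge_cell f < real (last j)}" for u
    by (rule inj_onI) (use inj_on_image_eq_iff[OF inj] sub in auto)
  have finB: "finite {f \<in> ?B. u \<in> f \<and> edge_cell f < real (last j)}" for u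
    by (rule finite_subset[OF _ finite_tree_edges[OF fin]]) (use B in \<open>auto simp: is_rdcp_edge_set_def\<close>)
  have cond: "finite {f \<in> A. \<phi> u \<in> f \<and> X f < ?X j} \<and> card {f \<in> A. \<phi> u \<in> f \<and> X f < ?X j} < d (\<phi> u) \<longleftrightarrow>
    finite {f \<in> ?B. u \<in> f \<and> edge_cell f < real (last j)} \<and>
    card {f \<in> ?B. u \<in> f \<and> edge_cell f < real (last j)} < D u" if "u \<in> {butlast j, j}" for u
  proof -
    have "d (\<phi> u) = D u" using ex that jS unfolding explored_def by blast
    then show ?thesis unfolding img[OF that] using card_image[OF injB[of u]] finB[of u] by simp
  qed
  have "{butlast j, j} \<in> tree_edges S" using less.prems by (auto simp: tree_edges_def)
  then have "{butlast j, j} \<in> ?B \<longleftrightarrow> (\<forall>u\<in>{butlast j, j}.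
      finite {f \<in> ?B. u \<in> f \<and> edge_cell f < real (last j)} \<and>
      card {f \<in> ?B. u \<in> f \<and> edge_cell f < real (last j)} < D u)"
    using B edge_cell[of j] less.prems(1) unfolding is_rdcp_edge_set_def by simp
  also have "\<dots> \<longleftrightarrow> (\<forall>u\<in>{butlast j, j}. finite {f \<in> A. \<phi> u \<in> f \<and> X f < ?X j} \<and>
      card {f \<in> A. \<phi> u \<in> f \<and> X f < ?X j} < d (\<phi> u))"
    using cond by blast
  also have "\<dots> \<longleftrightarrow> {\<phi> (butlast j), \<phi> j} \<in> A"
  proof -
    have "{\<phi> (butlast j), \<phi> j} \<in> E" using ex less.prems unfolding explored_def by blast
    then show ?thesis using A unfolding is_rdcp_edge_set_def by simp
  qed
  finally show ?case .
qed

lemma cell_rdcp_subset: "finite S \<Longrightarrow> cell_rdcp S D \<subseteq> tree_edges S"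
  using is_rdcp_edge_set_rdcp_edges[OF finite_tree_edges, of S D edge_cell]
  unfolding cell_rdcp_def is_rdcp_edge_set_def by blast

section \<open>Balls computed from cell trees\<close>

definition cell_ball :: "nat \<Rightarrow> nat list set \<Rightarrow> (nat list \<Rightarrow> nat) \<Rightarrow> nat list graph" where
  "cell_ball R S D = neighborhood R (S, cell_rdcp S D) []"

text \<open>Saturation is judged by the cell process, that is, at time \<open>T\<close>. It
  certifies that no vertex of the ball receives an edge afterwards.\<close>

definition saturated_ball :: "nat \<Rightarrow> nat list set \<Rightarrow> (nat list \<Rightarrow> nat) \<Rightarrow> bool" where
  "saturated_ball R S D \<longleftrightarrow> (\<forall>x\<in>verts (cell_ball R S D). D x \<le> card {f \<in> cell_rdcp S D. x \<in> f})"

lemma cell_relpow_length: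
  assumes "cell_tree m K S" "([], x) \<in> adj (S, cell_rdcp S D) ^^ k"
  shows "x \<in> S \<and> length x \<le> k"
  using assms(2)
proof (induction k arbitrary: x)
  case 0
  then show ?case using assms(1) by (auto simp: cell_tree_def)
next
  case (Suc k)
  then obtain y where y: "([], y) \<in> adj (S, cell_rdcp S D) ^^ k" "{y, x} \<in> cell_rdcp S D"
    by (auto simp: adj_def)
  then obtain j where j: "j \<in> S - {[]}" "{y, x} = {butlast j, j}"
    using cell_rdcp_subset[OF finite_cell_tree[OF assms(1)]] unfolding tree_edges_def by blast
  have "butlast j \<in> S" using cell_tree_butlast[OF assms(1)] j by blast
  moreover have "length y \<le> k" using Suc.IH y by blast
  ultimately show ?case using j by (auto simp: doubleton_eq_iff)
qed

lemma cell_ball_length: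
  assumes "cell_tree m K S" "x \<in> verts (cell_ball R S D)"
  shows "x \<in> S \<and> length x \<le> R"
  using assms cell_relpow_length[OF assms(1)] unfolding cell_ball_def verts_neighborhood
  by fastforce

lemma explored_edge_cases:
  assumes S: "cell_tree m K S" and ex: "explored T m K E d X w S D \<phi>"
    and "x \<in> S" "length x < K" "e \<in> E" "\<phi> x \<in> e" "X e \<le> T"
  obtains j where "j \<in> S - {[]}" "e = {\<phi> (butlast j), \<phi> j}" "x \<in> {butlast j, j}"
proof -
  obtain j where j: "j \<in> S - {[]}" "e = {\<phi> (butlast j), \<phi> j}"
    using ex assms(3-) unfolding explored_def by blast
  have "butlast j \<in> S" using cell_tree_butlast[OF S] j by blast
  moreover have "inj_on \<phi> S" using ex unfolding explored_def by blast
  ultimately have "x \<in> {butlast j, j}" using assms(3,6) j by (auto dest: inj_onD)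
  with that j show thesis by blast
qed

lemma explored_time_le:
  assumes "cell_tree m K S" "explored T m K E d X w S D \<phi>" "j \<in> S - {[]}" "0 \<le> T"
  shows "X {\<phi> (butlast j), \<phi> j} \<le> T"
  using assms cell_le[OF _ cell_tree_last[OF assms(1), of j] assms(4)] unfolding explored_def by blast

text \<open>At most one entry is left beyond depth \<open>R\<close>, so all edges at vertices of
  depth at most \<open>R\<close> satisfy the invariant of \<open>cell_rdcp_edge_iff\<close>.\<close>

lemma sorted_drop_short: "length j \<le> Suc R \<Longrightarrow> sorted_wrt (>) (drop R j)"
proof -
  assume "length j \<le> Suc R"
  then have "length (drop R j) \<le> 1" by simp
  then show ?thesis by (cases "drop R j") auto
qed

text \<open>All edges activated by time \<open>T\<close> at a vertex of depth at most
  \<open>R < K\<close> are explored. They end at depth at most \<open>R + 1\<close>, so the cell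
  process computes their status correctly.\<close>

lemma cell_rdcp_degree:
  assumes S: "cell_tree m K S" and g: "good_tree R K S" and ex: "explored T m K E d X w S D \<phi>"
    and T: "0 \<le> T" and A: "is_rdcp_edge_set E d X A" and x: "x \<in> S" "length x \<le> R"
  shows "{f \<in> A. \<phi> x \<in> f \<and> X f \<le> T} = (`) \<phi> ` {f \<in> cell_rdcp S D. x \<in> f}"
    and "card {f \<in> A. \<phi> x \<in> f \<and> X f \<le> T} = card {f \<in> cell_rdcp S D. x \<in> f}"
proof -
  have AE: "A \<subseteq> E" using A unfolding is_rdcp_edge_set_def by blast
  have RK: "R < K" using g unfolding good_tree_def by blast
  have B: "cell_rdcp S D \<subseteq> tree_edges S" using cell_rdcp_subset[OF finite_cell_tree[OF S]] .
  have iff: "{butlast j, j} \<in> cell_rdcp S D \<longleftrightarrow> {\<phi> (butlast j), \<phi> j} \<in> A"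
    if "j \<in> S - {[]}" "x \<in> {butlast j, j}" for j
    by (rule cell_rdcp_edge_iff[OF S g ex T A that(1)], rule sorted_drop_short) (use that x in auto)
  show eq: "{f \<in> A. \<phi> x \<in> f \<and> X f \<le> T} = (`) \<phi> ` {f \<in> cell_rdcp S D. x \<in> f}"
  proof (intro equalityI subsetI)
    fix f assume f: "f \<in> {f \<in> A. \<phi> x \<in> f \<and> X f \<le> T}"
    then have "f \<in> E" "\<phi> x \<in> f" "X f \<le> T" "length x < K" using AE x RK by auto
    with x(1) obtain j where j: "j \<in> S - {[]}" "f = {\<phi> (butlast j), \<phi> j}" "x \<in> {butlast j, j}"
      by (metis explored_edge_cases[OF S ex])
    then show "f \<in> (`) \<phi> ` {f \<in> cell_rdcp S D. x \<in> f}"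
      using iff[OF j(1,3)] f by (intro image_eqI[of _ _ "{butlast j, j}"]) auto
  next
    fix f assume "f \<in> (`) \<phi> ` {f \<in> cell_rdcp S D. x \<in> f}"
    then obtain f' where f': "f = \<phi> ` f'" "f' \<in> cell_rdcp S D" "x \<in> f'" by blast
    then obtain j where j: "j \<in> S - {[]}" "f' = {butlast j, j}" using B unfolding tree_edges_def by blast
    then show "f \<in> {f \<in> A. \<phi> x \<in> f \<and> X f \<le> T}"
      using f' iff[of j] explored_time_le[OF S ex j(1) T] by auto
  qed
  have sub: "f \<subseteq> S" if "f \<in> cell_rdcp S D" for f
    using that B cell_tree_butlast[OF S] unfolding tree_edges_def by blast
  have "inj_on \<phi> S" using ex unfolding explored_def by blast
  then have "inj_on ((`) \<phi>) {f \<in> cell_rdcp S D. x \<in> f}"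
    by (intro inj_on_subset[OF inj_on_image_Pow]) (use sub in auto)
  then show "card {f \<in> A. \<phi> x \<in> f \<and> X f \<le> T} = card {f \<in> cell_rdcp S D. x \<in> f}"
    unfolding eq by (rule card_image)
qed

text \<open>The map \<open>\<phi>\<close> itself is the isomorphism. For \<open>t > T\<close>, edges
  added after \<open>T\<close> must not touch the ball, which is what saturation provides.\<close>

lemma rooted_iso_explored:
  assumes S: "cell_tree m K S" and g: "good_tree R K S" and ex: "explored T m K (edges G) d X w S D \<phi>"
    and T: "0 \<le> T" "ereal T \<le> t" and A: "is_rdcp_edge_set (edges G) d X A"
    and G: "simple_graph G" "w \<in> verts G"
    and sat: "t \<le> ereal T \<or> saturated_ball R S D"
  shows "rooted_iso (neighborhood R (verts G, {e \<in> A. ereal (X e) \<le> t}) w) w H v \<longleftrightarrow>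
    rooted_iso (cell_ball R S D) [] H v"
proof -
  let ?G = "(verts G, {e \<in> A. ereal (X e) \<le> t})" and ?S = "(S, cell_rdcp S D)"
  let ?N = "neighborhood R ?G w" and ?M = "cell_ball R S D"
  have AE: "A \<subseteq> edges G" using A unfolding is_rdcp_edge_set_def by blast
  have fin: "finite S" using finite_cell_tree[OF S] .
  have RK: "R < K" using g unfolding good_tree_def by blast
  have inj: "inj_on \<phi> S" and root: "\<phi> [] = w" using ex unfolding explored_def by blast+
  \<comment> \<open>A vertex of the ball that has \<open>D x\<close> added edges by time
    \<open>T\<close> rejects every later edge.\<close>
  have late: "X e \<le> T" if x: "x \<in> verts ?M" and e: "e \<in> A" "\<phi> x \<in> e" "ereal (X e) \<le> t" for x e
  proof (cases "t \<le> ereal T")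
    case True
    then have "ereal (X e) \<le> ereal T" using e by (meson order_trans)
    then show ?thesis by simp
  next
    case False
    then have "D x \<le> card {f \<in> cell_rdcp S D. x \<in> f}"
      using sat x unfolding saturated_ball_def by blast
    also have "\<dots> = card {f \<in> A. \<phi> x \<in> f \<and> X f \<le> T}"
      using cell_rdcp_degree(2)[OF S g ex T(1) A] cell_ball_length[OF S x] by simp
    finally have D: "d (\<phi> x) \<le> card {f \<in> A. \<phi> x \<in> f \<and> X f \<le> T}"
      using ex cell_ball_length[OF S x] unfolding explored_def by simp
    show ?thesis
    proof (rule ccontr)
      assume "\<not> X e \<le> T"
      have *: "finite {f \<in> A. \<phi> x \<in> f \<and> X f < X e}" "card {f \<in> A. \<phi> x \<in> f \<and> X f < X e} < d (\<phi> x)"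
        using A e AE unfolding is_rdcp_edge_set_def by blast+
      have "card {f \<in> A. \<phi> x \<in> f \<and> X f \<le> T} \<le> card {f \<in> A. \<phi> x \<in> f \<and> X f < X e}"
        using \<open>\<not> X e \<le> T\<close> by (intro card_mono *) auto
      with D * show False by simp
    qed
  qed
  have iff: "{butlast j, j} \<in> cell_rdcp S D \<longleftrightarrow> {\<phi> (butlast j), \<phi> j} \<in> A"
    if "j \<in> S - {[]}" "length j \<le> R" for j
    by (rule cell_rdcp_edge_iff[OF S g ex T(1) A that(1)], rule sorted_drop_short) (use that in auto)
  have blS: "butlast j \<in> S" if "j \<in> S - {[]}" for j using cell_tree_butlast[OF S] that by blast
  have B: "cell_rdcp S D \<subseteq> tree_edges S" using cell_rdcp_subset[OF fin] .
  have short: "length x \<le> R" "x \<in> S" if "x \<in> verts ?M" for x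
    using cell_ball_length[OF S that] by auto
  \<comment> \<open>Walks from the root are followed edge by edge, so only edges at vertices already
    known to be in the ball have to be compared.\<close>
  have reach: "(w, y) \<in> adj ?G ^^ k \<longleftrightarrow> (\<exists>x. ([], x) \<in> adj ?S ^^ k \<and> y = \<phi> x)" if "k \<le> R" for k y
    using that
  proof (induction k arbitrary: y)
    case 0
    then show ?case using root by auto
  next
    case (Suc k)
    have "(w, y) \<in> adj ?G ^^ Suc k \<longleftrightarrow> (\<exists>x. ([], x) \<in> adj ?S ^^ k \<and> (\<phi> x, y) \<in> adj ?G)"
      using Suc.IH Suc.prems by (auto simp: relcomp_unfold)
    also have "\<dots> \<longleftrightarrow> (\<exists>x. ([], x) \<in> adj ?S ^^ k \<and> (\<exists>z. (x, z) \<in> adj ?S \<and> y = \<phi> z))"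
    proof (intro ex_cong1 conj_cong refl)
      fix x assume x: "([], x) \<in> adj ?S ^^ k"
      then have xM: "x \<in> verts ?M"
        using Suc.prems cell_relpow_length[OF S x] unfolding cell_ball_def verts_neighborhood
        by (auto intro!: exI[of _ k])
      have xk: "length x \<le> k" "x \<in> S" using cell_relpow_length[OF S x] by auto
      show "(\<phi> x, y) \<in> adj ?G \<longleftrightarrow> (\<exists>z. (x, z) \<in> adj ?S \<and> y = \<phi> z)"
      proof
        assume "(\<phi> x, y) \<in> adj ?G"
        then have e: "{\<phi> x, y} \<in> A" "ereal (X {\<phi> x, y}) \<le> t" by (auto simp: adj_def)
        then have "X {\<phi> x, y} \<le> T" using late[OF xM, of "{\<phi> x, y}"] by simp
        moreover have "{\<phi> x, y} \<in> edges G" "\<phi> x \<in> {\<phi> x, y}" "length x < K"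
          using e AE xk RK Suc.prems by auto
        ultimately obtain j where j: "j \<in> S - {[]}"
          "{\<phi> x, y} = {\<phi> (butlast j), \<phi> j}" "x \<in> {butlast j, j}"
          using xk(2) by (metis explored_edge_cases[OF S ex])
        then have "{butlast j, j} \<in> cell_rdcp S D"
          using iff[OF j(1)] e xk Suc.prems by auto
        moreover obtain z where "{x, z} = {butlast j, j}" "y = \<phi> z"
          using j(2,3) by (auto simp: doubleton_eq_iff)
        ultimately have "{x, z} \<in> cell_rdcp S D" "y = \<phi> z" by simp_all
        then show "\<exists>z. (x, z) \<in> adj ?S \<and> y = \<phi> z"
          unfolding adj_def by auto
      next
        assume "\<exists>z. (x, z) \<in> adj ?S \<and> y = \<phi> z"
        then obtain z where z: "{x, z} \<in> cell_rdcp S D" "y = \<phi> z" by (auto simp: adj_def)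
        then obtain j where j: "j \<in> S - {[]}" "{x, z} = {butlast j, j}"
          using B unfolding tree_edges_def by blast
        have "length j \<le> R" using j(2) xk Suc.prems by (auto simp: doubleton_eq_iff)
        then have "{\<phi> (butlast j), \<phi> j} \<in> A" using iff[OF j(1)] z j by simp
        moreover have "ereal (X {\<phi> (butlast j), \<phi> j}) \<le> t"
          using explored_time_le[OF S ex j(1) T(1)] T(2) by (meson ereal_less_eq(3) order_trans)
        moreover have "{\<phi> x, y} = {\<phi> (butlast j), \<phi> j}"
          using j z by (auto simp: doubleton_eq_iff)
        ultimately show "(\<phi> x, y) \<in> adj ?G" by (simp add: adj_def)
      qed
    qed
    finally show ?case by (auto simp: relcomp_unfold)
  qed
  have SV: "\<phi> x \<in> verts G" if "x \<in> S" for x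
  proof (cases "x = []")
    case False
    then have "{\<phi> (butlast x), \<phi> x} \<in> edges G" using ex that unfolding explored_def by blast
    then show ?thesis using G(1) by (auto elim!: simple_graphD simp: doubleton_eq_iff)
  qed (use root G in simp)
  have img: "verts ?N = \<phi> ` verts ?M"
    unfolding cell_ball_def verts_neighborhood using reach SV cell_relpow_length[OF S] by fastforce
  have "rooted_iso ?M [] ?N w"
    unfolding rooted_iso_def
  proof (intro exI[of _ \<phi>] conjI ballI root)
    show "bij_betw \<phi> (verts ?M) (verts ?N)"
      unfolding img by (intro inj_on_imp_bij_betw inj_on_subset[OF inj]) (use short in auto)
    fix x y assume x: "x \<in> verts ?M" and y: "y \<in> verts ?M"
    have "{x, y} \<in> cell_rdcp S D \<longleftrightarrow> {\<phi> x, \<phi> y} \<in> A \<and> ereal (X {\<phi> x, \<phi> y}) \<le> t"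
    proof
      assume xy: "{x, y} \<in> cell_rdcp S D"
      then obtain j where j: "j \<in> S - {[]}" "{x, y} = {butlast j, j}"
        using B unfolding tree_edges_def by blast
      have "length j \<le> R" using j(2) short[OF x] short[OF y] by (auto simp: doubleton_eq_iff)
      then have "{\<phi> (butlast j), \<phi> j} \<in> A" using iff[OF j(1)] xy j by simp
      moreover have "ereal (X {\<phi> (butlast j), \<phi> j}) \<le> t"
        using explored_time_le[OF S ex j(1) T(1)] T(2) by (meson ereal_less_eq(3) order_trans)
      moreover have "{\<phi> x, \<phi> y} = {\<phi> (butlast j), \<phi> j}"
        using j by (auto simp: doubleton_eq_iff)
      ultimately show "{\<phi> x, \<phi> y} \<in> A \<and> ereal (X {\<phi> x, \<phi> y}) \<le> t" by simp
    next
      assume xy: "{\<phi> x, \<phi> y} \<in> A \<and> ereal (X {\<phi> x, \<phi> y}) \<le> t"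
      then have "X {\<phi> x, \<phi> y} \<le> T" using late[OF x, of "{\<phi> x, \<phi> y}"] by simp
      moreover have "{\<phi> x, \<phi> y} \<in> edges G" "\<phi> x \<in> {\<phi> x, \<phi> y}" "length x < K"
        using xy AE short[OF x] RK by auto
      ultimately obtain j where j: "j \<in> S - {[]}"
        "{\<phi> x, \<phi> y} = {\<phi> (butlast j), \<phi> j}" "x \<in> {butlast j, j}"
        using short[OF x] by (metis explored_edge_cases[OF S ex])
      have eq: "{x, y} = {butlast j, j}"
      proof -
        have "\<phi> ` {x, y} = \<phi> ` {butlast j, j}" using j by simp
        then show ?thesis
          using inj_on_image_eq_iff[OF inj, of "{x, y}" "{butlast j, j}"] short[OF x] short[OF y] j(1) blS
          by auto
      qed
      then have "length j \<le> R" using short[OF x] short[OF y] by (auto simp: doubleton_eq_iff)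
      then show "{x, y} \<in> cell_rdcp S D" using iff[OF j(1)] xy j eq by simp
    qed
    then show "{x, y} \<in> edges ?M \<longleftrightarrow> {\<phi> x, \<phi> y} \<in> edges ?N"
      using x y img unfolding cell_ball_def edges_neighborhood by auto
  qed
  moreover have "[] \<in> verts ?M"
    using S unfolding cell_ball_def verts_neighborhood cell_tree_def by (auto intro!: exI[of _ 0])
  moreover have "w \<in> verts ?N"
    using G unfolding verts_neighborhood by (auto intro!: exI[of _ 0])
  ultimately have "rooted_iso ?M [] ?N w" "rooted_iso ?N w ?M []" by (blast intro: rooted_iso_sym)+
  note iso = this
  show ?thesis
    by (rule iffI) (erule rooted_iso_trans[OF iso(1)], erule rooted_iso_trans[OF iso(2)])
qed

text \<open>Both explorations are followed down from the root. An edge of one tree at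
  \<open>\<phi> i\<close> in cell \<open>c\<close> must occur in the other tree, where its cell
  identifies the child. Hence shapes at a vertex exclude each other, and each has a single
  placement.\<close>

lemma explored_unique:
  assumes S: "cell_tree m K S" and S': "cell_tree m K S'"
    and ex: "explored T m K E d X w S D \<phi>" and ex': "explored T m K E d X w S' D' \<phi>'"
    and T: "0 \<le> T"
  shows "S = S'" and "\<And>i. i \<in> S \<Longrightarrow> \<phi> i = \<phi>' i" and "\<And>i. i \<in> S \<Longrightarrow> D i = D' i"
proof -
  have sub: "i \<in> S' \<and> \<phi> i = \<phi>' i" if "i \<in> S"
      "cell_tree m K S" "cell_tree m K S'"
      "explored T m K E d X w S D \<phi>" "explored T m K E d X w S' D' \<phi>'"
    for S S' :: "nat list set" and D D' and \<phi> \<phi>' i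
    using that(1)
  proof (induction i rule: length_induct)
    case (1 i')
    show ?case
    proof (cases i' rule: rev_cases)
      case Nil
      then show ?thesis using that unfolding explored_def cell_tree_def by auto
    next
      case (snoc i c)
      have iS: "i \<in> S" using 1 snoc that(2) unfolding cell_tree_def by (metis butlast_snoc snoc_eq_iff_butlast)
      note H = that
      have IH: "x \<in> S' \<and> \<phi> x = \<phi>' x" if "x \<in> S" "length x \<le> length i" for x
        using 1 that snoc by simp
      have i: "i \<in> S'" "\<phi> i = \<phi>' i" using IH iS by auto
      let ?e = "{\<phi> i, \<phi> (i @ [c])}"
      have i': "i @ [c] \<in> S - {[]}" using 1 snoc by simp
      have e: "?e \<in> E" "X ?e \<in> cell (T / real m) c"
        using that(4) bspec[of "S - {[]}" _ "i @ [c]"] i' unfolding explored_def by (metis butlast_snoc last_snoc)+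
      have "length i < K" using that(2) i' unfolding cell_tree_def by force
      moreover have "X ?e \<le> T" using explored_time_le[OF that(2,4) i' T] by simp
      ultimately obtain j where j: "j \<in> S' - {[]}" "?e = {\<phi>' (butlast j), \<phi>' j}" "i \<in> {butlast j, j}"
        using explored_edge_cases[OF H(3,5) i(1), of ?e] e i(2) by auto
      have "X ?e \<in> cell (T / real m) (last j)"
        using that(5) j unfolding explored_def by auto
      then have c: "c = last j" using cell_unique e(2) T by (metis divide_nonneg_nonneg of_nat_0_le_iff)
      have inj: "inj_on \<phi> S" "inj_on \<phi>' S'" using that(4,5) unfolding explored_def by blast+
      \<comment> \<open>If the edge led to the parent in the second tree, then by induction this
        parent would be the same vertex in the first tree, and \<open>\<phi>\<close> would take it
        as a value twice.\<close>
      have "i \<noteq> j"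
      proof
        assume ij: "i = j"
        then have "i \<noteq> []" using j by auto
        then have bl: "butlast i \<in> S" "butlast i \<in> S'" using cell_tree_butlast that(2,3) iS i by blast+
        have "\<phi>' (butlast i) \<noteq> \<phi>' i" using inj(2) bl i \<open>i \<noteq> []\<close> butlast_neq by (metis inj_onD)
        moreover have "\<phi>' (butlast i) = \<phi> (butlast i)" using IH[OF bl(1)] by simp
        ultimately have "\<phi> (i @ [c]) = \<phi> (butlast i)"
          using j(2) ij i(2) by (auto simp: doubleton_eq_iff)
        then have "i @ [c] = butlast i" using inj(1) bl(1) i' by (auto dest: inj_onD)
        then have "length (i @ [c]) = length (butlast i)" by (rule arg_cong)
        then show False by simp
      qed
      then have "i = butlast j" using j by simp
      then have ji: "j = i @ [c]" using c j by (metis append_butlast_last_id DiffD2 singletonI)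
      then have "\<phi>' j = \<phi> (i @ [c])"
        using j(2) i(2) \<open>i = butlast j\<close> by (auto simp: doubleton_eq_iff)
      then show ?thesis using j ji snoc by simp
    qed
  qed
  show "S = S'" using sub[OF _ S S' ex ex'] sub[OF _ S' S ex' ex] by blast
  show *: "\<phi> i = \<phi>' i" if "i \<in> S" for i using sub[OF that S S' ex ex'] by blast
  show "D i = D' i" if "i \<in> S" for i
    using *[OF that] sub[OF that S S' ex ex'] that ex ex' unfolding explored_def by metis
qed

section \<open>Embeddings of forests\<close>

inductive forest :: "('i \<Rightarrow> 'i option) \<Rightarrow> 'i set \<Rightarrow> bool" for par where
  empty: "forest par {}"
| root: "forest par S \<Longrightarrow> j \<notin> S \<Longrightarrow> par j = None \<Longrightarrow> forest par (insert j S)"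
| child: "forest par S \<Longrightarrow> j \<notin> S \<Longrightarrow> par j = Some i \<Longrightarrow> i \<in> S \<Longrightarrow> forest par (insert j S)"

lemma forest_finite: "forest par S \<Longrightarrow> finite S"
  by (induction rule: forest.induct) auto

lemma forest_parent: "forest par S \<Longrightarrow> k \<in> S \<Longrightarrow> par k = Some i \<Longrightarrow> i \<in> S"
  by (induction rule: forest.induct) auto

definition roots :: "('i \<Rightarrow> 'i option) \<Rightarrow> 'i set \<Rightarrow> nat" where
  "roots par S = card {j \<in> S. par j = None}"

definition nonroots :: "('i \<Rightarrow> 'i option) \<Rightarrow> 'i set \<Rightarrow> nat" where
  "nonroots par S = card {j \<in> S. par j \<noteq> None}"

lemma roots_insert:
  assumes "finite S" "j \<notin> S"
  shows "roots par (insert j S) = (if par j = None then Suc (roots par S) else roots par S)"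
    and "nonroots par (insert j S) = (if par j = None then nonroots par S else Suc (nonroots par S))"
proof -
  have "{k \<in> insert j S. par k = None} =
      (if par j = None then insert j {k \<in> S. par k = None} else {k \<in> S. par k = None})"
    "{k \<in> insert j S. par k \<noteq> None} =
      (if par j = None then {k \<in> S. par k \<noteq> None} else insert j {k \<in> S. par k \<noteq> None})"
    by auto
  then show "roots par (insert j S) = (if par j = None then Suc (roots par S) else roots par S)"
    "nonroots par (insert j S) = (if par j = None then nonroots par S else Suc (nonroots par S))"
    unfolding roots_def nonroots_def using assms by (simp_all del: not_None_eq)
qed

text \<open>Homomorphisms are easy to bound from above, as no vertex has to be avoided. They control
  the losses in the lower bounds for embeddings.\<close>

definition forest_homs :: "'v set set \<Rightarrow> 'v set \<Rightarrow> ('i \<Rightarrow> 'i option) \<Rightarrow> 'i set \<Rightarrow> ('i \<Rightarrow> 'v) set" where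
  "forest_homs E W par S = {\<phi> \<in> S \<rightarrow>\<^sub>E W. \<forall>j\<in>S. \<forall>i. par j = Some i \<longrightarrow> {\<phi> i, \<phi> j} \<in> E}"

definition forest_embs :: "'v set set \<Rightarrow> 'v set \<Rightarrow> ('i \<Rightarrow> 'i option) \<Rightarrow> 'i set \<Rightarrow> ('i \<Rightarrow> 'v) set" where
  "forest_embs E W par S = {\<phi> \<in> forest_homs E W par S. inj_on \<phi> S}"

definition nbrs :: "'v set set \<Rightarrow> 'v \<Rightarrow> 'v set" where
  "nbrs E v = {u. {v, u} \<in> E}"

lemma finite_forest_homs: "finite S \<Longrightarrow> finite W \<Longrightarrow> finite (forest_homs E W par S)"
  unfolding forest_homs_def by (simp add: finite_PiE)

lemma forest_homs_root:
  assumes "forest par S" "j \<notin> S" "par j = None"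
  shows "bij_betw (\<lambda>(\<phi>, v). \<phi>(j := v)) (forest_homs E W par S \<times> W) (forest_homs E W par (insert j S))"
proof (rule bij_betw_byWitness[where f' = "\<lambda>\<psi>. (\<psi>(j := undefined), \<psi> j)"])
  have ne: "i \<noteq> j" if "k \<in> S" "par k = Some i" for i k using forest_parent[OF assms(1) that] assms(2) by blast
  show "\<forall>a\<in>forest_homs E W par S \<times> W.
      (\<lambda>\<psi>. (\<psi>(j := undefined), \<psi> j)) ((\<lambda>(\<phi>, v). \<phi>(j := v)) a) = a"
    using assms(2) by (auto simp: forest_homs_def fun_eq_iff PiE_def extensional_def)
  show "(\<lambda>(\<phi>, v). \<phi>(j := v)) ` (forest_homs E W par S \<times> W) \<subseteq> forest_homs E W par (insert j S)"
    using assms(2,3) ne by (auto simp: forest_homs_def PiE_def extensional_def Pi_def)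
  show "(\<lambda>\<psi>. (\<psi>(j := undefined), \<psi> j)) ` forest_homs E W par (insert j S) \<subseteq> forest_homs E W par S \<times> W"
    using assms(2,3) ne by (auto simp: forest_homs_def PiE_def extensional_def Pi_def)
qed auto

lemma forest_homs_child:
  assumes "forest par S" "j \<notin> S" "par j = Some i" "i \<in> S"
  shows "bij_betw (\<lambda>(\<phi>, v). \<phi>(j := v)) (SIGMA \<phi>:forest_homs E W par S. W \<inter> nbrs E (\<phi> i))
    (forest_homs E W par (insert j S))"
proof (rule bij_betw_byWitness[where f' = "\<lambda>\<psi>. (\<psi>(j := undefined), \<psi> j)"])
  have ne: "l \<noteq> j" if "k \<in> S" "par k = Some l" for l k using forest_parent[OF assms(1) that] assms(2) by blast
  have ij: "i \<noteq> j" using assms by blast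
  show "\<forall>a\<in>SIGMA \<phi>:forest_homs E W par S. W \<inter> nbrs E (\<phi> i).
      (\<lambda>\<psi>. (\<psi>(j := undefined), \<psi> j)) ((\<lambda>(\<phi>, v). \<phi>(j := v)) a) = a"
    using assms(2) by (auto simp: forest_homs_def fun_eq_iff PiE_def extensional_def)
  show "(\<lambda>(\<phi>, v). \<phi>(j := v)) ` (SIGMA \<phi>:forest_homs E W par S. W \<inter> nbrs E (\<phi> i))
      \<subseteq> forest_homs E W par (insert j S)"
    using assms(2,3) ne ij by (auto simp: forest_homs_def PiE_def extensional_def Pi_def nbrs_def)
  show "(\<lambda>\<psi>. (\<psi>(j := undefined), \<psi> j)) ` forest_homs E W par (insert j S)
      \<subseteq> (SIGMA \<phi>:forest_homs E W par S. W \<inter> nbrs E (\<phi> i))"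
    using assms(2,3) ne ij by (auto simp: forest_homs_def PiE_def extensional_def Pi_def nbrs_def)
qed auto

lemma card_forest_homs_le:
  assumes "forest par S" and W: "finite W" "real (card W) \<le> N"
    and \<Delta>: "0 \<le> \<Delta>" "\<And>v. v \<in> W \<Longrightarrow> real (card (W \<inter> nbrs E v)) \<le> \<Delta>"
  shows "real (card (forest_homs E W par S)) \<le> N ^ roots par S * \<Delta> ^ nonroots par S"
  using assms(1)
proof induction
  case empty
  have "forest_homs E W par {} = {\<lambda>x. undefined}" by (auto simp: forest_homs_def)
  then show ?case by (simp add: roots_def nonroots_def)
next
  case (root S j)
  have "real (card (forest_homs E W par (insert j S))) = real (card (forest_homs E W par S)) * real (card W)"
    using bij_betw_same_card[OF forest_homs_root[OF root(1-3)]] by (metis card_cartesian_product of_nat_mult)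
  also have "\<dots> \<le> (N ^ roots par S * \<Delta> ^ nonroots par S) * N"
    using W \<Delta> root.IH by (intro mult_mono) (auto simp: order_trans[OF of_nat_0_le_iff])
  finally show ?case using root forest_finite[OF root(1)] by (simp add: roots_insert mult_ac)
next
  case (child S j i)
  have fin: "finite S" using child forest_finite by blast
  have "real (card (forest_homs E W par (insert j S))) =
      real (card (SIGMA \<phi>:forest_homs E W par S. W \<inter> nbrs E (\<phi> i)))"
    using bij_betw_same_card[OF forest_homs_child[OF child(1-4)]] by metis
  also have "\<dots> = (\<Sum>\<phi>\<in>forest_homs E W par S. real (card (W \<inter> nbrs E (\<phi> i))))"
    using finite_forest_homs[OF fin W(1)] W(1) by (subst card_SigmaI) auto
  also have "\<dots> \<le> (\<Sum>\<phi>\<in>forest_homs E W par S. \<Delta>)"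
    using child by (intro sum_mono \<Delta>) (auto simp: forest_homs_def)
  also have "\<dots> = real (card (forest_homs E W par S)) * \<Delta>" by simp
  also have "\<dots> \<le> (N ^ roots par S * \<Delta> ^ nonroots par S) * \<Delta>"
    using \<Delta> child.IH by (intro mult_right_mono) auto
  finally show ?case using child fin by (simp add: roots_insert mult_ac)
qed

text \<open>No vertex of \<open>W\<close> is overly popular as the image of the fixed forest vertex
  \<open>i\<close>: counted outwards from \<open>i\<close>, every further vertex still costs at most
  a factor \<open>N\<close> or \<open>\<Delta>\<close>. With \<open>g\<close> counting the
  neighbours outside \<open>W\<close>, this will show that few homomorphisms come close to the
  complement of \<open>W\<close>.\<close>

lemma sum_forest_homs_le:
  assumes "forest par S" and W: "finite W" "real (card W) \<le> N"
    and \<Delta>: "0 \<le> \<Delta>" "\<And>v. v \<in> W \<Longrightarrow> real (card (W \<inter> nbrs E v)) \<le> \<Delta>"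
    and "i \<in> S" "\<And>v. (0::real) \<le> g v"
  shows "N * (\<Sum>\<phi>\<in>forest_homs E W par S. g (\<phi> i)) \<le> N ^ roots par S * \<Delta> ^ nonroots par S * (\<Sum>v\<in>W. g v)"
  using assms(1,6,7)
proof (induction arbitrary: i g)
  case empty
  then show ?case by simp
next
  case (root S j)
  have fin: "finite S" using root forest_finite by blast
  have N: "0 \<le> N" using W by (meson of_nat_0_le_iff order_trans)
  have eq: "(\<Sum>\<phi>\<in>forest_homs E W par (insert j S). g (\<phi> i)) =
      (\<Sum>\<phi>\<in>forest_homs E W par S. \<Sum>v\<in>W. g ((\<phi>(j := v)) i))"
    using sum.reindex_bij_betw[OF forest_homs_root[OF root(1-3)], of "\<lambda>\<phi>. g (\<phi> i)"]
    by (simp add: sum.cartesian_product case_prod_beta del: fun_upd_apply)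
  show ?case
  proof (cases "i = j")
    case True
    have "N * (\<Sum>\<phi>\<in>forest_homs E W par (insert j S). g (\<phi> i)) =
        N * (real (card (forest_homs E W par S)) * (\<Sum>v\<in>W. g v))"
      unfolding eq using True by simp
    also have "\<dots> \<le> N * ((N ^ roots par S * \<Delta> ^ nonroots par S) * (\<Sum>v\<in>W. g v))"
      using N root.prems by (intro mult_left_mono mult_right_mono card_forest_homs_le[OF root(1) W \<Delta>] sum_nonneg) auto
    finally show ?thesis using root fin by (simp add: roots_insert mult_ac)
  next
    case False
    then have iS: "i \<in> S" using root by blast
    have "N * (\<Sum>\<phi>\<in>forest_homs E W par (insert j S). g (\<phi> i)) =
        real (card W) * (N * (\<Sum>\<phi>\<in>forest_homs E W par S. g (\<phi> i)))"
      unfolding eq using False by (simp add: sum_distrib_left mult_ac)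
    also have "\<dots> \<le> N * (N ^ roots par S * \<Delta> ^ nonroots par S * (\<Sum>v\<in>W. g v))"
      using N W root.prems iS by (intro mult_mono root.IH) (auto intro!: mult_nonneg_nonneg sum_nonneg)
    finally show ?thesis using root fin by (simp add: roots_insert mult_ac)
  qed
next
  case (child S j k)
  have fin: "finite S" using child forest_finite by blast
  have N: "0 \<le> N" using W by (meson of_nat_0_le_iff order_trans)
  have kW: "\<phi> k \<in> W" if "\<phi> \<in> forest_homs E W par S" for \<phi>
    using that child by (auto simp: forest_homs_def)
  have eq: "(\<Sum>\<phi>\<in>forest_homs E W par (insert j S). g (\<phi> i)) =
      (\<Sum>\<phi>\<in>forest_homs E W par S. \<Sum>v\<in>W \<inter> nbrs E (\<phi> k). g ((\<phi>(j := v)) i))"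
    using sum.reindex_bij_betw[OF forest_homs_child[OF child(1-4)], of "\<lambda>\<phi>. g (\<phi> i)"]
      finite_forest_homs[OF fin W(1), of E par] W(1)
    by (simp add: sum.Sigma case_prod_beta del: fun_upd_apply)
  show ?case
  proof (cases "i = j")
    case True
    let ?g = "\<lambda>u. \<Sum>v\<in>W \<inter> nbrs E u. g v"
    \<comment> \<open>Double counting of adjacent pairs moves the sum from the parent to the child,
      whose number of possible parents is again at most \<open>\<Delta>\<close>.\<close>
    have "(\<Sum>u\<in>W. ?g u) = (\<Sum>u\<in>W. \<Sum>v\<in>W. if v \<in> nbrs E u then g v else 0)"
      using W(1) by (simp add: sum.inter_restrict)
    also have "\<dots> = (\<Sum>v\<in>W. \<Sum>u\<in>W. if u \<in> nbrs E v then g v else 0)"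
      by (subst sum.swap) (simp add: nbrs_def insert_commute)
    also have "\<dots> = (\<Sum>v\<in>W. real (card (W \<inter> nbrs E v)) * g v)"
      using W(1) by (simp flip: sum.inter_restrict)
    also have "\<dots> \<le> (\<Sum>v\<in>W. \<Delta> * g v)"
      using \<Delta> child.prems by (intro sum_mono mult_right_mono) auto
    finally have le: "(\<Sum>u\<in>W. ?g u) \<le> \<Delta> * (\<Sum>v\<in>W. g v)" by (simp add: sum_distrib_left)
    have "N * (\<Sum>\<phi>\<in>forest_homs E W par (insert j S). g (\<phi> i)) = N * (\<Sum>\<phi>\<in>forest_homs E W par S. ?g (\<phi> k))"
      unfolding eq using True by simp
    also have "\<dots> \<le> N ^ roots par S * \<Delta> ^ nonroots par S * (\<Sum>u\<in>W. ?g u)"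
      using child.prems by (intro child.IH child.hyps sum_nonneg)
    also have "\<dots> \<le> N ^ roots par S * \<Delta> ^ nonroots par S * (\<Delta> * (\<Sum>v\<in>W. g v))"
      using N \<Delta> by (intro mult_left_mono le) auto
    finally show ?thesis using child fin by (simp add: roots_insert mult_ac)
  next
    case False
    then have iS: "i \<in> S" using child by blast
    have "N * (\<Sum>\<phi>\<in>forest_homs E W par (insert j S). g (\<phi> i)) =
        N * (\<Sum>\<phi>\<in>forest_homs E W par S. real (card (W \<inter> nbrs E (\<phi> k))) * g (\<phi> i))"
      unfolding eq using False by simp
    also have "\<dots> \<le> N * (\<Sum>\<phi>\<in>forest_homs E W par S. \<Delta> * g (\<phi> i))"
      using N kW child.prems by (intro mult_left_mono sum_mono mult_right_mono \<Delta>) auto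
    also have "\<dots> = \<Delta> * (N * (\<Sum>\<phi>\<in>forest_homs E W par S. g (\<phi> i)))"
      by (simp add: sum_distrib_left mult_ac)
    also have "\<dots> \<le> \<Delta> * (N ^ roots par S * \<Delta> ^ nonroots par S * (\<Sum>v\<in>W. g v))"
      using \<Delta> child.prems iS by (intro mult_left_mono child.IH)
    finally show ?thesis using child fin by (simp add: roots_insert mult_ac)
  qed
qed

section \<open>Lower bounds for embeddings into typical vertices\<close>

lemma forest_embs_root_ge:
  assumes "forest par S" "j \<notin> S" "par j = None" and W: "finite W"
  shows "real (card (forest_embs E W par (insert j S))) \<ge>
    real (card (forest_embs E W par S)) * (real (card W) - real (card S))"
proof -
  have fin: "finite S" using assms forest_finite by blast
  let ?A = "SIGMA \<phi>:forest_embs E W par S. W - \<phi> ` S"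
  note bij = forest_homs_root[OF assms(1-3), of E W]
  have sub: "?A \<subseteq> forest_homs E W par S \<times> W" by (auto simp: forest_embs_def)
  have img: "(\<lambda>(\<phi>, v). \<phi>(j := v)) ` ?A \<subseteq> forest_embs E W par (insert j S)"
  proof
    fix \<psi> assume "\<psi> \<in> (\<lambda>(\<phi>, v). \<phi>(j := v)) ` ?A"
    then obtain \<phi> v where \<psi>: "\<psi> = \<phi>(j := v)" "(\<phi>, v) \<in> ?A" by auto
    have "(\<lambda>(\<phi>, v). \<phi>(j := v)) (\<phi>, v) \<in> forest_homs E W par (insert j S)"
      using bij \<psi>(2) sub by (intro bij_betw_apply[OF bij]) blast
    moreover have "inj_on \<psi> (insert j S)"
      using \<psi> assms(2) by (auto simp: forest_embs_def inj_on_def)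
    ultimately show "\<psi> \<in> forest_embs E W par (insert j S)" using \<psi> by (simp add: forest_embs_def)
  qed
  have fine: "finite (forest_embs E W par S)"
    unfolding forest_embs_def using finite_forest_homs[OF fin W] by simp
  have "real (card (forest_embs E W par S)) * (real (card W) - real (card S)) \<le>
      (\<Sum>\<phi>\<in>forest_embs E W par S. real (card (W - \<phi> ` S)))"
  proof -
    have "real (card W) - real (card S) \<le> real (card (W - \<phi> ` S))" for \<phi> :: "'a \<Rightarrow> 'b"
    proof -
      have "card W \<le> card (W - \<phi> ` S) + card (\<phi> ` S)"
        using diff_card_le_card_Diff[of "\<phi> ` S" W] finite_imageI[OF fin, of \<phi>] by linarith
      then show ?thesis using card_image_le[OF fin, of \<phi>] by linarith
    qed
    then show ?thesis using sum_mono[of "forest_embs E W par S" "\<lambda>_. real (card W) - real (card S)"] by simp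
  qed
  also have "\<dots> = real (card ?A)"
    using fine fin W by (subst card_SigmaI) auto
  also have "\<dots> = real (card ((\<lambda>(\<phi>, v). \<phi>(j := v)) ` ?A))"
    using bij sub by (subst card_image) (auto simp: bij_betw_def intro: inj_on_subset)
  also have "\<dots> \<le> real (card (forest_embs E W par (insert j S)))"
    using img finite_forest_homs[of "insert j S" W E par] fin W
    by (intro of_nat_mono card_mono) (auto simp: forest_embs_def)
  finally show ?thesis .
qed

text \<open>A new leaf may use the neighbours of the image of its parent, except those already
  occupied, at most \<open>card S\<close>, and those outside \<open>W\<close>. The second loss is
  summed over all homomorphisms instead of embeddings, where \<open>sum_forest_homs_le\<close>
  applies.\<close>

lemma forest_embs_child_ge:
  assumes "forest par S" "j \<notin> S" "par j = Some i" "i \<in> S" and W: "finite W"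
    and nb: "\<And>v. v \<in> W \<Longrightarrow> finite (nbrs E v)" "\<And>v. v \<in> W \<Longrightarrow> dmin \<le> real (card (nbrs E v))"
  shows "real (card (forest_embs E W par (insert j S))) \<ge>
    real (card (forest_embs E W par S)) * (dmin - real (card S)) -
    (\<Sum>\<phi>\<in>forest_homs E W par S. real (card (nbrs E (\<phi> i) - W)))"
proof -
  have fin: "finite S" using assms forest_finite by blast
  let ?A = "SIGMA \<phi>:forest_embs E W par S. (W \<inter> nbrs E (\<phi> i)) - \<phi> ` S"
  note bij = forest_homs_child[OF assms(1-4), of E W]
  have sub: "?A \<subseteq> (SIGMA \<phi>:forest_homs E W par S. W \<inter> nbrs E (\<phi> i))" by (auto simp: forest_embs_def)
  have img: "(\<lambda>(\<phi>, v). \<phi>(j := v)) ` ?A \<subseteq> forest_embs E W par (insert j S)"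
  proof
    fix \<psi> assume "\<psi> \<in> (\<lambda>(\<phi>, v). \<phi>(j := v)) ` ?A"
    then obtain \<phi> v where \<psi>: "\<psi> = \<phi>(j := v)" "(\<phi>, v) \<in> ?A" by auto
    have "(\<lambda>(\<phi>, v). \<phi>(j := v)) (\<phi>, v) \<in> forest_homs E W par (insert j S)"
      using bij \<psi>(2) sub by (intro bij_betw_apply[OF bij]) blast
    moreover have "inj_on \<psi> (insert j S)"
      using \<psi> assms(2) by (auto simp: forest_embs_def inj_on_def)
    ultimately show "\<psi> \<in> forest_embs E W par (insert j S)" using \<psi> by (simp add: forest_embs_def)
  qed
  have finh: "finite (forest_homs E W par S)" using finite_forest_homs[OF fin W] .
  have fine: "finite (forest_embs E W par S)" using finh unfolding forest_embs_def by auto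
  have "real (card (forest_embs E W par S)) * (dmin - real (card S)) -
      (\<Sum>\<phi>\<in>forest_homs E W par S. real (card (nbrs E (\<phi> i) - W))) \<le>
    (\<Sum>\<phi>\<in>forest_embs E W par S. dmin - real (card S)) -
      (\<Sum>\<phi>\<in>forest_embs E W par S. real (card (nbrs E (\<phi> i) - W)))"
    using finh by (simp, intro sum_mono2) (auto simp: forest_embs_def)
  also have "\<dots> = (\<Sum>\<phi>\<in>forest_embs E W par S. dmin - real (card S) - real (card (nbrs E (\<phi> i) - W)))"
    by (simp add: sum_subtractf)
  also have "\<dots> \<le> (\<Sum>\<phi>\<in>forest_embs E W par S. real (card ((W \<inter> nbrs E (\<phi> i)) - \<phi> ` S)))"
  proof (rule sum_mono)
    fix \<phi> assume "\<phi> \<in> forest_embs E W par S"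
    then have iW: "\<phi> i \<in> W" using assms(4) by (auto simp: forest_embs_def forest_homs_def)
    have "card (nbrs E (\<phi> i)) = card (W \<inter> nbrs E (\<phi> i)) + card (nbrs E (\<phi> i) - W)"
      using nb(1)[OF iW] by (metis Int_commute card_Int_Diff)
    moreover have "card (W \<inter> nbrs E (\<phi> i)) \<le> card (W \<inter> nbrs E (\<phi> i) - \<phi> ` S) + card (\<phi> ` S)"
      using diff_card_le_card_Diff[of "\<phi> ` S" "W \<inter> nbrs E (\<phi> i)"] finite_imageI[OF fin, of \<phi>] by linarith
    ultimately show "dmin - real (card S) - real (card (nbrs E (\<phi> i) - W)) \<le>
        real (card ((W \<inter> nbrs E (\<phi> i)) - \<phi> ` S))"
      using nb(2)[OF iW] card_image_le[OF fin, of \<phi>] by linarith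
  qed
  also have "\<dots> = real (card ?A)"
    using fine fin W by (subst card_SigmaI) auto
  also have "\<dots> = real (card ((\<lambda>(\<phi>, v). \<phi>(j := v)) ` ?A))"
    using bij sub by (subst card_image) (auto simp: bij_betw_def intro: inj_on_subset)
  also have "\<dots> \<le> real (card (forest_embs E W par (insert j S)))"
    using img finite_forest_homs[of "insert j S" W E par] fin W
    by (intro of_nat_mono card_mono) (auto simp: forest_embs_def)
  finally show ?thesis .
qed

text \<open>Degrees in \<open>W\<close> are bounded from both sides, while degrees outside are
  unrestricted. The bound on the total degree enters as \<open>out_W\<close>: only a vanishing
  fraction of the edges leaves \<open>W\<close>.\<close>

locale typical_vertices =
  fixes G :: "nat \<Rightarrow> 'v graph" and W :: "nat \<Rightarrow> 'v set" and r \<alpha> :: "nat \<Rightarrow> real"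
  assumes finite_verts: "\<And>n. finite (verts (G n))" and simple: "\<And>n. simple_graph (G n)"
    and W_sub: "\<And>n. W n \<subseteq> verts (G n)" and \<alpha>_nonneg: "\<And>n. 0 \<le> \<alpha> n" and \<alpha>_lim: "\<alpha> \<longlonglongrightarrow> 0"
    and r_lim: "filterlim r at_top sequentially"
    and card_lim: "filterlim (\<lambda>n. real (card (verts (G n)))) at_top sequentially"
    and card_W: "\<forall>\<^sub>F n in sequentially. (1 - \<alpha> n) * real (card (verts (G n))) \<le> real (card (W n))"
    and degree_W: "\<forall>\<^sub>F n in sequentially. \<forall>v\<in>W n.
      real (card (nbrs (edges (G n)) v)) \<in> {(1 - \<alpha> n) * r n .. (1 + \<alpha> n) * r n}"
    and out_W: "\<forall>\<^sub>F n in sequentially.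
      (\<Sum>v\<in>W n. real (card (nbrs (edges (G n)) v - W n))) \<le> \<alpha> n * r n * real (card (verts (G n)))"
begin

lemma nbrs_sub: "nbrs (edges (G n)) v \<subseteq> verts (G n)"
  using simple[of n] unfolding nbrs_def by (auto elim!: simple_graphD simp: doubleton_eq_iff)

lemma finite_nbrs: "finite (nbrs (edges (G n)) v)"
  using nbrs_sub finite_verts by (rule finite_subset)

lemma card_forest_embs_ge:
  assumes "forest par S" "0 < \<epsilon>"
  shows "\<forall>\<^sub>F n in sequentially. (1 - \<epsilon>) * (real (card (verts (G n))) ^ roots par S * r n ^ nonroots par S) \<le>
    real (card (forest_embs (edges (G n)) (W n) par S))"
  using assms
proof (induction arbitrary: \<epsilon>)
  case empty
  have "forest_embs (edges (G n)) (W n) par {} = {\<lambda>x. undefined}" for n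
    by (auto simp: forest_embs_def forest_homs_def)
  then show ?case using empty by (simp add: roots_def nonroots_def)
next
  case (root S j)
  have fin: "finite S" using root forest_finite by blast
  \<comment> \<open>Two factors \<open>1 - \<delta>\<close> are lost, one from the induction
    hypothesis and one from the choice of the root.\<close>
  define \<delta> where "\<delta> = min (\<epsilon> / 2) (1/2)"
  have \<delta>: "0 < \<delta>" "\<delta> \<le> 1/2" "\<delta> \<le> \<epsilon> / 2" using root by (auto simp: \<delta>_def)
  have ev1: "\<forall>\<^sub>F n in sequentially. \<alpha> n < \<delta> / 2"
    using order_tendstoD(2)[OF \<alpha>_lim, of "\<delta> / 2"] \<delta> by auto
  have ev2: "\<forall>\<^sub>F n in sequentially. real (card S) * 2 / \<delta> \<le> real (card (verts (G n)))"
    using card_lim unfolding filterlim_at_top by blast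
  have ev3: "\<forall>\<^sub>F n in sequentially. 1 \<le> r n" using r_lim unfolding filterlim_at_top by blast
  show ?case
    using root.IH[OF \<delta>(1)] card_W ev1 ev2 ev3
  proof eventually_elim
    case (elim n)
    let ?N = "real (card (verts (G n)))" and ?c = "real (card (forest_embs (edges (G n)) (W n) par S))"
    let ?M = "?N ^ roots par S * r n ^ nonroots par S"
    have M: "0 \<le> ?M" using elim by simp
    have "real (card S) \<le> \<delta> / 2 * ?N" using elim(4) \<delta> by (simp add: field_simps)
    moreover have "(1 - \<delta> / 2) * ?N \<le> (1 - \<alpha> n) * ?N" using elim by (intro mult_right_mono) auto
    ultimately have W: "(1 - \<delta>) * ?N \<le> real (card (W n)) - real (card S)"
      using elim(2) by (simp add: algebra_simps)
    have W0: "0 \<le> (1 - \<delta>) * ?N" using \<delta> by simp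
    have "(1 - \<epsilon>) * (?N ^ roots par (insert j S) * r n ^ nonroots par (insert j S)) = (1 - \<epsilon>) * (?M * ?N)"
      using root fin by (simp add: roots_insert mult_ac)
    also have "\<dots> \<le> ((1 - \<delta>) * (1 - \<delta>)) * (?M * ?N)"
    proof (intro mult_right_mono mult_nonneg_nonneg)
      have "(1 - \<delta>) * (1 - \<delta>) = 1 - 2 * \<delta> + \<delta> * \<delta>" by (simp add: algebra_simps)
      then show "1 - \<epsilon> \<le> (1 - \<delta>) * (1 - \<delta>)" using \<delta> by (smt (verit) mult_nonneg_nonneg field_sum_of_halves)
    qed (use elim in auto)
    also have "\<dots> = ((1 - \<delta>) * ?M) * ((1 - \<delta>) * ?N)" by simp
    also have "\<dots> \<le> ?c * (real (card (W n)) - real (card S))"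
      using elim(1) W W0 by (intro mult_mono) auto
    also have "\<dots> \<le> real (card (forest_embs (edges (G n)) (W n) par (insert j S)))"
      using forest_embs_root_ge[OF root(1-3)] finite_subset[OF W_sub finite_verts] by blast
    finally show ?case .
  qed
next
  case (child S j i)
  have fin: "finite S" using child forest_finite by blast
  \<comment> \<open>Two factors \<open>1 - \<delta>\<close> are lost, and a further
    \<open>\<delta>\<close> for the neighbours outside \<open>W\<close>, hence
    \<open>\<epsilon> / 3\<close>.\<close>
  define \<delta> where "\<delta> = min (\<epsilon> / 3) (1/2)"
  have \<delta>: "0 < \<delta>" "\<delta> \<le> 1/2" "\<delta> \<le> \<epsilon> / 3" using child by (auto simp: \<delta>_def)
  let ?e = "nonroots par S"
  \<comment> \<open>Degrees in \<open>W\<close> are at most \<open>2 * r n\<close>, so the bound for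
    homomorphisms carries a factor \<open>2 ^ nonroots par S\<close>, which
    \<open>\<alpha> n\<close> has to absorb.\<close>
  have ev1: "\<forall>\<^sub>F n in sequentially. \<alpha> n < min (\<delta> / 2) (\<delta> / 2 ^ ?e)"
    using order_tendstoD(2)[OF \<alpha>_lim, of "min (\<delta> / 2) (\<delta> / 2 ^ ?e)"] \<delta> by auto
  have ev2: "\<forall>\<^sub>F n in sequentially. max 1 (real (card S) * 2 / \<delta>) \<le> r n"
    using r_lim unfolding filterlim_at_top by blast
  have ev3: "\<forall>\<^sub>F n in sequentially. 1 \<le> real (card (verts (G n)))"
    using card_lim unfolding filterlim_at_top by blast
  show ?case
    using child.IH[OF \<delta>(1)] degree_W out_W ev1 ev2 ev3
  proof eventually_elim
    case (elim n)
    let ?N = "real (card (verts (G n)))" and ?E = "edges (G n)"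
    let ?c = "real (card (forest_embs ?E (W n) par S))"
    let ?M = "?N ^ roots par S * r n ^ nonroots par S"
    have M: "0 \<le> ?M" and r: "1 \<le> r n" using elim by auto
    have finW: "finite (W n)" using finite_subset[OF W_sub finite_verts] .
    have "real (card S) \<le> \<delta> / 2 * r n" using elim(5) \<delta> by (simp add: field_simps)
    moreover have "(1 - \<delta> / 2) * r n \<le> (1 - \<alpha> n) * r n" using elim by (intro mult_right_mono) auto
    ultimately have d: "(1 - \<delta>) * r n \<le> (1 - \<alpha> n) * r n - real (card S)"
      by (simp add: algebra_simps)
    have d0: "0 \<le> (1 - \<delta>) * r n" using \<delta> r by simp
    have "?N * (\<Sum>\<phi>\<in>forest_homs ?E (W n) par S. real (card (nbrs ?E (\<phi> i) - W n))) \<le>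
        ?N ^ roots par S * ((1 + \<alpha> n) * r n) ^ ?e * (\<Sum>v\<in>W n. real (card (nbrs ?E v - W n)))"
    proof (rule sum_forest_homs_le[OF child(1) finW _ _ _ child(4)])
      show "real (card (W n)) \<le> ?N" using W_sub finite_verts by (simp add: card_mono)
      show "0 \<le> (1 + \<alpha> n) * r n" using r \<alpha>_nonneg[of n] by simp
      fix v assume "v \<in> W n"
      then have "real (card (nbrs ?E v)) \<le> (1 + \<alpha> n) * r n" using elim(2) by auto
      moreover have "card (W n \<inter> nbrs ?E v) \<le> card (nbrs ?E v)" by (intro card_mono finite_nbrs) auto
      ultimately show "real (card (W n \<inter> nbrs ?E v)) \<le> (1 + \<alpha> n) * r n" by linarith
    qed auto
    also have "\<dots> \<le> ?N ^ roots par S * (2 * r n) ^ ?e * (\<alpha> n * r n * ?N)"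
    proof (intro mult_mono mult_left_mono power_mono elim(3))
      have "\<alpha> n \<le> 1" using elim(4) \<delta> by linarith
      then show "1 + \<alpha> n \<le> 2" by simp
    qed (use r \<alpha>_nonneg[of n] in \<open>auto intro!: sum_nonneg\<close>)
    also have "\<dots> = ?N * (?M * r n * (2 ^ ?e * \<alpha> n))" by (simp add: power_mult_distrib)
    finally have "(\<Sum>\<phi>\<in>forest_homs ?E (W n) par S. real (card (nbrs ?E (\<phi> i) - W n))) \<le>
        ?M * r n * (2 ^ ?e * \<alpha> n)"
      using elim(6) by (simp only: mult_le_cancel_left_pos)
    also have "\<dots> \<le> ?M * r n * \<delta>"
      using elim(4) M r by (intro mult_left_mono) (auto simp: field_simps)
    finally have out: "(\<Sum>\<phi>\<in>forest_homs ?E (W n) par S. real (card (nbrs ?E (\<phi> i) - W n))) \<le> ?M * r n * \<delta>" .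
    have "(1 - \<epsilon>) * (?N ^ roots par (insert j S) * r n ^ nonroots par (insert j S)) = (1 - \<epsilon>) * (?M * r n)"
      using child fin by (simp add: roots_insert mult_ac)
    also have "\<dots> \<le> ((1 - \<delta>) * (1 - \<delta>) - \<delta>) * (?M * r n)"
    proof (intro mult_right_mono mult_nonneg_nonneg)
      have "(1 - \<delta>) * (1 - \<delta>) = 1 - 2 * \<delta> + \<delta> * \<delta>" by (simp add: algebra_simps)
      moreover have "0 \<le> \<delta> * \<delta>" by simp
      ultimately show "1 - \<epsilon> \<le> (1 - \<delta>) * (1 - \<delta>) - \<delta>" using \<delta> by linarith
    qed (use r in auto)
    also have "\<dots> = ((1 - \<delta>) * ?M) * ((1 - \<delta>) * r n) - ?M * r n * \<delta>" by (simp add: algebra_simps)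
    also have "\<dots> \<le> ?c * ((1 - \<alpha> n) * r n - real (card S)) -
        (\<Sum>\<phi>\<in>forest_homs ?E (W n) par S. real (card (nbrs ?E (\<phi> i) - W n)))"
      using elim(1) d d0 by (intro diff_mono mult_mono out) auto
    also have "\<dots> \<le> real (card (forest_embs ?E (W n) par (insert j S)))"
      using forest_embs_child_ge[OF child(1-4) finW finite_nbrs, of "(1 - \<alpha> n) * r n"] elim(2) by auto
    finally show ?case .
  qed
qed

end

text \<open>An element of largest rank has no children, so it can be the last one added.\<close>

lemma forest_of_rank:
  fixes h :: "'i \<Rightarrow> nat"
  assumes "finite S" "\<And>i j. j \<in> S \<Longrightarrow> par j = Some i \<Longrightarrow> i \<in> S \<and> h i < h j"
  shows "forest par S"
  using assms
proof (induction "card S" arbitrary: S)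
  case 0
  then show ?case by (simp add: forest.empty)
next
  case (Suc n)
  then have ne: "S \<noteq> {}" by auto
  then have "Max (h ` S) \<in> h ` S" using Suc.prems(1) by (intro Max_in) auto
  then obtain j where j: "j \<in> S" "h j = Max (h ` S)" by force
  have jmax: "h k \<le> h j" if "k \<in> S" for k using that Suc.prems(1) j(2) by simp
  have f: "forest par (S - {j})"
  proof (rule Suc.hyps)
    show "n = card (S - {j})" using Suc j by simp
    show "i \<in> S - {j} \<and> h i < h k" if "k \<in> S - {j}" "par k = Some i" for i k
      using Suc.prems(2)[of k i] that jmax[of k] by auto
  qed (use Suc in auto)
  have S: "insert j (S - {j}) = S" using j by blast
  show ?case
  proof (cases "par j")
    case None
    then show ?thesis using forest.root[OF f, of j] S by simp
  next
    case (Some i)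
    then have "i \<in> S - {j}" using Suc.prems(2)[OF j(1) Some] by auto
    then show ?thesis using forest.child[OF f, of j i] Some S by simp
  qed
qed

text \<open>The first component tells apart the two trees of a pair, which thus form a single forest
  with the two roots \<open>(b, [])\<close>.\<close>

definition list_parent :: "'b \<times> nat list \<Rightarrow> ('b \<times> nat list) option" where
  "list_parent j = (if snd j = [] then None else Some (fst j, butlast (snd j)))"

lemma forest_cell_trees:
  fixes Ss :: "bool \<Rightarrow> nat list set"
  assumes "\<And>b. cell_tree m K (Ss b)"
  shows "forest list_parent (Sigma UNIV Ss)"
proof (rule forest_of_rank[where h = "length \<circ> snd"])
  show "finite (Sigma UNIV Ss)" using finite_cell_tree[OF assms] by simp
  fix i j assume "j \<in> Sigma UNIV Ss" "list_parent j = Some i"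
  then show "i \<in> Sigma UNIV Ss \<and> (length \<circ> snd) i < (length \<circ> snd) j"
    using cell_tree_butlast[OF assms] by (auto simp: list_parent_def split: if_splits)
qed

lemma roots_cell_trees:
  fixes Ss :: "bool \<Rightarrow> nat list set"
  assumes "\<And>b. cell_tree m K (Ss b)"
  shows "roots list_parent (Sigma UNIV Ss) = 2"
    and "nonroots list_parent (Sigma UNIV Ss) = (\<Sum>b\<in>UNIV. card (Ss b) - 1)"
proof -
  have nil: "[] \<in> Ss b" and fin: "finite (Ss b)" for b
    using assms finite_cell_tree[OF assms] by (auto simp: cell_tree_def)
  have "{j \<in> Sigma UNIV Ss. list_parent j = None} = UNIV \<times> {[]}"
    using nil by (auto simp: list_parent_def)
  then show "roots list_parent (Sigma UNIV Ss) = 2" by (simp add: roots_def card_cartesian_product)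
  have "{j \<in> Sigma UNIV Ss. list_parent j \<noteq> None} = (SIGMA b:UNIV. Ss b - {[]})"
    by (auto simp: list_parent_def)
  then show "nonroots list_parent (Sigma UNIV Ss) = (\<Sum>b\<in>UNIV. card (Ss b) - 1)"
    using nil fin by (simp add: nonroots_def)
qed

section \<open>Shapes at prescribed places of a finite graph\<close>

lemma nbrs_edges_card:
  assumes "simple_graph G"
  shows "card {e \<in> edges G. v \<in> e} = card (nbrs (edges G) v)"
proof (rule bij_betw_same_card[symmetric])
  show "bij_betw (\<lambda>u. {v, u}) (nbrs (edges G) v) {e \<in> edges G. v \<in> e}"
    unfolding bij_betw_def
  proof
    show "inj_on (\<lambda>u. {v, u}) (nbrs (edges G) v)" by (auto simp: inj_on_def doubleton_eq_iff)
    show "(\<lambda>u. {v, u}) ` nbrs (edges G) v = {e \<in> edges G. v \<in> e}"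
    proof (intro equalityI subsetI)
      fix e assume "e \<in> {e \<in> edges G. v \<in> e}"
      then obtain x y where "e = {x, y}" "e \<in> edges G" "v \<in> e" using assms by (auto elim!: simple_graphD)
      then show "e \<in> (\<lambda>u. {v, u}) ` nbrs (edges G) v"
        by (cases "v = x") (auto simp: nbrs_def insert_commute intro!: image_eqI)
    qed (auto simp: nbrs_def)
  qed
qed

lemma finite_edges:
  assumes "simple_graph G" "finite (verts G)"
  shows "finite (edges G)"
proof (rule finite_subset[of _ "Pow (verts G)"])
  show "edges G \<subseteq> Pow (verts G)" using assms(1) by (fastforce elim!: simple_graphD)
qed (use assms in simp)

text \<open>On \<open>[0,T]\<close> the exponential density is at least
  \<open>l * exp (- (T * l))\<close>, and each cell has length \<open>T / m\<close>.\<close>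

lemma exponential_cell_prob_ge:
  assumes "prob_space M" "distributed M lborel X (exponential_density l)" "0 < l"
    and "c < m" "0 \<le> T"
  shows "T / m * l * exp (- (T * l)) \<le> measure M {\<omega> \<in> space M. X \<omega> \<in> cell (T / real m) c}"
proof -
  interpret prob_space M by fact
  define \<delta> where "\<delta> = T / real m"
  have X [measurable]: "X \<in> borel_measurable M" using assms(2) by (simp add: distributed_def)
  have \<delta>: "0 \<le> \<delta>" using assms by (simp add: \<delta>_def)
  let ?a = "real c * \<delta>" and ?b = "real (Suc c) * \<delta>"
  have bT: "?b \<le> T"
  proof -
    have "?b \<le> real m * \<delta>" using assms \<delta> by (intro mult_right_mono) auto
    then show ?thesis using assms by (simp add: \<delta>_def)
  qed
  have "exp (- (?b * l)) * (1 + \<delta> * l) \<le> exp (- (?b * l)) * exp (\<delta> * l)"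
    using \<delta> assms by (intro mult_left_mono) auto
  also have "\<dots> = exp (- (?a * l))" by (simp add: exp_add[symmetric] algebra_simps)
  finally have 1: "\<delta> * l * exp (- (?b * l)) \<le> exp (- (?a * l)) - exp (- (?b * l))"
    by (simp add: algebra_simps)
  have "\<delta> * l * exp (- (T * l)) \<le> \<delta> * l * exp (- (?b * l))"
    using \<delta> assms bT by (intro mult_left_mono) auto
  also note 1
  also have "exp (- (?a * l)) - exp (- (?b * l)) =
      measure M {\<omega> \<in> space M. X \<omega> \<le> ?b} - measure M {\<omega> \<in> space M. X \<omega> \<le> ?a}"
    using exponential_distributedD_le[OF assms(2), of ?a] exponential_distributedD_le[OF assms(2), of ?b] assms(3) \<delta>
    by simp
  also have "\<dots> = measure M ({\<omega> \<in> space M. X \<omega> \<le> ?b} - {\<omega> \<in> space M. X \<omega> \<le> ?a})"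
    using \<delta> by (intro finite_measure_Diff[symmetric]) (auto simp: algebra_simps)
  also have "\<dots> \<le> measure M {\<omega> \<in> space M. X \<omega> \<in> cell (T / real m) c}"
    using \<delta> by (intro finite_measure_mono) (auto simp: cell_def \<delta>_def[symmetric])
  finally show ?thesis by (simp add: \<delta>_def)
qed

text \<open>Events of this rectangular form suffice for shapes, and on them the independence
  assumptions combine to a plain product.\<close>

lemma rdcp_input_prob_product:
  assumes inp: "rdcp_input_exponential M p l G d X" and "finite (verts G)" "finite (edges G)"
    and I: "I \<subseteq> verts G" and B: "\<And>e. e \<in> edges G \<Longrightarrow> B e \<in> sets borel"
  shows "{\<omega> \<in> space M. (\<forall>v\<in>I. d v \<omega> = D v) \<and> (\<forall>e\<in>edges G. X e \<omega> \<in> B e)} \<in> sets M"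
    and "measure M {\<omega> \<in> space M. (\<forall>v\<in>I. d v \<omega> = D v) \<and> (\<forall>e\<in>edges G. X e \<omega> \<in> B e)} =
      (\<Prod>v\<in>I. pmf p (D v)) * (\<Prod>e\<in>edges G. measure M {\<omega> \<in> space M. X e \<omega> \<in> B e})"
proof -
  interpret prob_space M using inp by (simp add: rdcp_input_exponential_def)
  let ?V = "verts G" and ?E = "edges G"
  have indep_d: "indep_vars (\<lambda>_. count_space UNIV) d ?V"
    and dist_d: "\<And>v. v \<in> ?V \<Longrightarrow> distr M (count_space UNIV) (d v) = measure_pmf p"
    and indep_X: "indep_vars (\<lambda>_. borel) X ?E"
    and indep: "constraints_indep_of_times M G d X"
    using inp by (auto simp: rdcp_input_exponential_def iid_constraints_def)
  have d: "d v \<in> measurable M (count_space UNIV)" if "v \<in> ?V" for v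
    using indep_d that by (auto simp: indep_vars_def)
  have X: "X e \<in> borel_measurable M" if "e \<in> ?E" for e
    using indep_X that by (auto simp: indep_vars_def)
  have finI: "finite I" using I assms(2) by (rule finite_subset)
  let ?A = "{\<omega> \<in> space M. \<forall>v\<in>I. d v \<omega> = D v}" and ?C = "{\<omega> \<in> space M. \<forall>e\<in>?E. X e \<omega> \<in> B e}"
  have "{\<omega> \<in> space M. d v \<omega> = D v} \<in> sets M" if "v \<in> I" for v
    using measurable_sets_Collect[OF d, of v "\<lambda>x. x = D v"] I that by auto
  then have A: "?A \<in> sets M" using finI by (intro sets.sets_Collect_finite_All) auto
  have "{\<omega> \<in> space M. X e \<omega> \<in> B e} \<in> sets M" if "e \<in> ?E" for e
    using measurable_sets[OF X[OF that] B[OF that]] by (simp add: vimage_def Int_def conj_commute)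
  then have C: "?C \<in> sets M" using assms(3) by (intro sets.sets_Collect_finite_All) auto
  have eq: "{\<omega> \<in> space M. (\<forall>v\<in>I. d v \<omega> = D v) \<and> (\<forall>e\<in>?E. X e \<omega> \<in> B e)} = ?A \<inter> ?C" by auto
  show "{\<omega> \<in> space M. (\<forall>v\<in>I. d v \<omega> = D v) \<and> (\<forall>e\<in>?E. X e \<omega> \<in> B e)} \<in> sets M"
    unfolding eq using A C by blast
  have "prob (?A \<inter> ?C) = prob ?A * prob ?C"
  proof (rule indep_setD[OF indep[unfolded constraints_indep_of_times_def]])
    have "?A = (\<lambda>\<omega>. \<lambda>v\<in>?V. d v \<omega>) -` {f \<in> space (PiM ?V (\<lambda>_. count_space UNIV)). \<forall>v\<in>I. f v = D v} \<inter> space M"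
      using I by (auto simp: space_PiM)
    moreover have "{f \<in> space (PiM ?V (\<lambda>_. count_space UNIV)). \<forall>v\<in>I. f v = D v} \<in> sets (PiM ?V (\<lambda>_. count_space UNIV))"
    proof (rule sets.sets_Collect_finite_All[OF _ finI])
      fix v assume "v \<in> I"
      then have "v \<in> ?V" using I by blast
      then show "{f \<in> space (PiM ?V (\<lambda>_. count_space UNIV)). f v = D v} \<in> sets (PiM ?V (\<lambda>_. count_space UNIV))"
        by measurable
    qed
    ultimately show "?A \<in> {(\<lambda>\<omega>. \<lambda>v\<in>?V. d v \<omega>) -` S \<inter> space M | S. S \<in> sets (PiM ?V (\<lambda>_. count_space UNIV))}"
      by blast
    have "?C = (\<lambda>\<omega>. \<lambda>e\<in>?E. X e \<omega>) -` {f \<in> space (PiM ?E (\<lambda>_. borel)). \<forall>e\<in>?E. f e \<in> B e} \<inter> space M"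
      by (auto simp: space_PiM)
    moreover have "{f \<in> space (PiM ?E (\<lambda>_. borel)). \<forall>e\<in>?E. f e \<in> B e} \<in> sets (PiM ?E (\<lambda>_. borel))"
      using assms(3) B by (intro sets.sets_Collect_finite_All) (auto intro!: measurable_sets_Collect measurable_component_singleton)
    ultimately show "?C \<in> {(\<lambda>\<omega>. \<lambda>e\<in>?E. X e \<omega>) -` S \<inter> space M | S. S \<in> sets (PiM ?E (\<lambda>_. borel))}"
      by blast
  qed
  also have "prob ?A = (\<Prod>v\<in>I. pmf p (D v))"
  proof (cases "I = {}")
    case True
    then show ?thesis by (simp add: prob_space)
  next
    case False
    have "?A = (\<Inter>v\<in>I. d v -` {D v} \<inter> space M)" using False by auto
    also have "prob \<dots> = (\<Prod>v\<in>I. prob (d v -` {D v} \<inter> space M))"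
      using indep_varsD[OF indep_d False finI I, of "\<lambda>v. {D v}"] by simp
    also have "\<dots> = (\<Prod>v\<in>I. pmf p (D v))"
    proof (rule prod.cong[OF refl])
      fix v assume "v \<in> I"
      then have v: "v \<in> ?V" using I by blast
      have "prob (d v -` {D v} \<inter> space M) = measure (distr M (count_space UNIV) (d v)) {D v}"
        using d[OF v] by (subst measure_distr) auto
      then show "prob (d v -` {D v} \<inter> space M) = pmf p (D v)"
        unfolding dist_d[OF v] by (simp add: pmf.rep_eq)
    qed
    finally show ?thesis .
  qed
  also have "prob ?C = (\<Prod>e\<in>?E. measure M {\<omega> \<in> space M. X e \<omega> \<in> B e})"
  proof (cases "?E = {}")
    case True
    then show ?thesis by (simp add: prob_space)
  next
    case False
    have "?C = (\<Inter>e\<in>?E. X e -` B e \<inter> space M)" using False by auto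
    also have "prob \<dots> = (\<Prod>e\<in>?E. prob (X e -` B e \<inter> space M))"
      using indep_varsD[OF indep_X False assms(3) subset_refl, of B] B by simp
    also have "\<dots> = (\<Prod>e\<in>?E. measure M {\<omega> \<in> space M. X e \<omega> \<in> B e})"
      by (intro prod.cong refl arg_cong[of _ _ prob]) auto
    finally show ?thesis .
  qed
  finally show "measure M {\<omega> \<in> space M. (\<forall>v\<in>I. d v \<omega> = D v) \<and> (\<forall>e\<in>?E. X e \<omega> \<in> B e)} =
      (\<Prod>v\<in>I. pmf p (D v)) * (\<Prod>e\<in>?E. measure M {\<omega> \<in> space M. X e \<omega> \<in> B e})"
    unfolding eq .
qed


definition has_shape ::
  "real \<Rightarrow> nat \<Rightarrow> nat \<Rightarrow> 'v set set \<Rightarrow> ('v \<Rightarrow> nat) \<Rightarrow> ('v set \<Rightarrow> real) \<Rightarrow> 'v \<Rightarrow>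
   nat list set \<Rightarrow> (nat list \<Rightarrow> nat) \<Rightarrow> bool" where
  "has_shape T m K E d X w S D \<longleftrightarrow> (\<exists>\<phi>. explored T m K E d X w S D \<phi>)"

lemma explored_cong:
  assumes S: "cell_tree m K S" and eq: "\<And>i. i \<in> S \<Longrightarrow> \<phi> i = \<psi> i"
  shows "explored T m K E d X w S D \<phi> \<longleftrightarrow> explored T m K E d X w S D \<psi>"
proof -
  have "[] \<in> S" using S unfolding cell_tree_def by blast
  moreover have "{\<phi> (butlast j), \<phi> j} = {\<psi> (butlast j), \<psi> j}" if "j \<in> S - {[]}" for j
    using eq that cell_tree_butlast[OF S] by auto
  moreover have "inj_on \<phi> S \<longleftrightarrow> inj_on \<psi> S" using eq by (intro inj_on_cong) auto
  ultimately show ?thesis using eq unfolding explored_def by simp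
qed

lemma explored_verts:
  assumes "cell_tree m K S" "explored T m K (edges G) d X w S D \<phi>" "simple_graph G" "w \<in> verts G" "i \<in> S"
  shows "\<phi> i \<in> verts G"
proof (cases "i = []")
  case False
  then have "{\<phi> (butlast i), \<phi> i} \<in> edges G" using assms unfolding explored_def by blast
  then show ?thesis using assms(3) by (auto elim!: simple_graphD simp: doubleton_eq_iff)
qed (use assms in \<open>auto simp: explored_def\<close>)

text \<open>A placement matters only through its values on the finite set \<open>S\<close>, so the
  event is a finite union over maps from \<open>S\<close> into the vertex set.\<close>

lemma sets_has_shape:
  assumes inp: "rdcp_input_exponential M p l G d X" and "finite (verts G)" "simple_graph G"
    and S: "cell_tree m K S" and w: "w \<in> verts G"
  shows "{\<omega> \<in> space M. has_shape T m K (edges G) (\<lambda>v. d v \<omega>) (\<lambda>e. X e \<omega>) w S D} \<in> sets M"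
proof -
  interpret prob_space M using inp by (simp add: rdcp_input_exponential_def)
  let ?E = "edges G"
  have d: "d v \<in> measurable M (count_space UNIV)" if "v \<in> verts G" for v
    using inp that by (auto simp: rdcp_input_exponential_def iid_constraints_def indep_vars_def)
  have X: "X e \<in> borel_measurable M" if "e \<in> ?E" for e
    using inp that by (auto simp: rdcp_input_exponential_def indep_vars_def)
  have finE: "finite ?E" by (rule finite_edges) fact+
  have fin: "finite S" using finite_cell_tree[OF S] .
  have cell: "cell \<delta> c \<in> sets borel" for \<delta> c by (simp add: cell_def)
  let ?P = "\<lambda>\<phi> \<omega>. explored T m K ?E (\<lambda>v. d v \<omega>) (\<lambda>e. X e \<omega>) w S D \<phi>"
  have "{\<omega> \<in> space M. ?P \<phi> \<omega>} \<in> sets M" if \<phi>: "\<phi> \<in> S \<rightarrow>\<^sub>E verts G" for \<phi>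
  proof -
    define Q where "Q = (\<lambda>\<omega>. \<forall>i\<in>S. d (\<phi> i) \<omega> = D i)"
    define Q' where "Q' = (\<lambda>\<omega>. \<forall>i\<in>S - {[]}. {\<phi> (butlast i), \<phi> i} \<in> ?E \<and>
        X {\<phi> (butlast i), \<phi> i} \<omega> \<in> cell (T / real m) (last i))"
    define Q'' where "Q'' = (\<lambda>\<omega>. \<forall>i\<in>S. length i < K \<longrightarrow> (\<forall>e\<in>?E. \<phi> i \<in> e \<longrightarrow> X e \<omega> \<le> T \<longrightarrow>
        (\<exists>j\<in>S - {[]}. e = {\<phi> (butlast j), \<phi> j})))"
    have 1: "{\<omega> \<in> space M. \<forall>i\<in>S. d (\<phi> i) \<omega> = D i} \<in> sets M"
    proof (rule sets.sets_Collect_finite_All[OF _ fin])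
      fix i assume "i \<in> S"
      then show "{\<omega> \<in> space M. d (\<phi> i) \<omega> = D i} \<in> sets M"
        using measurable_sets_Collect[OF d, of "\<phi> i" "\<lambda>x. x = D i"] \<phi> by auto
    qed
    have 2: "{\<omega> \<in> space M. \<forall>i\<in>S - {[]}. {\<phi> (butlast i), \<phi> i} \<in> ?E \<and>
        X {\<phi> (butlast i), \<phi> i} \<omega> \<in> cell (T / real m) (last i)} \<in> sets M"
    proof (intro sets.sets_Collect_finite_All)
      fix i
      show "{\<omega> \<in> space M. {\<phi> (butlast i), \<phi> i} \<in> ?E \<and>
        X {\<phi> (butlast i), \<phi> i} \<omega> \<in> cell (T / real m) (last i)} \<in> sets M"
        using measurable_sets[OF X cell, of "{\<phi> (butlast i), \<phi> i}"]
        by (cases "{\<phi> (butlast i), \<phi> i} \<in> ?E") (simp_all add: vimage_def Int_def conj_commute)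
    qed (use fin in auto)
    have 3: "{\<omega> \<in> space M. \<forall>i\<in>S. length i < K \<longrightarrow> (\<forall>e\<in>?E. \<phi> i \<in> e \<longrightarrow> X e \<omega> \<le> T \<longrightarrow>
        (\<exists>j\<in>S - {[]}. e = {\<phi> (butlast j), \<phi> j}))} \<in> sets M"
      using X by (intro sets.sets_Collect_finite_All fin sets.sets_Collect_imp finE sets.sets_Collect_const) auto
    have "?P \<phi> \<omega> \<longleftrightarrow> \<phi> [] = w \<and> inj_on \<phi> S \<and> Q \<omega> \<and> Q' \<omega> \<and> Q'' \<omega>" for \<omega>
      unfolding explored_def Q_def Q'_def Q''_def by (rule refl)
    then have eq: "{\<omega> \<in> space M. ?P \<phi> \<omega>} = {\<omega> \<in> space M. \<phi> [] = w \<and> inj_on \<phi> S} \<inter>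
        ({\<omega> \<in> space M. Q \<omega>} \<inter> ({\<omega> \<in> space M. Q' \<omega>} \<inter> {\<omega> \<in> space M. Q'' \<omega>}))"
      by auto
    have "{\<omega> \<in> space M. Q \<omega>} \<in> sets M" "{\<omega> \<in> space M. Q' \<omega>} \<in> sets M"
        "{\<omega> \<in> space M. Q'' \<omega>} \<in> sets M"
      unfolding Q_def Q'_def Q''_def by (fact 1 2 3)+
    then show ?thesis unfolding eq by (intro sets.Int sets.sets_Collect_const)
  qed
  moreover have "{\<omega> \<in> space M. has_shape T m K ?E (\<lambda>v. d v \<omega>) (\<lambda>e. X e \<omega>) w S D} =
      (\<Union>\<phi>\<in>S \<rightarrow>\<^sub>E verts G. {\<omega> \<in> space M. ?P \<phi> \<omega>})"
  proof (intro equalityI subsetI)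
    fix \<omega> assume "\<omega> \<in> {\<omega> \<in> space M. has_shape T m K ?E (\<lambda>v. d v \<omega>) (\<lambda>e. X e \<omega>) w S D}"
    then obtain \<phi> where \<phi>: "\<omega> \<in> space M" "?P \<phi> \<omega>" unfolding has_shape_def by blast
    have "?P (restrict \<phi> S) \<omega>" using \<phi>(2) by (subst explored_cong[OF S, of _ \<phi>]) auto
    moreover have "restrict \<phi> S \<in> S \<rightarrow>\<^sub>E verts G"
      using explored_verts[OF S \<phi>(2) assms(3) w] by auto
    ultimately show "\<omega> \<in> (\<Union>\<phi>\<in>S \<rightarrow>\<^sub>E verts G. {\<omega> \<in> space M. ?P \<phi> \<omega>})" using \<phi>(1) by blast
  qed (auto simp: has_shape_def)
  ultimately show ?thesis
    using fin assms(2) by (auto intro!: sets.finite_UN finite_PiE)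
qed

text \<open>In the infinite tree, a vertex has independent Poisson numbers of children in the
  \<open>m\<close> cells, each with mean \<open>T / m\<close>. A cell with one child contributes
  \<open>T / m * exp (- (T / m))\<close> and an empty one \<open>exp (- (T / m))\<close>. So every
  vertex of depth less than \<open>K\<close> gives \<open>exp (- T)\<close> and every edge gives
  \<open>T / m\<close>.\<close>

definition shape_weight :: "nat pmf \<Rightarrow> real \<Rightarrow> nat \<Rightarrow> nat \<Rightarrow> nat list set \<Rightarrow> (nat list \<Rightarrow> nat) \<Rightarrow> real" where
  "shape_weight p T m K S D = (\<Prod>i\<in>S. pmf p (D i)) * (T / real m) ^ (card S - 1) *
     exp (- (T * real (card {i \<in> S. length i < K})))"

definition shape_freq ::
  "real \<Rightarrow> nat \<Rightarrow> nat \<Rightarrow> 'v graph \<Rightarrow> ('v \<Rightarrow> nat) \<Rightarrow> ('v set \<Rightarrow> real) \<Rightarrow> nat list set \<Rightarrow> (nat list \<Rightarrow> nat) \<Rightarrow> real" where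
  "shape_freq T m K G d X S D =
     (\<Sum>w\<in>verts G. of_bool (has_shape T m K (edges G) d X w S D)) / real (card (verts G))"

text \<open>It suffices that the constraints are as prescribed, the tree edges fall into their
  cells, and all other edges at vertices of depth less than \<open>K\<close> come after time
  \<open>T\<close>. The latter include edges between the two trees, so the roots may be close to
  each other. Each such vertex has at most \<open>\<Delta>\<close> edges, whence the exponential
  factor.\<close>

lemma has_shape_pair_prob_ge:
  fixes Ss :: "bool \<Rightarrow> nat list set" and Ds :: "bool \<Rightarrow> nat list \<Rightarrow> nat"
  assumes inp: "rdcp_input_exponential M p (1 / r) G d X" and r: "0 < r"
    and fin: "finite (verts G)" and sg: "simple_graph G"
    and Ss: "\<And>b. cell_tree m K (Ss b)" and T: "0 \<le> T"
    and W: "W \<subseteq> verts G" and \<Delta>: "\<And>v. v \<in> W \<Longrightarrow> real (card (nbrs (edges G) v)) \<le> \<Delta>"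
    and \<Phi>: "\<Phi> \<in> forest_embs (edges G) W list_parent (Sigma UNIV Ss)"
  defines "A \<equiv> {\<omega> \<in> space M. \<forall>b. explored T m K (edges G) (\<lambda>v. d v \<omega>) (\<lambda>e. X e \<omega>) (\<Phi> (b, []))
      (Ss b) (Ds b) (\<lambda>i. \<Phi> (b, i))}"
  shows "\<exists>L \<in> sets M. L \<subseteq> A \<and> (\<Prod>b\<in>UNIV. \<Prod>i\<in>Ss b. pmf p (Ds b i)) * (T / m / r) ^ (\<Sum>b\<in>UNIV. card (Ss b) - 1) *
    exp (- (T / r * \<Delta> * (\<Sum>b\<in>UNIV. card {i \<in> Ss b. length i < K}))) \<le> measure M L"
proof -
  interpret prob_space M using inp by (simp add: rdcp_input_exponential_def)
  let ?E = "edges G" and ?S = "Sigma UNIV Ss"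
  define J where "J = {j \<in> ?S. snd j \<noteq> []}"
  define ed where "ed = (\<lambda>j :: bool \<times> nat list. {\<Phi> (fst j, butlast (snd j)), \<Phi> j})"
  define I where "I = {j \<in> ?S. length (snd j) < K}"
  define touch where "touch = {e \<in> ?E. \<exists>j\<in>I. \<Phi> j \<in> e}"
  define B where "B = (\<lambda>e. if e \<in> ed ` J then cell (T / real m) (last (snd (inv_into J ed e)))
    else if e \<in> touch then {T<..} else UNIV)"
  have finS: "finite (Ss b)" for b using finite_cell_tree[OF Ss] .
  have finS2: "finite ?S" using finS by simp
  have finE: "finite ?E" by (rule finite_edges) fact+
  have \<Phi>': "\<Phi> \<in> ?S \<rightarrow>\<^sub>E W" "inj_on \<Phi> ?S"
    "\<And>j i. j \<in> ?S \<Longrightarrow> list_parent j = Some i \<Longrightarrow> {\<Phi> i, \<Phi> j} \<in> ?E"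
    using \<Phi> by (auto simp: forest_embs_def forest_homs_def)
  have par: "(fst j, butlast (snd j)) \<in> ?S" if "j \<in> J" for j
    using that cell_tree_butlast[OF Ss] by (auto simp: J_def)
  have edE: "ed j \<in> ?E" if "j \<in> J" for j
    using \<Phi>'(3)[of j "(fst j, butlast (snd j))"] that by (auto simp: ed_def J_def list_parent_def)
  have mem_ed: "i \<in> {(fst j, butlast (snd j)), j}" if "j \<in> J" "i \<in> ?S" "\<Phi> i \<in> ed j" for i j
    using that \<Phi>'(2) par[OF that(1)] unfolding ed_def J_def by (auto dest: inj_onD)
  have inj_ed: "inj_on ed J"
  proof (rule inj_onI)
    fix j k assume jk: "j \<in> J" "k \<in> J" "ed j = ed k"
    have eq: "\<Phi> ` {(fst j, butlast (snd j)), j} = \<Phi> ` {(fst k, butlast (snd k)), k}"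
      using jk(3) by (simp add: ed_def)
    have sub: "{(fst i, butlast (snd i)), i} \<subseteq> ?S" if "i \<in> J" for i
      using par[OF that] that by (simp add: J_def)
    have "{(fst j, butlast (snd j)), j} = {(fst k, butlast (snd k)), k}"
      using inj_on_image_eq_iff[OF \<Phi>'(2) sub[OF jk(1)] sub[OF jk(2)]] eq by (rule iffD1)
    then have "fst j = fst k" "{butlast (snd j), snd j} = {butlast (snd k), snd k}"
      by (auto simp: doubleton_eq_iff prod_eq_iff)
    then show "j = k"
      using butlast_edge_inject[of "snd j" "snd k"] jk by (auto simp: J_def prod_eq_iff)
  qed
  have edtouch: "ed ` J \<subseteq> touch"
  proof
    fix e assume "e \<in> ed ` J"
    then obtain j where j: "j \<in> J" "e = ed j" by blast
    have "length (snd j) \<le> K" using j Ss unfolding J_def cell_tree_def by force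
    then have "(fst j, butlast (snd j)) \<in> I" using j par[OF j(1)] by (cases "snd j") (auto simp: I_def J_def)
    then show "e \<in> touch" using edE[OF j(1)] j by (auto simp: touch_def ed_def)
  qed
  have Bj: "B (ed j) = cell (T / real m) (last (snd j))" if "j \<in> J" for j
    using that inj_ed by (simp add: B_def)
  define L where "L = {\<omega> \<in> space M. (\<forall>v\<in>\<Phi> ` ?S. d v \<omega> = (\<lambda>j. Ds (fst j) (snd j)) (inv_into ?S \<Phi> v)) \<and>
    (\<forall>e\<in>?E. X e \<omega> \<in> B e)}"
  have imgV: "\<Phi> ` ?S \<subseteq> verts G" using \<Phi>'(1) W by blast
  have Bsets: "B e \<in> sets borel" for e by (simp add: B_def cell_def)
  have L: "L \<in> sets M"
    unfolding L_def by (rule rdcp_input_prob_product(1)[OF inp fin finE imgV Bsets])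
  have sub: "L \<subseteq> A"
  proof
    fix \<omega> assume \<omega>: "\<omega> \<in> L"
    have dv: "d (\<Phi> (b, i)) \<omega> = Ds b i" if "i \<in> Ss b" for b i
      using \<omega> that \<Phi>'(2) unfolding L_def by auto
    have XB: "X e \<omega> \<in> B e" if "e \<in> ?E" for e using \<omega> that unfolding L_def by blast
    have "explored T m K ?E (\<lambda>v. d v \<omega>) (\<lambda>e. X e \<omega>) (\<Phi> (b, [])) (Ss b) (Ds b) (\<lambda>i. \<Phi> (b, i))" for b
      unfolding explored_def
    proof (intro conjI ballI impI refl)
      show "inj_on (\<lambda>i. \<Phi> (b, i)) (Ss b)" using \<Phi>'(2) by (auto simp: inj_on_def)
      show "d (\<Phi> (b, i)) \<omega> = Ds b i" if "i \<in> Ss b" for i using dv that .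
      show "{\<Phi> (b, butlast i), \<Phi> (b, i)} \<in> ?E" if "i \<in> Ss b - {[]}" for i
        using edE[of "(b, i)"] that by (auto simp: J_def ed_def)
      show "X {\<Phi> (b, butlast i), \<Phi> (b, i)} \<omega> \<in> cell (T / real m) (last i)" if "i \<in> Ss b - {[]}" for i
        using XB[OF edE[of "(b, i)"]] Bj[of "(b, i)"] that by (auto simp: J_def ed_def)
      fix i e assume i: "i \<in> Ss b" "length i < K" and e: "e \<in> ?E" "\<Phi> (b, i) \<in> e" "X e \<omega> \<le> T"
      have "e \<in> touch" using i e by (auto simp: touch_def I_def)
      then have "e \<in> ed ` J" using XB[OF e(1)] e(3) by (auto simp: B_def split: if_splits)
      then obtain j where j: "j \<in> J" "e = ed j" by blast
      then have "(b, i) \<in> {(fst j, butlast (snd j)), j}" using mem_ed[OF j(1), of "(b, i)"] i e by auto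
      then have "fst j = b" by auto
      then show "\<exists>j\<in>Ss b - {[]}. e = {\<Phi> (b, butlast j), \<Phi> (b, j)}"
        using j by (intro bexI[of _ "snd j"]) (auto simp: ed_def J_def)
    qed
    then show "\<omega> \<in> A" using \<omega> by (auto simp: A_def L_def)
  qed
  \<comment> \<open>A tree edge hits its cell with probability at least
    \<open>T / m / r * exp (- (T / r))\<close>, and any other touching edge is late with probability
    \<open>exp (- (T / r))\<close>. So all touching edges share the exponential factor.\<close>
  let ?f = "\<lambda>e. (if e \<in> ed ` J then T / m / r else 1) * (if e \<in> touch then exp (- (T / r)) else 1)"
  have Bprob: "?f e \<le> prob {\<omega> \<in> space M. X e \<omega> \<in> B e}" if e: "e \<in> ?E" for e
  proof -
    have dist: "distributed M lborel (X e) (exponential_density (1 / r))"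
      using inp e by (simp add: rdcp_input_exponential_def)
    show ?thesis
    proof (cases "e \<in> ed ` J")
      case True
      then obtain j where j: "j \<in> J" "e = ed j" by blast
      have "last (snd j) < m" using cell_tree_last[OF Ss, of "snd j" "fst j"] j by (auto simp: J_def)
      then have "T / m * (1 / r) * exp (- (T * (1 / r))) \<le> prob {\<omega> \<in> space M. X e \<omega> \<in> cell (T / real m) (last (snd j))}"
        using r T by (intro exponential_cell_prob_ge[OF prob_space_axioms dist]) auto
      then show ?thesis using True edtouch Bj[OF j(1)] j by auto
    next
      case False
      show ?thesis
      proof (cases "e \<in> touch")
        case True
        then show ?thesis
          using exponential_distributedD_gt[OF dist T] False r by (simp add: B_def)
      qed (use False in \<open>simp add: B_def prob_space\<close>)
    qed
  qed
  have card_touch: "real (card touch) \<le> \<Delta> * (\<Sum>b\<in>UNIV. card {i \<in> Ss b. length i < K})"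
  proof -
    have I: "I = (SIGMA b:UNIV. {i \<in> Ss b. length i < K})" by (auto simp: I_def)
    have finI: "finite I" using finS2 by (simp add: I_def)
    have "touch \<subseteq> (\<Union>j\<in>I. {e \<in> ?E. \<Phi> j \<in> e})" by (auto simp: touch_def)
    then have "card touch \<le> card (\<Union>j\<in>I. {e \<in> ?E. \<Phi> j \<in> e})"
      using finI finE by (intro card_mono) auto
    also have "\<dots> \<le> (\<Sum>j\<in>I. card {e \<in> ?E. \<Phi> j \<in> e})" by (rule card_UN_le[OF finI])
    finally have "real (card touch) \<le> (\<Sum>j\<in>I. real (card {e \<in> ?E. \<Phi> j \<in> e}))"
      by (simp flip: of_nat_sum)
    also have "\<dots> \<le> (\<Sum>j\<in>I. \<Delta>)"
      using \<Phi>'(1) by (intro sum_mono) (auto simp: nbrs_edges_card[OF sg] I_def intro!: \<Delta>)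
    also have "\<dots> = \<Delta> * real (card I)" by simp
    also have "card I = (\<Sum>b\<in>UNIV. card {i \<in> Ss b. length i < K})"
      unfolding I using finS by (subst card_SigmaI) auto
    finally show ?thesis .
  qed
  have prod_f: "(\<Prod>e\<in>?E. ?f e) = (T / m / r) ^ card J * exp (- (T / r)) ^ card touch"
  proof -
    have "(\<Prod>e\<in>?E. if e \<in> ed ` J then T / m / r else 1) = (T / m / r) ^ card (?E \<inter> ed ` J)"
      using finE by (simp flip: prod.inter_restrict)
    also have "?E \<inter> ed ` J = ed ` J" using edE by blast
    also have "card (ed ` J) = card J" using inj_ed by (rule card_image)
    finally have 1: "(\<Prod>e\<in>?E. if e \<in> ed ` J then T / m / r else 1) = (T / m / r) ^ card J" .
    have "(\<Prod>e\<in>?E. if e \<in> touch then exp (- (T / r)) else 1) = exp (- (T / r)) ^ card (?E \<inter> touch)"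
      using finE by (simp flip: prod.inter_restrict)
    also have "?E \<inter> touch = touch" by (auto simp: touch_def)
    finally show ?thesis using 1 by (simp add: prod.distrib)
  qed
  have cardJ: "card J = (\<Sum>b\<in>UNIV. card (Ss b) - 1)"
  proof -
    have "J = {j \<in> ?S. list_parent j \<noteq> None}" by (auto simp: J_def list_parent_def)
    then show ?thesis using roots_cell_trees(2)[of m K Ss, OF Ss] by (simp add: nonroots_def)
  qed
  have nn: "0 \<le> (\<Prod>b\<in>UNIV. \<Prod>i\<in>Ss b. pmf p (Ds b i))" by (intro prod_nonneg ballI) auto
  have "(\<Prod>b\<in>UNIV. \<Prod>i\<in>Ss b. pmf p (Ds b i)) * (T / m / r) ^ (\<Sum>b\<in>UNIV. card (Ss b) - 1) *
    exp (- (T / r * \<Delta> * (\<Sum>b\<in>UNIV. card {i \<in> Ss b. length i < K}))) \<le>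
    (\<Prod>b\<in>UNIV. \<Prod>i\<in>Ss b. pmf p (Ds b i)) * ((T / m / r) ^ card J * exp (- (T / r)) ^ card touch)"
  proof -
    have "T / r * real (card touch) \<le> T / r * (\<Delta> * (\<Sum>b\<in>UNIV. card {i \<in> Ss b. length i < K}))"
      using T r by (intro mult_left_mono card_touch) auto
    then have "exp (- (T / r * \<Delta> * (\<Sum>b\<in>UNIV. card {i \<in> Ss b. length i < K}))) \<le> exp (- (T / r)) ^ card touch"
      by (simp flip: exp_of_nat_mult add: mult_ac)
    then show ?thesis
      unfolding cardJ mult.assoc using T r by (intro mult_left_mono nn) auto
  qed
  also have "(\<Prod>b\<in>UNIV. \<Prod>i\<in>Ss b. pmf p (Ds b i)) * ((T / m / r) ^ card J * exp (- (T / r)) ^ card touch) \<le>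
      (\<Prod>b\<in>UNIV. \<Prod>i\<in>Ss b. pmf p (Ds b i)) * (\<Prod>e\<in>?E. prob {\<omega> \<in> space M. X e \<omega> \<in> B e})"
    unfolding prod_f[symmetric] using T r
    by (intro mult_left_mono[OF _ nn] prod_mono conjI Bprob) auto
  also have "(\<Prod>b\<in>UNIV. \<Prod>i\<in>Ss b. pmf p (Ds b i)) * (\<Prod>e\<in>?E. prob {\<omega> \<in> space M. X e \<omega> \<in> B e}) = prob L"
  proof -
    have "(\<Prod>b\<in>UNIV. \<Prod>i\<in>Ss b. pmf p (Ds b i)) =
        (\<Prod>v\<in>\<Phi> ` ?S. pmf p ((\<lambda>j. Ds (fst j) (snd j)) (inv_into ?S \<Phi> v)))"
      using \<Phi>'(2) finS by (simp add: prod.reindex prod.Sigma case_prod_beta)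
    then show ?thesis
      unfolding L_def by (simp only: rdcp_input_prob_product(2)[OF inp fin finE imgV Bsets])
  qed
  finally show ?thesis by (intro bexI[OF _ L] conjI sub)
qed


text \<open>Distinct embeddings realised at the same time have distinct pairs of roots, as a shape
  at a vertex has only one placement. So realised embeddings are at most as many as pairs of
  vertices with the two shapes, and it remains to take expectations.\<close>

lemma shape_freq_pair_ge:
  fixes Ss :: "bool \<Rightarrow> nat list set" and Ds :: "bool \<Rightarrow> nat list \<Rightarrow> nat"
  assumes inp: "rdcp_input_exponential M p (1 / r) G d X" and r: "0 < r"
    and fin: "finite (verts G)" and sg: "simple_graph G"
    and Ss: "\<And>b. cell_tree m K (Ss b)" and T: "0 \<le> T"
    and W: "W \<subseteq> verts G" and \<Delta>: "\<And>v. v \<in> W \<Longrightarrow> real (card (nbrs (edges G) v)) \<le> \<Delta>"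
  shows "real (card (forest_embs (edges G) W list_parent (Sigma UNIV Ss))) / real (card (verts G)) ^ 2 *
    ((\<Prod>b\<in>UNIV. \<Prod>i\<in>Ss b. pmf p (Ds b i)) * (T / m / r) ^ (\<Sum>b\<in>UNIV. card (Ss b) - 1) *
    exp (- (T / r * \<Delta> * (\<Sum>b\<in>UNIV. card {i \<in> Ss b. length i < K})))) \<le>
    integral\<^sup>L M (\<lambda>\<omega>. \<Prod>b\<in>UNIV. shape_freq T m K G (\<lambda>v. d v \<omega>) (\<lambda>e. X e \<omega>) (Ss b) (Ds b))"
proof -
  interpret prob_space M using inp by (simp add: rdcp_input_exponential_def)
  let ?E = "edges G" and ?F = "forest_embs (edges G) W list_parent (Sigma UNIV Ss)"
  let ?q = "(\<Prod>b\<in>UNIV. \<Prod>i\<in>Ss b. pmf p (Ds b i)) * (T / m / r) ^ (\<Sum>b\<in>UNIV. card (Ss b) - 1) *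
    exp (- (T / r * \<Delta> * (\<Sum>b\<in>UNIV. card {i \<in> Ss b. length i < K})))"
  define N where "N = real (card (verts G))"
  let ?ex = "\<lambda>\<Phi> \<omega> b. explored T m K ?E (\<lambda>v. d v \<omega>) (\<lambda>e. X e \<omega>) (\<Phi> (b, [])) (Ss b) (Ds b) (\<lambda>i. \<Phi> (b, i))"
  let ?h = "\<lambda>\<omega> b w. has_shape T m K ?E (\<lambda>v. d v \<omega>) (\<lambda>e. X e \<omega>) w (Ss b) (Ds b)"
  obtain L where L: "\<And>\<Phi>. \<Phi> \<in> ?F \<Longrightarrow> L \<Phi> \<in> sets M"
    "\<And>\<Phi> \<omega>. \<Phi> \<in> ?F \<Longrightarrow> \<omega> \<in> L \<Phi> \<Longrightarrow> \<omega> \<in> space M \<and> (\<forall>b. ?ex \<Phi> \<omega> b)"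
    "\<And>\<Phi>. \<Phi> \<in> ?F \<Longrightarrow> ?q \<le> prob (L \<Phi>)"
  proof -
    have "\<forall>\<Phi>\<in>?F. \<exists>L. L \<in> sets M \<and> (\<forall>\<omega>\<in>L. \<omega> \<in> space M \<and> (\<forall>b. ?ex \<Phi> \<omega> b)) \<and> ?q \<le> prob L"
    proof
      fix \<Phi> assume "\<Phi> \<in> ?F"
      from has_shape_pair_prob_ge[OF inp r fin sg Ss T W \<Delta> this, of Ds]
      show "\<exists>L. L \<in> sets M \<and> (\<forall>\<omega>\<in>L. \<omega> \<in> space M \<and> (\<forall>b. ?ex \<Phi> \<omega> b)) \<and> ?q \<le> prob L" by blast
    qed
    from bchoice[OF this] obtain L0 where L0: "\<forall>\<Phi>\<in>?F. L0 \<Phi> \<in> sets M \<and>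
      (\<forall>\<omega>\<in>L0 \<Phi>. \<omega> \<in> space M \<and> (\<forall>b. ?ex \<Phi> \<omega> b)) \<and> ?q \<le> prob (L0 \<Phi>)" ..
    show ?thesis by (rule that[of L0]) (use L0 in blast)+
  qed
  have finW: "finite W" using W fin by (rule finite_subset)
  have "finite (Sigma UNIV Ss)" using finite_cell_tree[OF Ss] by simp
  then have finF: "finite ?F"
    unfolding forest_embs_def using finite_forest_homs[OF _ finW] by fastforce
  have inj: "inj_on (\<lambda>\<Phi>. (\<Phi> (False, []), \<Phi> (True, []))) {\<Phi> \<in> ?F. \<omega> \<in> L \<Phi>}" for \<omega>
  proof (rule inj_onI)
    fix \<Phi> \<Psi> assume \<Phi>: "\<Phi> \<in> {\<Phi> \<in> ?F. \<omega> \<in> L \<Phi>}" and \<Psi>: "\<Psi> \<in> {\<Phi> \<in> ?F. \<omega> \<in> L \<Phi>}"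
      and eq: "(\<Phi> (False, []), \<Phi> (True, [])) = (\<Psi> (False, []), \<Psi> (True, []))"
    have root: "\<Phi> (b, []) = \<Psi> (b, [])" for b using eq by (cases b) auto
    have "\<Phi> (b, i) = \<Psi> (b, i)" if "i \<in> Ss b" for b i
    proof -
      have "?ex \<Phi> \<omega> b" "?ex \<Psi> \<omega> b" using \<Phi> \<Psi> L(2) by blast+
      then show ?thesis using explored_unique(2)[OF Ss Ss _ _ T] that root by metis
    qed
    then show "\<Phi> = \<Psi>"
      using \<Phi> \<Psi> by (intro extensionalityI[of _ "Sigma UNIV Ss"]) (auto simp: forest_embs_def forest_homs_def PiE_def)
  qed
  have pointwise: "(\<Sum>\<Phi>\<in>?F. indicator (L \<Phi>) \<omega>) / N ^ 2 \<le>
      (\<Prod>b\<in>UNIV. shape_freq T m K G (\<lambda>v. d v \<omega>) (\<lambda>e. X e \<omega>) (Ss b) (Ds b))" for \<omega>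
  proof -
    have VW: "\<Phi> (b, []) \<in> verts G" if "\<Phi> \<in> ?F" for \<Phi> b
      using that Ss[of b] W by (auto simp: forest_embs_def forest_homs_def cell_tree_def)
    have "(\<Sum>\<Phi>\<in>?F. indicator (L \<Phi>) \<omega>) = (\<Sum>\<Phi>\<in>?F. of_bool (\<omega> \<in> L \<Phi>) :: real)"
      by (simp add: indicator_def of_bool_def)
    also have "\<dots> = real (card {\<Phi> \<in> ?F. \<omega> \<in> L \<Phi>})" using finF by (simp add: Int_def)
    also have "\<dots> \<le> real (card ({w \<in> verts G. ?h \<omega> False w} \<times> {w \<in> verts G. ?h \<omega> True w}))"
    proof (intro of_nat_mono card_inj_on_le[OF inj])
      show "(\<lambda>\<Phi>. (\<Phi> (False, []), \<Phi> (True, []))) ` {\<Phi> \<in> ?F. \<omega> \<in> L \<Phi>} \<subseteq>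
          {w \<in> verts G. ?h \<omega> False w} \<times> {w \<in> verts G. ?h \<omega> True w}"
        using L(2) VW unfolding has_shape_def by blast
    qed (use fin in auto)
    also have "\<dots> = (\<Prod>b\<in>UNIV. \<Sum>w\<in>verts G. of_bool (?h \<omega> b w))"
      using fin by (simp add: UNIV_bool card_cartesian_product Int_def)
    finally have "(\<Sum>\<Phi>\<in>?F. indicator (L \<Phi>) \<omega>) / N ^ 2 \<le> (\<Prod>b\<in>UNIV. \<Sum>w\<in>verts G. of_bool (?h \<omega> b w)) / N ^ 2"
      by (intro divide_right_mono) auto
    also have "\<dots> = (\<Prod>b\<in>UNIV. shape_freq T m K G (\<lambda>v. d v \<omega>) (\<lambda>e. X e \<omega>) (Ss b) (Ds b))"
      by (simp add: UNIV_bool shape_freq_def N_def power2_eq_square)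
    finally show ?thesis .
  qed
  have meas: "(\<lambda>\<omega>. shape_freq T m K G (\<lambda>v. d v \<omega>) (\<lambda>e. X e \<omega>) S D) \<in> borel_measurable M"
    if S: "cell_tree m K S" for S D
    unfolding shape_freq_def of_bool_def
    by (intro borel_measurable_divide borel_measurable_sum borel_measurable_const measurable_If
        sets_has_shape[OF inp fin sg S])
  have "real (card ?F) / N ^ 2 * ?q = (\<Sum>\<Phi>\<in>?F. ?q) / N ^ 2" by simp
  also have "\<dots> \<le> (\<Sum>\<Phi>\<in>?F. prob (L \<Phi>)) / N ^ 2"
    by (intro divide_right_mono sum_mono L(3)) auto
  also have "\<dots> = expectation (\<lambda>\<omega>. (\<Sum>\<Phi>\<in>?F. indicator (L \<Phi>) \<omega>) / N ^ 2)"
    using L(1) by (simp add: integral_sum emeasure_eq_measure)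
  also have "\<dots> \<le> expectation (\<lambda>\<omega>. \<Prod>b\<in>UNIV. shape_freq T m K G (\<lambda>v. d v \<omega>) (\<lambda>e. X e \<omega>) (Ss b) (Ds b))"
  proof (rule integral_mono[OF _ _ pointwise])
    show "integrable M (\<lambda>\<omega>. (\<Sum>\<Phi>\<in>?F. indicator (L \<Phi>) \<omega>) / N ^ 2)"
      using L(1) by (simp add: emeasure_eq_measure)
    have le1: "0 \<le> shape_freq T m K G a x S D \<and> shape_freq T m K G a x S D \<le> 1" for S D a x
    proof -
      have "(\<Sum>w\<in>verts G. of_bool (has_shape T m K (edges G) a x w S D)) \<le> (\<Sum>w\<in>verts G. 1 :: real)"
        by (intro sum_mono) auto
      then show ?thesis
        by (auto simp: shape_freq_def divide_le_eq intro!: divide_nonneg_nonneg sum_nonneg)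
    qed
    show "integrable M (\<lambda>\<omega>. \<Prod>b\<in>UNIV. shape_freq T m K G (\<lambda>v. d v \<omega>) (\<lambda>e. X e \<omega>) (Ss b) (Ds b))"
    proof (rule integrable_const_bound[where B = 1])
      show "(\<lambda>\<omega>. \<Prod>b\<in>UNIV. shape_freq T m K G (\<lambda>v. d v \<omega>) (\<lambda>e. X e \<omega>) (Ss b) (Ds b)) \<in> borel_measurable M"
        by (intro borel_measurable_prod meas Ss)
      show "AE \<omega> in M. norm (\<Prod>b\<in>UNIV. shape_freq T m K G (\<lambda>v. d v \<omega>) (\<lambda>e. X e \<omega>) (Ss b) (Ds b)) \<le> 1"
        using le1 by (intro AE_I2) (auto simp: abs_prod intro!: prod_le_1)
    qed
  qed
  finally show ?thesis unfolding N_def .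
qed

section \<open>Frequencies of shapes in almost regular graphs\<close>

text \<open>Constraints extensional on \<open>S\<close> make the shape of a vertex unique as a
  pair.\<close>

definition shapes :: "nat \<Rightarrow> nat \<Rightarrow> (nat list set \<times> (nat list \<Rightarrow> nat)) set" where
  "shapes m K = {(S, D). cell_tree m K S \<and> D \<in> extensional S}"

definition weight_sum :: "nat pmf \<Rightarrow> real \<Rightarrow> nat \<Rightarrow> nat \<Rightarrow> (nat list set \<times> (nat list \<Rightarrow> nat)) set \<Rightarrow> real" where
  "weight_sum p T m K F = (\<Sum>(S, D)\<in>F. shape_weight p T m K S D)"

definition freq_sum ::
  "real \<Rightarrow> nat \<Rightarrow> nat \<Rightarrow> 'v graph \<Rightarrow> ('v \<Rightarrow> nat) \<Rightarrow> ('v set \<Rightarrow> real) \<Rightarrow> (nat list set \<times> (nat list \<Rightarrow> nat)) set \<Rightarrow> real" where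
  "freq_sum T m K G d X F = (\<Sum>(S, D)\<in>F. shape_freq T m K G d X S D)"

lemma shape_weight_nonneg: "0 \<le> T \<Longrightarrow> 0 \<le> shape_weight p T m K S D"
  by (auto simp: shape_weight_def intro!: mult_nonneg_nonneg prod_nonneg)

lemma weight_sum_nonneg: "0 \<le> T \<Longrightarrow> 0 \<le> weight_sum p T m K F"
  by (auto simp: weight_sum_def intro!: sum_nonneg shape_weight_nonneg)

lemma has_shape_unique:
  assumes "s \<in> shapes m K" "s' \<in> shapes m K" "0 \<le> T"
    and "has_shape T m K E d X w (fst s) (snd s)" "has_shape T m K E d X w (fst s') (snd s')"
  shows "s = s'"
proof -
  obtain \<phi> \<psi> where ex: "explored T m K E d X w (fst s) (snd s) \<phi>" "explored T m K E d X w (fst s') (snd s') \<psi>"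
    using assms(4,5) unfolding has_shape_def by blast
  have S: "cell_tree m K (fst s)" "cell_tree m K (fst s')" and ext: "snd s \<in> extensional (fst s)"
      "snd s' \<in> extensional (fst s')"
    using assms(1,2) by (auto simp: shapes_def)
  have "fst s = fst s'" using explored_unique(1)[OF S ex assms(3)] .
  moreover have "snd s = snd s'"
    using ext explored_unique(3)[OF S ex assms(3)] calculation by (metis extensionalityI)
  ultimately show ?thesis by (simp add: prod_eq_iff)
qed

text \<open>A vertex has at most one shape, so the indicators add up to the indicator of the
  union.\<close>

lemma freq_sum_eq:
  assumes "finite F" "F \<subseteq> shapes m K" "0 \<le> T"
  shows "freq_sum T m K G d X F =
    (\<Sum>w\<in>verts G. of_bool (\<exists>(S, D)\<in>F. has_shape T m K (edges G) d X w S D)) / real (card (verts G))"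
proof -
  have "(\<Sum>s\<in>F. of_bool (has_shape T m K (edges G) d X w (fst s) (snd s)) :: real) =
      of_bool (\<exists>s\<in>F. has_shape T m K (edges G) d X w (fst s) (snd s))" for w
  proof (cases "\<exists>s\<in>F. has_shape T m K (edges G) d X w (fst s) (snd s)")
    case True
    then obtain s where s: "s \<in> F" "has_shape T m K (edges G) d X w (fst s) (snd s)" by blast
    then have "{s \<in> F. has_shape T m K (edges G) d X w (fst s) (snd s)} = {s}"
      using assms(2,3) by (auto intro: has_shape_unique)
    then show ?thesis using True assms(1) by (simp add: Int_def)
  qed auto
  then have "(\<Sum>s\<in>F. \<Sum>w\<in>verts G. of_bool (has_shape T m K (edges G) d X w (fst s) (snd s)) :: real) =
      (\<Sum>w\<in>verts G. of_bool (\<exists>s\<in>F. has_shape T m K (edges G) d X w (fst s) (snd s)))"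
    by (subst sum.swap) simp
  then show ?thesis
    unfolding freq_sum_def shape_freq_def case_prod_beta
    by (simp flip: sum_divide_distrib)
qed

lemma freq_sum_bounds:
  assumes "finite F" "F \<subseteq> shapes m K" "0 \<le> T"
  shows "0 \<le> freq_sum T m K G d X F" "freq_sum T m K G d X F \<le> 1"
proof -
  have "(\<Sum>w\<in>verts G. of_bool (\<exists>(S, D)\<in>F. has_shape T m K (edges G) d X w S D)) \<le> (\<Sum>w\<in>verts G. 1 :: real)"
    by (intro sum_mono) auto
  then show "0 \<le> freq_sum T m K G d X F" "freq_sum T m K G d X F \<le> 1"
    unfolding freq_sum_eq[OF assms] by (auto simp: divide_le_eq intro!: divide_nonneg_nonneg sum_nonneg)
qed

lemma borel_measurable_shape_freq:
  assumes "rdcp_input_exponential M p l G d X" "finite (verts G)" "simple_graph G" "cell_tree m K S"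
  shows "(\<lambda>\<omega>. shape_freq T m K G (\<lambda>v. d v \<omega>) (\<lambda>e. X e \<omega>) S D) \<in> borel_measurable M"
  unfolding shape_freq_def of_bool_def
  by (intro borel_measurable_divide borel_measurable_sum borel_measurable_const measurable_If
      sets_has_shape[OF assms])

lemma borel_measurable_freq_sum:
  assumes "rdcp_input_exponential M p l G d X" "finite (verts G)" "simple_graph G" "F \<subseteq> shapes m K"
  shows "(\<lambda>\<omega>. freq_sum T m K G (\<lambda>v. d v \<omega>) (\<lambda>e. X e \<omega>) F) \<in> borel_measurable M"
  unfolding freq_sum_def case_prod_beta using assms(4)
  by (intro borel_measurable_sum borel_measurable_shape_freq[OF assms(1-3)]) (auto simp: shapes_def)

context typical_vertices
begin

text \<open>With \<open>N\<close> vertices and \<open>e\<close> tree edges there are at least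
  \<open>(1 - \<delta>) * N ^ 2 * r n ^ e\<close> embeddings. Each is realised with probability at
  least about \<open>(T / m / r n) ^ e\<close> times the remaining factors of the weights, and the
  powers of \<open>r n\<close> cancel.\<close>

lemma shape_freq_pair_eventually:
  fixes Ss :: "bool \<Rightarrow> nat list set" and Ds :: "bool \<Rightarrow> nat list \<Rightarrow> nat"
  assumes inp: "\<forall>n. 0 < r n \<longrightarrow> rdcp_input_exponential (M n) p (1 / r n) (G n) (d n) (X n)"
    and Ss: "\<And>b. cell_tree m K (Ss b)" and T: "0 \<le> T" and \<epsilon>: "0 < \<epsilon>"
  shows "\<forall>\<^sub>F n in sequentially. (\<Prod>b\<in>UNIV. shape_weight p T m K (Ss b) (Ds b)) - \<epsilon> \<le>
    integral\<^sup>L (M n) (\<lambda>\<omega>. \<Prod>b\<in>UNIV. shape_freq T m K (G n) (\<lambda>v. d n v \<omega>) (\<lambda>e. X n e \<omega>) (Ss b) (Ds b))"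
proof -
  let ?S = "Sigma UNIV Ss" and ?e = "\<Sum>b\<in>UNIV. card (Ss b) - 1"
  let ?P = "\<Prod>b\<in>UNIV. \<Prod>i\<in>Ss b. pmf p (Ds b i)"
  let ?i = "\<Sum>b\<in>UNIV. card {i \<in> Ss b. length i < K}"
  define w where "w = (\<Prod>b\<in>UNIV. shape_weight p T m K (Ss b) (Ds b))"
  have w0: "0 \<le> w" unfolding w_def by (intro prod_nonneg ballI shape_weight_nonneg T)
  \<comment> \<open>Chosen with \<open>\<delta> * w < \<epsilon>\<close>; the summand
    \<open>1\<close> covers the case \<open>w = 0\<close>.\<close>
  define \<delta> where "\<delta> = min (1/2) (\<epsilon> / (2 * (w + 1)))"
  have \<delta>: "0 < \<delta>" "\<delta> < 1" using \<epsilon> w0 by (auto simp: \<delta>_def)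
  have "\<delta> * w \<le> \<epsilon> / (2 * (w + 1)) * w" using w0 by (intro mult_right_mono) (auto simp: \<delta>_def)
  also have "\<dots> < \<epsilon>" using \<epsilon> w0 by (simp add: field_simps add_strict_increasing)
  finally have \<delta>w: "w - \<epsilon> < (1 - \<delta>) * exp (- (T * 0 * real ?i)) * w" by (simp add: algebra_simps)
  have "(\<lambda>n. (1 - \<delta>) * exp (- (T * \<alpha> n * real ?i)) * w) \<longlonglongrightarrow> (1 - \<delta>) * exp (- (T * 0 * real ?i)) * w"
    by (intro tendsto_intros \<alpha>_lim)
  from order_tendstoD(1)[OF this \<delta>w]
  have ev1: "\<forall>\<^sub>F n in sequentially. w - \<epsilon> < (1 - \<delta>) * exp (- (T * \<alpha> n * real ?i)) * w" .
  have ev2: "\<forall>\<^sub>F n in sequentially. 1 \<le> r n" using r_lim unfolding filterlim_at_top by blast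
  have ev3: "\<forall>\<^sub>F n in sequentially. 1 \<le> real (card (verts (G n)))"
    using card_lim unfolding filterlim_at_top by blast
  have weq: "w = ?P * (T / m) ^ ?e * exp (- (T * real ?i))"
    unfolding w_def by (simp add: UNIV_bool shape_weight_def power_add exp_add[symmetric] algebra_simps)
  show ?thesis
    using card_forest_embs_ge[OF forest_cell_trees[of m K Ss, OF Ss] \<delta>(1)] ev1 ev2 ev3 degree_W
  proof eventually_elim
    case (elim n)
    let ?N = "real (card (verts (G n)))" and ?E = "edges (G n)"
    have r: "0 < r n" using elim by simp
    have P0: "0 \<le> ?P" by (intro prod_nonneg ballI) auto
    have c: "(1 - \<delta>) * r n ^ ?e \<le> real (card (forest_embs ?E (W n) list_parent ?S)) / ?N ^ 2"
      using elim(1,4) by (simp add: roots_cell_trees[of m K Ss, OF Ss] field_simps)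
    have "(1 - \<delta>) * exp (- (T * \<alpha> n * real ?i)) * w =
        ((1 - \<delta>) * r n ^ ?e) * (?P * (T / m / r n) ^ ?e * exp (- (T / r n * ((1 + \<alpha> n) * r n) * ?i)))"
    proof -
      have "exp (- (T / r n * ((1 + \<alpha> n) * r n) * ?i)) = exp (- (T * real ?i)) * exp (- (T * \<alpha> n * real ?i))"
        using r by (simp add: exp_add[symmetric] field_simps)
      moreover have "r n ^ ?e * (T / m / r n) ^ ?e = (T / m) ^ ?e"
        using r by (simp flip: power_mult_distrib)
      ultimately show ?thesis unfolding weq by (simp add: mult_ac)
    qed
    also have "\<dots> \<le> real (card (forest_embs ?E (W n) list_parent ?S)) / ?N ^ 2 *
        (?P * (T / m / r n) ^ ?e * exp (- (T / r n * ((1 + \<alpha> n) * r n) * ?i)))"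
      using P0 T r by (intro mult_right_mono c) auto
    also have "\<dots> \<le> integral\<^sup>L (M n) (\<lambda>\<omega>. \<Prod>b\<in>UNIV. shape_freq T m K (G n) (\<lambda>v. d n v \<omega>) (\<lambda>e. X n e \<omega>) (Ss b) (Ds b))"
      by (rule shape_freq_pair_ge[OF inp[rule_format, OF r] r finite_verts simple Ss T W_sub]) (use elim(5) in auto)
    finally show ?case using elim(2) by (simp add: w_def)
  qed
qed

lemma freq_sum_product_eventually:
  assumes inp: "\<forall>n. 0 < r n \<longrightarrow> rdcp_input_exponential (M n) p (1 / r n) (G n) (d n) (X n)"
    and T: "0 \<le> T" and \<epsilon>: "0 < \<epsilon>"
    and F: "finite F" "F \<subseteq> shapes m K" and F': "finite F'" "F' \<subseteq> shapes m K"
  shows "\<forall>\<^sub>F n in sequentially. weight_sum p T m K F * weight_sum p T m K F' - \<epsilon> \<le>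
    integral\<^sup>L (M n) (\<lambda>\<omega>. freq_sum T m K (G n) (\<lambda>v. d n v \<omega>) (\<lambda>e. X n e \<omega>) F *
      freq_sum T m K (G n) (\<lambda>v. d n v \<omega>) (\<lambda>e. X n e \<omega>) F')"
proof -
  let ?f = "\<lambda>n \<omega> s. shape_freq T m K (G n) (\<lambda>v. d n v \<omega>) (\<lambda>e. X n e \<omega>) (fst s) (snd s)"
  let ?w = "\<lambda>s. shape_weight p T m K (fst s) (snd s)"
  define \<delta> where "\<delta> = \<epsilon> / (real (card (F \<times> F')) + 1)"
  have \<delta>: "0 < \<delta>" using \<epsilon> by (simp add: \<delta>_def add_nonneg_pos)
  have ev: "\<forall>\<^sub>F n in sequentially. \<forall>q\<in>F \<times> F'. ?w (fst q) * ?w (snd q) - \<delta> \<le>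
      integral\<^sup>L (M n) (\<lambda>\<omega>. ?f n \<omega> (fst q) * ?f n \<omega> (snd q))"
  proof (rule eventually_ball_finite)
    show "\<forall>q\<in>F \<times> F'. \<forall>\<^sub>F n in sequentially. ?w (fst q) * ?w (snd q) - \<delta> \<le>
      integral\<^sup>L (M n) (\<lambda>\<omega>. ?f n \<omega> (fst q) * ?f n \<omega> (snd q))"
    proof
      fix q assume q: "q \<in> F \<times> F'"
      let ?Ss = "\<lambda>b. if b then fst (fst q) else fst (snd q)"
      let ?Ds = "\<lambda>b. if b then snd (fst q) else snd (snd q)"
      have "cell_tree m K (?Ss b)" for b
        using q F F' by (auto simp: shapes_def)
      from shape_freq_pair_eventually[where Ss = ?Ss and Ds = ?Ds, OF inp this T \<delta>]
      show "\<forall>\<^sub>F n in sequentially. ?w (fst q) * ?w (snd q) - \<delta> \<le>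
        integral\<^sup>L (M n) (\<lambda>\<omega>. ?f n \<omega> (fst q) * ?f n \<omega> (snd q))"
        by (simp add: UNIV_bool mult_ac)
    qed
  qed (use F F' in auto)
  have ev2: "\<forall>\<^sub>F n in sequentially. 1 \<le> r n" using r_lim unfolding filterlim_at_top by blast
  show ?thesis
    using ev ev2
  proof eventually_elim
    case (elim n)
    then have rn: "0 < r n" by simp
    interpret prob_space "M n" using inp[rule_format, OF rn] by (simp add: rdcp_input_exponential_def)
    have int: "integrable (M n) (\<lambda>\<omega>. ?f n \<omega> (fst q) * ?f n \<omega> (snd q))" if q: "q \<in> F \<times> F'" for q
    proof (rule integrable_const_bound[where B = 1])
      have S: "cell_tree m K (fst (fst q))" "cell_tree m K (fst (snd q))"
        using q F F' by (auto simp: shapes_def)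
      show "(\<lambda>\<omega>. ?f n \<omega> (fst q) * ?f n \<omega> (snd q)) \<in> borel_measurable (M n)"
        by (intro borel_measurable_times borel_measurable_shape_freq[OF inp[rule_format, OF rn] finite_verts simple] S)
      have "0 \<le> ?f n \<omega> s \<and> ?f n \<omega> s \<le> 1" for \<omega> s
      proof -
        have "(\<Sum>w\<in>verts (G n). of_bool (has_shape T m K (edges (G n)) (\<lambda>v. d n v \<omega>) (\<lambda>e. X n e \<omega>) w (fst s) (snd s)))
            \<le> (\<Sum>w\<in>verts (G n). 1 :: real)"
          by (intro sum_mono) auto
        then show ?thesis
          by (auto simp: shape_freq_def divide_le_eq intro!: divide_nonneg_nonneg sum_nonneg)
      qed
      then show "AE \<omega> in M n. norm (?f n \<omega> (fst q) * ?f n \<omega> (snd q)) \<le> 1"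
        by (intro AE_I2) (auto simp: abs_mult intro!: mult_le_one)
    qed
    have "weight_sum p T m K F * weight_sum p T m K F' - \<epsilon> \<le> (\<Sum>q\<in>F \<times> F'. ?w (fst q) * ?w (snd q) - \<delta>)"
    proof -
      have "weight_sum p T m K F * weight_sum p T m K F' = (\<Sum>q\<in>F \<times> F'. ?w (fst q) * ?w (snd q))"
        unfolding weight_sum_def by (simp add: sum_product sum.cartesian_product case_prod_beta)
      moreover have "real (card (F \<times> F')) * \<delta> \<le> \<epsilon>"
        using \<epsilon> by (simp add: \<delta>_def field_simps)
      ultimately show ?thesis by (simp add: sum_subtractf)
    qed
    also have "\<dots> \<le> (\<Sum>q\<in>F \<times> F'. expectation (\<lambda>\<omega>. ?f n \<omega> (fst q) * ?f n \<omega> (snd q)))"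
      using elim by (intro sum_mono) blast
    also have "\<dots> = expectation (\<lambda>\<omega>. \<Sum>q\<in>F \<times> F'. ?f n \<omega> (fst q) * ?f n \<omega> (snd q))"
      by (rule Bochner_Integration.integral_sum[symmetric]) (rule int)
    also have "(\<lambda>\<omega>. \<Sum>q\<in>F \<times> F'. ?f n \<omega> (fst q) * ?f n \<omega> (snd q)) =
        (\<lambda>\<omega>. freq_sum T m K (G n) (\<lambda>v. d n v \<omega>) (\<lambda>e. X n e \<omega>) F *
          freq_sum T m K (G n) (\<lambda>v. d n v \<omega>) (\<lambda>e. X n e \<omega>) F')"
      unfolding freq_sum_def by (simp add: sum_product sum.cartesian_product case_prod_beta)
    finally show ?case .
  qed
qed

text \<open>Only lower bounds for the second moments are available. As the frequencies add up to at most
  \<open>1\<close> and the weights to almost \<open>1\<close>, they imply the matching upper bounds.\<close>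

lemma freq_sum_concentration:
  assumes inp: "\<forall>n. 0 < r n \<longrightarrow> rdcp_input_exponential (M n) p (1 / r n) (G n) (d n) (X n)"
    and T: "0 \<le> T" and \<epsilon>: "0 < \<epsilon>" "\<epsilon> \<le> 1" and \<eta>: "0 < \<eta>"
    and F: "finite F" "F \<subseteq> shapes m K" and F': "finite F'" "F' \<subseteq> shapes m K" "F \<inter> F' = {}"
    and total: "1 - \<epsilon> \<le> weight_sum p T m K (F \<union> F')"
  shows "\<forall>\<^sub>F n in sequentially. measure (M n) {\<omega> \<in> space (M n).
    freq_sum T m K (G n) (\<lambda>v. d n v \<omega>) (\<lambda>e. X n e \<omega>) F < weight_sum p T m K F - \<eta>} \<le> 11 * \<epsilon> / \<eta>\<^sup>2"
proof -
  define a where "a = weight_sum p T m K F"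
  define b where "b = weight_sum p T m K F'"
  have ab: "0 \<le> a" "0 \<le> b" "1 - \<epsilon> \<le> a + b"
    using total F F' weight_sum_nonneg[OF T] by (auto simp: a_def b_def weight_sum_def sum.union_disjoint)
  have ev: "\<forall>\<^sub>F n in sequentially. 1 \<le> r n" using r_lim unfolding filterlim_at_top by blast
  show ?thesis
    using freq_sum_product_eventually[OF inp T \<epsilon>(1) F F, folded a_def]
      freq_sum_product_eventually[OF inp T \<epsilon>(1) F F'(1,2), folded a_def b_def]
      freq_sum_product_eventually[OF inp T \<epsilon>(1) F'(1,2) F'(1,2), folded b_def] ev
  proof eventually_elim
    case (elim n)
    then have rn: "0 < r n" by simp
    interpret prob_space "M n" using inp[rule_format, OF rn] by (simp add: rdcp_input_exponential_def)
    define y where "y = (\<lambda>\<omega>. freq_sum T m K (G n) (\<lambda>v. d n v \<omega>) (\<lambda>e. X n e \<omega>) F)"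
    define z where "z = (\<lambda>\<omega>. freq_sum T m K (G n) (\<lambda>v. d n v \<omega>) (\<lambda>e. X n e \<omega>) F')"
    have [measurable]: "y \<in> borel_measurable (M n)" "z \<in> borel_measurable (M n)"
      unfolding y_def z_def by (intro borel_measurable_freq_sum[OF inp[rule_format, OF rn] finite_verts simple] F F')+
    have yz: "0 \<le> y \<omega>" "0 \<le> z \<omega>" "y \<omega> + z \<omega> \<le> 1" for \<omega>
    proof -
      have "y \<omega> + z \<omega> = freq_sum T m K (G n) (\<lambda>v. d n v \<omega>) (\<lambda>e. X n e \<omega>) (F \<union> F')"
        using F F' by (simp add: y_def z_def freq_sum_def sum.union_disjoint)
      also have "\<dots> \<le> 1" using F F' T by (intro freq_sum_bounds) auto
      finally show "y \<omega> + z \<omega> \<le> 1" .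
      show "0 \<le> y \<omega>" "0 \<le> z \<omega>" using F F' T unfolding y_def z_def by (auto intro: freq_sum_bounds)
    qed
    have bnd: "y \<omega> \<le> 1" "z \<omega> \<le> 1" for \<omega> using yz[of \<omega>] by linarith+
    have int: "integrable (M n) y" "integrable (M n) (\<lambda>\<omega>. y \<omega> * y \<omega>)"
      "integrable (M n) (\<lambda>\<omega>. y \<omega> * z \<omega>)" "integrable (M n) (\<lambda>\<omega>. z \<omega> * z \<omega>)"
      by (rule integrable_const_bound[where B = 1], use yz bnd in \<open>auto simp: abs_mult intro!: mult_le_one\<close>)+
    have 1: "a * a - \<epsilon> \<le> expectation (\<lambda>\<omega>. y \<omega> * y \<omega>)" "a * b - \<epsilon> \<le> expectation (\<lambda>\<omega>. y \<omega> * z \<omega>)"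
      "b * b - \<epsilon> \<le> expectation (\<lambda>\<omega>. z \<omega> * z \<omega>)"
      using elim by (simp_all add: y_def z_def)
    \<comment> \<open>Expanding \<open>(y \<omega> + z \<omega>) * (y \<omega> + z \<omega>) \<le>
      1\<close> turns lower bounds for the mixed moment and for the second moment of
      \<open>z\<close> into an upper bound for the second moment of \<open>y\<close>.\<close>
    have Eyy: "expectation (\<lambda>\<omega>. y \<omega> * y \<omega>) \<le>
        1 - 2 * expectation (\<lambda>\<omega>. y \<omega> * z \<omega>) - expectation (\<lambda>\<omega>. z \<omega> * z \<omega>)"
    proof -
      have "expectation (\<lambda>\<omega>. y \<omega> * y \<omega> + 2 * (y \<omega> * z \<omega>) + z \<omega> * z \<omega>) \<le> expectation (\<lambda>\<omega>. 1)"
      proof (rule integral_mono)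
        fix \<omega>
        have "(y \<omega> + z \<omega>) * (y \<omega> + z \<omega>) \<le> 1" using yz[of \<omega>] by (intro mult_le_one) auto
        then show "y \<omega> * y \<omega> + 2 * (y \<omega> * z \<omega>) + z \<omega> * z \<omega> \<le> 1" by (simp add: algebra_simps)
      qed (use int in auto)
      then show ?thesis using int by (simp add: prob_space)
    qed
    \<comment> \<open>Multiplying \<open>y \<omega> + z \<omega> \<le> 1\<close> by
      \<open>y \<omega>\<close> bounds the mean from below by second moments, in place of a separate
      first moment estimate.\<close>
    have Ey: "expectation (\<lambda>\<omega>. y \<omega> * y \<omega>) + expectation (\<lambda>\<omega>. y \<omega> * z \<omega>) \<le> expectation y"
    proof -
      have "expectation (\<lambda>\<omega>. y \<omega> * y \<omega> + y \<omega> * z \<omega>) \<le> expectation y"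
      proof (rule integral_mono)
        fix \<omega>
        have "y \<omega> * (y \<omega> + z \<omega>) \<le> y \<omega> * 1" using yz[of \<omega>] by (intro mult_left_mono) auto
        then show "y \<omega> * y \<omega> + y \<omega> * z \<omega> \<le> y \<omega>" by (simp add: algebra_simps)
      qed (use int in auto)
      then show ?thesis using int by simp
    qed
    have var: "expectation (\<lambda>\<omega>. (y \<omega> - a)\<^sup>2) \<le> 11 * \<epsilon>"
    proof -
      have a1: "a \<le> 1 + \<epsilon>" "a * a \<le> 1 + \<epsilon>"
      proof -
        have "expectation (\<lambda>\<omega>. y \<omega> * y \<omega>) \<le> expectation (\<lambda>\<omega>. 1)"
          using int bnd yz by (intro integral_mono) (auto intro!: mult_le_one)
        then show aa: "a * a \<le> 1 + \<epsilon>" using 1(1) by (simp add: prob_space)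
        show "a \<le> 1 + \<epsilon>"
        proof (rule ccontr)
          assume "\<not> a \<le> 1 + \<epsilon>"
          then have "(1 + \<epsilon>) * 1 < a * a" using \<epsilon> by (intro mult_strict_mono) auto
          then show False using aa by simp
        qed
      qed
      have "expectation (\<lambda>\<omega>. (y \<omega> - a)\<^sup>2) = expectation (\<lambda>\<omega>. y \<omega> * y \<omega> - 2 * a * y \<omega> + a * a)"
        by (simp add: power2_eq_square algebra_simps)
      also have "\<dots> = expectation (\<lambda>\<omega>. y \<omega> * y \<omega>) - 2 * a * expectation y + a * a"
        using int by (simp add: prob_space)
      also have "\<dots> \<le> (1 - 2 * (a * b - \<epsilon>) - (b * b - \<epsilon>)) - 2 * a * (a * a + a * b - 2 * \<epsilon>) + a * a"
      proof -
        have "a * (a * a + a * b - 2 * \<epsilon>) \<le> a * expectation y"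
          using Ey 1 ab by (intro mult_left_mono) auto
        then have "2 * a * (a * a + a * b - 2 * \<epsilon>) \<le> 2 * a * expectation y" by simp
        moreover have "expectation (\<lambda>\<omega>. y \<omega> * y \<omega>) \<le> 1 - 2 * (a * b - \<epsilon>) - (b * b - \<epsilon>)"
          using Eyy 1(2,3) by argo
        ultimately show ?thesis by (intro add_mono diff_mono order_refl)
      qed
      \<comment> \<open>The errors amount to \<open>3 * \<epsilon> + 4 * (a * \<epsilon>)\<close>.
        If \<open>1 \<le> a + b\<close>, the main term is nonpositive and \<open>a \<le> 2\<close>;
        otherwise \<open>a \<le> 1\<close> and the main term is at most
        \<open>4 * \<epsilon>\<close>. Both cases stay below \<open>11 * \<epsilon>\<close>.\<close>
      also have "\<dots> \<le> 11 * \<epsilon>"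
      proof -
        have "(1 - 2 * (a * b - \<epsilon>) - (b * b - \<epsilon>)) - 2 * a * (a * a + a * b - 2 * \<epsilon>) + a * a =
            (1 - (a + b)) * (1 + (a + b) + 2 * (a * a)) + 3 * \<epsilon> + 4 * (a * \<epsilon>)"
          by (simp add: algebra_simps)
        moreover have "(1 - (a + b)) * (1 + (a + b) + 2 * (a * a)) + 4 * (a * \<epsilon>) \<le> 8 * \<epsilon>"
        proof (cases "1 \<le> a + b")
          case True
          have "(1 - (a + b)) * (1 + (a + b) + 2 * (a * a)) \<le> 0"
            using True ab by (intro mult_nonpos_nonneg) auto
          moreover have "a * \<epsilon> \<le> 2 * \<epsilon>" using a1 \<epsilon> by (intro mult_right_mono) auto
          ultimately show ?thesis by linarith
        next
          case False
          have "a * a \<le> 1" using False ab by (intro mult_le_one) auto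
          then have "(1 - (a + b)) * (1 + (a + b) + 2 * (a * a)) \<le> \<epsilon> * 4"
            using False ab by (intro mult_mono) auto
          moreover have "a * \<epsilon> \<le> 1 * \<epsilon>" using False ab \<epsilon> by (intro mult_right_mono) auto
          ultimately show ?thesis by linarith
        qed
        ultimately show ?thesis by linarith
      qed
      finally show ?thesis .
    qed
    \<comment> \<open>Chebyshev's inequality, centred at the weight \<open>a\<close> instead of the
      mean.\<close>
    have "\<eta>\<^sup>2 * prob {\<omega> \<in> space (M n). y \<omega> < a - \<eta>} \<le> 11 * \<epsilon>"
    proof -
      have sq: "integrable (M n) (\<lambda>\<omega>. (y \<omega> - a)\<^sup>2)"
        using int by (simp add: power2_eq_square algebra_simps)
      have "expectation (\<lambda>\<omega>. \<eta>\<^sup>2 * indicator {\<omega> \<in> space (M n). y \<omega> < a - \<eta>} \<omega>) \<le> expectation (\<lambda>\<omega>. (y \<omega> - a)\<^sup>2)"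
      proof (rule integral_mono[OF _ sq])
        show "integrable (M n) (\<lambda>\<omega>. \<eta>\<^sup>2 * indicator {\<omega> \<in> space (M n). y \<omega> < a - \<eta>} \<omega>)"
          by (intro integrable_mult_right) (simp add: emeasure_eq_measure)
        fix \<omega>
        show "\<eta>\<^sup>2 * indicator {\<omega> \<in> space (M n). y \<omega> < a - \<eta>} \<omega> \<le> (y \<omega> - a)\<^sup>2"
        proof (cases "y \<omega> < a - \<eta>")
          case True
          then have "\<eta>\<^sup>2 \<le> (a - y \<omega>)\<^sup>2" using \<eta> by (intro power_mono) auto
          then show ?thesis by (simp add: indicator_def power2_commute)
        qed (simp add: indicator_def)
      qed
      also have "expectation (\<lambda>\<omega>. \<eta>\<^sup>2 * indicator {\<omega> \<in> space (M n). y \<omega> < a - \<eta>} \<omega>) =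
          \<eta>\<^sup>2 * prob {\<omega> \<in> space (M n). y \<omega> < a - \<eta>}"
        by simp
      finally show ?thesis using var by simp
    qed
    then show ?case using \<eta> by (simp add: y_def a_def field_simps)
  qed
qed

end


section \<open>Typical vertices of almost regular graphs\<close>

lemma graph_degree_eq_card_nbrs: "simple_graph G \<Longrightarrow> graph_degree G v = card (nbrs (edges G) v)"
  by (simp add: graph_degree_def nbrs_edges_card)

text \<open>Each edge leaving \<open>W\<close> is charged to its end outside
  \<open>W\<close>.\<close>

lemma sum_out_degree_le:
  assumes "simple_graph G" "finite (verts G)" "W \<subseteq> verts G"
  shows "(\<Sum>v\<in>W. card (nbrs (edges G) v - W)) \<le> (\<Sum>u\<in>verts G - W. card (nbrs (edges G) u))"
proof -
  let ?E = "edges G"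
  have sub: "nbrs ?E v \<subseteq> verts G" for v
    using assms(1) unfolding nbrs_def by (auto elim!: simple_graphD simp: doubleton_eq_iff)
  have fin: "finite W" "finite (verts G - W)" "finite (nbrs ?E v)" for v
    using assms finite_subset sub[of v] by auto
  have "(\<Sum>v\<in>W. card (nbrs ?E v - W)) = card (SIGMA v:W. nbrs ?E v - W)"
    using fin by (subst card_SigmaI) auto
  also have "\<dots> \<le> card (SIGMA u:verts G - W. nbrs ?E u)"
  proof (rule card_inj_on_le[where f = prod.swap])
    show "prod.swap ` (SIGMA v:W. nbrs ?E v - W) \<subseteq> (SIGMA u:verts G - W. nbrs ?E u)"
      using sub by (fastforce simp: nbrs_def insert_commute)
  qed (use fin in auto)
  also have "\<dots> = (\<Sum>u\<in>verts G - W. card (nbrs ?E u))"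
    using fin by (subst card_SigmaI) auto
  finally show ?thesis .
qed

text \<open>The degrees outside \<open>W\<close> add up to the total degree minus the degrees
  inside, which is at most \<open>(1 + c n) - (1 - a n) * (1 - b n)\<close> times \<open>r n\<close>
  times the number of vertices. The leading terms cancel, and \<open>a n + b n + c n\<close> serves
  as the common error \<open>\<alpha> n\<close>.\<close>

lemma typical_vertices_exist:
  assumes "high_degree_almost_regular G r"
  obtains W \<alpha> where "typical_vertices G W r \<alpha>"
proof -
  from assms obtain a b c :: "nat \<Rightarrow> real" where
    sg: "\<And>n. simple_graph (G n)" and fin: "\<And>n. finite (verts (G n))" and con: "\<And>n. connected_graph (G n)"
    and r0: "\<And>n. 0 \<le> r n" and r: "filterlim r at_top sequentially"
    and abc: "\<And>n. 0 \<le> a n \<and> 0 \<le> b n \<and> 0 \<le> c n"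
    and lim: "(\<lambda>n. Max {a n, b n, c n}) \<longlonglongrightarrow> 0"
    and ev: "\<forall>\<^sub>F n in sequentially.
           (1 - a n) * real (card (verts (G n))) \<le>
             real (card {v \<in> verts (G n).
                real (graph_degree (G n) v) \<in> {(1 - b n) * r n .. (1 + b n) * r n}}) \<and>
           real (\<Sum>v\<in>verts (G n). graph_degree (G n) v) \<in>
             {(1 - c n) * r n * real (card (verts (G n))) ..
              (1 + c n) * r n * real (card (verts (G n)))}"
    unfolding high_degree_almost_regular_def by blast
  define W where "W = (\<lambda>n. {v \<in> verts (G n).
    real (graph_degree (G n) v) \<in> {(1 - b n) * r n .. (1 + b n) * r n}})"
  define \<alpha> where "\<alpha> = (\<lambda>n. a n + b n + c n)"
  have lims: "a \<longlonglongrightarrow> 0" "b \<longlonglongrightarrow> 0" "c \<longlonglongrightarrow> 0"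
    by (rule tendsto_sandwich[OF _ _ tendsto_const lim], use abc in \<open>auto intro!: always_eventually\<close>)+
  have \<alpha>: "\<alpha> \<longlonglongrightarrow> 0" using tendsto_add[OF tendsto_add[OF lims(1,2)] lims(3)] by (simp add: \<alpha>_def)
  have half: "\<forall>\<^sub>F n in sequentially. \<alpha> n < 1/2" using order_tendstoD(2)[OF \<alpha>, of "1/2"] by simp
  have W_sub: "W n \<subseteq> verts (G n)" for n by (auto simp: W_def)
  have N1: "1 \<le> real (card (verts (G n)))" for n
    using con[of n] fin[of n] by (simp add: connected_graph_def Suc_le_eq card_gt_0_iff)
  have deg_le: "graph_degree (G n) v \<le> card (verts (G n))" for n v
  proof -
    have "nbrs (edges (G n)) v \<subseteq> verts (G n)"
      using sg[of n] unfolding nbrs_def by (auto elim!: simple_graphD simp: doubleton_eq_iff)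
    then show ?thesis unfolding graph_degree_eq_card_nbrs[OF sg] using fin by (intro card_mono)
  qed
  \<comment> \<open>Eventually \<open>r n / 2\<close> is at most the degree of some typical vertex,
    hence at most the number of vertices.\<close>
  have card_lim: "filterlim (\<lambda>n. real (card (verts (G n)))) at_top sequentially"
  proof (rule filterlim_at_top_mono)
    show "filterlim (\<lambda>n. r n * (1/2)) at_top sequentially"
      by (rule filterlim_at_top_mult_tendsto_pos[OF tendsto_const _ r]) simp
    show "\<forall>\<^sub>F n in sequentially. r n * (1/2) \<le> real (card (verts (G n)))"
      using ev half
    proof eventually_elim
      case (elim n)
      have "0 < (1 - a n) * real (card (verts (G n)))"
        using elim(2) abc[of n] N1[of n] unfolding \<alpha>_def by (intro mult_pos_pos) auto
      then have "0 < real (card (W n))" using elim(1) by (simp add: W_def)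
      then obtain v where v: "v \<in> W n" by (metis card.empty equals0I of_nat_0 order_less_irrefl)
      have "r n * (1/2) \<le> (1 - b n) * r n"
        using elim(2) abc[of n] r0[of n] unfolding \<alpha>_def by (subst mult.commute, intro mult_right_mono) auto
      also have "\<dots> \<le> real (graph_degree (G n) v)" using v by (auto simp: W_def)
      also have "\<dots> \<le> real (card (verts (G n)))" using deg_le by simp
      finally show ?case .
    qed
  qed
  have "typical_vertices G W r \<alpha>"
  proof
    show "0 \<le> \<alpha> n" for n using abc[of n] by (simp add: \<alpha>_def)
    show "\<forall>\<^sub>F n in sequentially. (1 - \<alpha> n) * real (card (verts (G n))) \<le> real (card (W n))"
      using ev
    proof eventually_elim
      case (elim n)
      have "(1 - \<alpha> n) * real (card (verts (G n))) \<le> (1 - a n) * real (card (verts (G n)))"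
        using abc[of n] by (intro mult_right_mono) (auto simp: \<alpha>_def)
      then show ?case using elim by (simp add: W_def)
    qed
    show "\<forall>\<^sub>F n in sequentially. \<forall>v\<in>W n.
        real (card (nbrs (edges (G n)) v)) \<in> {(1 - \<alpha> n) * r n .. (1 + \<alpha> n) * r n}"
    proof (rule always_eventually, intro allI ballI)
      fix n v assume v: "v \<in> W n"
      have "(1 - \<alpha> n) * r n \<le> (1 - b n) * r n" "(1 + b n) * r n \<le> (1 + \<alpha> n) * r n"
        using abc[of n] r0[of n] by (auto simp: \<alpha>_def intro!: mult_right_mono)
      then show "real (card (nbrs (edges (G n)) v)) \<in> {(1 - \<alpha> n) * r n .. (1 + \<alpha> n) * r n}"
        using v by (auto simp: W_def graph_degree_eq_card_nbrs[OF sg])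
    qed
    show "\<forall>\<^sub>F n in sequentially.
      (\<Sum>v\<in>W n. real (card (nbrs (edges (G n)) v - W n))) \<le> \<alpha> n * r n * real (card (verts (G n)))"
      using ev half
    proof eventually_elim
      case (elim n)
      let ?N = "real (card (verts (G n)))" and ?deg = "\<lambda>v. real (card (nbrs (edges (G n)) v))"
      have "(\<Sum>v\<in>W n. real (card (nbrs (edges (G n)) v - W n))) \<le> (\<Sum>u\<in>verts (G n) - W n. ?deg u)"
        using sum_out_degree_le[OF sg fin W_sub, of n] by (simp flip: of_nat_sum)
      also have "\<dots> = (\<Sum>u\<in>verts (G n). ?deg u) - (\<Sum>u\<in>W n. ?deg u)"
        using fin W_sub by (intro sum_diff) auto
      also have "\<dots> \<le> (1 + c n) * r n * ?N - (1 - a n) * ?N * ((1 - b n) * r n)"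
      proof (intro diff_mono)
        show "(\<Sum>u\<in>verts (G n). ?deg u) \<le> (1 + c n) * r n * ?N"
          using elim(1) by (simp add: graph_degree_eq_card_nbrs[OF sg])
        have "(1 - a n) * ?N * ((1 - b n) * r n) \<le> real (card (W n)) * ((1 - b n) * r n)"
          using elim abc[of n] r0[of n] by (intro mult_right_mono) (auto simp: W_def \<alpha>_def)
        also have "\<dots> = (\<Sum>u\<in>W n. (1 - b n) * r n)" by simp
        also have "\<dots> \<le> (\<Sum>u\<in>W n. ?deg u)"
          by (intro sum_mono) (auto simp: W_def graph_degree_eq_card_nbrs[OF sg])
        finally show "(1 - a n) * ?N * ((1 - b n) * r n) \<le> (\<Sum>u\<in>W n. ?deg u)" .
      qed
      also have "\<dots> = (\<alpha> n - a n * b n) * (r n * ?N)" by (simp add: \<alpha>_def algebra_simps)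
      also have "\<dots> \<le> \<alpha> n * (r n * ?N)"
        using abc[of n] r0[of n] by (intro mult_right_mono) auto
      finally show ?case by (simp add: mult.assoc)
    qed
  qed (use fin sg W_sub \<alpha> r card_lim in auto)
  then show thesis by (rule that)
qed

section \<open>Independence in the Poisson weighted infinite tree\<close>

fun path_times :: "(nat list set \<Rightarrow> real) \<Rightarrow> nat list \<Rightarrow> nat list \<Rightarrow> real list" where
  "path_times X u [] = []"
| "path_times X u (j # js) = X {u, u @ [j]} # path_times X (u @ [j]) js"

lemma path_times_append: "path_times X u (js @ ks) = path_times X u js @ path_times X (u @ js) ks"
  by (induction js arbitrary: u) auto

lemma length_path_times [simp]: "length (path_times X u js) = length js"
  by (induction js arbitrary: u) auto

abbreviation tree_verts :: "nat list set" where "tree_verts \<equiv> lists {1..}"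

lemma tree_edgeI: "i \<in> tree_verts \<Longrightarrow> 1 \<le> j \<Longrightarrow> {i, i @ [j]} \<in> edges pwit"
  by (auto simp: pwit_def)

lemma poisson_mean:
  "(\<lambda>k. real k * (\<mu> ^ k / fact k * exp (- \<mu>))) sums \<mu>"
proof -
  have "(\<lambda>k. \<mu> ^ k / fact k) sums exp \<mu>"
    using exp_converges[of \<mu>] by (simp add: field_simps scaleR_conv_of_real)
  then have s1: "(\<lambda>k. \<mu> * exp (- \<mu>) * (\<mu> ^ k / fact k)) sums (\<mu> * exp (- \<mu>) * exp \<mu>)"
    by (rule sums_mult)
  have e1: "\<mu> * exp (- \<mu>) * exp \<mu> = \<mu>" by (simp add: exp_minus field_simps)
  have e2: "\<mu> * exp (- \<mu>) * (\<mu> ^ k / fact k) = real (Suc k) * (\<mu> ^ Suc k / fact (Suc k) * exp (- \<mu>))" for k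
  proof -
    have "real (Suc k) * (\<mu> ^ Suc k / (real (Suc k) * fact k) * exp (- \<mu>)) = \<mu> ^ Suc k / fact k * exp (- \<mu>)"
      by (simp del: of_nat_Suc)
    then show ?thesis by (simp add: mult_ac)
  qed
  have "(\<lambda>k. real (Suc k) * (\<mu> ^ Suc k / fact (Suc k) * exp (- \<mu>))) sums \<mu>"
    using s1 unfolding e1 e2 .
  then show ?thesis by (subst (asm) sums_Suc_iff) simp
qed

locale pwit_process =
  fixes P :: "'q measure" and p :: "nat pmf" and d :: "nat list \<Rightarrow> 'q \<Rightarrow> nat" and X :: "nat list set \<Rightarrow> 'q \<Rightarrow> real"
  assumes input: "rdcp_input_pwit P p d X"

sublocale pwit_process \<subseteq> prob_space P
  using input by (simp add: rdcp_input_pwit_def)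

context pwit_process
begin

definition row :: "nat list \<Rightarrow> 'q \<Rightarrow> nat \<Rightarrow> real" where
  "row i \<omega> = (\<lambda>j\<in>{1..}. X {i, i @ [j]} \<omega>)"

abbreviation count :: "nat list \<Rightarrow> real set \<Rightarrow> 'q \<Rightarrow> nat" where
  "count i B \<equiv> num_points (\<lambda>j. X {i, i @ [j]}) B"

lemma poisson: "i \<in> tree_verts \<Longrightarrow> unit_poisson_points P (\<lambda>j. X {i, i @ [j]})"
  using input by (simp add: rdcp_input_pwit_def pwit_def)

lemma d_measurable [measurable (raw)]: "i \<in> tree_verts \<Longrightarrow> d i \<in> measurable P (count_space UNIV)"
  using input by (auto simp: rdcp_input_pwit_def iid_constraints_def indep_vars_def pwit_def)

lemma X_measurable: "i \<in> tree_verts \<Longrightarrow> 1 \<le> j \<Longrightarrow> X {i, i @ [j]} \<in> borel_measurable P"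
  using poisson unfolding unit_poisson_points_def by blast

lemma row_measurable: "i \<in> tree_verts \<Longrightarrow> row i \<in> measurable P (PiM {1..} (\<lambda>_. borel))"
  unfolding row_def using X_measurable by (intro measurable_restrict) auto

definition row_algebra :: "nat list \<Rightarrow> 'q measure" where
  "row_algebra i = vimage_algebra (space P) (row i) (PiM {1..} (\<lambda>_. borel))"

lemma space_row_algebra [simp]: "space (row_algebra i) = space P"
  by (simp add: row_algebra_def)

lemma sets_row_algebra:
  "sets (row_algebra i) = {row i -` C \<inter> space P | C. C \<in> sets (PiM {1..} (\<lambda>_. borel))}"
  unfolding row_algebra_def by (intro sets_vimage_algebra2) (auto simp: space_PiM row_def)

lemma X_row_measurable [measurable (raw)]:
  assumes "1 \<le> j"
  shows "X {i, i @ [j]} \<in> borel_measurable (row_algebra i)"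
proof -
  have "row i \<in> measurable (row_algebra i) (PiM {1..} (\<lambda>_. borel))"
    unfolding row_algebra_def by (intro measurable_vimage_algebra1) (auto simp: space_PiM row_def)
  then have "(\<lambda>\<omega>. row i \<omega> j) \<in> borel_measurable (row_algebra i)"
    by (rule measurable_compose[OF _ measurable_component_singleton]) (use assms in simp)
  then show ?thesis using assms by (simp add: row_def)
qed

lemma count_row_measurable [measurable (raw)]:
  assumes "B \<in> sets borel"
  shows "count i B \<in> measurable (row_algebra i) (count_space UNIV)"
proof -
  have "{\<omega> \<in> space (row_algebra i). j \<in> {j. 1 \<le> j \<and> X {i, i @ [j]} \<omega> \<in> B}} \<in> sets (row_algebra i)" for j
  proof (cases "1 \<le> j")
    case True
    then show ?thesis
      using measurable_sets[OF X_row_measurable[OF True] assms] by (simp add: vimage_def Int_def conj_commute)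
  qed simp
  then show ?thesis unfolding num_points_def by (rule measurable_card)
qed

text \<open>Events of product form about the constraint of \<open>i\<close> and the labels of the
  edges to its children. The form is stable under intersection, and such events at different
  vertices are independent.\<close>

definition vertex_events :: "nat list \<Rightarrow> 'q set set" where
  "vertex_events i = {A. \<exists>D. \<exists>C\<in>sets (row_algebra i). A = {\<omega> \<in> space P. d i \<omega> \<in> D} \<inter> C}"

lemma row_sub: "i \<in> tree_verts \<Longrightarrow> sets (row_algebra i) \<subseteq> events"
  unfolding sets_row_algebra using row_measurable by (auto intro: measurable_sets)

lemma vertex_events_sub: "i \<in> tree_verts \<Longrightarrow> vertex_events i \<subseteq> events"
proof
  fix A assume i: "i \<in> tree_verts" and "A \<in> vertex_events i"
  then obtain D C where A: "C \<in> events" "A = {\<omega> \<in> space P. d i \<omega> \<in> D} \<inter> C"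
    using row_sub[OF i] unfolding vertex_events_def by blast
  have "{\<omega> \<in> space P. d i \<omega> \<in> D} \<in> events"
    using measurable_sets[OF d_measurable[OF i], of D] by (simp add: vimage_def Int_def conj_commute)
  then show "A \<in> events" using A by auto
qed

lemma row_vertex_events: "C \<in> sets (row_algebra i) \<Longrightarrow> C \<in> vertex_events i"
  using sets.sets_into_space[of C "row_algebra i"] unfolding vertex_events_def
  by (auto intro!: exI[of _ UNIV] bexI[of _ C])

lemma d_vertex_events: "{\<omega> \<in> space P. d i \<omega> \<in> D} \<in> vertex_events i"
  unfolding vertex_events_def
  by (auto intro!: exI[of _ D] bexI[of _ "space P"] simp: sets.top[of "row_algebra i", simplified])

lemma Int_vertex_events: "A \<in> vertex_events i \<Longrightarrow> B \<in> vertex_events i \<Longrightarrow> A \<inter> B \<in> vertex_events i"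
proof -
  assume "A \<in> vertex_events i" "B \<in> vertex_events i"
  then obtain D C D' C' where "C \<in> sets (row_algebra i)" "C' \<in> sets (row_algebra i)"
    "A = {\<omega> \<in> space P. d i \<omega> \<in> D} \<inter> C" "B = {\<omega> \<in> space P. d i \<omega> \<in> D'} \<inter> C'"
    unfolding vertex_events_def by blast
  then show "A \<inter> B \<in> vertex_events i"
    unfolding vertex_events_def by (auto intro!: exI[of _ "D \<inter> D'"] bexI[of _ "C \<inter> C'"])
qed

text \<open>Independence is given within the constraints, within the rows of labels, and between the
  two families as wholes. Together this yields the product rule over finitely many vertices.\<close>

lemma prob_d_row:
  assumes I: "finite I" "I \<subseteq> tree_verts" and C: "\<And>i. i \<in> I \<Longrightarrow> C i \<in> sets (row_algebra i)"
  shows "prob {\<omega> \<in> space P. \<forall>i\<in>I. d i \<omega> \<in> D i \<and> \<omega> \<in> C i} =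
    (\<Prod>i\<in>I. prob {\<omega> \<in> space P. d i \<omega> \<in> D i}) * (\<Prod>i\<in>I. prob (C i))"
proof (cases "I = {}")
  case True
  then show ?thesis by (simp add: prob_space)
next
  case False
  have indep_d: "indep_vars (\<lambda>_. count_space UNIV) d tree_verts"
    and indep_row: "indep_vars (\<lambda>_. PiM {1..} (\<lambda>_. borel)) row tree_verts"
    and indep: "constraints_indep_of_times P pwit d X"
    using input unfolding rdcp_input_pwit_def iid_constraints_def row_def by (auto simp: pwit_def)
  let ?V = "verts pwit" and ?E = "edges pwit"
  have V: "?V = tree_verts" by (simp add: pwit_def)
  have "\<forall>i\<in>I. \<exists>B. B \<in> sets (PiM {1..} (\<lambda>_. borel)) \<and> C i = row i -` B \<inter> space P"
    using C unfolding sets_row_algebra by blast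
  then obtain B where B: "\<And>i. i \<in> I \<Longrightarrow> B i \<in> sets (PiM {1..} (\<lambda>_. borel))" "\<And>i. i \<in> I \<Longrightarrow> C i = row i -` B i \<inter> space P"
    by metis
  let ?A = "{\<omega> \<in> space P. \<forall>i\<in>I. d i \<omega> \<in> D i}" and ?C = "{\<omega> \<in> space P. \<forall>i\<in>I. row i \<omega> \<in> B i}"
  have "{\<omega> \<in> space P. \<forall>i\<in>I. d i \<omega> \<in> D i \<and> \<omega> \<in> C i} = ?A \<inter> ?C" using B(2) by auto
  also have "prob (?A \<inter> ?C) = prob ?A * prob ?C"
  proof (rule indep_setD[OF indep[unfolded constraints_indep_of_times_def]])
    have "?A = (\<lambda>\<omega>. \<lambda>v\<in>?V. d v \<omega>) -` {f \<in> space (PiM ?V (\<lambda>_. count_space UNIV)). \<forall>v\<in>I. f v \<in> D v} \<inter> space P"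
      using I V by (auto simp: space_PiM)
    moreover have "{f \<in> space (PiM ?V (\<lambda>_. count_space UNIV)). \<forall>v\<in>I. f v \<in> D v} \<in> sets (PiM ?V (\<lambda>_. count_space UNIV))"
    proof (rule sets.sets_Collect_finite_All[OF _ I(1)])
      fix v assume "v \<in> I"
      then have "v \<in> ?V" using I V by blast
      then show "{f \<in> space (PiM ?V (\<lambda>_. count_space UNIV)). f v \<in> D v} \<in> sets (PiM ?V (\<lambda>_. count_space UNIV))"
        by measurable
    qed
    ultimately show "?A \<in> {(\<lambda>\<omega>. \<lambda>v\<in>?V. d v \<omega>) -` S \<inter> space P | S. S \<in> sets (PiM ?V (\<lambda>_. count_space UNIV))}"
      by blast
    \<comment> \<open>A row is a measurable function of the whole family of labels, the form in
      which the independence of the two families is given.\<close>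
    let ?r = "\<lambda>i (f :: nat list set \<Rightarrow> real). \<lambda>j\<in>{1..}. f {i, i @ [j]}"
    have edge: "{i, i @ [j]} \<in> ?E" if "i \<in> I" "j \<in> {1..}" for i j
      by (rule tree_edgeI) (use that I in auto)
    have "?r i (\<lambda>e\<in>?E. X e \<omega>) = row i \<omega>" if "i \<in> I" for i \<omega>
      unfolding row_def using edge[OF that] by (intro restrict_ext) simp
    then have "?C = (\<lambda>\<omega>. \<lambda>e\<in>?E. X e \<omega>) -` {f \<in> space (PiM ?E (\<lambda>_. borel)). \<forall>i\<in>I. ?r i f \<in> B i} \<inter> space P"
      by (auto simp: space_PiM)
    moreover have "{f \<in> space (PiM ?E (\<lambda>_. borel)). \<forall>i\<in>I. ?r i f \<in> B i} \<in> sets (PiM ?E (\<lambda>_. borel))"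
    proof (rule sets.sets_Collect_finite_All[OF _ I(1)])
      fix i assume i: "i \<in> I"
      have "?r i \<in> measurable (PiM ?E (\<lambda>_. borel)) (PiM {1..} (\<lambda>_. borel))"
        using edge[OF i] by (intro measurable_restrict measurable_component_singleton) auto
      from measurable_sets[OF this B(1)[OF i]]
      show "{f \<in> space (PiM ?E (\<lambda>_. borel)). ?r i f \<in> B i} \<in> sets (PiM ?E (\<lambda>_. borel))"
        by (simp only: vimage_def Int_def mem_Collect_eq conj_commute)
    qed
    ultimately show "?C \<in> {(\<lambda>\<omega>. \<lambda>e\<in>?E. X e \<omega>) -` S \<inter> space P | S. S \<in> sets (PiM ?E (\<lambda>_. borel))}"
      by blast
  qed
  also have "prob ?A = (\<Prod>i\<in>I. prob {\<omega> \<in> space P. d i \<omega> \<in> D i})"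
  proof -
    have "?A = (\<Inter>i\<in>I. d i -` D i \<inter> space P)" using False by auto
    also have "prob \<dots> = (\<Prod>i\<in>I. prob (d i -` D i \<inter> space P))"
      using indep_varsD[OF indep_d False I, of D] by simp
    finally show ?thesis by (simp add: vimage_def Int_def conj_commute)
  qed
  also have "prob ?C = (\<Prod>i\<in>I. prob (C i))"
  proof -
    have "?C = (\<Inter>i\<in>I. row i -` B i \<inter> space P)" using False by auto
    also have "prob \<dots> = (\<Prod>i\<in>I. prob (row i -` B i \<inter> space P))"
      using indep_varsD[OF indep_row False I, of B] B(1) by simp
    finally show ?thesis using B(2) by simp
  qed
  finally show ?thesis .
qed

lemma prob_vertex_events:
  assumes I: "finite I" "I \<subseteq> tree_verts" and A: "\<And>i. i \<in> I \<Longrightarrow> A i \<in> vertex_events i"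
  shows "{\<omega> \<in> space P. \<forall>i\<in>I. \<omega> \<in> A i} \<in> events"
    and "prob {\<omega> \<in> space P. \<forall>i\<in>I. \<omega> \<in> A i} = (\<Prod>i\<in>I. prob (A i))"
proof -
  have Aev: "A i \<in> events" if "i \<in> I" for i using A[OF that] vertex_events_sub I that by blast
  show "{\<omega> \<in> space P. \<forall>i\<in>I. \<omega> \<in> A i} \<in> events"
    using Aev I(1) by (intro sets.sets_Collect_finite_All) (auto simp: Int_def[symmetric] Collect_conj_eq)
  have "\<forall>i\<in>I. \<exists>D. \<exists>C. C \<in> sets (row_algebra i) \<and> A i = {\<omega> \<in> space P. d i \<omega> \<in> D} \<inter> C"
    using A unfolding vertex_events_def by blast
  then obtain D C where DC: "\<And>i. i \<in> I \<Longrightarrow> C i \<in> sets (row_algebra i)"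
    "\<And>i. i \<in> I \<Longrightarrow> A i = {\<omega> \<in> space P. d i \<omega> \<in> D i} \<inter> C i"
    by metis
  have Csp: "C i \<subseteq> space P" if "i \<in> I" for i
    using DC(1)[OF that] sets.sets_into_space[of _ "row_algebra i"] by auto
  have one: "prob (A i) = prob {\<omega> \<in> space P. d i \<omega> \<in> D i} * prob (C i)" if i: "i \<in> I" for i
  proof -
    have "A i = {\<omega> \<in> space P. \<forall>k\<in>{i}. d k \<omega> \<in> D k \<and> \<omega> \<in> C k}" using DC(2)[OF i] by auto
    then show ?thesis using prob_d_row[of "{i}" C D] I i DC(1) by auto
  qed
  have "{\<omega> \<in> space P. \<forall>i\<in>I. \<omega> \<in> A i} = {\<omega> \<in> space P. \<forall>i\<in>I. d i \<omega> \<in> D i \<and> \<omega> \<in> C i}"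
    using DC(2) by auto
  then show "prob {\<omega> \<in> space P. \<forall>i\<in>I. \<omega> \<in> A i} = (\<Prod>i\<in>I. prob (A i))"
    using prob_d_row[OF I DC(1)] one by (simp add: prod.distrib)
qed

text \<open>The almost sure properties of the point processes are collected for all of the countably
  many vertices, so that later arguments can fix one \<omega>.\<close>

definition regular :: "'q \<Rightarrow> bool" where
  "regular \<omega> \<longleftrightarrow> (\<forall>i\<in>tree_verts. 0 \<le> X {i, i @ [1]} \<omega> \<and> (\<forall>j\<ge>1. X {i, i @ [j]} \<omega> < X {i, i @ [Suc j]} \<omega>) \<and>
     (\<forall>b. finite {j. 1 \<le> j \<and> X {i, i @ [j]} \<omega> \<le> b}))"

lemma AE_regular: "AE \<omega> in P. regular \<omega>"
proof -
  have "AE \<omega> in P. 0 \<le> X {i, i @ [1]} \<omega> \<and> (\<forall>j\<ge>1. X {i, i @ [j]} \<omega> < X {i, i @ [Suc j]} \<omega>) \<and>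
     (\<forall>b. finite {j. 1 \<le> j \<and> X {i, i @ [j]} \<omega> \<le> b})" if "i \<in> tree_verts" for i
    using poisson[OF that] unfolding unit_poisson_points_def by blast
  then show ?thesis unfolding regular_def by (simp add: AE_ball_countable)
qed

lemma regular_less:
  assumes "regular \<omega>" "i \<in> tree_verts" "1 \<le> j" "j < k"
  shows "X {i, i @ [j]} \<omega> < X {i, i @ [k]} \<omega>"
  using assms(4)
proof (induction k)
  case (Suc k)
  have "X {i, i @ [k]} \<omega> < X {i, i @ [Suc k]} \<omega>" if "1 \<le> k"
    using assms(1,2) that unfolding regular_def by blast
  then show ?case using Suc assms(3) by (cases "j = k") auto
qed simp

lemma regular_less_iff:
  assumes "regular \<omega>" "i \<in> tree_verts" "1 \<le> j" "1 \<le> k"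
  shows "X {i, i @ [j]} \<omega> < X {i, i @ [k]} \<omega> \<longleftrightarrow> j < k"
  using regular_less[OF assms(1,2,3), of k] regular_less[OF assms(1,2,4), of j]
  by (metis linorder_neqE_nat order_less_asym order_less_irrefl)

lemma regular_nonneg:
  assumes "regular \<omega>" "i \<in> tree_verts" "1 \<le> j"
  shows "0 \<le> X {i, i @ [j]} \<omega>"
proof -
  have "0 \<le> X {i, i @ [1]} \<omega>" using assms unfolding regular_def by blast
  then show ?thesis using regular_less[OF assms(1,2), of 1 j] assms(3) by (cases "j = 1") auto
qed

lemma regular_finite:
  assumes "regular \<omega>" "i \<in> tree_verts"
  shows "finite {j. 1 \<le> j \<and> X {i, i @ [j]} \<omega> \<le> b}"
  using assms unfolding regular_def by blast

lemma prob_count: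
  assumes "i \<in> tree_verts" "B \<in> sets borel" "B \<subseteq> {0..b}"
  shows "prob {\<omega> \<in> space P. count i B \<omega> = k} = measure lborel B ^ k / fact k * exp (- measure lborel B)"
proof -
  have "emeasure lborel B \<le> emeasure lborel {0..b}" using assms by (intro emeasure_mono) auto
  also have "\<dots> < \<infinity>" by (simp add: emeasure_lborel_Icc_eq)
  finally have "emeasure lborel B < \<infinity>" .
  moreover have "B \<subseteq> {0..}" using assms(3) by auto
  ultimately show ?thesis
    using poisson[OF assms(1)] assms(2) unfolding unit_poisson_points_def by blast
qed

text \<open>Both sides are the expected number of points in \<open>B\<close>: the series by
  exchanging sum and expectation, the measure as the mean of the Poisson count. The distributions of
  individual points never enter.\<close>

lemma suminf_emeasure_points:
  assumes i: "i \<in> tree_verts" and B: "B \<in> sets borel" "B \<subseteq> {0..b}"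
  shows "(\<Sum>j. emeasure P {\<omega> \<in> space P. X {i, i @ [Suc j]} \<omega> \<in> B}) = ennreal (measure lborel B)"
proof -
  let ?A = "\<lambda>j. {\<omega> \<in> space P. X {i, i @ [Suc j]} \<omega> \<in> B}" and ?N = "count i B"
  have A: "?A j \<in> events" for j
    using measurable_sets[OF X_measurable[OF i, of "Suc j"] B(1)] by (simp add: vimage_def Int_def conj_commute)
  have N: "{\<omega> \<in> space P. ?N \<omega> = k} \<in> events" for k
  proof -
    have "?N -` {k} \<inter> space P \<in> sets (row_algebra i)"
      using measurable_sets[OF count_row_measurable[OF B(1)], of "{k}" i] by simp
    then show ?thesis using row_sub[OF i] by (auto simp: vimage_def Int_def conj_commute)
  qed
  have "(\<Sum>j. emeasure P (?A j)) = (\<Sum>j. \<integral>\<^sup>+\<omega>. indicator (?A j) \<omega> \<partial>P)"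
    using A by simp
  also have "\<dots> = (\<integral>\<^sup>+\<omega>. (\<Sum>j. indicator (?A j) \<omega>) \<partial>P)"
    using A by (intro nn_integral_suminf[symmetric]) auto
  also have "\<dots> = (\<integral>\<^sup>+\<omega>. (\<Sum>k. of_nat k * indicator {\<omega> \<in> space P. ?N \<omega> = k} \<omega>) \<partial>P)"
  proof (rule nn_integral_cong_AE)
    show "AE \<omega> in P. (\<Sum>j. indicator (?A j) \<omega>) = (\<Sum>k. of_nat k * indicator {\<omega> \<in> space P. ?N \<omega> = k} \<omega> :: ennreal)"
      using AE_regular
    proof (rule AE_mp, intro AE_I2 impI)
      fix \<omega> assume \<omega>: "\<omega> \<in> space P" "regular \<omega>"
      define J where "J = {j. X {i, i @ [Suc j]} \<omega> \<in> B}"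
      have J: "{j. 1 \<le> j \<and> X {i, i @ [j]} \<omega> \<in> B} = Suc ` J"
        by (auto simp: J_def image_iff Suc_le_eq gr0_conv_Suc)
      have "finite (Suc ` J)"
        unfolding J[symmetric] by (rule finite_subset[OF _ regular_finite[OF \<omega>(2) i, of b]]) (use B in auto)
      then have fin: "finite J" by (simp add: finite_image_iff)
      have card: "?N \<omega> = card J" unfolding num_points_def J by (simp add: card_image)
      have "(\<Sum>j. indicator (?A j) \<omega>) = (\<Sum>j\<in>J. indicator (?A j) \<omega> :: ennreal)"
        using \<omega> by (intro suminf_finite fin) (auto simp: J_def indicator_def)
      also have "\<dots> = of_nat (card J)" using \<omega> by (simp add: J_def indicator_def)
      also have "\<dots> = (\<Sum>k\<in>{card J}. of_nat k * indicator {\<omega> \<in> space P. ?N \<omega> = k} \<omega>)"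
        using \<omega> card by (simp add: indicator_def)
      also have "\<dots> = (\<Sum>k. of_nat k * indicator {\<omega> \<in> space P. ?N \<omega> = k} \<omega>)"
        using card by (intro suminf_finite[symmetric]) (auto simp: indicator_def)
      finally show "(\<Sum>j. indicator (?A j) \<omega>) = (\<Sum>k. of_nat k * indicator {\<omega> \<in> space P. ?N \<omega> = k} \<omega> :: ennreal)" .
    qed
  qed
  also have "\<dots> = (\<Sum>k. \<integral>\<^sup>+\<omega>. of_nat k * indicator {\<omega> \<in> space P. ?N \<omega> = k} \<omega> \<partial>P)"
    using N by (intro nn_integral_suminf) auto
  also have "\<dots> = (\<Sum>k. ennreal (real k * (measure lborel B ^ k / fact k * exp (- measure lborel B))))"
  proof (intro suminf_cong)
    fix k
    have "(\<integral>\<^sup>+\<omega>. of_nat k * indicator {\<omega> \<in> space P. ?N \<omega> = k} \<omega> \<partial>P) =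
        ennreal (real k) * ennreal (prob {\<omega> \<in> space P. ?N \<omega> = k})"
      using N by (simp add: nn_integral_cmult_indicator emeasure_eq_measure ennreal_of_nat_eq_real_of_nat)
    then show "(\<integral>\<^sup>+\<omega>. of_nat k * indicator {\<omega> \<in> space P. ?N \<omega> = k} \<omega> \<partial>P) =
        ennreal (real k * (measure lborel B ^ k / fact k * exp (- measure lborel B)))"
      unfolding prob_count[OF i B] by (simp only: ennreal_mult'[OF of_nat_0_le_iff])
  qed
  also have "\<dots> = ennreal (measure lborel B)"
    by (rule suminf_ennreal_eq[OF _ poisson_mean]) auto
  finally show ?thesis .
qed

section \<open>First moment bounds for paths with prescribed labels\<close>

definition path_event :: "nat list \<Rightarrow> real set list \<Rightarrow> (nat list \<Rightarrow> 'q set) \<Rightarrow> 'q set" where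
  "path_event u Bs A = {\<omega> \<in> space P. \<exists>js\<in>tree_verts.
     list_all2 (\<in>) (path_times (\<lambda>e. X e \<omega>) u js) Bs \<and> \<omega> \<in> A (u @ js)}"

lemma path_event_Nil: "A u \<subseteq> space P \<Longrightarrow> path_event u [] A = A u"
proof -
  assume A: "A u \<subseteq> space P"
  have "list_all2 (\<in>) (path_times X' u js) [] \<longleftrightarrow> js = []" for X' js by (cases js) auto
  then show ?thesis using A unfolding path_event_def by auto
qed

lemma path_event_Cons:
  "path_event u (B # Bs) A = (\<Union>j. {\<omega> \<in> space P. X {u, u @ [Suc j]} \<omega> \<in> B} \<inter> path_event (u @ [Suc j]) Bs A)"
proof (intro equalityI subsetI)
  fix \<omega> assume "\<omega> \<in> path_event u (B # Bs) A"
  then obtain js where js: "\<omega> \<in> space P" "js \<in> tree_verts"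
    "list_all2 (\<in>) (path_times (\<lambda>e. X e \<omega>) u js) (B # Bs)" "\<omega> \<in> A (u @ js)"
    unfolding path_event_def by blast
  then obtain k ks where k: "js = k # ks" by (cases js) auto
  then obtain j where "k = Suc j" using js(2) by (cases k) auto
  then have "X {u, u @ [Suc j]} \<omega> \<in> B" "\<omega> \<in> path_event (u @ [Suc j]) Bs A"
    using js k unfolding path_event_def by (auto intro!: bexI[of _ ks])
  then show "\<omega> \<in> (\<Union>j. {\<omega> \<in> space P. X {u, u @ [Suc j]} \<omega> \<in> B} \<inter> path_event (u @ [Suc j]) Bs A)"
    using js(1) by blast
next
  fix \<omega> assume "\<omega> \<in> (\<Union>j. {\<omega> \<in> space P. X {u, u @ [Suc j]} \<omega> \<in> B} \<inter> path_event (u @ [Suc j]) Bs A)"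
  then obtain j js where "\<omega> \<in> space P" "X {u, u @ [Suc j]} \<omega> \<in> B" "js \<in> tree_verts"
    "list_all2 (\<in>) (path_times (\<lambda>e. X e \<omega>) (u @ [Suc j]) js) Bs" "\<omega> \<in> A (u @ Suc j # js)"
    unfolding path_event_def by auto
  then show "\<omega> \<in> path_event u (B # Bs) A"
    unfolding path_event_def by (auto intro!: bexI[of _ "Suc j # js"])
qed

text \<open>Each step of a path costs a factor \<open>measure lborel B\<close>, by a union bound
  over the children and \<open>suminf_emeasure_points\<close>. The events \<open>H\<close> on
  \<open>I\<close> stand for the vertices already passed; these lie outside the subtree of
  \<open>u\<close>, hence are independent of what follows.\<close>

lemma path_event_bound:
  assumes "u \<in> tree_verts" "\<And>B. B \<in> set Bs \<Longrightarrow> B \<in> sets borel \<and> B \<subseteq> {0..b}"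
    and A: "\<And>v. v \<in> tree_verts \<Longrightarrow> A v \<in> vertex_events v \<and> prob (A v) \<le> f" and f: "0 \<le> f"
    and "finite I" "I \<subseteq> tree_verts" "\<And>i. i \<in> I \<Longrightarrow> \<not> prefix u i" "\<And>i. i \<in> I \<Longrightarrow> H i \<in> vertex_events i"
  shows "path_event u Bs A \<in> events \<and>
    emeasure P ({\<omega> \<in> space P. \<forall>i\<in>I. \<omega> \<in> H i} \<inter> path_event u Bs A) \<le>
      emeasure P {\<omega> \<in> space P. \<forall>i\<in>I. \<omega> \<in> H i} * ennreal (prod_list (map (measure lborel) Bs) * f)"
  using assms(1,2,5-)
proof (induction Bs arbitrary: u I H)
  case Nil
  have Au: "A u \<in> vertex_events u" "prob (A u) \<le> f" using A Nil by auto
  have Aev: "A u \<in> events" using vertex_events_sub Nil(1) Au by blast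
  then have eq: "path_event u [] A = A u" using sets.sets_into_space by (intro path_event_Nil) blast
  have uI: "u \<notin> I" using Nil by auto
  let ?H = "H(u := A u)"
  have H': "?H i \<in> vertex_events i" if "i \<in> insert u I" for i using that Nil Au by auto
  have HI: "?H i = H i" if "i \<in> I" for i using that uI by auto
  have "{\<omega> \<in> space P. \<forall>i\<in>I. \<omega> \<in> H i} \<inter> A u = {\<omega> \<in> space P. \<forall>i\<in>insert u I. \<omega> \<in> ?H i}"
    using HI by auto
  also have "prob \<dots> = (\<Prod>i\<in>insert u I. prob (?H i))"
    by (rule prob_vertex_events(2)) (use Nil H' in auto)
  also have "\<dots> = prob (A u) * (\<Prod>i\<in>I. prob (H i))"
    using Nil uI prod.cong[OF refl, of I "\<lambda>i. prob (?H i)" "\<lambda>i. prob (H i)"] HI by simp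
  also have "(\<Prod>i\<in>I. prob (H i)) = prob {\<omega> \<in> space P. \<forall>i\<in>I. \<omega> \<in> H i}"
    by (rule prob_vertex_events(2)[symmetric]) (use Nil in auto)
  finally have "prob ({\<omega> \<in> space P. \<forall>i\<in>I. \<omega> \<in> H i} \<inter> A u) \<le> prob {\<omega> \<in> space P. \<forall>i\<in>I. \<omega> \<in> H i} * f"
    using mult_right_mono[OF Au(2), of "prob {\<omega> \<in> space P. \<forall>i\<in>I. \<omega> \<in> H i}"] by (simp add: mult.commute)
  then show ?case
    unfolding eq using Aev f by (simp add: emeasure_eq_measure ennreal_mult'[symmetric])
next
  case (Cons B Bs)
  let ?HI = "{\<omega> \<in> space P. \<forall>i\<in>I. \<omega> \<in> H i}"
  let ?E = "\<lambda>j. {\<omega> \<in> space P. X {u, u @ [Suc j]} \<omega> \<in> B}"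
  let ?c = "prod_list (map (measure lborel) Bs) * f"
  have B: "B \<in> sets borel" "B \<subseteq> {0..b}" using Cons.prems(2) by auto
  have c: "0 \<le> ?c" using f by (intro mult_nonneg_nonneg prod_list_nonneg) auto
  have E: "?E j \<in> vertex_events u" for j
    using measurable_sets[OF X_row_measurable B(1), of "Suc j" u]
    by (intro row_vertex_events) (simp add: vimage_def Int_def conj_commute)
  have Eev: "?E j \<in> events" for j using E vertex_events_sub Cons.prems(1) by blast
  have HI: "?HI \<in> events" by (rule prob_vertex_events(1)) (use Cons.prems in auto)
  have uI: "u \<notin> I" using Cons.prems(5)[of u] by auto
  have uj: "u @ [Suc j] \<in> tree_verts" for j using Cons.prems(1) by auto
  have step: "path_event (u @ [Suc j]) Bs A \<in> events \<and>
      emeasure P (?HI \<inter> ?E j \<inter> path_event (u @ [Suc j]) Bs A) \<le> emeasure P ?HI * emeasure P (?E j) * ennreal ?c" for j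
  proof -
    let ?H = "H(u := ?E j)"
    have Heq: "?H i = H i" if "i \<in> I" for i using that uI by auto
    have H': "?H i \<in> vertex_events i" if "i \<in> insert u I" for i using that Cons.prems E by auto
    have eq: "{\<omega> \<in> space P. \<forall>i\<in>insert u I. \<omega> \<in> ?H i} = ?HI \<inter> ?E j" using Heq by auto
    have np: "\<not> prefix (u @ [Suc j]) i" if "i \<in> insert u I" for i
      using that Cons.prems(5) by (auto dest: append_prefixD)
    have 1: "path_event (u @ [Suc j]) Bs A \<in> events \<and>
      emeasure P ({\<omega> \<in> space P. \<forall>i\<in>insert u I. \<omega> \<in> ?H i} \<inter> path_event (u @ [Suc j]) Bs A) \<le>
      emeasure P {\<omega> \<in> space P. \<forall>i\<in>insert u I. \<omega> \<in> ?H i} * ennreal ?c"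
      by (rule Cons.IH) (use uj np H' Cons.prems in auto)
    have "prob {\<omega> \<in> space P. \<forall>i\<in>insert u I. \<omega> \<in> ?H i} = (\<Prod>i\<in>insert u I. prob (?H i))"
      by (rule prob_vertex_events(2)) (use Cons.prems H' in auto)
    also have "\<dots> = prob (?E j) * (\<Prod>i\<in>I. prob (H i))"
      using Cons.prems uI prod.cong[OF refl, of I "\<lambda>i. prob (?H i)" "\<lambda>i. prob (H i)"] Heq by simp
    also have "(\<Prod>i\<in>I. prob (H i)) = prob ?HI"
      by (rule prob_vertex_events(2)[symmetric]) (use Cons.prems in auto)
    finally have "emeasure P {\<omega> \<in> space P. \<forall>i\<in>insert u I. \<omega> \<in> ?H i} = emeasure P ?HI * emeasure P (?E j)"
      by (simp add: emeasure_eq_measure ennreal_mult'[symmetric] mult.commute)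
    then show ?thesis using 1 unfolding eq by simp
  qed
  have ev: "path_event u (B # Bs) A \<in> events"
    unfolding path_event_Cons using step Eev by blast
  have "?HI \<inter> path_event u (B # Bs) A = (\<Union>j. ?HI \<inter> ?E j \<inter> path_event (u @ [Suc j]) Bs A)"
    unfolding path_event_Cons by auto
  then have "emeasure P (?HI \<inter> path_event u (B # Bs) A) \<le>
      (\<Sum>j. emeasure P (?HI \<inter> ?E j \<inter> path_event (u @ [Suc j]) Bs A))"
    using step Eev HI by (simp only:, intro emeasure_subadditive_countably) blast
  also have "\<dots> \<le> (\<Sum>j. emeasure P ?HI * ennreal ?c * emeasure P (?E j))"
    using step by (intro suminf_le) (auto simp: mult_ac)
  also have "\<dots> = emeasure P ?HI * ennreal ?c * ennreal (measure lborel B)"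
    using suminf_emeasure_points[OF Cons.prems(1) B] by simp
  also have "\<dots> = emeasure P ?HI * ennreal (prod_list (map (measure lborel) (B # Bs)) * f)"
  proof -
    have "prod_list (map (measure lborel) (B # Bs)) * f = ?c * measure lborel B" by simp
    then have "ennreal (prod_list (map (measure lborel) (B # Bs)) * f) = ennreal ?c * ennreal (measure lborel B)"
      using ennreal_mult'[OF c, of "measure lborel B"] by (rule trans[OF arg_cong])
    then show ?thesis by (simp only: mult.assoc[of "emeasure P ?HI"])
  qed
  finally show ?case using ev by blast
qed

lemma prob_path_event_le:
  assumes "u \<in> tree_verts" "\<And>B. B \<in> set Bs \<Longrightarrow> B \<in> sets borel \<and> B \<subseteq> {0..b}"
    and "\<And>v. v \<in> tree_verts \<Longrightarrow> A v \<in> vertex_events v \<and> prob (A v) \<le> f" and "0 \<le> f"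
  shows "path_event u Bs A \<in> events" "prob (path_event u Bs A) \<le> prod_list (map (measure lborel) Bs) * f"
proof -
  have *: "path_event u Bs A \<in> events \<and>
    emeasure P ({\<omega> \<in> space P. \<forall>i\<in>({} :: nat list set). \<omega> \<in> {}} \<inter> path_event u Bs A) \<le>
      emeasure P {\<omega> \<in> space P. \<forall>i\<in>({} :: nat list set). \<omega> \<in> {}} * ennreal (prod_list (map (measure lborel) Bs) * f)"
    by (rule path_event_bound[where b = b and H = "\<lambda>_. {}"]) (use assms in auto)
  then show ev: "path_event u Bs A \<in> events" by simp
  have "{\<omega> \<in> space P. \<forall>i\<in>({} :: nat list set). \<omega> \<in> {}} \<inter> path_event u Bs A = path_event u Bs A"
    using sets.sets_into_space[OF ev] by auto
  moreover have "0 \<le> prod_list (map (measure lborel) Bs) * f"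
    using assms(4) by (intro mult_nonneg_nonneg prod_list_nonneg) auto
  ultimately show "prob (path_event u Bs A) \<le> prod_list (map (measure lborel) Bs) * f"
    using * sets.sets_into_space[OF ev] by (simp add: emeasure_eq_measure prob_space ennreal_le_iff Int_absorb1)
qed

end

section \<open>Shapes in the Poisson weighted infinite tree\<close>

lemma cell_sub: "0 \<le> T \<Longrightarrow> c < m \<Longrightarrow> cell (T / real m) c \<subseteq> {0..T}"
proof
  fix x assume a: "0 \<le> T" "c < m" "x \<in> cell (T / real m) c"
  then have "0 \<le> real c * (T / real m)" by simp
  moreover have "real c * (T / real m) < x \<or> 0 \<le> x" using a(3) by (auto simp only: cell_def split: if_splits) simp_all
  ultimately have "0 \<le> x" by linarith
  then show "x \<in> {0..T}" using cell_le[OF a(3,2,1)] by simp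
qed

lemma cell_borel [measurable]: "cell \<delta> c \<in> sets borel"
  by (simp add: cell_def)

lemma measure_cell: "0 \<le> \<delta> \<Longrightarrow> measure lborel (cell \<delta> c) = \<delta>"
  by (simp add: cell_def algebra_simps)

lemma in_some_cell:
  assumes "0 \<le> x" "x \<le> T" "0 < m"
  shows "\<exists>c<m. x \<in> cell (T / real m) c"
proof -
  let ?P = "\<lambda>c. x \<le> real (Suc c) * (T / real m)"
  have ex: "?P (m - 1)" using assms by simp
  define c where "c = (LEAST c. ?P c)"
  have c: "?P c" unfolding c_def by (rule LeastI) (rule ex)
  have "c \<le> m - 1" unfolding c_def by (rule Least_le) (rule ex)
  moreover have "x \<in> cell (T / real m) c"
  proof (cases c)
    case 0
    then show ?thesis using c assms(1) by (simp add: cell_def)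
  next
    case (Suc b)
    then have "\<not> ?P b" using not_less_Least[of b ?P] by (simp add: c_def)
    then show ?thesis using Suc c by (simp add: cell_def)
  qed
  ultimately show ?thesis using assms(3) by (intro exI[of _ c]) auto
qed

text \<open>The children of a vertex of the tree are ordered by their labels. So the child in cell \<open>c\<close> has
  as its number the rank of \<open>c\<close> among the occupied cells.\<close>

definition rank_path :: "nat list set \<Rightarrow> nat list \<Rightarrow> nat list" where
  "rank_path S i = map (\<lambda>l. card {c. c \<le> i ! l \<and> take l i @ [c] \<in> S}) [0..<length i]"

lemma rank_path_Nil [simp]: "rank_path S [] = []"
  by (simp add: rank_path_def)

lemma rank_path_snoc [simp]: "rank_path S (i @ [c]) = rank_path S i @ [card {c'. c' \<le> c \<and> i @ [c'] \<in> S}]"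
  by (auto simp: rank_path_def nth_append intro!: map_cong)

lemma length_rank_path [simp]: "length (rank_path S i) = length i"
  by (simp add: rank_path_def)

text \<open>Among siblings in \<open>S\<close>, the rank increases strictly with the cell.\<close>

lemma rank_path_inj:
  assumes "cell_tree m K S"
  shows "inj_on (rank_path S) S"
proof (rule inj_onI)
  fix i j assume "i \<in> S" "j \<in> S" "rank_path S i = rank_path S j"
  then show "i = j"
  proof (induction i arbitrary: j rule: rev_induct)
    case Nil
    then show ?case by (metis length_0_conv length_rank_path)
  next
    case (snoc c i)
    then have "length j = Suc (length i)" by (metis length_append_singleton length_rank_path)
    then obtain c' i' where j: "j = i' @ [c']" by (cases j rule: rev_cases) auto
    have "i \<in> S" "i' \<in> S"
      using cell_tree_butlast[OF assms, of "i @ [c]"] cell_tree_butlast[OF assms, of "i' @ [c']"] snoc.prems j by auto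
    moreover have "rank_path S i = rank_path S i'" using snoc.prems(3) unfolding j by simp
    ultimately have ii: "i = i'" using snoc.IH by blast
    let ?r = "\<lambda>c. {c'. c' \<le> c \<and> i @ [c'] \<in> S}"
    have r: "card (?r c) = card (?r c')" using snoc.prems j ii by simp
    have less: "card (?r a) < card (?r b)" if "a < b" "i @ [b] \<in> S" for a b
    proof -
      have "?r a \<subseteq> ?r b" "b \<in> ?r b" "b \<notin> ?r a" "finite (?r b)" using that by auto
      then show ?thesis by (intro psubset_card_mono) blast+
    qed
    have "c = c'" using less[of c c'] less[of c' c] r snoc.prems j ii by (cases c c' rule: linorder_cases) auto
    then show ?case using j ii by simp
  qed
qed

lemma rank_path_verts:
  assumes "cell_tree m K S" "i \<in> S"
  shows "rank_path S i \<in> tree_verts"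
  using assms(2)
proof (induction i rule: rev_induct)
  case (snoc c i)
  have "i \<in> S" using cell_tree_butlast[OF assms(1)] snoc by (metis butlast_snoc snoc_eq_iff_butlast)
  moreover have "card {c'. c' \<le> c \<and> i @ [c'] \<in> S} \<noteq> 0"
    using snoc.prems by auto
  ultimately show ?case using snoc.IH by (auto simp: Suc_le_eq card_gt_0_iff)
qed simp

text \<open>The edges of the subtree of \<open>u\<close>, in which the process will also be run on
  its own.\<close>

definition below :: "nat list \<Rightarrow> nat list set set" where
  "below u = {{u @ i, u @ i @ [j]} | i j. i \<in> tree_verts \<and> 1 \<le> j}"

lemma below_root: "edges pwit = below []"
  by (simp add: below_def pwit_def)

lemma sum_children:
  assumes S: "cell_tree m K S"
  shows "(\<Sum>i\<in>{i \<in> S. length i < K}. card {c. c < m \<and> i @ [c] \<in> S}) = card S - 1"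
proof -
  have fin: "finite S" using finite_cell_tree[OF S] .
  have "(\<Sum>i\<in>{i \<in> S. length i < K}. card {c. c < m \<and> i @ [c] \<in> S}) =
      card (SIGMA i:{i \<in> S. length i < K}. {c. c < m \<and> i @ [c] \<in> S})"
    using fin by (subst card_SigmaI) auto
  also have "\<dots> = card (S - {[]})"
  proof (rule bij_betw_same_card, rule bij_betw_byWitness[where f = "\<lambda>(i, c). i @ [c]" and f' = "\<lambda>j. (butlast j, last j)"])
    show "(\<lambda>j. (butlast j, last j)) ` (S - {[]}) \<subseteq> (SIGMA i:{i \<in> S. length i < K}. {c. c < m \<and> i @ [c] \<in> S})"
    proof
      fix q assume "q \<in> (\<lambda>j. (butlast j, last j)) ` (S - {[]})"
      then obtain j where j: "j \<in> S" "j \<noteq> []" "q = (butlast j, last j)" by blast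
      have "length j \<le> K" using S j unfolding cell_tree_def by blast
      then have "length (butlast j) < K" using j by (cases j) auto
      then show "q \<in> (SIGMA i:{i \<in> S. length i < K}. {c. c < m \<and> i @ [c] \<in> S})"
        using j cell_tree_butlast[OF S] cell_tree_last[OF S] by simp
    qed
  qed auto
  also have "\<dots> = card S - 1" using S by (simp add: cell_tree_def)
  finally show ?thesis .
qed

context pwit_process
begin

lemma prob_cells:
  assumes i: "i \<in> tree_verts" and T: "0 \<le> T" and m: "0 < m"
  shows "{\<omega> \<in> space P. \<forall>c<m. count i (cell (T / real m) c) \<omega> = of_bool (c \<in> Q)} \<in> sets (row_algebra i)"
    and "prob {\<omega> \<in> space P. \<forall>c<m. count i (cell (T / real m) c) \<omega> = of_bool (c \<in> Q)} =
      (T / real m) ^ card {c. c < m \<and> c \<in> Q} * exp (- T)"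
proof -
  let ?B = "cell (T / real m)" and ?\<delta> = "T / real m"
  have "{\<omega> \<in> space (row_algebra i). \<forall>c\<in>{..<m}. count i (?B c) \<omega> = of_bool (c \<in> Q)} \<in> sets (row_algebra i)"
    by measurable
  then show "{\<omega> \<in> space P. \<forall>c<m. count i (?B c) \<omega> = of_bool (c \<in> Q)} \<in> sets (row_algebra i)"
    by (simp only: space_row_algebra Ball_def lessThan_iff)
  have sub: "?B c \<subseteq> {0..T}" if "c < m" for c using cell_sub T that by blast
  have disj: "disjoint_family_on ?B {..<m}"
    unfolding disjoint_family_on_def
  proof (intro ballI impI equals0I)
    fix c c' x assume "c \<noteq> c'" "x \<in> ?B c \<inter> ?B c'"
    then show False using cell_unique[of x ?\<delta> c c'] T by simp
  qed
  have "\<forall>k\<in>{..<m}. ?B k \<in> sets borel \<and> ?B k \<subseteq> {0..} \<and> emeasure lborel (?B k) < \<infinity>"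
  proof
    fix k assume "k \<in> {..<m}"
    then have s: "?B k \<subseteq> {0..T}" using sub by simp
    have "emeasure lborel (?B k) \<le> emeasure lborel {0..T}" using s by (intro emeasure_mono) auto
    also have "\<dots> < \<infinity>" by (simp add: emeasure_lborel_Icc_eq)
    finally show "?B k \<in> sets borel \<and> ?B k \<subseteq> {0..} \<and> emeasure lborel (?B k) < \<infinity>"
      using s by auto
  qed
  then have indep: "indep_vars (\<lambda>_. count_space UNIV) (\<lambda>c. count i (?B c)) {..<m}"
    using poisson[OF i] disj unfolding unit_poisson_points_def by blast
  have "{\<omega> \<in> space P. \<forall>c<m. count i (?B c) \<omega> = of_bool (c \<in> Q)} =
      (\<Inter>c\<in>{..<m}. count i (?B c) -` {of_bool (c \<in> Q)} \<inter> space P)"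
    using m by auto
  also have "prob \<dots> = (\<Prod>c\<in>{..<m}. prob (count i (?B c) -` {of_bool (c \<in> Q)} \<inter> space P))"
    by (rule indep_varsD[OF indep]) (use m in auto)
  also have "\<dots> = (\<Prod>c\<in>{..<m}. (if c \<in> Q then ?\<delta> else 1) * exp (- ?\<delta>))"
  proof (rule prod.cong[OF refl])
    fix c assume "c \<in> {..<m}"
    then have "prob {\<omega> \<in> space P. count i (?B c) \<omega> = of_bool (c \<in> Q)} =
        ?\<delta> ^ of_bool (c \<in> Q) / fact (of_bool (c \<in> Q)) * exp (- ?\<delta>)"
      using prob_count[OF i cell_borel sub, of c "of_bool (c \<in> Q)"] T by (simp add: measure_cell)
    then show "prob (count i (?B c) -` {of_bool (c \<in> Q)} \<inter> space P) = (if c \<in> Q then ?\<delta> else 1) * exp (- ?\<delta>)"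
      by (simp add: vimage_def Int_def conj_commute)
  qed
  also have "\<dots> = (\<Prod>c\<in>{..<m}. if c \<in> Q then ?\<delta> else 1) * exp (- ?\<delta>) ^ m"
    by (simp add: prod.distrib)
  also have "(\<Prod>c\<in>{..<m}. if c \<in> Q then ?\<delta> else 1) = ?\<delta> ^ card ({..<m} \<inter> Q)"
    by (simp flip: prod.inter_restrict)
  also have "{..<m} \<inter> Q = {c. c < m \<and> c \<in> Q}" by auto
  also have "exp (- ?\<delta>) ^ m = exp (- T)" using m by (simp flip: exp_of_nat_mult)
  finally show "prob {\<omega> \<in> space P. \<forall>c<m. count i (?B c) \<omega> = of_bool (c \<in> Q)} =
      (T / real m) ^ card {c. c < m \<and> c \<in> Q} * exp (- T)" .
qed

text \<open>With \<open>\<mu> = measure lborel B\<close>, the complement has probability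
  \<open>(1 + \<mu>) * exp (- \<mu>)\<close>, and
  \<open>1 - \<mu> \<le> exp (- \<mu>)\<close>.\<close>

lemma prob_count_ge_2:
  assumes i: "i \<in> tree_verts" and B: "B \<in> sets borel" "B \<subseteq> {0..b}"
  shows "{\<omega> \<in> space P. 2 \<le> count i B \<omega>} \<in> sets (row_algebra i)"
    and "prob {\<omega> \<in> space P. 2 \<le> count i B \<omega>} \<le> (measure lborel B)\<^sup>2"
proof -
  let ?N = "count i B" and ?\<mu> = "measure lborel B"
  note [measurable] = B(1)
  have "{\<omega> \<in> space (row_algebra i). 2 \<le> ?N \<omega>} \<in> sets (row_algebra i)"
    by measurable
  then show ge: "{\<omega> \<in> space P. 2 \<le> ?N \<omega>} \<in> sets (row_algebra i)" by simp
  have N: "{\<omega> \<in> space P. ?N \<omega> = k} \<in> events" for k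
  proof -
    have "{\<omega> \<in> space (row_algebra i). ?N \<omega> = k} \<in> sets (row_algebra i)" by measurable
    then show ?thesis using row_sub[OF i] by auto
  qed
  have "{\<omega> \<in> space P. 2 \<le> ?N \<omega>} = space P - ({\<omega> \<in> space P. ?N \<omega> = 0} \<union> {\<omega> \<in> space P. ?N \<omega> = 1})" by auto
  then have "prob {\<omega> \<in> space P. 2 \<le> ?N \<omega>} = 1 - prob ({\<omega> \<in> space P. ?N \<omega> = 0} \<union> {\<omega> \<in> space P. ?N \<omega> = 1})"
    using N by (simp only:, intro prob_compl) auto
  also have "prob ({\<omega> \<in> space P. ?N \<omega> = 0} \<union> {\<omega> \<in> space P. ?N \<omega> = 1}) =
      prob {\<omega> \<in> space P. ?N \<omega> = 0} + prob {\<omega> \<in> space P. ?N \<omega> = 1}"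
    using N by (intro finite_measure_Union) auto
  also have "\<dots> = (1 + ?\<mu>) * exp (- ?\<mu>)"
    by (simp add: prob_count[OF i B] algebra_simps)
  finally have "prob {\<omega> \<in> space P. 2 \<le> ?N \<omega>} = 1 - (1 + ?\<mu>) * exp (- ?\<mu>)" .
  moreover have "(1 + ?\<mu>) * (1 - ?\<mu>) \<le> (1 + ?\<mu>) * exp (- ?\<mu>)"
    using exp_ge_add_one_self[of "- ?\<mu>"] by (intro mult_left_mono) auto
  ultimately show "prob {\<omega> \<in> space P. 2 \<le> ?N \<omega>} \<le> ?\<mu>\<^sup>2"
    by (simp add: algebra_simps power2_eq_square)
qed

lemma prob_d: "i \<in> tree_verts \<Longrightarrow> prob {\<omega> \<in> space P. d i \<omega> \<in> D} = measure (measure_pmf p) D"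
proof -
  assume i: "i \<in> tree_verts"
  have "distr P (count_space UNIV) (d i) = measure_pmf p"
    using input i by (auto simp: rdcp_input_pwit_def iid_constraints_def pwit_def)
  then have "measure (measure_pmf p) D = prob (d i -` D \<inter> space P)"
    using measure_distr[OF d_measurable[OF i], of D] by simp
  then show ?thesis by (simp add: vimage_def Int_def conj_commute)
qed

text \<open>Stated through counts at the vertices \<open>u @ rank_path S i\<close>, the event
  concerns finitely many vertices known in advance, although the child found in a given cell is
  random.\<close>

definition shape_event :: "real \<Rightarrow> nat \<Rightarrow> nat \<Rightarrow> nat list \<Rightarrow> nat list set \<Rightarrow> (nat list \<Rightarrow> nat) \<Rightarrow> 'q set" where
  "shape_event T m K u S D = {\<omega> \<in> space P. \<forall>i\<in>S. d (u @ rank_path S i) \<omega> = D i \<and>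
     (length i < K \<longrightarrow> (\<forall>c<m. count (u @ rank_path S i) (cell (T / real m) c) \<omega> = of_bool (i @ [c] \<in> S)))}"

text \<open>The roots in \<open>J\<close> are pairwise incomparable, so all vertices involved are
  distinct and independence gives a product. Each vertex contributes the probability of its
  constraint and, above depth \<open>K\<close>, that of its cell counts.\<close>

lemma prob_shape_events:
  assumes J: "finite J" "J \<subseteq> tree_verts" "\<And>u v. u \<in> J \<Longrightarrow> v \<in> J \<Longrightarrow> prefix u v \<Longrightarrow> u = v"
    and S: "\<And>u. u \<in> J \<Longrightarrow> cell_tree m K (S u)" and T: "0 \<le> T" and m: "0 < m"
  shows "{\<omega> \<in> space P. \<forall>u\<in>J. \<omega> \<in> shape_event T m K u (S u) (D u)} \<in> events"
    and "prob {\<omega> \<in> space P. \<forall>u\<in>J. \<omega> \<in> shape_event T m K u (S u) (D u)} =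
      (\<Prod>u\<in>J. shape_weight p T m K (S u) (D u))"
proof -
  let ?I = "Sigma J S"
  define v where "v = (\<lambda>q. fst q @ rank_path (S (fst q)) (snd q))"
  define A where "A = (\<lambda>q. {\<omega> \<in> space P. d (v q) \<omega> \<in> {D (fst q) (snd q)}} \<inter>
    (if length (snd q) < K then {\<omega> \<in> space P. \<forall>c<m. count (v q) (cell (T / real m) c) \<omega> = of_bool (c \<in> {c. snd q @ [c] \<in> S (fst q)})}
     else space P))"
  have fin: "finite (S u)" if "u \<in> J" for u using finite_cell_tree[OF S[OF that]] .
  have finI: "finite ?I" using J(1) fin by auto
  have vT: "v q \<in> tree_verts" if "q \<in> ?I" for q
  proof -
    have "fst q \<in> tree_verts" "rank_path (S (fst q)) (snd q) \<in> tree_verts"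
      using that J(2) rank_path_verts[OF S, of "fst q" "snd q"] by auto
    then show ?thesis unfolding v_def by simp
  qed
  have inj: "inj_on v ?I"
  proof (rule inj_onI)
    fix q q' assume q: "q \<in> ?I" "q' \<in> ?I" "v q = v q'"
    have "prefix (fst q) (v q)" "prefix (fst q') (v q')" unfolding v_def by simp_all
    then have "prefix (fst q) (fst q') \<or> prefix (fst q') (fst q)" using prefix_same_cases q(3) by metis
    then have eq: "fst q = fst q'" using J(3)[of "fst q" "fst q'"] J(3)[of "fst q'" "fst q"] q by auto
    then have "rank_path (S (fst q)) (snd q) = rank_path (S (fst q)) (snd q')" using q(3) unfolding v_def by simp
    then have "snd q = snd q'" using rank_path_inj[OF S[of "fst q"]] q eq by (auto dest: inj_onD)
    then show "q = q'" using eq by (simp add: prod_eq_iff)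
  qed
  have Aev: "A q \<in> vertex_events (v q)" if "q \<in> ?I" for q
    unfolding A_def
  proof (rule Int_vertex_events[OF d_vertex_events], cases "length (snd q) < K")
    case True
    then show "(if length (snd q) < K then {\<omega> \<in> space P. \<forall>c<m. count (v q) (cell (T / real m) c) \<omega> = of_bool (c \<in> {c. snd q @ [c] \<in> S (fst q)})}
     else space P) \<in> vertex_events (v q)"
      unfolding if_P[OF True] by (intro row_vertex_events prob_cells(1)[OF vT[OF that] T m])
  next
    case False
    then show "(if length (snd q) < K then {\<omega> \<in> space P. \<forall>c<m. count (v q) (cell (T / real m) c) \<omega> = of_bool (c \<in> {c. snd q @ [c] \<in> S (fst q)})}
     else space P) \<in> vertex_events (v q)"
      using row_vertex_events[of "space P" "v q"] sets.top[of "row_algebra (v q)"] by simp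
  qed
  let ?g = "inv_into ?I v"
  have eq: "{\<omega> \<in> space P. \<forall>u\<in>J. \<omega> \<in> shape_event T m K u (S u) (D u)} = {\<omega> \<in> space P. \<forall>x\<in>v ` ?I. \<omega> \<in> A (?g x)}"
  proof -
    have A_iff: "\<omega> \<in> A (u, i) \<longleftrightarrow> \<omega> \<in> space P \<and> d (u @ rank_path (S u) i) \<omega> = D u i \<and>
      (length i < K \<longrightarrow> (\<forall>c<m. count (u @ rank_path (S u) i) (cell (T / real m) c) \<omega> = of_bool (i @ [c] \<in> S u)))"
      for \<omega> u i
      unfolding A_def v_def by (cases "length i < K"; simp; blast)
    have "(\<forall>x\<in>v ` ?I. \<omega> \<in> A (?g x)) \<longleftrightarrow> (\<forall>u\<in>J. \<forall>i\<in>S u. \<omega> \<in> A (u, i))" for \<omega>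
      using inj by simp
    then show ?thesis unfolding shape_event_def A_iff by blast
  qed
  have Aev': "A (?g x) \<in> vertex_events x" if "x \<in> v ` ?I" for x
    using that Aev inj by auto
  have vI: "finite (v ` ?I)" "v ` ?I \<subseteq> tree_verts" using finI vT by auto
  show "{\<omega> \<in> space P. \<forall>u\<in>J. \<omega> \<in> shape_event T m K u (S u) (D u)} \<in> events"
    unfolding eq by (rule prob_vertex_events(1)[OF vI Aev'])
  have probA: "prob (A q) = pmf p (D (fst q) (snd q)) *
      (if length (snd q) < K then (T / real m) ^ card {c. c < m \<and> snd q @ [c] \<in> S (fst q)} * exp (- T) else 1)"
    if q: "q \<in> ?I" for q
  proof (cases "length (snd q) < K")
    case True
    define C where "C = {\<omega> \<in> space P. \<forall>c<m. count (v q) (cell (T / real m) c) \<omega> = of_bool (c \<in> {c. snd q @ [c] \<in> S (fst q)})}"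
    have C: "C \<in> sets (row_algebra (v q))" unfolding C_def by (rule prob_cells(1)[OF vT[OF q] T m])
    have "A q = {\<omega> \<in> space P. d (v q) \<omega> \<in> {D (fst q) (snd q)}} \<inter> C"
      unfolding A_def C_def if_P[OF True] by (rule refl)
    also have "\<dots> = {\<omega> \<in> space P. \<forall>i\<in>{v q}. d i \<omega> \<in> {D (fst q) (snd q)} \<and> \<omega> \<in> C}" by auto
    also have "prob \<dots> = prob {\<omega> \<in> space P. d (v q) \<omega> \<in> {D (fst q) (snd q)}} * prob C"
      using prob_d_row[of "{v q}" "\<lambda>_. C" "\<lambda>_. {D (fst q) (snd q)}"] C vT[OF q] by simp
    also have "prob C = (T / real m) ^ card {c. c < m \<and> snd q @ [c] \<in> S (fst q)} * exp (- T)"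
      unfolding C_def prob_cells(2)[OF vT[OF q] T m] by simp
    also have "prob {\<omega> \<in> space P. d (v q) \<omega> \<in> {D (fst q) (snd q)}} = pmf p (D (fst q) (snd q))"
      unfolding prob_d[OF vT[OF q]] by (simp add: pmf.rep_eq)
    finally show ?thesis using True by simp
  next
    case False
    then have "A q = {\<omega> \<in> space P. d (v q) \<omega> \<in> {D (fst q) (snd q)}}" unfolding A_def by auto
    then show ?thesis using False prob_d[OF vT[OF q], of "{D (fst q) (snd q)}"] by (simp add: pmf.rep_eq)
  qed
  have "prob {\<omega> \<in> space P. \<forall>x\<in>v ` ?I. \<omega> \<in> A (?g x)} = (\<Prod>x\<in>v ` ?I. prob (A (?g x)))"
    by (rule prob_vertex_events(2)[OF vI Aev'])
  also have "\<dots> = (\<Prod>q\<in>?I. prob (A q))" using inj by (simp add: prod.reindex)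
  also have "\<dots> = (\<Prod>u\<in>J. \<Prod>i\<in>S u. prob (A (u, i)))" using J(1) fin by (simp add: prod.Sigma)
  also have "\<dots> = (\<Prod>u\<in>J. shape_weight p T m K (S u) (D u))"
  proof (rule prod.cong[OF refl])
    fix u assume u: "u \<in> J"
    let ?In = "{i \<in> S u. length i < K}" and ?ch = "\<lambda>i. card {c. c < m \<and> i @ [c] \<in> S u}"
    have "(\<Prod>i\<in>S u. prob (A (u, i))) =
        (\<Prod>i\<in>S u. pmf p (D u i)) * (\<Prod>i\<in>S u. if length i < K then (T / real m) ^ ?ch i * exp (- T) else 1)"
    proof -
      have "prob (A (u, i)) = pmf p (D u i) * (if length i < K then (T / real m) ^ ?ch i * exp (- T) else 1)"
        if "i \<in> S u" for i
        using probA[of "(u, i)"] u that by (simp only: fst_conv snd_conv mem_Sigma_iff simp_thms)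
      then show ?thesis unfolding prod.distrib[symmetric] by (rule prod.cong[OF refl])
    qed
    also have "(\<Prod>i\<in>S u. if length i < K then (T / real m) ^ ?ch i * exp (- T) else 1) = (\<Prod>i\<in>?In. (T / real m) ^ ?ch i * exp (- T))"
      using fin[OF u] by (simp add: prod.inter_filter)
    also have "\<dots> = (T / real m) ^ (\<Sum>i\<in>?In. ?ch i) * exp (- T) ^ card ?In"
      by (simp add: prod.distrib power_sum)
    also have "(\<Sum>i\<in>?In. ?ch i) = card (S u) - 1" by (rule sum_children[OF S[OF u]])
    also have "exp (- T) ^ card ?In = exp (- (T * real (card ?In)))"
      by (simp flip: exp_of_nat_mult add: mult.commute)
    finally show "(\<Prod>i\<in>S u. prob (A (u, i))) = shape_weight p T m K (S u) (D u)"
      by (simp add: shape_weight_def)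
  qed
  finally show "prob {\<omega> \<in> space P. \<forall>u\<in>J. \<omega> \<in> shape_event T m K u (S u) (D u)} =
      (\<Prod>u\<in>J. shape_weight p T m K (S u) (D u))"
    unfolding eq .
qed

lemma prob_shape_event:
  assumes "u \<in> tree_verts" "cell_tree m K S" "0 \<le> T" "0 < m"
  shows "shape_event T m K u S D \<in> events"
    and "prob (shape_event T m K u S D) = shape_weight p T m K S D"
proof -
  have "{\<omega> \<in> space P. \<forall>u'\<in>{u}. \<omega> \<in> shape_event T m K u' S D} = shape_event T m K u S D"
    by (auto simp: shape_event_def)
  then show "shape_event T m K u S D \<in> events" "prob (shape_event T m K u S D) = shape_weight p T m K S D"
    using prob_shape_events[of "{u}" m K "\<lambda>_. S" T "\<lambda>_. D"] assms by auto
qed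

text \<open>Equal ranks so far mean that both trees inspect the same vertex, whose counts and
  constraint then give both trees the same children and the same value.\<close>

lemma shape_event_unique:
  assumes "cell_tree m K S" "cell_tree m K S'" "\<omega> \<in> shape_event T m K u S D" "\<omega> \<in> shape_event T m K u S' D'"
  shows "S = S'" "\<And>i. i \<in> S \<Longrightarrow> D i = D' i"
proof -
  have sub: "i \<in> S' \<and> rank_path S i = rank_path S' i"
    if "i \<in> S" "cell_tree m K S" "cell_tree m K S'"
      "\<omega> \<in> shape_event T m K u S D" "\<omega> \<in> shape_event T m K u S' D'" for S S' D D' i
    using that(1)
  proof (induction i rule: rev_induct)
    case Nil
    then show ?case using that(3) by (simp add: cell_tree_def)
  next
    case (snoc c i)
    have i: "i \<in> S" using cell_tree_butlast[OF that(2)] snoc by (metis butlast_snoc snoc_eq_iff_butlast)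
    then have i': "i \<in> S'" "rank_path S i = rank_path S' i" using snoc.IH by auto
    have "length (i @ [c]) \<le> K" using that(2) snoc.prems unfolding cell_tree_def by blast
    then have "length i < K" by simp
    then have eq: "i @ [c'] \<in> S \<longleftrightarrow> i @ [c'] \<in> S'" if "c' < m" for c'
      using that \<open>\<omega> \<in> shape_event T m K u S D\<close> \<open>\<omega> \<in> shape_event T m K u S' D'\<close> i i'
      unfolding shape_event_def by (fastforce simp: of_bool_def split: if_splits)
    have lt: "c' < m" if "i @ [c'] \<in> S \<or> i @ [c'] \<in> S'" for c'
      using that cell_tree_last[OF \<open>cell_tree m K S\<close>, of "i @ [c']"] cell_tree_last[OF \<open>cell_tree m K S'\<close>, of "i @ [c']"]
      by auto
    have "i @ [c'] \<in> S \<longleftrightarrow> i @ [c'] \<in> S'" for c' using eq lt by blast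
    then show ?case using snoc.prems i' by simp
  qed
  show "S = S'" using sub[OF _ assms] sub[OF _ assms(2,1,4,3)] by blast
  fix i assume i: "i \<in> S"
  then have "i \<in> S'" "rank_path S i = rank_path S' i" using sub[OF _ assms] by auto
  then show "D i = D' i" using assms(3,4) i unfolding shape_event_def by force
qed

definition some_shape :: "real \<Rightarrow> nat \<Rightarrow> nat \<Rightarrow> nat list \<Rightarrow> (nat list set \<times> (nat list \<Rightarrow> nat)) set \<Rightarrow> 'q set" where
  "some_shape T m K u F = (\<Union>(S, D)\<in>F. shape_event T m K u S D)"

lemma prob_some_shape:
  assumes u: "u \<in> tree_verts" and F: "finite F" "F \<subseteq> shapes m K" and T: "0 \<le> T" "0 < m"
  shows "some_shape T m K u F \<in> events" "prob (some_shape T m K u F) = weight_sum p T m K F"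
proof -
  have S: "cell_tree m K (fst s)" if "s \<in> F" for s using that F by (auto simp: shapes_def)
  have ev: "shape_event T m K u (fst s) (snd s) \<in> events" if "s \<in> F" for s
    using prob_shape_event(1)[OF u S[OF that] T] .
  have eq: "some_shape T m K u F = (\<Union>s\<in>F. shape_event T m K u (fst s) (snd s))"
    unfolding some_shape_def by auto
  show "some_shape T m K u F \<in> events" unfolding eq using ev F(1) by blast
  have "disjoint_family_on (\<lambda>s. shape_event T m K u (fst s) (snd s)) F"
    unfolding disjoint_family_on_def
  proof (intro ballI impI, rule ccontr)
    fix s s' assume s: "s \<in> F" "s' \<in> F" "s \<noteq> s'"
      and "shape_event T m K u (fst s) (snd s) \<inter> shape_event T m K u (fst s') (snd s') \<noteq> {}"
    then obtain \<omega> where \<omega>: "\<omega> \<in> shape_event T m K u (fst s) (snd s)" "\<omega> \<in> shape_event T m K u (fst s') (snd s')" by blast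
    note un = shape_event_unique[OF S[OF s(1)] S[OF s(2)] \<omega>]
    have "snd s \<in> extensional (fst s)" "snd s' \<in> extensional (fst s')" using s F by (auto simp: shapes_def)
    then have "snd s = snd s'" using un by (metis extensionalityI)
    then show False using un(1) s(3) by (simp add: prod_eq_iff)
  qed
  then have "prob (some_shape T m K u F) = (\<Sum>s\<in>F. prob (shape_event T m K u (fst s) (snd s)))"
    unfolding eq using ev F(1) by (intro finite_measure_finite_Union) auto
  also have "\<dots> = weight_sum p T m K F"
    unfolding weight_sum_def case_prod_beta using prob_shape_event(2)[OF u S T] by simp
  finally show "prob (some_shape T m K u F) = weight_sum p T m K F" .
qed

end

section \<open>Bad events and the existence of a good shape\<close>

lemma card_strictly_decreasing_le:
  "finite {cs. length cs = L \<and> set cs \<subseteq> {..<m::nat} \<and> sorted_wrt (>) cs}"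
  "card {cs. length cs = L \<and> set cs \<subseteq> {..<m::nat} \<and> sorted_wrt (>) cs} \<le> m choose L"
proof -
  let ?D = "{cs. length cs = L \<and> set cs \<subseteq> {..<m} \<and> sorted_wrt (>) cs}"
  show "finite ?D" by (rule finite_subset[OF _ finite_lists_length_eq[of "{..<m}" L]]) auto
  have dist: "distinct cs" if "sorted_wrt (>) cs" for cs :: "nat list"
    using that by (induction cs) auto
  have "inj_on set ?D"
  proof (rule inj_onI)
    fix xs ys assume "xs \<in> ?D" "ys \<in> ?D" "set xs = set ys"
    then have s: "sorted_wrt (<) (rev xs)" "sorted_wrt (<) (rev ys)" "set (rev xs) = set (rev ys)"
      by (auto simp: sorted_wrt_rev)
    then have "rev xs = rev ys"
      using strict_sorted_equal by blast
    then show "xs = ys" by simp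
  qed
  moreover have "set ` ?D \<subseteq> {A. A \<subseteq> {..<m} \<and> card A = L}"
    using dist by (auto simp: distinct_card)
  ultimately have "card ?D \<le> card {A. A \<subseteq> {..<m} \<and> card A = L}"
    by (intro card_inj_on_le) auto
  also have "\<dots> = m choose L" by (simp add: n_subsets)
  finally show "card ?D \<le> m choose L" .
qed

text \<open>The bound is uniform in \<open>m\<close>, so the length of decreasing paths can be fixed
  before the cells are refined.\<close>

lemma choose_times_power_le:
  assumes "0 \<le> T" "0 < m"
  shows "real (m choose L) * (T / real m) ^ L \<le> T ^ L / fact L"
proof -
  have "(m choose L) * fact L \<le> m ^ L" by (rule binomial_fact_pow)
  then have "real (m choose L) * fact L \<le> real m ^ L"
    by (metis of_nat_fact of_nat_le_iff of_nat_mult of_nat_power)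
  then have "real (m choose L) \<le> real m ^ L / fact L" by (simp add: field_simps)
  then have "real (m choose L) * (T / real m) ^ L \<le> real m ^ L / fact L * (T / real m) ^ L"
    using assms by (intro mult_right_mono) auto
  also have "\<dots> = T ^ L / fact L" using assms by (simp add: power_divide)
  finally show ?thesis .
qed

context pwit_process
begin

definition occupied :: "real \<Rightarrow> nat \<Rightarrow> 'q \<Rightarrow> nat list \<Rightarrow> nat \<Rightarrow> bool" where
  "occupied T m \<omega> v c \<longleftrightarrow> (\<exists>j\<ge>1. X {v, v @ [j]} \<omega> \<in> cell (T / real m) c)"

lemma finite_cell_points:
  assumes "regular \<omega>" "v \<in> tree_verts" "c < m" "0 \<le> T"
  shows "finite {j. 1 \<le> j \<and> X {v, v @ [j]} \<omega> \<in> cell (T / real m) c}"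
  by (rule finite_subset[OF _ regular_finite[OF assms(1,2), of T]]) (use cell_le assms(3,4) in auto)

lemma count_occupied:
  assumes "regular \<omega>" "v \<in> tree_verts" "c < m" "0 \<le> T" "count v (cell (T / real m) c) \<omega> \<le> 1"
  shows "count v (cell (T / real m) c) \<omega> = of_bool (occupied T m \<omega> v c)"
  using assms(5) finite_cell_points[OF assms(1-4)] unfolding num_points_def occupied_def
  by (auto simp: le_Suc_eq)

lemma cell_point_unique:
  assumes "regular \<omega>" "v \<in> tree_verts" "c < m" "0 \<le> T" "count v (cell (T / real m) c) \<omega> \<le> 1"
    and "1 \<le> j" "X {v, v @ [j]} \<omega> \<in> cell (T / real m) c" "1 \<le> k" "X {v, v @ [k]} \<omega> \<in> cell (T / real m) c"
  shows "j = k"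
proof -
  let ?J = "{j. 1 \<le> j \<and> X {v, v @ [j]} \<omega> \<in> cell (T / real m) c}"
  have "card ?J \<le> 1" using assms(5) unfolding num_points_def .
  then show ?thesis using card_le_Suc0_iff_eq[OF finite_cell_points[OF assms(1-4)]] assms(6-) by auto
qed

text \<open>Labels increase with the number of the child, and every cell holds at most one of them.
  So the children up to \<open>j\<close> correspond to the occupied cells up to
  \<open>c\<close>.\<close>

lemma cell_point_rank:
  assumes reg: "regular \<omega>" and v: "v \<in> tree_verts" and T: "0 \<le> T" and m: "0 < m"
    and cnt: "\<And>c. c < m \<Longrightarrow> count v (cell (T / real m) c) \<omega> \<le> 1"
    and c: "c < m" and j: "1 \<le> j" "X {v, v @ [j]} \<omega> \<in> cell (T / real m) c"
  shows "j = card {c'. c' \<le> c \<and> occupied T m \<omega> v c'}"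
proof -
  let ?x = "\<lambda>j. X {v, v @ [j]} \<omega>" and ?Q = "{c'. c' \<le> c \<and> occupied T m \<omega> v c'}"
  define cl where "cl = (\<lambda>k. THE c'. ?x k \<in> cell (T / real m) c')"
  have cl: "cl k = c'" if "?x k \<in> cell (T / real m) c'" for k c'
    unfolding cl_def using that cell_unique[of "?x k" "T / real m"] T by (intro the_equality) auto
  have ex: "\<exists>c'\<le>c. ?x k \<in> cell (T / real m) c'" if k: "1 \<le> k" "k \<le> j" for k
  proof -
    have le: "?x k \<le> ?x j" using regular_less[OF reg v k(1), of j] k by (cases "k = j") auto
    also have "\<dots> \<le> T" using cell_le[OF j(2) c T] .
    finally obtain c' where c': "c' < m" "?x k \<in> cell (T / real m) c'"
      using in_some_cell[of "?x k" T m] regular_nonneg[OF reg v k(1)] m by blast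
    have "\<not> c < c'" using cell_less[OF j(2) c'(2)] le T by fastforce
    then show ?thesis using c'(2) by (intro exI[of _ c']) simp
  qed
  have "bij_betw cl {1..j} ?Q"
    unfolding bij_betw_def
  proof
    show "inj_on cl {1..j}"
    proof (rule inj_onI)
      fix k l assume kl: "k \<in> {1..j}" "l \<in> {1..j}" "cl k = cl l"
      then obtain a b where a: "a \<le> c" "?x k \<in> cell (T / real m) a" and b: "b \<le> c" "?x l \<in> cell (T / real m) b"
        using ex by (metis atLeastAtMost_iff)
      then have "a = b" using cl kl(3) by metis
      then show "k = l"
        using cell_point_unique[OF reg v _ T cnt, of a k l] a b c kl by auto
    qed
    show "cl ` {1..j} = ?Q"
    proof (intro equalityI subsetI)
      fix a assume "a \<in> cl ` {1..j}"
      then obtain k where k: "1 \<le> k" "k \<le> j" "a = cl k" by auto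
      from ex[OF k(1,2)] obtain c' where "c' \<le> c" "?x k \<in> cell (T / real m) c'" by blast
      then show "a \<in> ?Q" using k cl unfolding occupied_def by auto
    next
      fix a assume "a \<in> ?Q"
      then obtain k where a: "a \<le> c" and k: "1 \<le> k" "?x k \<in> cell (T / real m) a"
        unfolding occupied_def by blast
      have "k \<le> j"
      proof (cases "a = c")
        case True
        then show ?thesis using cell_point_unique[OF reg v c T cnt[OF c] k(1) _ j] k by simp
      next
        case False
        then have "?x k < ?x j" using cell_less[OF k(2) j(2)] a T by simp
        then show ?thesis using regular_less_iff[OF reg v k(1) j(1)] by simp
      qed
      then show "a \<in> cl ` {1..j}" using cl[OF k(2)] k by force
    qed
  qed
  then show ?thesis using bij_betw_same_card by fastforce
qed

lemma below_edges:
  assumes "e \<in> below u" "u @ i \<in> e"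
  shows "(\<exists>j\<ge>1. e = {u @ i, u @ i @ [j]}) \<or> (i \<noteq> [] \<and> e = {u @ butlast i, u @ i})"
  using assms by (auto simp: below_def)

text \<open>The counts tell which cells below a vertex are occupied, each by a single child, whose
  number is then the rank of its cell. Exploring only the subtree makes this applicable at every
  vertex \<open>u\<close>.\<close>

lemma shape_event_explored:
  assumes reg: "regular \<omega>" and u: "u \<in> tree_verts" and S: "cell_tree m K S" and T: "0 \<le> T" and m: "0 < m"
    and \<omega>: "\<omega> \<in> shape_event T m K u S D"
  shows "explored T m K (below u) (\<lambda>v. d v \<omega>) (\<lambda>e. X e \<omega>) u S D (\<lambda>i. u @ rank_path S i)"
  unfolding explored_def
proof (intro conjI ballI impI)
  have vT: "u @ rank_path S i \<in> tree_verts" if "i \<in> S" for i using u rank_path_verts[OF S that] by simp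
  have cnt: "count (u @ rank_path S i) (cell (T / real m) c) \<omega> = of_bool (i @ [c] \<in> S)"
    if "i \<in> S" "length i < K" "c < m" for i c
    using \<omega> that unfolding shape_event_def by blast
  have cnt1: "count (u @ rank_path S i) (cell (T / real m) c) \<omega> \<le> 1"
    if "i \<in> S" "length i < K" "c < m" for i c
    using cnt[OF that] by simp
  have occ: "occupied T m \<omega> (u @ rank_path S i) c \<longleftrightarrow> i @ [c] \<in> S"
    if "i \<in> S" "length i < K" "c < m" for i c
    using count_occupied[OF reg vT[OF that(1)] that(3) T cnt1[OF that]] unfolding cnt[OF that]
    by (simp only: of_bool_eq_iff)
  have lt: "c < m" if "i @ [c] \<in> S" for i c using cell_tree_last[OF S that] by simp
  have rank: "j = card {c'. c' \<le> c \<and> i @ [c'] \<in> S}"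
    if i: "i \<in> S" "length i < K" and c: "c < m"
      and j: "1 \<le> j" "X {u @ rank_path S i, (u @ rank_path S i) @ [j]} \<omega> \<in> cell (T / real m) c" for i j c
  proof -
    have "j = card {c'. c' \<le> c \<and> occupied T m \<omega> (u @ rank_path S i) c'}"
      by (rule cell_point_rank[OF reg vT[OF i(1)] T m _ c j]) (use cnt1 i in auto)
    also have "{c'. c' \<le> c \<and> occupied T m \<omega> (u @ rank_path S i) c'} = {c'. c' \<le> c \<and> i @ [c'] \<in> S}"
      using occ[OF i] c by auto
    finally show ?thesis .
  qed
  show "u @ rank_path S [] = u" by simp
  show "inj_on (\<lambda>i. u @ rank_path S i) S" using rank_path_inj[OF S] by (auto simp: inj_on_def)
  show "d (u @ rank_path S i) \<omega> = D i" if "i \<in> S" for i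
    using \<omega> that unfolding shape_event_def by blast
  show "{u @ rank_path S (butlast i), u @ rank_path S i} \<in> below u" if i: "i \<in> S - {[]}" for i
  proof -
    obtain k c where k: "i = k @ [c]" using i by (cases i rule: rev_cases) auto
    have "rank_path S i \<in> tree_verts" using rank_path_verts[OF S, of i] i by blast
    then show ?thesis using k by (auto simp: below_def)
  qed
  show "X {u @ rank_path S (butlast i), u @ rank_path S i} \<omega> \<in> cell (T / real m) (last i)" if i: "i \<in> S - {[]}" for i
  proof -
    obtain k c where k: "i = k @ [c]" using i by (cases i rule: rev_cases) auto
    have kS: "k \<in> S" using cell_tree_butlast[OF S, of i] i k by simp
    have "length i \<le> K" using S i unfolding cell_tree_def by blast
    then have kK: "length k < K" using k by simp
    have c: "c < m" using lt i k by blast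
    have "occupied T m \<omega> (u @ rank_path S k) c" using occ[OF kS kK c] i k by simp
    then obtain j where j: "1 \<le> j" "X {u @ rank_path S k, (u @ rank_path S k) @ [j]} \<omega> \<in> cell (T / real m) c"
      unfolding occupied_def by blast
    then show ?thesis using rank[OF kS kK c j] k by simp
  qed
  fix i e assume i: "i \<in> S" "length i < K" and e: "e \<in> below u" "u @ rank_path S i \<in> e" "X e \<omega> \<le> T"
  show "\<exists>j\<in>S - {[]}. e = {u @ rank_path S (butlast j), u @ rank_path S j}"
    using below_edges[OF e(1,2)]
  proof
    assume "\<exists>j\<ge>1. e = {u @ rank_path S i, u @ rank_path S i @ [j]}"
    then obtain j where j: "1 \<le> j" "e = {u @ rank_path S i, u @ rank_path S i @ [j]}" by blast
    let ?v = "u @ rank_path S i"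
    have ev: "e = {?v, ?v @ [j]}" using j by simp
    have "0 \<le> X e \<omega>" unfolding ev by (rule regular_nonneg[OF reg vT[OF i(1)] j(1)])
    then obtain c where c: "c < m" "X e \<omega> \<in> cell (T / real m) c"
      using in_some_cell[OF _ e(3) m] by blast
    then have "j = card {c'. c' \<le> c \<and> i @ [c'] \<in> S}" using rank[OF i c(1) j(1)] ev by simp
    moreover have "i @ [c] \<in> S" using occ[OF i c(1)] c j ev unfolding occupied_def by auto
    ultimately show ?thesis using j by (intro bexI[of _ "i @ [c]"]) auto
  next
    assume *: "rank_path S i \<noteq> [] \<and> e = {u @ butlast (rank_path S i), u @ rank_path S i}"
    then have "i \<noteq> []" by auto
    then obtain k c where "i = k @ [c]" using \<open>i \<noteq> []\<close> by (cases i rule: rev_cases) auto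
    then show ?thesis using * i by (intro bexI[of _ i]) auto
  qed
qed

text \<open>This and the next three events are what can prevent a good shape with bounded
  constraints: two points of a vertex in one cell, consecutive edges of a path in one cell, a long
  decreasing path, a large constraint. Each is expressed by paths with labels in
  \<open>[0,T]\<close>, to which the first moment bound applies.\<close>

definition crowded :: "real \<Rightarrow> nat \<Rightarrow> nat list \<Rightarrow> nat \<Rightarrow> 'q set" where
  "crowded T m u K = (\<Union>l<K. \<Union>c<m. path_event u (replicate l {0..T}) (\<lambda>v. {\<omega> \<in> space P. 2 \<le> count v (cell (T / real m) c) \<omega>}))"

definition tied :: "real \<Rightarrow> nat \<Rightarrow> nat list \<Rightarrow> nat \<Rightarrow> 'q set" where
  "tied T m u K = (\<Union>l<K. \<Union>c<m. path_event u (replicate l {0..T} @ [cell (T / real m) c, cell (T / real m) c]) (\<lambda>_. space P))"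

definition decreasing :: "real \<Rightarrow> nat \<Rightarrow> nat list \<Rightarrow> nat \<Rightarrow> nat \<Rightarrow> 'q set" where
  "decreasing T m u R L = (\<Union>cs\<in>{cs. length cs = L \<and> set cs \<subseteq> {..<m} \<and> sorted_wrt (>) cs}.
     path_event u (replicate R {0..T} @ map (cell (T / real m)) cs) (\<lambda>_. space P))"

definition large_constraint :: "real \<Rightarrow> nat \<Rightarrow> nat list \<Rightarrow> nat \<Rightarrow> 'q set" where
  "large_constraint T b u K = (\<Union>l\<le>K. path_event u (replicate l {0..T}) (\<lambda>v. {\<omega> \<in> space P. d v \<omega> \<in> {b<..}}))"

lemma space_vertex_event: "space P \<in> vertex_events v \<and> prob (space P) \<le> 1"
  using row_vertex_events[of "space P" v] sets.top[of "row_algebra v"] by simp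

lemma prod_list_replicate: "prod_list (replicate n (a::real)) = a ^ n"
  by (induction n) auto

text \<open>At a given vertex each of the \<open>m\<close> cells is crowded with probability at most
  \<open>(T / m)\<^sup>2\<close>, and the expected number of vertices reached in \<open>l\<close>
  steps is \<open>T ^ l\<close>. The total vanishes as \<open>m\<close> grows. The computation for
  \<open>tied\<close> is the same.\<close>

lemma prob_crowded:
  assumes u: "u \<in> tree_verts" and T: "0 \<le> T" and m: "0 < m"
  shows "crowded T m u K \<in> events" "prob (crowded T m u K) \<le> (\<Sum>l<K. T ^ (l + 2)) / m"
proof -
  let ?A = "\<lambda>l c. path_event u (replicate l {0..T}) (\<lambda>v. {\<omega> \<in> space P. 2 \<le> count v (cell (T / real m) c) \<omega>})"
  have A: "?A l c \<in> events \<and> prob (?A l c) \<le> T ^ l * (T / m)\<^sup>2" if c: "c < m" for l c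
  proof -
    have *: "{\<omega> \<in> space P. 2 \<le> count v (cell (T / real m) c) \<omega>} \<in> vertex_events v \<and>
        prob {\<omega> \<in> space P. 2 \<le> count v (cell (T / real m) c) \<omega>} \<le> (T / m)\<^sup>2" if "v \<in> tree_verts" for v
      using prob_count_ge_2[OF that cell_borel cell_sub[OF T c]] T row_vertex_events by (simp add: measure_cell)
    have "?A l c \<in> events" by (rule prob_path_event_le(1)[OF u _ *, where b = T]) auto
    moreover have "prob (?A l c) \<le> prod_list (map (measure lborel) (replicate l {0..T})) * (T / m)\<^sup>2"
      by (rule prob_path_event_le(2)[OF u _ *, where b = T]) auto
    ultimately show ?thesis using T by (simp add: prod_list_replicate)
  qed
  show "crowded T m u K \<in> events" unfolding crowded_def using A by auto
  have "prob (crowded T m u K) \<le> (\<Sum>l<K. prob (\<Union>c<m. ?A l c))"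
    unfolding crowded_def using A by (intro finite_measure_subadditive_finite) auto
  also have "\<dots> \<le> (\<Sum>l<K. \<Sum>c<m. prob (?A l c))"
    using A by (intro sum_mono finite_measure_subadditive_finite) auto
  also have "\<dots> \<le> (\<Sum>l<K. \<Sum>c<m. T ^ l * (T / m)\<^sup>2)"
    using A by (intro sum_mono) auto
  also have "\<dots> = (\<Sum>l<K. T ^ (l + 2)) / m"
    using m by (simp add: sum_divide_distrib power2_eq_square field_simps)
  finally show "prob (crowded T m u K) \<le> (\<Sum>l<K. T ^ (l + 2)) / m" .
qed

lemma prob_tied:
  assumes u: "u \<in> tree_verts" and T: "0 \<le> T" and m: "0 < m"
  shows "tied T m u K \<in> events" "prob (tied T m u K) \<le> (\<Sum>l<K. T ^ (l + 2)) / m"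
proof -
  let ?A = "\<lambda>l c. path_event u (replicate l {0..T} @ [cell (T / real m) c, cell (T / real m) c]) (\<lambda>_. space P)"
  have A: "?A l c \<in> events \<and> prob (?A l c) \<le> T ^ l * (T / m)\<^sup>2" if c: "c < m" for l c
  proof -
    have B: "B \<in> sets borel \<and> B \<subseteq> {0..T}" if "B \<in> set (replicate l {0..T} @ [cell (T / real m) c, cell (T / real m) c])" for B
      using that cell_sub[OF T c] by (auto split: if_splits)
    have "?A l c \<in> events" by (rule prob_path_event_le(1)[OF u B space_vertex_event]) auto
    moreover have "prob (?A l c) \<le>
        prod_list (map (measure lborel) (replicate l {0..T} @ [cell (T / real m) c, cell (T / real m) c])) * 1"
      by (rule prob_path_event_le(2)[OF u B space_vertex_event]) auto
    ultimately show ?thesis using T by (simp add: prod_list_replicate measure_cell power2_eq_square)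
  qed
  show "tied T m u K \<in> events" unfolding tied_def using A by auto
  have "prob (tied T m u K) \<le> (\<Sum>l<K. prob (\<Union>c<m. ?A l c))"
    unfolding tied_def using A by (intro finite_measure_subadditive_finite) auto
  also have "\<dots> \<le> (\<Sum>l<K. \<Sum>c<m. prob (?A l c))"
    using A by (intro sum_mono finite_measure_subadditive_finite) auto
  also have "\<dots> \<le> (\<Sum>l<K. \<Sum>c<m. T ^ l * (T / m)\<^sup>2)"
    using A by (intro sum_mono) auto
  also have "\<dots> = (\<Sum>l<K. T ^ (l + 2)) / m"
    using m by (simp add: sum_divide_distrib power2_eq_square field_simps)
  finally show "prob (tied T m u K) \<le> (\<Sum>l<K. T ^ (l + 2)) / m" .
qed

text \<open>There are at most \<open>m choose L\<close> decreasing sequences of cells, each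
  contributing \<open>(T / m) ^ L\<close>; this is where the factorial comes from.\<close>

lemma prob_decreasing:
  assumes u: "u \<in> tree_verts" and T: "0 \<le> T" and m: "0 < m"
  shows "decreasing T m u R L \<in> events" "prob (decreasing T m u R L) \<le> T ^ R * (T ^ L / fact L)"
proof -
  let ?D = "{cs. length cs = L \<and> set cs \<subseteq> {..<m} \<and> sorted_wrt (>) cs}"
  let ?A = "\<lambda>cs. path_event u (replicate R {0..T} @ map (cell (T / real m)) cs) (\<lambda>_. space P)"
  have A: "?A cs \<in> events \<and> prob (?A cs) \<le> T ^ R * (T / m) ^ L" if cs: "cs \<in> ?D" for cs
  proof -
    have B: "B \<in> sets borel \<and> B \<subseteq> {0..T}" if "B \<in> set (replicate R {0..T} @ map (cell (T / real m)) cs)" for B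
      using that cell_sub[OF T] cs by (auto split: if_splits)
    have "?A cs \<in> events" by (rule prob_path_event_le(1)[OF u B space_vertex_event]) auto
    moreover have "prob (?A cs) \<le>
        prod_list (map (measure lborel) (replicate R {0..T} @ map (cell (T / real m)) cs)) * 1"
      by (rule prob_path_event_le(2)[OF u B space_vertex_event]) auto
    moreover have "map (measure lborel) (map (cell (T / real m)) cs) = replicate L (T / m)"
    proof -
      have "map (measure lborel) (map (cell (T / real m)) cs) = map (\<lambda>_. T / m) cs"
        using T by (simp add: measure_cell)
      then show ?thesis using cs by (simp add: map_replicate_const)
    qed
    ultimately show ?thesis using T by (simp add: prod_list_replicate del: map_map)
  qed
  have fin: "finite ?D" by (rule card_strictly_decreasing_le)
  show "decreasing T m u R L \<in> events" unfolding decreasing_def using A fin by (intro sets.finite_UN) auto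
  have "prob (decreasing T m u R L) \<le> (\<Sum>cs\<in>?D. prob (?A cs))"
    unfolding decreasing_def using A fin by (intro finite_measure_subadditive_finite) auto
  also have "\<dots> \<le> (\<Sum>cs\<in>?D. T ^ R * (T / m) ^ L)"
    using A by (intro sum_mono) blast
  also have "\<dots> = T ^ R * (real (card ?D) * (T / m) ^ L)" by simp
  also have "\<dots> \<le> T ^ R * (real (m choose L) * (T / m) ^ L)"
    using card_strictly_decreasing_le(2)[of L m] T by (intro mult_left_mono mult_right_mono) auto
  also have "\<dots> \<le> T ^ R * (T ^ L / fact L)"
    using choose_times_power_le[OF T m, of L] T by (intro mult_left_mono) auto
  finally show "prob (decreasing T m u R L) \<le> T ^ R * (T ^ L / fact L)" .
qed

lemma prob_large_constraint:
  assumes u: "u \<in> tree_verts" and T: "0 \<le> T"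
  shows "large_constraint T b u K \<in> events"
    "prob (large_constraint T b u K) \<le> (\<Sum>l\<le>K. T ^ l) * measure (measure_pmf p) {b<..}"
proof -
  let ?A = "\<lambda>l. path_event u (replicate l {0..T}) (\<lambda>v. {\<omega> \<in> space P. d v \<omega> \<in> {b<..}})"
  have A: "?A l \<in> events \<and> prob (?A l) \<le> T ^ l * measure (measure_pmf p) {b<..}" for l
  proof -
    have *: "{\<omega> \<in> space P. d v \<omega> \<in> {b<..}} \<in> vertex_events v \<and>
        prob {\<omega> \<in> space P. d v \<omega> \<in> {b<..}} \<le> measure (measure_pmf p) {b<..}" if "v \<in> tree_verts" for v
      using prob_d[OF that, of "{b<..}"] d_vertex_events[of v "{b<..}"] by simp
    have "?A l \<in> events" by (rule prob_path_event_le(1)[OF u _ *, where b = T]) auto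
    moreover have "prob (?A l) \<le> prod_list (map (measure lborel) (replicate l {0..T})) * measure (measure_pmf p) {b<..}"
      by (rule prob_path_event_le(2)[OF u _ *, where b = T]) auto
    ultimately show ?thesis using T by (simp add: prod_list_replicate)
  qed
  show "large_constraint T b u K \<in> events" unfolding large_constraint_def using A by auto
  have "prob (large_constraint T b u K) \<le> (\<Sum>l\<le>K. prob (?A l))"
    unfolding large_constraint_def using A by (intro finite_measure_subadditive_finite) auto
  also have "\<dots> \<le> (\<Sum>l\<le>K. T ^ l * measure (measure_pmf p) {b<..})"
    using A by (intro sum_mono) auto
  finally show "prob (large_constraint T b u K) \<le> (\<Sum>l\<le>K. T ^ l) * measure (measure_pmf p) {b<..}"
    by (simp add: sum_distrib_right)
qed

text \<open>The shape is read off from \<omega>: \<open>S\<close> consists of the cell sequences of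
  all paths of length at most \<open>K\<close> with labels in \<open>[0,T]\<close>. Outside
  \<open>crowded\<close> a cell sequence determines its path. Avoiding the other three events gives
  the clauses of \<open>good_tree\<close> and the bound \<open>b\<close>.\<close>

lemma shape_exists:
  assumes \<omega>: "\<omega> \<in> space P" "regular \<omega>" and u: "u \<in> tree_verts" and T: "0 \<le> T" and m: "0 < m" and R: "R < K"
    and good: "\<omega> \<notin> crowded T m u K" "\<omega> \<notin> tied T m u K" "\<omega> \<notin> decreasing T m u R (K - R)"
      "\<omega> \<notin> large_constraint T b u K"
  shows "\<exists>S D. cell_tree m K S \<and> good_tree R K S \<and> D \<in> S \<rightarrow>\<^sub>E {..b} \<and> \<omega> \<in> shape_event T m K u S D"
proof -
  let ?cell = "cell (T / real m)"
  define pth where "pth = (\<lambda>js cs. js \<in> tree_verts \<and> list_all2 (\<lambda>x c. x \<in> ?cell c) (path_times (\<lambda>e. X e \<omega>) u js) cs)"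
  define S where "S = {cs. length cs \<le> K \<and> set cs \<subseteq> {..<m} \<and> (\<exists>js. pth js cs)}"
  have pth_length: "length js = length cs" if "pth js cs" for js cs
    using that list_all2_lengthD unfolding pth_def by fastforce
  have pth_snoc: "pth (js @ [k]) (cs @ [c]) \<longleftrightarrow> pth js cs \<and> 1 \<le> k \<and> X {u @ js, (u @ js) @ [k]} \<omega> \<in> ?cell c"
    if "length js = length cs" for js k cs c
    using that unfolding pth_def by (auto simp: path_times_append list_all2_append)
  have pth_snocE: "\<exists>js k. js' = js @ [k] \<and> pth js cs \<and> 1 \<le> k \<and> X {u @ js, (u @ js) @ [k]} \<omega> \<in> ?cell c"
    if "pth js' (cs @ [c])" for js' cs c
  proof -
    have l: "length js' = Suc (length cs)" using pth_length[OF that] by simp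
    then obtain js k where js': "js' = js @ [k]" by (cases js' rule: rev_cases) auto
    then show ?thesis using l pth_snoc[of js cs k c] that by auto
  qed
  have box: "list_all2 (\<in>) (path_times (\<lambda>e. X e \<omega>) u js) (replicate (length cs) {0..T})"
    if "pth js cs" "set cs \<subseteq> {..<m}" for js cs
  proof -
    have "path_times (\<lambda>e. X e \<omega>) u js ! l \<in> {0..T}" if "l < length js" for l
    proof -
      have "path_times (\<lambda>e. X e \<omega>) u js ! l \<in> ?cell (cs ! l)"
        using \<open>pth js cs\<close> that unfolding pth_def by (auto simp: list_all2_conv_all_nth)
      moreover have "cs ! l < m" using \<open>set cs \<subseteq> {..<m}\<close> that pth_length[OF \<open>pth js cs\<close>] nth_mem by fastforce
      ultimately show ?thesis using cell_sub[OF T] by blast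
    qed
    then show ?thesis using pth_length[OF that(1)] by (simp add: list_all2_conv_all_nth)
  qed
  have vT: "u @ js \<in> tree_verts" if "pth js cs" for js cs using u that unfolding pth_def by simp
  have cnt: "count (u @ js) (?cell c) \<omega> \<le> 1" if "pth js cs" "set cs \<subseteq> {..<m}" "length cs < K" "c < m" for js cs c
  proof (rule ccontr)
    assume "\<not> count (u @ js) (?cell c) \<omega> \<le> 1"
    then have "\<omega> \<in> path_event u (replicate (length cs) {0..T}) (\<lambda>v. {\<omega> \<in> space P. 2 \<le> count v (?cell c) \<omega>})"
      unfolding path_event_def using \<omega>(1) box[OF that(1,2)] that(1) by (auto simp: pth_def)
    then show False using good(1) that(3,4) unfolding crowded_def by blast
  qed
  have nilS: "[] \<in> S" unfolding S_def pth_def by (auto intro!: exI[of _ "[]"])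
  have sub: "cs \<in> S" if "cs @ [c] \<in> S" for cs c
    using that pth_snocE unfolding S_def by fastforce
  \<comment> \<open>By induction the path with given cells is unique and its child numbers are ranks
    of cells. This identifies the vertices actually reached with those prescribed by
    \<open>rank_path S\<close>.\<close>
  have key: "rank_path S cs = js \<and> (length cs < K \<longrightarrow> (\<forall>c<m. cs @ [c] \<in> S \<longleftrightarrow> occupied T m \<omega> (u @ js) c))"
    if "cs \<in> S" "pth js cs" for cs js
    using that
  proof (induction cs arbitrary: js rule: rev_induct)
    case Nil
    then have "js = []" using pth_length by fastforce
    moreover have "[c] \<in> S \<longleftrightarrow> occupied T m \<omega> u c" if "0 < K" "c < m" for c
    proof
      assume "[c] \<in> S"
      then obtain js' where "pth js' ([] @ [c])" unfolding S_def by auto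
      then obtain js k where "js' = js @ [k]" "pth js []" "1 \<le> k" "X {u @ js, (u @ js) @ [k]} \<omega> \<in> ?cell c"
        using pth_snocE by blast
      moreover then have "js = []" using pth_length by fastforce
      ultimately show "occupied T m \<omega> u c" unfolding occupied_def by auto
    next
      assume "occupied T m \<omega> u c"
      then obtain k where "1 \<le> k" "X {u, u @ [k]} \<omega> \<in> ?cell c" unfolding occupied_def by blast
      then have "pth ([] @ [k]) ([] @ [c])" using Nil \<open>js = []\<close> by (subst pth_snoc) auto
      then show "[c] \<in> S" using that unfolding S_def by auto
    qed
    ultimately show ?case by simp
  next
    case (snoc c cs)
    obtain ks k where js: "js = ks @ [k]" "pth ks cs" "1 \<le> k" "X {u @ ks, (u @ ks) @ [k]} \<omega> \<in> ?cell c"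
      using pth_snocE[OF snoc.prems(2)] by blast
    have cs: "cs \<in> S" using sub snoc.prems(1) .
    note IH = snoc.IH[OF cs js(2)]
    have len: "length cs < K" and set: "set cs \<subseteq> {..<m}" and c: "c < m" using snoc.prems(1) unfolding S_def by auto
    have "k = card {c'. c' \<le> c \<and> occupied T m \<omega> (u @ ks) c'}"
      by (rule cell_point_rank[OF \<omega>(2) vT[OF js(2)] T m _ c js(3,4)]) (use cnt[OF js(2) set len] in auto)
    also have "{c'. c' \<le> c \<and> occupied T m \<omega> (u @ ks) c'} = {c'. c' \<le> c \<and> cs @ [c'] \<in> S}"
      using IH len c by auto
    finally have r: "rank_path S (cs @ [c]) = js" using IH js(1) by simp
    have "(cs @ [c]) @ [c'] \<in> S \<longleftrightarrow> occupied T m \<omega> (u @ js) c'" if l: "length (cs @ [c]) < K" "c' < m" for c'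
    proof
      assume "(cs @ [c]) @ [c'] \<in> S"
      then obtain js' where "pth js' ((cs @ [c]) @ [c'])" unfolding S_def by auto
      then obtain ls i where ls: "js' = ls @ [i]" "pth ls (cs @ [c])" "1 \<le> i" "X {u @ ls, (u @ ls) @ [i]} \<omega> \<in> ?cell c'"
        using pth_snocE by blast
      obtain ls' i' where ls': "ls = ls' @ [i']" "pth ls' cs" "1 \<le> i'" "X {u @ ls', (u @ ls') @ [i']} \<omega> \<in> ?cell c"
        using pth_snocE[OF ls(2)] by blast
      have "ls' = ks" using snoc.IH[OF cs ls'(2)] IH by simp
      moreover have "i' = k"
        using cell_point_unique[OF \<omega>(2) vT[OF js(2)] c T cnt[OF js(2) set len c], of i' k] ls'(3,4) js(3,4) calculation by simp
      ultimately show "occupied T m \<omega> (u @ js) c'" using ls ls' js(1) unfolding occupied_def by auto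
    next
      assume "occupied T m \<omega> (u @ js) c'"
      then obtain i where "1 \<le> i" "X {u @ js, (u @ js) @ [i]} \<omega> \<in> ?cell c'" unfolding occupied_def by blast
      then have "pth (js @ [i]) ((cs @ [c]) @ [c'])"
        using snoc.prems(2) pth_length[OF snoc.prems(2)] by (subst pth_snoc) auto
      then show "(cs @ [c]) @ [c'] \<in> S" using l set c unfolding S_def by auto
    qed
    with r show ?case by blast
  qed
  define D where "D = (\<lambda>i\<in>S. d (u @ rank_path S i) \<omega>)"
  have witness: "pth (rank_path S i) i \<and> set i \<subseteq> {..<m} \<and> length i \<le> K" if i: "i \<in> S" for i
  proof -
    obtain js where "pth js i" using i unfolding S_def by blast
    then show ?thesis using key[OF i] i unfolding S_def by auto
  qed
  have "butlast i \<in> S" if "i \<in> S" "i \<noteq> []" for i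
    using sub[of "butlast i" "last i"] that by simp
  then have tree: "cell_tree m K S" using nilS unfolding cell_tree_def S_def by blast
  have "i @ [c, c] \<notin> S" for i c
  proof
    assume a: "i @ [c, c] \<in> S"
    then have "pth (rank_path S (i @ [c, c])) ((i @ [c]) @ [c])" and sm: "set i \<subseteq> {..<m}" "c < m" "length i < K"
      using witness[OF a] by auto
    then obtain ls k where ls: "rank_path S (i @ [c, c]) = ls @ [k]" "pth ls (i @ [c])" "1 \<le> k" "X {u @ ls, (u @ ls) @ [k]} \<omega> \<in> ?cell c"
      using pth_snocE by blast
    obtain ls' k' where ls': "ls = ls' @ [k']" "pth ls' i" "1 \<le> k'" "X {u @ ls', (u @ ls') @ [k']} \<omega> \<in> ?cell c"
      using pth_snocE[OF ls(2)] by blast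
    have "list_all2 (\<in>) (path_times (\<lambda>e. X e \<omega>) u (ls' @ [k', k])) (replicate (length i) {0..T} @ [?cell c, ?cell c])"
      using box[OF ls'(2) sm(1)] ls ls' by (auto simp: path_times_append intro!: list_all2_appendI)
    moreover have "ls' @ [k', k] \<in> tree_verts" using ls ls' unfolding pth_def by auto
    ultimately have "\<omega> \<in> path_event u (replicate (length i) {0..T} @ [?cell c, ?cell c]) (\<lambda>_. space P)"
      unfolding path_event_def using \<omega>(1) by blast
    then show False using good(2) sm unfolding tied_def by blast
  qed
  moreover have "length j < K" if j: "j \<in> S" "sorted_wrt (>) (drop R j)" for j
  proof (rule ccontr)
    assume "\<not> length j < K"
    then have len: "length j = K" using witness[OF j(1)] by auto
    let ?js = "rank_path S j"
    have w: "pth ?js j" "set j \<subseteq> {..<m}" using witness[OF j(1)] by auto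
    have "list_all2 (\<in>) (path_times (\<lambda>e. X e \<omega>) u ?js) (replicate R {0..T} @ map ?cell (drop R j))"
      unfolding list_all2_conv_all_nth
    proof (intro conjI allI impI)
      show "length (path_times (\<lambda>e. X e \<omega>) u ?js) = length (replicate R {0..T} @ map ?cell (drop R j))"
        using len R by simp
      fix l assume l: "l < length (path_times (\<lambda>e. X e \<omega>) u ?js)"
      have "path_times (\<lambda>e. X e \<omega>) u ?js ! l \<in> {0..T}"
        using box[OF w] l by (simp add: list_all2_conv_all_nth)
      moreover have "path_times (\<lambda>e. X e \<omega>) u ?js ! l \<in> ?cell (j ! l)"
        using w(1) l unfolding pth_def by (simp add: list_all2_conv_all_nth)
      ultimately show "path_times (\<lambda>e. X e \<omega>) u ?js ! l \<in> (replicate R {0..T} @ map ?cell (drop R j)) ! l"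
        using l len R by (simp add: nth_append)
    qed
    then have "\<omega> \<in> path_event u (replicate R {0..T} @ map ?cell (drop R j)) (\<lambda>_. space P)"
      unfolding path_event_def using \<omega>(1) w(1) by (auto simp: pth_def)
    moreover have "length (drop R j) = K - R" "set (drop R j) \<subseteq> {..<m}"
      using len w(2) set_drop_subset[of R j] by auto
    ultimately show False using good(3) j(2) unfolding decreasing_def by blast
  qed
  ultimately have gt: "good_tree R K S" unfolding good_tree_def using R by blast
  have "d (u @ rank_path S i) \<omega> \<le> b" if i: "i \<in> S" for i
  proof (rule ccontr)
    assume "\<not> d (u @ rank_path S i) \<omega> \<le> b"
    then have "\<omega> \<in> path_event u (replicate (length i) {0..T}) (\<lambda>v. {\<omega> \<in> space P. d v \<omega> \<in> {b<..}})"
      unfolding path_event_def using \<omega>(1) box[of "rank_path S i" i] witness[OF i] by (auto simp: pth_def)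
    then show False using good(4) witness[OF i] unfolding large_constraint_def by blast
  qed
  then have DB: "D \<in> S \<rightarrow>\<^sub>E {..b}" by (auto simp: D_def)
  have "\<omega> \<in> shape_event T m K u S D"
    unfolding shape_event_def
  proof (intro CollectI conjI ballI impI allI \<omega>(1))
    fix i assume i: "i \<in> S"
    then show "d (u @ rank_path S i) \<omega> = D i" by (simp add: D_def)
    fix c assume ic: "length i < K" "c < m"
    have w: "pth (rank_path S i) i" "set i \<subseteq> {..<m}" using witness[OF i] by auto
    have "count (u @ rank_path S i) (?cell c) \<omega> = of_bool (occupied T m \<omega> (u @ rank_path S i) c)"
      by (rule count_occupied[OF \<omega>(2) vT[OF w(1)] ic(2) T cnt[OF w ic]])
    then show "count (u @ rank_path S i) (?cell c) \<omega> = of_bool (i @ [c] \<in> S)"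
      using key[OF i w(1)] ic by simp
  qed
  with tree gt DB show ?thesis by blast
qed

text \<open>The bound \<open>b\<close> on the constraints is what makes this set finite.\<close>

definition good_shapes :: "nat \<Rightarrow> nat \<Rightarrow> nat \<Rightarrow> nat \<Rightarrow> (nat list set \<times> (nat list \<Rightarrow> nat)) set" where
  "good_shapes R m K b = {(S, D). cell_tree m K S \<and> good_tree R K S \<and> D \<in> S \<rightarrow>\<^sub>E {..b}}"

lemma good_shapes_sub: "good_shapes R m K b \<subseteq> shapes m K"
  by (auto simp: good_shapes_def shapes_def PiE_def)

lemma finite_good_shapes: "finite (good_shapes R m K b)"
proof -
  let ?L = "{cs :: nat list. set cs \<subseteq> {..<m} \<and> length cs \<le> K}"
  have L: "finite ?L" by (rule finite_lists_length_le) simp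
  have "good_shapes R m K b \<subseteq> (SIGMA S:Pow ?L. S \<rightarrow>\<^sub>E {..b})"
    by (auto simp: good_shapes_def cell_tree_def)
  moreover have "finite (SIGMA S:Pow ?L. S \<rightarrow>\<^sub>E {..b})"
    using L by (intro finite_SigmaI finite_PiE) (auto intro: finite_subset)
  ultimately show ?thesis by (rule finite_subset)
qed

text \<open>The order of the choices is \<open>L\<close>, \<open>K\<close>, \<open>m\<close>,
  \<open>b\<close>. The bound for decreasing paths is uniform in \<open>m\<close>, those for
  \<open>crowded\<close> and \<open>tied\<close> depend on \<open>K\<close>, and the tail of
  \<open>p\<close> beyond \<open>b\<close> must beat the expected number of vertices in reach. Each
  bad event receives \<open>\<epsilon> / 4\<close>.\<close>

lemma good_shapes_mass:
  assumes T: "0 \<le> T" and \<epsilon>: "0 < \<epsilon>"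
  shows "\<exists>m K b. 0 < m \<and> 1 - \<epsilon> \<le> weight_sum p T m K (good_shapes R m K b)"
proof -
  have "(\<lambda>L. T ^ L / fact L) \<longlonglongrightarrow> 0"
    using summable_LIMSEQ_zero[OF summable_exp[of T]] by (simp add: field_simps)
  then have "(\<lambda>L. T ^ R * (T ^ L / fact L)) \<longlonglongrightarrow> T ^ R * 0" by (intro tendsto_intros)
  then have "\<forall>\<^sub>F L in sequentially. T ^ R * (T ^ L / fact L) < \<epsilon> / 4"
    using \<epsilon> by (intro order_tendstoD(2)) auto
  from eventually_conj[OF this eventually_ge_at_top[of 1]]
  obtain L where L: "T ^ R * (T ^ L / fact L) < \<epsilon> / 4" "1 \<le> L"
    by (auto dest: eventually_happens)
  define K where "K = R + L"
  have K: "R < K" "K - R = L" using L by (auto simp: K_def)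
  have "(\<lambda>m. (\<Sum>l<K. T ^ (l + 2)) / real m) \<longlonglongrightarrow> 0"
    by (rule lim_const_over_n)
  then have "\<forall>\<^sub>F m in sequentially. (\<Sum>l<K. T ^ (l + 2)) / real m < \<epsilon> / 4"
    using \<epsilon> by (intro order_tendstoD(2)) auto
  from eventually_conj[OF this eventually_ge_at_top[of 1]]
  obtain m where m: "(\<Sum>l<K. T ^ (l + 2)) / real m < \<epsilon> / 4" "0 < m"
    by (auto dest: eventually_happens)
  have "(\<lambda>b. measure (measure_pmf p) {b<..}) \<longlonglongrightarrow> measure (measure_pmf p) (\<Inter>b. {b<..})"
    by (intro measure_pmf.finite_Lim_measure_decseq) (auto simp: decseq_def)
  moreover have "(\<Inter>b. {b<..}) = ({} :: nat set)" by auto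
  ultimately have "(\<lambda>b. (\<Sum>l\<le>K. T ^ l) * measure (measure_pmf p) {b<..}) \<longlonglongrightarrow> (\<Sum>l\<le>K. T ^ l) * 0"
    by (intro tendsto_intros) simp
  then have "\<forall>\<^sub>F b in sequentially. (\<Sum>l\<le>K. T ^ l) * measure (measure_pmf p) {b<..} < \<epsilon> / 4"
    using \<epsilon> by (intro order_tendstoD(2)) auto
  then obtain b where b: "(\<Sum>l\<le>K. T ^ l) * measure (measure_pmf p) {b<..} < \<epsilon> / 4"
    by (auto dest: eventually_happens)
  have u: "[] \<in> tree_verts" by simp
  let ?bad = "crowded T m [] K \<union> tied T m [] K \<union> decreasing T m [] R L \<union> large_constraint T b [] K"
  have ev: "crowded T m [] K \<in> events" "tied T m [] K \<in> events" "decreasing T m [] R L \<in> events"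
      "large_constraint T b [] K \<in> events"
    using prob_crowded(1)[OF u T m(2)] prob_tied(1)[OF u T m(2)] prob_decreasing(1)[OF u T m(2)]
      prob_large_constraint(1)[OF u T] by auto
  have "prob ?bad \<le> prob (crowded T m [] K) + prob (tied T m [] K) + prob (decreasing T m [] R L) + prob (large_constraint T b [] K)"
    using ev by (intro measure_Un_le[THEN order_trans] add_mono order_refl) auto
  also have "\<dots> \<le> \<epsilon>"
    using prob_crowded(2)[OF u T m(2), of K] prob_tied(2)[OF u T m(2), of K] prob_decreasing(2)[OF u T m(2), of R L]
      prob_large_constraint(2)[OF u T, of b K] L m b by linarith
  finally have bad: "prob ?bad \<le> \<epsilon>" .
  let ?F = "good_shapes R m K b"
  have sh: "some_shape T m K [] ?F \<in> events" "prob (some_shape T m K [] ?F) = weight_sum p T m K ?F"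
    using prob_some_shape[OF u finite_good_shapes good_shapes_sub T m(2)] by blast+
  have "AE \<omega> in P. \<omega> \<in> some_shape T m K [] ?F \<union> ?bad"
    using AE_regular
  proof (rule AE_mp, intro AE_I2 impI)
    fix \<omega> assume \<omega>: "\<omega> \<in> space P" "regular \<omega>"
    show "\<omega> \<in> some_shape T m K [] ?F \<union> ?bad"
    proof (cases "\<omega> \<in> ?bad")
      case False
      then obtain S D where "cell_tree m K S" "good_tree R K S" "D \<in> S \<rightarrow>\<^sub>E {..b}" "\<omega> \<in> shape_event T m K [] S D"
        using shape_exists[OF \<omega> u T m(2) K(1), of b] K(2) by auto
      then show ?thesis unfolding some_shape_def good_shapes_def by blast
    qed blast
  qed
  then have "prob (some_shape T m K [] ?F \<union> ?bad) = 1"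
    using sh(1) ev by (intro prob_eq_1[THEN iffD2]) auto
  moreover have "prob (some_shape T m K [] ?F \<union> ?bad) \<le> prob (some_shape T m K [] ?F) + prob ?bad"
    using sh(1) ev by (intro measure_Un_le) auto
  ultimately have "1 - \<epsilon> \<le> weight_sum p T m K ?F" using sh(2) bad by linarith
  then show ?thesis using m(2) by blast
qed

end

section \<open>Almost sure well-definedness of the process on the tree\<close>

lemma path_times_take: "path_times X u (take n js) = take n (path_times X u js)"
proof (induction js arbitrary: u n)
  case (Cons j js)
  then show ?case by (cases n) auto
qed simp

lemma path_times_nth:
  "l < length js \<Longrightarrow> path_times X u js ! l = X {u @ take l js, (u @ take l js) @ [js ! l]}"
proof (induction js arbitrary: u l)
  case (Cons j js)
  then show ?case by (cases l) auto
qed simp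

context prob_space
begin

text \<open>The property \<open>Q\<close> itself need not be measurable. Up to a null set it fails
  only inside the intersection of exceptional events with vanishing probabilities.\<close>

lemma AE_small_exceptions:
  assumes "\<And>\<eta>. 0 < \<eta> \<Longrightarrow> \<exists>E\<in>events. prob E \<le> \<eta> \<and> (AE \<omega> in M. Q \<omega> \<or> \<omega> \<in> E)"
  shows "AE \<omega> in M. Q \<omega>"
proof -
  have "\<forall>n::nat. \<exists>E. E \<in> events \<and> prob E \<le> inverse (real (Suc n)) \<and> (AE \<omega> in M. Q \<omega> \<or> \<omega> \<in> E)"
  proof
    fix n :: nat
    show "\<exists>E. E \<in> events \<and> prob E \<le> inverse (real (Suc n)) \<and> (AE \<omega> in M. Q \<omega> \<or> \<omega> \<in> E)"
      using assms[of "inverse (real (Suc n))"] by auto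
  qed
  from choice[OF this] obtain E where E: "\<And>n. E n \<in> events" "\<And>n. prob (E n) \<le> inverse (real (Suc n))"
    "\<And>n. AE \<omega> in M. Q \<omega> \<or> \<omega> \<in> E n"
    by blast
  have ev: "(\<Inter>n. E n) \<in> events" using E(1) by auto
  have "prob (\<Inter>n. E n) \<le> inverse (real (Suc n))" for n
  proof -
    have "prob (\<Inter>n. E n) \<le> prob (E n)" using E(1) by (intro finite_measure_mono) auto
    then show ?thesis using E(2)[of n] by linarith
  qed
  then have "prob (\<Inter>n. E n) \<le> 0"
    by (intro LIMSEQ_le_const[OF LIMSEQ_inverse_real_of_nat]) auto
  then have "(\<Inter>n. E n) \<in> null_sets M"
    using ev by (simp add: null_sets_def emeasure_eq_measure measure_le_0_iff)
  then have "AE \<omega> in M. \<omega> \<notin> (\<Inter>n. E n)" by (rule AE_not_in)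
  moreover have "AE \<omega> in M. \<forall>n. Q \<omega> \<or> \<omega> \<in> E n" by (rule AE_all_countable[THEN iffD2]) (use E(3) in blast)
  ultimately show ?thesis by eventually_elim auto
qed

text \<open>The intersections over \<open>n \<ge> N\<close> increase with \<open>N\<close>, and each
  is contained in some \<open>D n\<close> of probability at most \<open>c\<close>.\<close>

lemma prob_liminf_le:
  fixes D :: "nat \<Rightarrow> 'a set"
  assumes "\<And>n. D n \<in> events" "\<exists>\<^sub>F n in sequentially. prob (D n) \<le> c"
  shows "(\<Union>N. \<Inter>n\<in>{N..}. D n) \<in> events" "prob (\<Union>N. \<Inter>n\<in>{N..}. D n) \<le> c"
proof -
  let ?I = "\<lambda>N. \<Inter>n\<in>{N..}. D n"
  have I: "?I N \<in> events" for N using assms(1) by auto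
  then show "(\<Union>N. ?I N) \<in> events" by auto
  have "prob (?I N) \<le> c" for N
  proof -
    obtain n where n: "N \<le> n" "prob (D n) \<le> c" using assms(2) unfolding frequently_sequentially by blast
    have "prob (?I N) \<le> prob (D n)" using n(1) assms(1) by (intro finite_measure_mono) auto
    then show ?thesis using n(2) by simp
  qed
  moreover have "(\<lambda>N. prob (?I N)) \<longlonglongrightarrow> prob (\<Union>N. ?I N)"
    by (intro finite_Lim_measure_incseq) (use I in \<open>auto simp: incseq_def\<close>)
  ultimately show "prob (\<Union>N. ?I N) \<le> c" by (intro LIMSEQ_le_const2) auto
qed

end

context pwit_process
begin

definition decreasing_path :: "'q \<Rightarrow> real \<Rightarrow> nat list \<Rightarrow> nat list \<Rightarrow> bool" where
  "decreasing_path \<omega> T u js \<longleftrightarrow> js \<in> tree_verts \<and> sorted_wrt (>) (path_times (\<lambda>e. X e \<omega>) u js) \<and>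
     (\<forall>x\<in>set (path_times (\<lambda>e. X e \<omega>) u js). x \<le> T)"

lemma path_times_nonneg:
  assumes "regular \<omega>" "u \<in> tree_verts" "js \<in> tree_verts" "l < length js"
  shows "0 \<le> path_times (\<lambda>e. X e \<omega>) u js ! l"
proof -
  have "u @ take l js \<in> tree_verts" using assms(2,3) by (auto dest: in_set_takeD)
  moreover have "1 \<le> js ! l" using assms(3,4) nth_mem by fastforce
  ultimately show ?thesis unfolding path_times_nth[OF assms(4)] by (rule regular_nonneg[OF assms(1)])
qed

text \<open>Round the labels of the path to cells: either two consecutive ones share a cell, or the
  cells decrease strictly.\<close>

lemma decreasing_path_tied_or_decreasing:
  assumes \<omega>: "\<omega> \<in> space P" "regular \<omega>" and u: "u \<in> tree_verts" and T: "0 \<le> T" and m: "0 < m"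
    and js: "decreasing_path \<omega> T u js" "length js = L"
  shows "\<omega> \<in> tied T m u L \<union> decreasing T m u 0 L"
proof -
  let ?x = "path_times (\<lambda>e. X e \<omega>) u js"
  have jsv: "js \<in> tree_verts" using js unfolding decreasing_path_def by blast
  have x: "0 \<le> ?x ! l" "?x ! l \<le> T" if "l < L" for l
    using path_times_nonneg[OF \<omega>(2) u jsv] js that unfolding decreasing_path_def by auto
  then have "\<forall>l. \<exists>c. l < L \<longrightarrow> c < m \<and> ?x ! l \<in> cell (T / real m) c" using in_some_cell[OF _ _ m] by blast
  then obtain c where c: "\<And>l. l < L \<Longrightarrow> c l < m \<and> ?x ! l \<in> cell (T / real m) (c l)" by metis
  show ?thesis
  proof (cases "\<exists>l. Suc l < L \<and> c l = c (Suc l)")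
    case True
    then obtain l where l: "Suc l < L" "c l = c (Suc l)" by blast
    let ?Bs = "replicate l {0..T} @ [cell (T / real m) (c l), cell (T / real m) (c l)]"
    have "list_all2 (\<in>) (path_times (\<lambda>e. X e \<omega>) u (take (Suc (Suc l)) js)) ?Bs"
      unfolding list_all2_conv_all_nth path_times_take
    proof (intro conjI allI impI)
      show "length (take (Suc (Suc l)) ?x) = length ?Bs" using l js by simp
      fix k assume "k < length (take (Suc (Suc l)) ?x)"
      then have k: "k < Suc (Suc l)" "k < L" using js by auto
      then consider "k < l" | "k = l" | "k = Suc l" by linarith
      then show "take (Suc (Suc l)) ?x ! k \<in> ?Bs ! k"
        using x[OF k(2)] c[OF k(2)] l k by cases (auto simp: nth_append)
    qed
    moreover have "take (Suc (Suc l)) js \<in> tree_verts" using jsv by (auto dest: in_set_takeD)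
    ultimately have "\<omega> \<in> path_event u ?Bs (\<lambda>_. space P)" unfolding path_event_def using \<omega>(1) by blast
    moreover have "l < L" "c l < m" using l c by auto
    ultimately show ?thesis unfolding tied_def by blast
  next
    case False
    let ?cs = "map c [0..<L]"
    have "c (Suc l) < c l" if l: "Suc l < L" for l
    proof -
      have "?x ! Suc l < ?x ! l"
        using js l sorted_wrt_nth_less[of "(>)" ?x l "Suc l"] unfolding decreasing_path_def by simp
      moreover have "c l \<noteq> c (Suc l)" using False l by blast
      ultimately show ?thesis
        using cell_less_iff[of "?x ! Suc l" "T / real m" "c (Suc l)" "?x ! l" "c l"] c[OF l] c[of l] l T by auto
    qed
    then have "sorted_wrt (>) ?cs"
      by (subst sorted_wrt_iff_nth_Suc_transp) (auto intro: transpI)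
    moreover have "set ?cs \<subseteq> {..<m}" using c by auto
    moreover have "list_all2 (\<in>) ?x (replicate 0 {0..T} @ map (cell (T / real m)) ?cs)"
      using c js by (auto simp: list_all2_conv_all_nth)
    then have "\<omega> \<in> path_event u (replicate 0 {0..T} @ map (cell (T / real m)) ?cs) (\<lambda>_. space P)"
      unfolding path_event_def using \<omega>(1) jsv by blast
    moreover have "length ?cs = L" by simp
    ultimately show ?thesis unfolding decreasing_def by blast
  qed
qed

text \<open>Excluding a single length \<open>L\<close> bounds all lengths, since initial segments of
  decreasing paths are decreasing. Take \<open>L\<close> with \<open>T ^ L / fact L\<close> small
  and then \<open>m\<close> large.\<close>

lemma AE_bounded_decreasing_paths:
  assumes u: "u \<in> tree_verts" and T: "0 \<le> T"
  shows "AE \<omega> in P. \<exists>L. \<forall>js. decreasing_path \<omega> T u js \<longrightarrow> length js \<noteq> L"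
proof (rule AE_small_exceptions)
  fix \<eta> :: real assume \<eta>: "0 < \<eta>"
  have "(\<lambda>L. T ^ L / fact L) \<longlonglongrightarrow> 0"
    using summable_LIMSEQ_zero[OF summable_exp[of T]] by (simp add: field_simps)
  then have "\<forall>\<^sub>F L in sequentially. T ^ L / fact L < \<eta> / 2"
    using \<eta> by (intro order_tendstoD(2)) auto
  then obtain L where L: "T ^ L / fact L < \<eta> / 2"
    by (auto dest: eventually_happens)
  have "(\<lambda>m. (\<Sum>l<L. T ^ (l + 2)) / real m) \<longlonglongrightarrow> 0"
    by (rule lim_const_over_n)
  then have "\<forall>\<^sub>F m in sequentially. (\<Sum>l<L. T ^ (l + 2)) / real m < \<eta> / 2"
    using \<eta> by (intro order_tendstoD(2)) auto
  from eventually_conj[OF this eventually_ge_at_top[of 1]]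
  obtain m where m: "(\<Sum>l<L. T ^ (l + 2)) / real m < \<eta> / 2" "0 < m"
    by (auto dest: eventually_happens)
  let ?E = "tied T m u L \<union> decreasing T m u 0 L"
  have ev: "tied T m u L \<in> events" "decreasing T m u 0 L \<in> events"
    using prob_tied(1)[OF u T m(2)] prob_decreasing(1)[OF u T m(2)] by auto
  have "prob ?E \<le> prob (tied T m u L) + prob (decreasing T m u 0 L)" using ev by (intro measure_Un_le)
  also have "\<dots> \<le> \<eta>"
  proof -
    have "prob (decreasing T m u 0 L) \<le> T ^ L / fact L" using prob_decreasing(2)[OF u T m(2), of 0 L] by simp
    then show ?thesis using prob_tied(2)[OF u T m(2), of L] L m(1) by linarith
  qed
  finally have "prob ?E \<le> \<eta>" .
  moreover have "AE \<omega> in P. (\<exists>L. \<forall>js. decreasing_path \<omega> T u js \<longrightarrow> length js \<noteq> L) \<or> \<omega> \<in> ?E"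
    using AE_regular
  proof (rule AE_mp, intro AE_I2 impI)
    fix \<omega> assume "\<omega> \<in> space P" "regular \<omega>"
    then show "(\<exists>L. \<forall>js. decreasing_path \<omega> T u js \<longrightarrow> length js \<noteq> L) \<or> \<omega> \<in> ?E"
      using decreasing_path_tied_or_decreasing[OF _ _ u T m(2)] by blast
  qed
  ultimately show "\<exists>E\<in>events. prob E \<le> \<eta> \<and>
      (AE \<omega> in P. (\<exists>L. \<forall>js. decreasing_path \<omega> T u js \<longrightarrow> length js \<noteq> L) \<or> \<omega> \<in> E)"
    using ev by (intro bexI[of _ ?E]) auto
qed

text \<open>The sample points on which all deterministic arguments about the tree run. Integer time
  horizons keep the condition countable.\<close>

definition nice :: "'q \<Rightarrow> bool" where
  "nice \<omega> \<longleftrightarrow> \<omega> \<in> space P \<and> regular \<omega> \<and>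
     (\<forall>u\<in>tree_verts. \<forall>N::nat. \<exists>L. \<forall>js. decreasing_path \<omega> (real N) u js \<longrightarrow> length js \<noteq> L)"

lemma AE_nice: "AE \<omega> in P. nice \<omega>"
proof -
  have "AE \<omega> in P. \<forall>u\<in>tree_verts. \<forall>N::nat. \<exists>L. \<forall>js. decreasing_path \<omega> (real N) u js \<longrightarrow> length js \<noteq> L"
    using AE_bounded_decreasing_paths by (simp add: AE_ball_countable AE_all_countable)
  then show ?thesis using AE_regular AE_space unfolding nice_def by eventually_elim auto
qed

lemma finite_short_paths:
  assumes "regular \<omega>" "u \<in> tree_verts"
  shows "finite {js \<in> tree_verts. length js \<le> n \<and> (\<forall>x\<in>set (path_times (\<lambda>e. X e \<omega>) u js). x \<le> T)}"
  using assms(2)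
proof (induction n arbitrary: u)
  case 0
  show ?case by (rule finite_subset[of _ "{[]}"]) auto
next
  case (Suc n)
  let ?S = "\<lambda>n u. {js \<in> tree_verts. length js \<le> n \<and> (\<forall>x\<in>set (path_times (\<lambda>e. X e \<omega>) u js). x \<le> T)}"
  let ?J = "{j. 1 \<le> j \<and> X {u, u @ [j]} \<omega> \<le> T}"
  have sub: "?S (Suc n) u \<subseteq> insert [] (\<Union>j\<in>?J. (#) j ` ?S n (u @ [j]))"
  proof
    fix js assume "js \<in> ?S (Suc n) u"
    then show "js \<in> insert [] (\<Union>j\<in>?J. (#) j ` ?S n (u @ [j]))"
      by (cases js) auto
  qed
  have "finite (?S n (u @ [j]))" if "j \<in> ?J" for j
    by (rule Suc.IH) (use that Suc.prems in auto)
  moreover have "finite ?J" by (rule regular_finite[OF assms(1) Suc.prems])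
  ultimately have "finite (insert [] (\<Union>j\<in>?J. (#) j ` ?S n (u @ [j])))" by simp
  then show ?case by (rule finite_subset[OF sub])
qed

lemma decreasing_path_take: "decreasing_path \<omega> T u js \<Longrightarrow> decreasing_path \<omega> T u (take n js)"
  unfolding decreasing_path_def path_times_take
  by (auto dest: in_set_takeD simp: sorted_wrt_take)

lemma finite_decreasing_paths:
  assumes "nice \<omega>" "u \<in> tree_verts"
  shows "finite {js. decreasing_path \<omega> (real N) u js}"
proof -
  obtain L where L: "\<And>js. decreasing_path \<omega> (real N) u js \<Longrightarrow> length js \<noteq> L"
    using assms unfolding nice_def by blast
  have "length js \<le> L" if "decreasing_path \<omega> (real N) u js" for js
  proof (rule ccontr)
    assume "\<not> length js \<le> L"
    then have "length (take L js) = L" by simp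
    then show False using L[OF decreasing_path_take[OF that]] by blast
  qed
  then have "{js. decreasing_path \<omega> (real N) u js} \<subseteq>
      {js \<in> tree_verts. length js \<le> L \<and> (\<forall>x\<in>set (path_times (\<lambda>e. X e \<omega>) u js). x \<le> real N)}"
    by (auto simp: decreasing_path_def)
  moreover have "regular \<omega>" using assms(1) unfolding nice_def by blast
  ultimately show ?thesis by (rule finite_subset[OF _ finite_short_paths[OF _ assms(2)]])
qed

lemma decreasing_path_snoc:
  "decreasing_path \<omega> T u (js @ [k]) \<longleftrightarrow> decreasing_path \<omega> T u js \<and> 1 \<le> k \<and> X {u @ js, u @ js @ [k]} \<omega> \<le> T \<and>
    (\<forall>x\<in>set (path_times (\<lambda>e. X e \<omega>) u js). X {u @ js, u @ js @ [k]} \<omega> < x)"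
  unfolding decreasing_path_def by (auto simp: path_times_append sorted_wrt_append)

lemma edge_pwitE:
  assumes "e \<in> edges pwit"
  obtains c where "c \<in> tree_verts" "c \<noteq> []" "e = {butlast c, c}"
proof -
  obtain i j where "i \<in> tree_verts" "1 \<le> j" "e = {i, i @ [j]}" using assms unfolding pwit_def by auto
  then show thesis by (intro that[of "i @ [j]"]) auto
qed

text \<open>A chain of adjacent edges back in time may climb towards the root, but it descends only
  along paths with decreasing labels. So its edges end on decreasing paths from ancestors of the
  starting vertex, and there are only finitely many of these, whereas the edges of an infinite chain
  are distinct.\<close>

lemma wf_earlier_adjacent_pwit:
  assumes "nice \<omega>"
  shows "wf (earlier_adjacent (edges pwit) (\<lambda>e. X e \<omega>))"
proof (rule ccontr)
  let ?r = "earlier_adjacent (edges pwit) (\<lambda>e. X e \<omega>)"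
  assume "\<not> wf ?r"
  then obtain f where f: "\<And>i. (f (Suc i), f i) \<in> ?r" unfolding wf_iff_no_infinite_down_chain by blast
  have fE: "f i \<in> edges pwit" for i using f[of i] unfolding earlier_adjacent_def by blast
  then have "\<forall>i. \<exists>c. c \<in> tree_verts \<and> c \<noteq> [] \<and> f i = {butlast c, c}" by (metis edge_pwitE)
  then obtain c where c: "\<And>i. c i \<in> tree_verts" "\<And>i. c i \<noteq> []" "\<And>i. f i = {butlast (c i), c i}" by metis
  obtain N :: nat where N: "X (f 0) \<omega> \<le> real N" using real_arch_simple by blast
  have dec: "X (f (Suc i)) \<omega> < X (f i) \<omega>" for i using f[of i] unfolding earlier_adjacent_def by blast
  have XN: "X (f i) \<omega> \<le> real N" for i
    by (induction i) (use N dec in \<open>auto intro: less_imp_le order_trans\<close>)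
  \<comment> \<open>The invariant of the chain: the lower end of the current edge is reached by a
    decreasing path \<open>js\<close>, possibly empty, from \<open>c 0\<close> or one of its
    ancestors.\<close>
  let ?I = "\<lambda>c'. \<exists>v js. prefix v (c 0) \<and> c' = v @ js \<and> decreasing_path \<omega> (real N) v js"
  have "?I (c i)" for i
  proof (induction i)
    case 0
    have "decreasing_path \<omega> (real N) (c 0) []" by (simp add: decreasing_path_def)
    then show ?case by (intro exI[of _ "c 0"] exI[of _ "[]"]) simp
  next
    case (Suc i)
    then obtain v js where I: "prefix v (c 0)" "c i = v @ js" "decreasing_path \<omega> (real N) v js" by blast
    let ?a = "c i" and ?b = "c (Suc i)"
    have b1: "1 \<le> last ?b" using c(1)[of "Suc i"] c(2)[of "Suc i"] last_in_set by fastforce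
    have lt: "X {butlast ?b, ?b} \<omega> < X {butlast ?a, ?a} \<omega>" using dec[of i] c(3) by simp
    have bN: "X {butlast ?b, ?b} \<omega> \<le> real N" using XN[of "Suc i"] c(3) by simp
    obtain u where u: "u \<in> {butlast ?a, ?a}" "u \<in> {butlast ?b, ?b}"
      using f[of i] c(3) unfolding earlier_adjacent_def by blast
    have "?a \<noteq> ?b" using lt by auto
    have jsa: "\<forall>x\<in>set (path_times (\<lambda>e. X e \<omega>) v js). X {butlast ?a, ?a} \<omega> \<le> x"
    proof (cases js rule: rev_cases)
      case (snoc ks k)
      have "X {butlast ?a, ?a} \<omega> = X {v @ ks, v @ ks @ [k]} \<omega>" using I(2) snoc by (simp add: butlast_append)
      then show ?thesis using I(3) snoc by (auto simp: decreasing_path_snoc path_times_append)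
    qed simp
    have vb: "prefix (butlast v) (c 0)" using I(1) by (metis prefixeq_butlast prefix_order.trans)
    from c(2)[of i] c(2)[of "Suc i"] u \<open>?a \<noteq> ?b\<close> show ?case
    proof (cases rule: edge_touching_cases)
      case 1
      show ?thesis
      proof (cases js rule: rev_cases)
        \<comment> \<open>With \<open>js\<close> empty, the sibling edge hangs off the parent of
          \<open>v\<close>, which becomes the new ancestor with a path of one step.\<close>
        case Nil
        then have v: "?a = v" "v \<noteq> []" using I(2) c(2)[of i] by auto
        then have b: "?b = butlast v @ [last ?b]" using 1 c(2)[of "Suc i"] by (metis append_butlast_last_id)
        have "X {butlast v, butlast v @ [last ?b]} \<omega> \<le> real N"
          using bN b by (metis butlast_snoc)
        then have "decreasing_path \<omega> (real N) (butlast v) [last ?b]"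
          using b1 by (simp add: decreasing_path_def)
        then show ?thesis using vb b by blast
      next
        case (snoc ks k)
        have b: "?b = v @ ks @ [last ?b]"
          using 1 c(2)[of "Suc i"] I(2) snoc by (metis append_assoc append_butlast_last_id butlast_snoc)
        have e: "{butlast ?b, ?b} = {v @ ks, v @ ks @ [last ?b]}" using b by (metis append_assoc butlast_snoc)
        have "\<forall>x\<in>set (path_times (\<lambda>e. X e \<omega>) v ks). X {butlast ?b, ?b} \<omega> < x"
          using jsa lt snoc by (fastforce simp: path_times_append)
        then have "decreasing_path \<omega> (real N) v (ks @ [last ?b])"
          using I(3) snoc b1 bN unfolding e by (simp add: decreasing_path_snoc)
        then show ?thesis using I(1) b by (intro exI[of _ v] exI[of _ "ks @ [last ?b]"]) simp
      qed
    next
      case 2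
      show ?thesis
      proof (cases js rule: rev_cases)
        case Nil
        have "decreasing_path \<omega> (real N) (butlast v) []" by (simp add: decreasing_path_def)
        then show ?thesis using 2 Nil I(2) vb by (intro exI[of _ "butlast v"] exI[of _ "[]"]) simp
      next
        case (snoc ks k)
        then show ?thesis using 2 I by (intro exI[of _ v] exI[of _ ks]) (simp add: decreasing_path_snoc butlast_append)
      qed
    next
      case 3
      have b: "?b = v @ js @ [last ?b]"
        using 3 c(2)[of "Suc i"] I(2) by (metis append_assoc append_butlast_last_id)
      have e: "{butlast ?b, ?b} = {v @ js, v @ js @ [last ?b]}" using b by (metis append_assoc butlast_snoc)
      have "\<forall>x\<in>set (path_times (\<lambda>e. X e \<omega>) v js). X {butlast ?b, ?b} \<omega> < x"
        using jsa lt by fastforce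
      then have "decreasing_path \<omega> (real N) v (js @ [last ?b])"
        using I(3) b1 bN unfolding e by (simp add: decreasing_path_snoc)
      then show ?thesis using I(1) b by (intro exI[of _ v] exI[of _ "js @ [last ?b]"]) simp
    qed
  qed
  then have sub: "range c \<subseteq> (\<Union>v\<in>set (prefixes (c 0)). (@) v ` {js. decreasing_path \<omega> (real N) v js})"
    by fastforce
  have "finite (\<Union>v\<in>set (prefixes (c 0)). (@) v ` {js. decreasing_path \<omega> (real N) v js})"
  proof (intro finite_UN_I finite_imageI finite_decreasing_paths[OF assms])
    fix v assume "v \<in> set (prefixes (c 0))"
    then show "v \<in> tree_verts" using c(1)[of 0] by (auto simp: prefix_def)
  qed simp
  then have "finite (range c)" using sub by (rule finite_subset[rotated])
  moreover have "range f = (\<lambda>c. {butlast c, c}) ` range c" using c(3) by auto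
  ultimately have "finite (range f)" by simp
  moreover have "inj f"
  proof (rule injI)
    have less: "X (f j) \<omega> < X (f i) \<omega>" if "i < j" for i j
      using that by (induction j) (use dec in \<open>auto simp: less_Suc_eq intro: less_trans\<close>)
    fix i j assume "f i = f j"
    then show "i = j" using less[of i j] less[of j i] by (cases i j rule: linorder_cases) auto
  qed
  ultimately show False using finite_imageD infinite_UNIV_nat by blast
qed

section \<open>The process in subtrees\<close>

lemma below_subset: "u \<in> tree_verts \<Longrightarrow> below u \<subseteq> edges pwit"
  unfolding below_def pwit_def by fastforce

text \<open>The process run in the subtree of \<open>u\<close> alone; for \<open>u = []\<close> it
  is the process on the whole tree.\<close>

definition added :: "'q \<Rightarrow> nat list \<Rightarrow> nat list set set" where
  "added \<omega> u = rdcp_edges (below u) (\<lambda>v. d v \<omega>) (\<lambda>e. X e \<omega>)"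

lemma touching_edges:
  assumes "e \<in> edges pwit" "v \<in> e"
  shows "v \<in> tree_verts" "(\<exists>j\<ge>1. e = {v, v @ [j]}) \<or> e = {butlast v, v}"
proof -
  obtain i j where i: "i \<in> tree_verts" "1 \<le> j" "e = {i, i @ [j]}" using assms(1) unfolding pwit_def by auto
  then show "v \<in> tree_verts" using assms(2) by auto
  show "(\<exists>j\<ge>1. e = {v, v @ [j]}) \<or> e = {butlast v, v}" using i assms(2) by auto
qed

lemma finite_earlier_edges:
  assumes "nice \<omega>" "v \<in> tree_verts"
  shows "finite {f \<in> edges pwit. v \<in> f \<and> X f \<omega> < x}"
proof -
  have "{f \<in> edges pwit. v \<in> f \<and> X f \<omega> < x} \<subseteq>
      insert {butlast v, v} ((\<lambda>j. {v, v @ [j]}) ` {j. 1 \<le> j \<and> X {v, v @ [j]} \<omega> \<le> x})"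
    using touching_edges(2) by fastforce
  moreover have "finite {j. 1 \<le> j \<and> X {v, v @ [j]} \<omega> \<le> x}"
    using assms regular_finite unfolding nice_def by blast
  ultimately show ?thesis by (auto intro: finite_subset)
qed

lemma wf_below: "nice \<omega> \<Longrightarrow> u \<in> tree_verts \<Longrightarrow> wf (earlier_adjacent (below u) (\<lambda>e. X e \<omega>))"
proof (rule wf_subset[OF wf_earlier_adjacent_pwit])
  assume "u \<in> tree_verts"
  then show "earlier_adjacent (below u) (\<lambda>e. X e \<omega>) \<subseteq> earlier_adjacent (edges pwit) (\<lambda>e. X e \<omega>)"
    using below_subset[of u] unfolding earlier_adjacent_def by auto
qed

lemma added_rdcp:
  assumes "nice \<omega>" "u \<in> tree_verts"
  shows "is_rdcp_edge_set (below u) (\<lambda>v. d v \<omega>) (\<lambda>e. X e \<omega>) (added \<omega> u)"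
  unfolding added_def
proof (rule is_rdcp_edge_set_rdcp_edges_wf[OF wf_below[OF assms]])
  fix e v assume "e \<in> below u" "v \<in> e"
  then have "v \<in> tree_verts" using below_subset[OF assms(2)] touching_edges(1) by blast
  then have "finite {f \<in> edges pwit. v \<in> f \<and> X f \<omega> < X e \<omega>}" by (rule finite_earlier_edges[OF assms(1)])
  then show "finite {f \<in> below u. v \<in> f \<and> X f \<omega> < X e \<omega>}"
    by (rule finite_subset[rotated]) (use below_subset[OF assms(2)] in auto)
qed

lemma added_iff:
  assumes "nice \<omega>" "u \<in> tree_verts" "e \<in> below u"
  shows "e \<in> added \<omega> u \<longleftrightarrow> (\<forall>v\<in>e. card {f \<in> added \<omega> u. v \<in> f \<and> X f \<omega> < X e \<omega>} < d v \<omega>)"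
    and "v \<in> e \<Longrightarrow> finite {f \<in> added \<omega> u. v \<in> f \<and> X f \<omega> < X e \<omega>}"
proof -
  note A = added_rdcp[OF assms(1,2)]
  have sub: "added \<omega> u \<subseteq> edges pwit" using A below_subset[OF assms(2)] unfolding is_rdcp_edge_set_def by blast
  show fin: "finite {f \<in> added \<omega> u. v \<in> f \<and> X f \<omega> < X e \<omega>}" if "v \<in> e" for v
  proof -
    have "v \<in> tree_verts" using below_subset[OF assms(2)] touching_edges(1) assms(3) that by blast
    then have "finite {f \<in> edges pwit. v \<in> f \<and> X f \<omega> < X e \<omega>}" by (rule finite_earlier_edges[OF assms(1)])
    then show ?thesis by (rule finite_subset[rotated]) (use sub in auto)
  qed
  show "e \<in> added \<omega> u \<longleftrightarrow> (\<forall>v\<in>e. card {f \<in> added \<omega> u. v \<in> f \<and> X f \<omega> < X e \<omega>} < d v \<omega>)"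
    using A assms(3) fin unfolding is_rdcp_edge_set_def by simp
qed

section \<open>Saturation of the vertices of the tree\<close>

lemma below_mono: "prefix u w \<Longrightarrow> w \<in> tree_verts \<Longrightarrow> below w \<subseteq> below u"
proof
  fix e assume w: "prefix u w" "w \<in> tree_verts" "e \<in> below w"
  obtain z where z: "w = u @ z" using w(1) by (auto simp: prefix_def)
  obtain i j where i: "i \<in> tree_verts" "1 \<le> j" "e = {w @ i, w @ i @ [j]}" using w(3) by (auto simp: below_def)
  have "z @ i \<in> tree_verts" using i(1) w(2) z by simp
  moreover have "e = {u @ (z @ i), u @ (z @ i) @ [j]}" using i(3) z by simp
  ultimately show "e \<in> below u" using i(2) unfolding below_def by blast
qed

lemma below_touching:
  assumes "u \<in> tree_verts" "f \<in> below u" "x \<in> f" "prefix v x" "v \<noteq> []"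
  shows "f \<in> below v \<or> f = {butlast v, v}"
proof -
  obtain i j where f: "i \<in> tree_verts" "1 \<le> j" "f = {u @ i, u @ i @ [j]}" using assms(2) by (auto simp: below_def)
  show ?thesis
  proof (cases "prefix v (u @ i)")
    case True
    then obtain z where z: "u @ i = v @ z" by (auto simp: prefix_def)
    moreover have "u @ i \<in> tree_verts" using assms(1) f(1) by simp
    ultimately have zT: "z \<in> tree_verts" by simp
    have "f = {v @ z, v @ z @ [j]}" using f(3) z by (metis append_assoc)
    then show ?thesis using zT f(2) unfolding below_def by blast
  next
    case False
    then have "x = (u @ i) @ [j]" using assms(3,4) f by auto
    then have "prefix v ((u @ i) @ [j])" using assms(4) by simp
    then have "v = (u @ i) @ [j]" using False unfolding prefix_snoc by argo
    moreover from this have "butlast v = u @ i" by (simp only: butlast_snoc)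
    ultimately show ?thesis using f by simp
  qed
qed

lemma added_subset: "nice \<omega> \<Longrightarrow> u \<in> tree_verts \<Longrightarrow> added \<omega> u \<subseteq> below u"
  using added_rdcp unfolding is_rdcp_edge_set_def by blast

lemma below_prefix: "e \<in> below v \<Longrightarrow> x \<in> e \<Longrightarrow> prefix v x"
  by (auto simp: below_def)

lemma below_child_edge:
  assumes "u \<in> tree_verts" "1 \<le> j"
  shows "{u, u @ [j]} \<in> below u"
  unfolding below_def using assms by (intro CollectI exI[of _ "[]"] exI[of _ j]) auto

text \<open>Before the edge above \<open>w @ [j]\<close> is tried, the subtree of this vertex is
  separated from the rest, so every surrounding process acts there like the process of the
  subtree.\<close>

lemma added_child_iff:
  assumes n: "nice \<omega>" and u: "u \<in> tree_verts" and w: "w \<in> tree_verts" "prefix u w" and j: "1 \<le> j"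
    and e: "e \<in> below (w @ [j])" "X e \<omega> < X {w, w @ [j]} \<omega>"
  shows "e \<in> added \<omega> u \<longleftrightarrow> e \<in> added \<omega> (w @ [j])"
  using wf_earlier_adjacent_pwit[OF n] e
proof (induction e rule: wf_induct_rule)
  case (less e)
  let ?v = "w @ [j]"
  have v: "?v \<in> tree_verts" using w j by simp
  have sub: "below ?v \<subseteq> below u" by (rule below_mono[OF _ v]) (use w(2) in \<open>auto intro: prefix_order.trans\<close>)
  have eu: "e \<in> below u" using less.prems(1) sub by blast
  have pw: "below u \<subseteq> edges pwit" by (rule below_subset[OF u])
  have eq: "{f \<in> added \<omega> u. x \<in> f \<and> X f \<omega> < X e \<omega>} = {f \<in> added \<omega> ?v. x \<in> f \<and> X f \<omega> < X e \<omega>}" if x: "x \<in> e" for x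
  proof -
    have IH: "f \<in> added \<omega> u \<longleftrightarrow> f \<in> added \<omega> ?v" if f: "f \<in> below ?v" "x \<in> f" "X f \<omega> < X e \<omega>" for f
    proof (rule less.IH)
      show "(f, e) \<in> earlier_adjacent (edges pwit) (\<lambda>e. X e \<omega>)"
        using f x eu sub pw unfolding earlier_adjacent_def by auto
    qed (use f less.prems in auto)
    have "f \<in> below ?v" if f: "f \<in> below u" "x \<in> f" "X f \<omega> < X e \<omega>" for f
    proof -
      have "prefix ?v x" by (rule below_prefix[OF less.prems(1) x])
      then have "f \<in> below ?v \<or> f = {butlast ?v, ?v}" by (intro below_touching[OF u f(1,2)]) auto
      then show ?thesis using f(3) less.prems(2) by auto
    qed
    then show ?thesis using IH added_subset[OF n u] added_subset[OF n v] by blast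
  qed
  show ?case
    using added_iff(1)[OF n u eu] added_iff(1)[OF n v less.prems(1)] eq by simp
qed

text \<open>If infinitely many child edges were added at \<open>v\<close>, one of them would come
  after \<open>d v \<omega>\<close> others and would have been rejected.\<close>

lemma finite_added_degree:
  assumes n: "nice \<omega>" and u: "u \<in> tree_verts" and v: "v \<in> tree_verts"
  shows "finite {f \<in> added \<omega> u. v \<in> f}"
proof -
  let ?C = "{j. 1 \<le> j \<and> {v, v @ [j]} \<in> added \<omega> u}" and ?e = "\<lambda>j. {v, v @ [j]}"
  have reg: "regular \<omega>" using n unfolding nice_def by blast
  have inj: "inj_on ?e A" for A by (auto simp: inj_on_def doubleton_eq_iff)
  have "finite ?C"
  proof (rule ccontr)
    assume inf: "infinite ?C"
    then obtain F where F: "F \<subseteq> ?C" "finite F" "card F = d v \<omega>" using infinite_arbitrarily_large by blast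
    obtain j where j: "j \<in> ?C" "Max (insert 0 F) < j" using inf infinite_nat_iff_unbounded by blast
    let ?A = "{f \<in> added \<omega> u. v \<in> f \<and> X f \<omega> < X (?e j) \<omega>}"
    have jb: "?e j \<in> below u" using j(1) added_subset[OF n u] by blast
    have "?e ` F \<subseteq> ?A"
    proof
      fix f assume "f \<in> ?e ` F"
      then obtain k where k: "k \<in> F" "f = ?e k" by blast
      have "k < j" using k(1) F(2) j(2) by auto
      then show "f \<in> ?A" using k F(1) regular_less[OF reg v, of k j] by auto
    qed
    moreover have "finite ?A" using added_iff(2)[OF n u jb, of v] by simp
    ultimately have "card (?e ` F) \<le> card ?A" by (intro card_mono)
    moreover have "card ?A < d v \<omega>" using added_iff(1)[OF n u jb] j(1) by auto
    ultimately show False using F(3) card_image[OF inj, of F] by simp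
  qed
  moreover have "{f \<in> added \<omega> u. v \<in> f} \<subseteq> insert {butlast v, v} (?e ` ?C)"
  proof
    fix f assume f: "f \<in> {f \<in> added \<omega> u. v \<in> f}"
    then have "f \<in> edges pwit" using added_subset[OF n u] below_subset[OF u] by blast
    then show "f \<in> insert {butlast v, v} (?e ` ?C)" using touching_edges(2)[of f v] f by blast
  qed
  ultimately show ?thesis by (meson finite_imageI finite_insert finite_subset)
qed

definition unsaturated :: "'q \<Rightarrow> nat list \<Rightarrow> nat list \<Rightarrow> bool" where
  "unsaturated \<omega> u v \<longleftrightarrow> card {f \<in> added \<omega> u. v \<in> f} < d v \<omega>"

text \<open>If \<open>u\<close> and a child are unsaturated forever, the child in its own subtree,
  then nothing blocks the edge between them when it is tried, and it is added. All these edges count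
  towards the degree of \<open>u\<close>, which stays below its constraint.\<close>

lemma unsaturated_children:
  assumes n: "nice \<omega>" and u: "u \<in> tree_verts" and uns: "unsaturated \<omega> u u"
  shows "finite {j. 1 \<le> j \<and> unsaturated \<omega> (u @ [j]) (u @ [j])}"
    and "card {j. 1 \<le> j \<and> unsaturated \<omega> (u @ [j]) (u @ [j])} < d u \<omega>"
proof -
  let ?J = "{j. 1 \<le> j \<and> unsaturated \<omega> (u @ [j]) (u @ [j])}" and ?e = "\<lambda>j. {u, u @ [j]}"
  have inj: "inj_on ?e ?J" by (auto simp: inj_on_def doubleton_eq_iff)
  have sub: "?e ` ?J \<subseteq> {f \<in> added \<omega> u. u \<in> f}"
  proof
    fix f assume "f \<in> ?e ` ?J"
    then obtain j where j: "1 \<le> j" "unsaturated \<omega> (u @ [j]) (u @ [j])" "f = ?e j" by blast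
    let ?v = "u @ [j]"
    have v: "?v \<in> tree_verts" using u j by simp
    have fb: "f \<in> below u" using below_child_edge[OF u j(1)] j(3) by simp
    have "card {g \<in> added \<omega> u. u \<in> g \<and> X g \<omega> < X f \<omega>} \<le> card {g \<in> added \<omega> u. u \<in> g}"
      by (intro card_mono finite_added_degree[OF n u u]) auto
    then have 1: "card {g \<in> added \<omega> u. u \<in> g \<and> X g \<omega> < X f \<omega>} < d u \<omega>"
      using uns unfolding unsaturated_def by linarith
    have "{g \<in> added \<omega> u. ?v \<in> g \<and> X g \<omega> < X f \<omega>} \<subseteq> {g \<in> added \<omega> ?v. ?v \<in> g}"
    proof
      fix g assume g: "g \<in> {g \<in> added \<omega> u. ?v \<in> g \<and> X g \<omega> < X f \<omega>}"
      then have "g \<in> below ?v \<or> g = {butlast ?v, ?v}"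
        using added_subset[OF n u] by (intro below_touching[OF u, of g ?v]) auto
      then have "g \<in> below ?v" using g j(3) by auto
      then show "g \<in> {g \<in> added \<omega> ?v. ?v \<in> g}"
        using added_child_iff[OF n u u _ j(1), of g] g j(3) by auto
    qed
    then have "card {g \<in> added \<omega> u. ?v \<in> g \<and> X g \<omega> < X f \<omega>} \<le> card {g \<in> added \<omega> ?v. ?v \<in> g}"
      by (intro card_mono finite_added_degree[OF n v v])
    then have "card {g \<in> added \<omega> u. ?v \<in> g \<and> X g \<omega> < X f \<omega>} < d ?v \<omega>"
      using j(2) unfolding unsaturated_def by linarith
    then have "f \<in> added \<omega> u" using added_iff(1)[OF n u fb] 1 j(3) by simp
    then show "f \<in> {f \<in> added \<omega> u. u \<in> f}" using j(3) by simp
  qed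
  have fin: "finite {f \<in> added \<omega> u. u \<in> f}" by (rule finite_added_degree[OF n u u])
  show "finite ?J" using finite_subset[OF sub fin] inj by (rule finite_imageD)
  have "card ?J = card (?e ` ?J)" using inj by (simp add: card_image)
  also have "\<dots> \<le> card {f \<in> added \<omega> u. u \<in> f}" by (rule card_mono[OF fin sub])
  finally show "card ?J < d u \<omega>" using uns unfolding unsaturated_def by linarith
qed

text \<open>In the full tree, the edge to the parent may only make a vertex reach its constraint
  earlier.\<close>

lemma saturated_full_tree:
  assumes n: "nice \<omega>" and u: "u \<in> tree_verts" and sat: "\<not> unsaturated \<omega> u u"
  shows "\<not> unsaturated \<omega> [] u"
proof
  assume uns: "unsaturated \<omega> [] u"
  have nil: "[] \<in> tree_verts" by simp
  have "{f \<in> added \<omega> u. u \<in> f} \<subseteq> {f \<in> added \<omega> []. u \<in> f}"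
  proof
    fix f assume f: "f \<in> {f \<in> added \<omega> u. u \<in> f}"
    then have fb: "f \<in> below u" using added_subset[OF n u] by blast
    then obtain j where j: "1 \<le> j" "f = {u, u @ [j]}"
      using f below_edges[of f u "[]"] by auto
    let ?v = "u @ [j]"
    have v: "?v \<in> tree_verts" using u j by simp
    have fb': "f \<in> below []" using fb below_mono[of "[]" u] u by auto
    have "card {g \<in> added \<omega> []. u \<in> g \<and> X g \<omega> < X f \<omega>} \<le> card {g \<in> added \<omega> []. u \<in> g}"
      by (intro card_mono finite_added_degree[OF n nil u]) auto
    then have 1: "card {g \<in> added \<omega> []. u \<in> g \<and> X g \<omega> < X f \<omega>} < d u \<omega>"
      using uns unfolding unsaturated_def by linarith
    have "{g \<in> added \<omega> []. ?v \<in> g \<and> X g \<omega> < X f \<omega>} \<subseteq> {g \<in> added \<omega> u. ?v \<in> g \<and> X g \<omega> < X f \<omega>}"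
    proof
      fix g assume g: "g \<in> {g \<in> added \<omega> []. ?v \<in> g \<and> X g \<omega> < X f \<omega>}"
      then have "g \<in> below ?v \<or> g = {butlast ?v, ?v}"
        using added_subset[OF n nil] by (intro below_touching[OF nil, of g ?v]) auto
      then have "g \<in> below ?v" using g j(2) by auto
      then show "g \<in> {g \<in> added \<omega> u. ?v \<in> g \<and> X g \<omega> < X f \<omega>}"
        using added_child_iff[OF n nil u _ j(1), of g] added_child_iff[OF n u u _ j(1), of g] g j(2) by auto
    qed
    then have "card {g \<in> added \<omega> []. ?v \<in> g \<and> X g \<omega> < X f \<omega>} \<le> card {g \<in> added \<omega> u. ?v \<in> g \<and> X g \<omega> < X f \<omega>}"
      using added_iff(2)[OF n u fb, of ?v] j(2) by (intro card_mono) auto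
    also have "\<dots> < d ?v \<omega>" using added_iff(1)[OF n u fb] f j(2) by auto
    finally have "f \<in> added \<omega> []" using added_iff(1)[OF n nil fb'] 1 j(2) by simp
    then show "f \<in> {f \<in> added \<omega> []. u \<in> f}" using f by simp
  qed
  then have "card {f \<in> added \<omega> u. u \<in> f} \<le> card {f \<in> added \<omega> []. u \<in> f}"
    by (intro card_mono finite_added_degree[OF n nil u])
  then show False using uns sat unfolding unsaturated_def by linarith
qed

definition saturated_root :: "(nat list set \<times> (nat list \<Rightarrow> nat)) set \<Rightarrow> (nat list set \<times> (nat list \<Rightarrow> nat)) set" where
  "saturated_root F = {(S, D) \<in> F. D [] \<le> card {f \<in> cell_rdcp S D. [] \<in> f}}"

text \<open>With \<open>R = 0\<close> only the edges at the root have to be decided, which every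
  good shape does.\<close>

lemma shape_root_degree:
  assumes n: "nice \<omega>" and u: "u \<in> tree_verts" and T: "0 \<le> T" and m: "0 < m"
    and SD: "(S, D) \<in> good_shapes 0 m K b" "\<omega> \<in> shape_event T m K u S D"
  shows "card {f \<in> added \<omega> u. u \<in> f \<and> X f \<omega> \<le> T} = card {f \<in> cell_rdcp S D. [] \<in> f}" "d u \<omega> = D []"
proof -
  have S: "cell_tree m K S" "good_tree 0 K S" using SD by (auto simp: good_shapes_def)
  have nil: "[] \<in> S" using S(1) by (simp add: cell_tree_def)
  have reg: "regular \<omega>" using n by (simp add: nice_def)
  have ex: "explored T m K (below u) (\<lambda>v. d v \<omega>) (\<lambda>e. X e \<omega>) u S D (\<lambda>i. u @ rank_path S i)"
    by (rule shape_event_explored[OF reg u S(1) T m SD(2)])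
  show "card {f \<in> added \<omega> u. u \<in> f \<and> X f \<omega> \<le> T} = card {f \<in> cell_rdcp S D. [] \<in> f}"
    using cell_rdcp_degree(2)[OF S ex T added_rdcp[OF n u] nil] by simp
  show "d u \<omega> = D []" using ex nil unfolding explored_def by fastforce
qed

lemma saturated_root_imp:
  assumes n: "nice \<omega>" and u: "u \<in> tree_verts" and T: "0 \<le> T" and m: "0 < m"
    and "\<omega> \<in> some_shape T m K u (saturated_root (good_shapes 0 m K b))"
  shows "\<not> unsaturated \<omega> u u"
proof -
  obtain S D where SD: "(S, D) \<in> good_shapes 0 m K b" "\<omega> \<in> shape_event T m K u S D"
    "D [] \<le> card {f \<in> cell_rdcp S D. [] \<in> f}"
    using assms(5) unfolding some_shape_def saturated_root_def by blast
  have "d u \<omega> \<le> card {f \<in> added \<omega> u. u \<in> f \<and> X f \<omega> \<le> T}"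
    using shape_root_degree[OF n u T m SD(1,2)] SD(3) by simp
  also have "\<dots> \<le> card {f \<in> added \<omega> u. u \<in> f}"
    by (intro card_mono finite_added_degree[OF n u u]) auto
  finally show ?thesis unfolding unsaturated_def by simp
qed

text \<open>Only finitely many edges are added at \<open>v\<close>, so all of them are present from
  some integer time on.\<close>

lemma saturated_by_some_time:
  assumes n: "nice \<omega>" and u: "u \<in> tree_verts" and v: "v \<in> tree_verts" and sat: "\<not> unsaturated \<omega> u v"
  shows "\<forall>\<^sub>F N in sequentially. d v \<omega> \<le> card {f \<in> added \<omega> u. v \<in> f \<and> X f \<omega> \<le> real N}"
proof -
  let ?A = "{f \<in> added \<omega> u. v \<in> f}"
  have fin: "finite ?A" by (rule finite_added_degree[OF n u v])
  obtain N0 :: nat where N0: "Max (insert 0 ((\<lambda>f. X f \<omega>) ` ?A)) \<le> real N0" using real_arch_simple by blast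
  have "{f \<in> added \<omega> u. v \<in> f \<and> X f \<omega> \<le> real N} = ?A" if "N0 \<le> N" for N
  proof -
    have "X f \<omega> \<le> real N" if "f \<in> ?A" for f
    proof -
      have "X f \<omega> \<le> Max (insert 0 ((\<lambda>f. X f \<omega>) ` ?A))" using fin that by (intro Max_ge) auto
      then show ?thesis using N0 \<open>N0 \<le> N\<close> by linarith
    qed
    then show ?thesis by auto
  qed
  then show ?thesis
    using sat unfolding unsaturated_def eventually_sequentially by (intro exI[of _ N0]) auto
qed

text \<open>Shapes at incomparable vertices are independent, and the sum over all assignments of
  shapes from \<open>F\<close> to the vertices of \<open>J\<close> factorises into a power.\<close>

lemma prob_all_saturated_root_le:
  assumes J: "finite J" "J \<subseteq> tree_verts" "\<And>u v. u \<in> J \<Longrightarrow> v \<in> J \<Longrightarrow> prefix u v \<Longrightarrow> u = v"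
    and F: "finite F" "F \<subseteq> shapes m K" and T: "0 \<le> T" and m: "0 < m"
  shows "{\<omega> \<in> space P. \<forall>u\<in>J. \<omega> \<in> some_shape T m K u F} \<in> events"
    and "prob {\<omega> \<in> space P. \<forall>u\<in>J. \<omega> \<in> some_shape T m K u F} \<le> weight_sum p T m K F ^ card J"
proof -
  let ?E = "\<lambda>g. {\<omega> \<in> space P. \<forall>u\<in>J. \<omega> \<in> shape_event T m K u (fst (g u)) (snd (g u))}"
  have S: "cell_tree m K (fst s)" if "s \<in> F" for s using that F by (auto simp: shapes_def)
  have ev: "some_shape T m K u F \<in> events" if "u \<in> J" for u using prob_some_shape(1)[OF _ F T m] that J(2) by blast
  show "{\<omega> \<in> space P. \<forall>u\<in>J. \<omega> \<in> some_shape T m K u F} \<in> events"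
    using ev J(1) by (intro sets.sets_Collect_finite_All) (auto simp: Int_def[symmetric] Collect_conj_eq)
  have g: "?E g \<in> events \<and> prob (?E g) = (\<Prod>u\<in>J. shape_weight p T m K (fst (g u)) (snd (g u)))" if "g \<in> J \<rightarrow>\<^sub>E F" for g
  proof -
    have "cell_tree m K (fst (g u))" if "u \<in> J" for u
      using S PiE_mem[OF \<open>g \<in> J \<rightarrow>\<^sub>E F\<close> that] by blast
    then show ?thesis
      using prob_shape_events[OF J _ T m, of K "\<lambda>u. fst (g u)" "\<lambda>u. snd (g u)"] by blast
  qed
  have fin: "finite (J \<rightarrow>\<^sub>E F)" using J(1) F(1) by (intro finite_PiE) auto
  have "{\<omega> \<in> space P. \<forall>u\<in>J. \<omega> \<in> some_shape T m K u F} \<subseteq> (\<Union>g\<in>J \<rightarrow>\<^sub>E F. ?E g)"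
  proof
    fix \<omega> assume \<omega>: "\<omega> \<in> {\<omega> \<in> space P. \<forall>u\<in>J. \<omega> \<in> some_shape T m K u F}"
    then have "\<forall>u\<in>J. \<exists>s. s \<in> F \<and> \<omega> \<in> shape_event T m K u (fst s) (snd s)"
      unfolding some_shape_def by fastforce
    from bchoice[OF this] obtain g where g: "\<forall>u\<in>J. g u \<in> F \<and> \<omega> \<in> shape_event T m K u (fst (g u)) (snd (g u))" ..
    then have "restrict g J \<in> J \<rightarrow>\<^sub>E F" "\<omega> \<in> ?E (restrict g J)" using \<omega> by auto
    then show "\<omega> \<in> (\<Union>g\<in>J \<rightarrow>\<^sub>E F. ?E g)" by blast
  qed
  then have "prob {\<omega> \<in> space P. \<forall>u\<in>J. \<omega> \<in> some_shape T m K u F} \<le> prob (\<Union>g\<in>J \<rightarrow>\<^sub>E F. ?E g)"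
    using g fin by (intro finite_measure_mono sets.finite_UN) auto
  also have "\<dots> \<le> (\<Sum>g\<in>J \<rightarrow>\<^sub>E F. prob (?E g))"
    using g fin by (intro finite_measure_subadditive_finite) auto
  also have "\<dots> = (\<Sum>g\<in>J \<rightarrow>\<^sub>E F. \<Prod>u\<in>J. shape_weight p T m K (fst (g u)) (snd (g u)))"
    using g by (intro sum.cong) auto
  also have "\<dots> = (\<Prod>u\<in>J. \<Sum>s\<in>F. shape_weight p T m K (fst s) (snd s))"
    using J(1) F(1) by (subst prod_sum_PiE) auto
  also have "\<dots> = weight_sum p T m K F ^ card J"
    by (simp add: weight_sum_def case_prod_beta)
  finally show "prob {\<omega> \<in> space P. \<forall>u\<in>J. \<omega> \<in> some_shape T m K u F} \<le> weight_sum p T m K F ^ card J" .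
qed

lemma finite_saturated_root: "finite F \<Longrightarrow> finite (saturated_root F)"
  by (rule finite_subset[of _ F]) (auto simp: saturated_root_def)

lemma saturated_root_sub: "saturated_root F \<subseteq> F"
  by (auto simp: saturated_root_def)

text \<open>Suppose that a root stays unsaturated forever with positive probability. Then almost surely
  infinitely many children of the root are unsaturated forever in their own subtrees. If the root
  were unsaturated forever, then the edges to all of these would be added.\<close>

lemma AE_saturated: "AE \<omega> in P. \<forall>u\<in>tree_verts. \<not> unsaturated \<omega> u u"
proof -
  have "\<forall>n::nat. \<exists>mKb. 0 < fst mKb \<and> 1 - inverse (real (Suc n)) \<le>
      weight_sum p (real n) (fst mKb) (fst (snd mKb)) (good_shapes 0 (fst mKb) (fst (snd mKb)) (snd (snd mKb)))"
  proof
    fix n :: nat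
    obtain m K b where "0 < m" "1 - inverse (real (Suc n)) \<le> weight_sum p (real n) m K (good_shapes 0 m K b)"
      using good_shapes_mass[of "real n" "inverse (real (Suc n))" 0] by auto
    then show "\<exists>mKb. 0 < fst mKb \<and> 1 - inverse (real (Suc n)) \<le>
      weight_sum p (real n) (fst mKb) (fst (snd mKb)) (good_shapes 0 (fst mKb) (fst (snd mKb)) (snd (snd mKb)))"
      by (intro exI[of _ "(m, K, b)"]) simp
  qed
  from choice[OF this] obtain mKb :: "nat \<Rightarrow> nat \<times> nat \<times> nat" where mKb: "\<forall>n. 0 < fst (mKb n) \<and> 1 - inverse (real (Suc n)) \<le>
      weight_sum p (real n) (fst (mKb n)) (fst (snd (mKb n)))
        (good_shapes 0 (fst (mKb n)) (fst (snd (mKb n))) (snd (snd (mKb n))))" ..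
  define m where "m = (\<lambda>n. fst (mKb n))"
  define K where "K = (\<lambda>n. fst (snd (mKb n)))"
  define F where "F = (\<lambda>n. good_shapes 0 (m n) (K n) (snd (snd (mKb n))))"
  define G where "G = (\<lambda>n. saturated_root (F n))"
  \<comment> \<open>The probability that a shape in \<open>F n\<close> shows the root to be
    saturated by time \<open>n\<close>. The aim is that it is eventually close to
    \<open>1\<close>.\<close>
  define q where "q = (\<lambda>n. weight_sum p (real n) (m n) (K n) (G n))"
  define sh where "sh = (\<lambda>n. some_shape (real n) (m n) (K n))"
  have m: "0 < m n" and mass: "1 - inverse (real (Suc n)) \<le> weight_sum p (real n) (m n) (K n) (F n)" for n
    using mKb unfolding m_def K_def F_def by blast+
  have F: "finite (F n)" "F n \<subseteq> shapes (m n) (K n)" for n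
    unfolding F_def by (rule finite_good_shapes, rule good_shapes_sub)
  have G: "finite (G n)" "G n \<subseteq> shapes (m n) (K n)" for n
    unfolding G_def using finite_saturated_root F saturated_root_sub by blast+
  have shF: "sh n u (F n) \<in> events" "1 - inverse (real (Suc n)) \<le> prob (sh n u (F n))" if "u \<in> tree_verts" for n u
    using prob_some_shape[OF that F[of n] _ m[of n], of "real n"] mass[of n] unfolding sh_def by auto
  have shG: "sh n u (G n) \<in> events" "prob (sh n u (G n)) = q n" if "u \<in> tree_verts" for n u
    using prob_some_shape[OF that G[of n] _ m[of n], of "real n"] unfolding sh_def q_def by auto
  have q0: "0 \<le> q n" for n unfolding q_def by (rule weight_sum_nonneg) simp
  \<comment> \<open>Saturation happens by some finite time. From then on, a shape found in
    \<open>F n\<close> also lies in \<open>G n\<close>.\<close>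
  have catch: "\<forall>\<^sub>F n in sequentially. \<omega> \<in> sh n u (F n) \<longrightarrow> \<omega> \<in> sh n u (G n)"
    if n: "nice \<omega>" and u: "u \<in> tree_verts" and sat: "\<not> unsaturated \<omega> u u" for \<omega> u
    using saturated_by_some_time[OF n u u sat]
  proof eventually_elim
    case (elim N)
    show ?case
    proof
      assume "\<omega> \<in> sh N u (F N)"
      then obtain S D where SD: "(S, D) \<in> F N" "\<omega> \<in> shape_event (real N) (m N) (K N) u S D"
        unfolding sh_def some_shape_def by blast
      have "D [] \<le> card {f \<in> cell_rdcp S D. [] \<in> f}"
        using shape_root_degree[OF n u _ m SD(1)[unfolded F_def] SD(2)] elim by simp
      then show "\<omega> \<in> sh N u (G N)"
        using SD unfolding sh_def some_shape_def G_def saturated_root_def by blast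
    qed
  qed
  \<comment> \<open>Either all vertices of \<open>J\<close> are seen to be saturated at time
    \<open>n\<close>, or the shape of one of them is missed. Joint saturation of \<open>J\<close>
    forces this for all large \<open>n\<close>, so its probability is bounded through the limit
    inferior.\<close>
  define caught where "caught = (\<lambda>J n. {\<omega> \<in> space P. \<forall>u\<in>J. \<omega> \<in> sh n u (G n)} \<union> (\<Union>u\<in>J. space P - sh n u (F n)))"
  have caught: "caught J n \<in> events" "prob (caught J n) \<le> q n ^ card J + real (card J) * inverse (real (Suc n))"
    if J: "finite J" "J \<subseteq> tree_verts" "\<And>u v. u \<in> J \<Longrightarrow> v \<in> J \<Longrightarrow> prefix u v \<Longrightarrow> u = v" for J n
  proof -
    let ?A = "{\<omega> \<in> space P. \<forall>u\<in>J. \<omega> \<in> sh n u (G n)}" and ?B = "\<Union>u\<in>J. space P - sh n u (F n)"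
    have A: "?A \<in> events" "prob ?A \<le> q n ^ card J"
      using prob_all_saturated_root_le[OF J G[of n] _ m[of n], of "real n"] unfolding sh_def q_def by auto
    have cmp: "space P - sh n u (F n) \<in> events" if "u \<in> J" for u
      using shF(1)[of u n] J(2) that by (intro sets.compl_sets) blast
    then have B: "?B \<in> events" using J(1) by (intro sets.finite_UN)
    show "caught J n \<in> events" unfolding caught_def using A B by blast
    have "prob ?B \<le> (\<Sum>u\<in>J. prob (space P - sh n u (F n)))"
      using cmp J(1) by (intro finite_measure_subadditive_finite) auto
    also have "\<dots> \<le> (\<Sum>u\<in>J. inverse (real (Suc n)))"
    proof (rule sum_mono)
      fix u assume "u \<in> J"
      then have u: "u \<in> tree_verts" using J by blast
      show "prob (space P - sh n u (F n)) \<le> inverse (real (Suc n))"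
        using prob_compl[OF shF(1)[OF u, of n]] shF(2)[OF u, of n] by simp
    qed
    finally have "prob ?B \<le> real (card J) * inverse (real (Suc n))" by simp
    moreover have "prob (caught J n) \<le> prob ?A + prob ?B"
      unfolding caught_def using A B by (intro measure_Un_le)
    ultimately show "prob (caught J n) \<le> q n ^ card J + real (card J) * inverse (real (Suc n))"
      using A(2) by linarith
  qed
  have caught_limit: "\<omega> \<in> (\<Union>N. \<Inter>n\<in>{N..}. caught J n)"
    if n: "nice \<omega>" and J: "finite J" "J \<subseteq> tree_verts" and sat: "\<And>u. u \<in> J \<Longrightarrow> \<not> unsaturated \<omega> u u" for J \<omega>
  proof -
    have "\<forall>\<^sub>F n in sequentially. \<forall>u\<in>J. \<omega> \<in> sh n u (F n) \<longrightarrow> \<omega> \<in> sh n u (G n)"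
    proof (rule eventually_ball_finite[OF J(1)], rule ballI)
      fix u assume "u \<in> J"
      then show "\<forall>\<^sub>F n in sequentially. \<omega> \<in> sh n u (F n) \<longrightarrow> \<omega> \<in> sh n u (G n)"
        using J(2) sat by (intro catch[OF n]) blast+
    qed
    then obtain N where N: "\<And>k. N \<le> k \<Longrightarrow> \<forall>u\<in>J. \<omega> \<in> sh k u (F k) \<longrightarrow> \<omega> \<in> sh k u (G k)"
      unfolding eventually_sequentially by blast
    have "\<omega> \<in> space P" using n by (simp add: nice_def)
    then have "\<omega> \<in> caught J k" if "N \<le> k" for k using N[OF that] unfolding caught_def by blast
    then show ?thesis by blast
  qed
  have inv: "(\<lambda>n. inverse (real (Suc n))) \<longlonglongrightarrow> 0" by (rule LIMSEQ_inverse_real_of_nat)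
  have q1: "\<forall>\<^sub>F n in sequentially. 1 - \<epsilon> < q n" if \<epsilon>: "0 < \<epsilon>" "\<epsilon> \<le> 1" for \<epsilon>
  proof (rule ccontr)
    assume "\<not> (\<forall>\<^sub>F n in sequentially. 1 - \<epsilon> < q n)"
    then have freq: "\<exists>\<^sub>F n in sequentially. q n \<le> 1 - \<epsilon>"
      by (simp add: frequently_def not_le)
    have root: "AE \<omega> in P. \<not> unsaturated \<omega> [] []"
    proof (rule AE_small_exceptions)
      fix \<eta> :: real assume \<eta>: "0 < \<eta>"
      have "(\<lambda>b. measure (measure_pmf p) {b<..}) \<longlonglongrightarrow> measure (measure_pmf p) (\<Inter>b. {b<..})"
        by (intro measure_pmf.finite_Lim_measure_decseq) (auto simp: decseq_def)
      moreover have "(\<Inter>b. {b<..}) = ({} :: nat set)" by auto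
      ultimately have "(\<lambda>b. measure (measure_pmf p) {b<..}) \<longlonglongrightarrow> 0" by simp
      then have "\<forall>\<^sub>F b in sequentially. measure (measure_pmf p) {b<..} < \<eta> / 2"
        using \<eta> by (intro order_tendstoD(2)) auto
      then obtain k where k: "measure (measure_pmf p) {k<..} < \<eta> / 2" by (auto dest: eventually_happens)
      \<comment> \<open>There will be \<open>k + 1\<close> exceptional events of probability at most
        \<open>2 * \<delta>\<close>, together at most \<open>\<eta> / 2\<close>. The other half of
        \<open>\<eta>\<close> pays for a root constraint above \<open>k\<close>.\<close>
      define \<delta> where "\<delta> = \<eta> / (4 * real (Suc k))"
      have \<delta>: "0 < \<delta>" using \<eta> by (simp add: \<delta>_def)
      have "(\<lambda>l. (1 - \<epsilon>) ^ l) \<longlonglongrightarrow> 0" using \<epsilon> by (intro LIMSEQ_realpow_zero) auto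
      then have "\<forall>\<^sub>F l in sequentially. (1 - \<epsilon>) ^ l < \<delta>" using \<delta> by (intro order_tendstoD(2)) auto
      then obtain l where l: "(1 - \<epsilon>) ^ l < \<delta>" by (auto dest: eventually_happens)
      \<comment> \<open>Blocks of \<open>l\<close> children, disjoint for different
        \<open>b\<close>. Outside the exceptional events each of \<open>k + 1\<close> blocks
        contains an unsaturated child, whereas an unsaturated root with constraint at most
        \<open>k\<close> has fewer than \<open>k\<close> of them.\<close>
      define J where "J = (\<lambda>b. (\<lambda>i. [Suc (b * l + i)]) ` {..<l})"
      have J: "finite (J b)" "J b \<subseteq> tree_verts" "\<And>u v. u \<in> J b \<Longrightarrow> v \<in> J b \<Longrightarrow> prefix u v \<Longrightarrow> u = v" "card (J b) = l" for b
        unfolding J_def by (auto simp: card_image inj_on_def)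
      have "(\<lambda>n. real l * inverse (real (Suc n))) \<longlonglongrightarrow> real l * 0" by (intro tendsto_intros inv)
      then have "\<forall>\<^sub>F n in sequentially. real l * inverse (real (Suc n)) < \<delta>"
        using \<delta> by (intro order_tendstoD(2)) auto
      then have freq2: "\<exists>\<^sub>F n in sequentially. q n \<le> 1 - \<epsilon> \<and> real l * inverse (real (Suc n)) < \<delta>"
        using freq by (rule frequently_eventually_frequently[rotated])
      have freqJ: "\<exists>\<^sub>F n in sequentially. prob (caught (J b) n) \<le> 2 * \<delta>" for b
        using freq2
      proof (rule frequently_elim1)
        fix n assume n: "q n \<le> 1 - \<epsilon> \<and> real l * inverse (real (Suc n)) < \<delta>"
        have "prob (caught (J b) n) \<le> q n ^ card (J b) + real (card (J b)) * inverse (real (Suc n))"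
          by (rule caught(2)) (rule J(1), rule J(2), erule (2) J(3))
        then have "prob (caught (J b) n) \<le> q n ^ l + real l * inverse (real (Suc n))"
          unfolding J(4) .
        moreover have "q n ^ l \<le> (1 - \<epsilon>) ^ l" using n q0 by (intro power_mono) auto
        ultimately show "prob (caught (J b) n) \<le> 2 * \<delta>" using n l by linarith
      qed
      let ?L = "\<lambda>b. \<Union>N. \<Inter>n\<in>{N..}. caught (J b) n"
      have Jev: "caught (J b) n \<in> events" for b n
        by (rule caught(1)) (rule J(1), rule J(2), erule (2) J(3))
      have L: "?L b \<in> events" "prob (?L b) \<le> 2 * \<delta>" for b
        using prob_liminf_le[OF Jev freqJ] by blast+
      let ?E = "{\<omega> \<in> space P. d [] \<omega> \<in> {k<..}} \<union> (\<Union>b\<le>k. ?L b)"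
      have Ed: "{\<omega> \<in> space P. d [] \<omega> \<in> {k<..}} \<in> events"
        using d_vertex_events vertex_events_sub[of "[]"] by blast
      have EL: "(\<Union>b\<le>k. ?L b) \<in> events" by (rule sets.finite_UN[OF finite_atMost L(1)])
      have "prob (\<Union>b\<le>k. ?L b) \<le> (\<Sum>b\<le>k. prob (?L b))"
        using L(1) by (intro finite_measure_subadditive_finite) blast+
      also have "\<dots> \<le> (\<Sum>b\<le>k. 2 * \<delta>)" by (intro sum_mono L(2))
      also have "\<dots> = \<eta> / 2" by (simp add: \<delta>_def field_simps)
      finally have "prob (\<Union>b\<le>k. ?L b) \<le> \<eta> / 2" .
      moreover have "prob {\<omega> \<in> space P. d [] \<omega> \<in> {k<..}} \<le> \<eta> / 2" using prob_d[of "[]" "{k<..}"] k by simp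
      moreover have "prob ?E \<le> prob {\<omega> \<in> space P. d [] \<omega> \<in> {k<..}} + prob (\<Union>b\<le>k. ?L b)"
        using Ed EL by (rule measure_Un_le)
      ultimately have PE: "prob ?E \<le> \<eta>" by linarith
      have "AE \<omega> in P. \<not> unsaturated \<omega> [] [] \<or> \<omega> \<in> ?E"
        using AE_nice
      proof (rule AE_mp, intro AE_I2 impI)
        fix \<omega> assume n: "nice \<omega>" and sp: "\<omega> \<in> space P"
        show "\<not> unsaturated \<omega> [] [] \<or> \<omega> \<in> ?E"
        proof (rule ccontr)
          assume c: "\<not> (\<not> unsaturated \<omega> [] [] \<or> \<omega> \<in> ?E)"
          then have uns: "unsaturated \<omega> [] []" and dk: "d [] \<omega> \<le> k" and nL: "\<And>b. b \<le> k \<Longrightarrow> \<omega> \<notin> ?L b"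
            using sp by (auto simp: not_less)
          let ?U = "{j. 1 \<le> j \<and> unsaturated \<omega> [j] [j]}"
          have "\<forall>b\<in>{..k}. \<exists>i. i < l \<and> unsaturated \<omega> [Suc (b * l + i)] [Suc (b * l + i)]"
          proof
            fix b assume "b \<in> {..k}"
            then have "\<omega> \<notin> ?L b" using nL by simp
            then obtain u where "u \<in> J b" "unsaturated \<omega> u u" using caught_limit[OF n J(1,2)] by blast
            then show "\<exists>i. i < l \<and> unsaturated \<omega> [Suc (b * l + i)] [Suc (b * l + i)]"
              unfolding J_def by blast
          qed
          from bchoice[OF this] obtain i where i: "\<forall>b\<in>{..k}. i b < l \<and> unsaturated \<omega> [Suc (b * l + i b)] [Suc (b * l + i b)]" ..
          have "inj_on (\<lambda>b. Suc (b * l + i b)) {..k}"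
          proof (rule inj_onI)
            fix a b assume ab: "a \<in> {..k}" "b \<in> {..k}" "Suc (a * l + i a) = Suc (b * l + i b)"
            then have il: "i a < l" "i b < l" using i by blast+
            have "(a * l + i a) div l = (b * l + i b) div l" using ab(3) by simp
            then show "a = b" using il by simp
          qed
          then have "card {..k} = card ((\<lambda>b. Suc (b * l + i b)) ` {..k})" by (simp add: card_image)
          also have "\<dots> \<le> card ?U"
            using i unsaturated_children(1)[OF n _ uns] by (intro card_mono) auto
          also have "\<dots> < d [] \<omega>" using unsaturated_children(2)[OF n _ uns] by simp
          finally show False using dk by simp
        qed
      qed
      then show "\<exists>E\<in>events. prob E \<le> \<eta> \<and> (AE \<omega> in P. \<not> unsaturated \<omega> [] [] \<or> \<omega> \<in> E)"
        using PE Ed EL by (intro bexI[of _ ?E] conjI sets.Un)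
    qed
    \<comment> \<open>Now \<open>J\<close> is the root alone: its almost sure saturation means that
      it is caught at all large times, against the bound \<open>1 - \<epsilon> / 2\<close>.\<close>
    have J: "finite {[] :: nat list}" "{[]} \<subseteq> tree_verts" "\<And>u v. u \<in> {[] :: nat list} \<Longrightarrow> v \<in> {[]} \<Longrightarrow> prefix u v \<Longrightarrow> u = v"
      by auto
    let ?L = "\<Union>N. \<Inter>n\<in>{N..}. caught {[]} n"
    have "\<forall>\<^sub>F n in sequentially. inverse (real (Suc n)) < \<epsilon> / 2"
      using \<epsilon> inv by (intro order_tendstoD(2)) auto
    then have "\<exists>\<^sub>F n in sequentially. q n \<le> 1 - \<epsilon> \<and> inverse (real (Suc n)) < \<epsilon> / 2"
      using freq by (rule frequently_eventually_frequently[rotated])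
    then have "\<exists>\<^sub>F n in sequentially. prob (caught {[]} n) \<le> 1 - \<epsilon> / 2"
    proof (rule frequently_elim1)
      fix n assume n: "q n \<le> 1 - \<epsilon> \<and> inverse (real (Suc n)) < \<epsilon> / 2"
      have "prob (caught {[]} n) \<le> q n + inverse (real (Suc n))"
        using caught(2)[OF J, of n] by simp
      then show "prob (caught {[]} n) \<le> 1 - \<epsilon> / 2" using n by linarith
    qed
    from prob_liminf_le[OF caught(1)[OF J] this]
    have L: "?L \<in> events" "prob ?L \<le> 1 - \<epsilon> / 2" by simp_all
    have "AE \<omega> in P. \<omega> \<in> ?L"
      using AE_nice root
    proof eventually_elim
      case (elim \<omega>)
      then show ?case by (intro caught_limit J) auto
    qed
    then have "prob ?L = 1" using L(1) by (intro prob_eq_1[THEN iffD2])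
    then show False using L(2) \<epsilon> by simp
  qed
  \<comment> \<open>The probability \<open>q n\<close> is the same at every vertex, and suitable
    \<open>n\<close> make it as close to \<open>1\<close> as desired.\<close>
  have "AE \<omega> in P. \<not> unsaturated \<omega> u u" if u: "u \<in> tree_verts" for u
  proof (rule AE_small_exceptions)
    fix \<eta> :: real assume \<eta>: "0 < \<eta>"
    then obtain n where n: "1 - min \<eta> 1 < q n" using q1[of "min \<eta> 1"] by (auto dest: eventually_happens)
    let ?E = "space P - sh n u (G n)"
    have "prob ?E \<le> \<eta>" using prob_compl[OF shG(1)[OF u, of n]] shG(2)[OF u, of n] n by simp
    moreover have "AE \<omega> in P. \<not> unsaturated \<omega> u u \<or> \<omega> \<in> ?E"
      using AE_nice
    proof (rule AE_mp, intro AE_I2 impI)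
      fix \<omega> assume "nice \<omega>" "\<omega> \<in> space P"
      then show "\<not> unsaturated \<omega> u u \<or> \<omega> \<in> ?E"
        using saturated_root_imp[OF _ u _ m[of n], of \<omega> "real n" "K n" "snd (snd (mKb n))"]
        unfolding sh_def G_def F_def by auto
    qed
    moreover have "?E \<in> events" using shG(1)[OF u] by blast
    ultimately show "\<exists>E\<in>events. prob E \<le> \<eta> \<and> (AE \<omega> in P. \<not> unsaturated \<omega> u u \<or> \<omega> \<in> E)"
      by (intro bexI[of _ ?E] conjI)
  qed
  then show ?thesis by (simp add: AE_ball_countable)
qed

end

section \<open>The limit theorem\<close>

text \<open>This locates the ball of the cell process, which belongs to time \<open>T\<close>,
  inside the ball of the final graph, which is the same for all \<open>T\<close>.\<close>

lemma cell_relpow_embed: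
  assumes S: "cell_tree m K S" and g: "good_tree R K S" and ex: "explored T m K E d X w S D \<phi>"
    and T: "0 \<le> T" and A: "is_rdcp_edge_set E d X A" and "k \<le> R" "([], x) \<in> adj (S, cell_rdcp S D) ^^ k"
  shows "(w, \<phi> x) \<in> adj (V, A) ^^ k"
  using assms(6,7)
proof (induction k arbitrary: x)
  case 0
  then show ?case using ex by (simp add: explored_def)
next
  case (Suc k)
  then obtain y where y: "([], y) \<in> adj (S, cell_rdcp S D) ^^ k" "{y, x} \<in> cell_rdcp S D"
    by (auto simp: adj_def)
  then have IH: "(w, \<phi> y) \<in> adj (V, A) ^^ k" using Suc by simp
  obtain j where j: "j \<in> S - {[]}" "{y, x} = {butlast j, j}"
    using y(2) cell_rdcp_subset[OF finite_cell_tree[OF S]] unfolding tree_edges_def by blast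
  have "length x \<le> R" "length y \<le> R"
    using cell_relpow_length[OF S Suc.prems(2)] cell_relpow_length[OF S y(1)] Suc.prems(1) by auto
  then have "length j \<le> Suc R" using j(2) by (auto simp: doubleton_eq_iff)
  then have "{\<phi> (butlast j), \<phi> j} \<in> A"
    using cell_rdcp_edge_iff[OF S g ex T A j(1) sorted_drop_short] y(2) j(2) by simp
  moreover have "{\<phi> y, \<phi> x} = {\<phi> (butlast j), \<phi> j}" using j(2) by (auto simp: doubleton_eq_iff)
  ultimately have "(\<phi> y, \<phi> x) \<in> adj (V, A)" by (simp add: adj_def)
  with IH show ?case by auto
qed

context pwit_process
begin

lemma finite_root_ball:
  assumes n: "nice \<omega>"
  shows "finite {v. ([], v) \<in> adj (tree_verts, added \<omega> []) ^^ k} \<and>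
    {v. ([], v) \<in> adj (tree_verts, added \<omega> []) ^^ k} \<subseteq> tree_verts"
proof (induction k)
  case (Suc k)
  let ?B = "\<lambda>k. {v. ([], v) \<in> adj (tree_verts, added \<omega> []) ^^ k}"
  have nil: "[] \<in> tree_verts" by simp
  have sub: "?B (Suc k) \<subseteq> (\<Union>v\<in>?B k. \<Union>{f \<in> added \<omega> []. v \<in> f})"
    by (auto simp: adj_def)
  have pw: "added \<omega> [] \<subseteq> edges pwit" using added_subset[OF n nil] below_root by simp
  have "finite f \<and> f \<subseteq> tree_verts" if "f \<in> added \<omega> []" for f
  proof -
    have "f \<in> edges pwit" using that pw by blast
    then obtain i j where "f = {i, i @ [j]}" unfolding pwit_def by auto
    then have "finite f" by simp
    moreover have "f \<subseteq> tree_verts" using touching_edges(1)[OF \<open>f \<in> edges pwit\<close>] by blast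
    ultimately show ?thesis by blast
  qed
  moreover have "finite {f \<in> added \<omega> []. v \<in> f}" if "v \<in> ?B k" for v
    using finite_added_degree[OF n nil] Suc that by blast
  ultimately have "finite (\<Union>v\<in>?B k. \<Union>{f \<in> added \<omega> []. v \<in> f})"
    using Suc by (intro finite_UN_I finite_Union) auto
  moreover have "(\<Union>v\<in>?B k. \<Union>{f \<in> added \<omega> []. v \<in> f}) \<subseteq> tree_verts"
    using \<open>\<And>f. f \<in> added \<omega> [] \<Longrightarrow> finite f \<and> f \<subseteq> tree_verts\<close> by blast
  ultimately show ?case using sub by (meson finite_subset order_trans)
qed simp

lemma shape_root_explored:
  assumes n: "nice \<omega>" and T: "0 \<le> T" and m: "0 < m" and S: "cell_tree m K S"
    and \<omega>: "\<omega> \<in> shape_event T m K [] S D"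
  shows "explored T m K (edges pwit) (\<lambda>v. d v \<omega>) (\<lambda>e. X e \<omega>) [] S D (rank_path S)"
proof -
  have "regular \<omega>" using n by (simp add: nice_def)
  from shape_event_explored[OF this _ S T m \<omega>] show ?thesis by (simp add: below_root)
qed

text \<open>The ball of the final graph is finite, so all its vertices are saturated by some time.
  It contains the images of the balls of all good shapes found later.\<close>

lemma ball_saturated:
  assumes n: "nice \<omega>" and sat: "\<And>u. u \<in> tree_verts \<Longrightarrow> \<not> unsaturated \<omega> u u"
  shows "\<forall>\<^sub>F N in sequentially. \<forall>m K S D. 0 < m \<longrightarrow> cell_tree m K S \<longrightarrow> good_tree R K S \<longrightarrow>
    \<omega> \<in> shape_event (real N) m K [] S D \<longrightarrow> saturated_ball R S D"
proof -
  let ?B = "\<lambda>k. {v. ([], v) \<in> adj (tree_verts, added \<omega> []) ^^ k}"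
  have nil: "[] \<in> tree_verts" by simp
  have "\<forall>\<^sub>F N in sequentially. \<forall>v\<in>(\<Union>k\<le>R. ?B k). d v \<omega> \<le> card {f \<in> added \<omega> []. v \<in> f \<and> X f \<omega> \<le> real N}"
  proof (rule eventually_ball_finite)
    show "finite (\<Union>k\<le>R. ?B k)" using finite_root_ball[OF n] by (intro finite_UN_I) auto
    show "\<forall>v\<in>(\<Union>k\<le>R. ?B k). \<forall>\<^sub>F N in sequentially. d v \<omega> \<le> card {f \<in> added \<omega> []. v \<in> f \<and> X f \<omega> \<le> real N}"
    proof
      fix v assume "v \<in> (\<Union>k\<le>R. ?B k)"
      then obtain k where "v \<in> ?B k" by blast
      then have v: "v \<in> tree_verts" using finite_root_ball[OF n, of k] by (meson subsetD)
      show "\<forall>\<^sub>F N in sequentially. d v \<omega> \<le> card {f \<in> added \<omega> []. v \<in> f \<and> X f \<omega> \<le> real N}"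
        by (rule saturated_by_some_time[OF n nil v saturated_full_tree[OF n v sat[OF v]]])
    qed
  qed
  then show ?thesis
  proof eventually_elim
    case (elim N)
    show ?case
    proof (intro allI impI)
      fix m K S D assume m: "0 < m" and S: "cell_tree m K S" and g: "good_tree R K S"
        and \<omega>: "\<omega> \<in> shape_event (real N) m K [] S D"
      have ex: "explored (real N) m K (edges pwit) (\<lambda>v. d v \<omega>) (\<lambda>e. X e \<omega>) [] S D (rank_path S)"
        using shape_root_explored[OF n _ m S \<omega>] by simp
      have A: "is_rdcp_edge_set (edges pwit) (\<lambda>v. d v \<omega>) (\<lambda>e. X e \<omega>) (added \<omega> [])"
        using added_rdcp[OF n nil] by (simp add: below_root)
      show "saturated_ball R S D"
        unfolding saturated_ball_def
      proof
        fix x assume x: "x \<in> verts (cell_ball R S D)"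
        then obtain k where k: "k \<le> R" "([], x) \<in> adj (S, cell_rdcp S D) ^^ k"
          unfolding cell_ball_def verts_neighborhood by auto
        have "([], rank_path S x) \<in> adj (tree_verts, added \<omega> []) ^^ k"
          by (rule cell_relpow_embed[OF S g ex _ A k]) simp
        then have "d (rank_path S x) \<omega> \<le> card {f \<in> added \<omega> []. rank_path S x \<in> f \<and> X f \<omega> \<le> real N}"
          using elim k(1) by blast
        also have "\<dots> = card {f \<in> cell_rdcp S D. x \<in> f}"
          using cell_rdcp_degree(2)[OF S g ex _ A] cell_ball_length[OF S x] by simp
        also have "d (rank_path S x) \<omega> = D x"
          using ex cell_ball_length[OF S x] unfolding explored_def by simp
        finally show "D x \<le> card {f \<in> cell_rdcp S D. x \<in> f}" .
      qed
    qed
  qed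
qed

text \<open>The shapes of such a family decide the ball of radius \<open>R\<close> at time
  \<open>t\<close>: either \<open>T = t\<close>, or the ball is already saturated at time
  \<open>T\<close>.\<close>

definition determining :: "nat \<Rightarrow> ereal \<Rightarrow> real \<Rightarrow> nat \<Rightarrow> nat \<Rightarrow> (nat list set \<times> (nat list \<Rightarrow> nat)) set \<Rightarrow> bool" where
  "determining R t T m K F \<longleftrightarrow> 0 \<le> T \<and> ereal T \<le> t \<and> 0 < m \<and> finite F \<and> F \<subseteq> shapes m K \<and>
     (\<forall>(S, D)\<in>F. good_tree R K S \<and> (t \<le> ereal T \<or> saturated_ball R S D))"

text \<open>For finite \<open>t\<close>, take the good shapes at \<open>T = t\<close>. For
  \<open>t = \<infinity>\<close>, almost surely every good shape found at a large integer time has a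
  saturated ball. If such shapes had weight below \<open>1 - \<epsilon>\<close> at all integer
  times, the bound for the limit inferior would be violated.\<close>

lemma determining_shapes_exist:
  assumes t: "0 \<le> t" and \<epsilon>: "0 < \<epsilon>"
  shows "\<exists>T m K F. determining R t T m K F \<and> 1 - \<epsilon> \<le> weight_sum p T m K F"
proof (cases "t = \<infinity>")
  case False
  then obtain T where T: "t = ereal T" "0 \<le> T" using t by (cases t) auto
  obtain m K b where mK: "0 < m" "1 - \<epsilon> \<le> weight_sum p T m K (good_shapes R m K b)"
    using good_shapes_mass[OF T(2) \<epsilon>] by blast
  have "determining R t T m K (good_shapes R m K b)"
    using T mK(1) finite_good_shapes good_shapes_sub unfolding determining_def by (auto simp: good_shapes_def)
  then show ?thesis using mK(2) by blast
next
  case True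
  have "\<forall>n::nat. \<exists>mKb. 0 < fst mKb \<and> 1 - \<epsilon> / 2 \<le>
      weight_sum p (real n) (fst mKb) (fst (snd mKb)) (good_shapes R (fst mKb) (fst (snd mKb)) (snd (snd mKb)))"
  proof
    fix n :: nat
    obtain m K b where "0 < m" "1 - \<epsilon> / 2 \<le> weight_sum p (real n) m K (good_shapes R m K b)"
      using good_shapes_mass[of "real n" "\<epsilon> / 2" R] \<epsilon> by auto
    then show "\<exists>mKb. 0 < fst mKb \<and> 1 - \<epsilon> / 2 \<le>
      weight_sum p (real n) (fst mKb) (fst (snd mKb)) (good_shapes R (fst mKb) (fst (snd mKb)) (snd (snd mKb)))"
      by (intro exI[of _ "(m, K, b)"]) simp
  qed
  from choice[OF this] obtain mKb :: "nat \<Rightarrow> nat \<times> nat \<times> nat" where mKb: "\<forall>n. 0 < fst (mKb n) \<and> 1 - \<epsilon> / 2 \<le>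
      weight_sum p (real n) (fst (mKb n)) (fst (snd (mKb n)))
        (good_shapes R (fst (mKb n)) (fst (snd (mKb n))) (snd (snd (mKb n))))" ..
  define m where "m = (\<lambda>n. fst (mKb n))"
  define K where "K = (\<lambda>n. fst (snd (mKb n)))"
  define F where "F = (\<lambda>n. good_shapes R (m n) (K n) (snd (snd (mKb n))))"
  define G where "G = (\<lambda>n. {(S, D) \<in> F n. saturated_ball R S D})"
  define sh where "sh = (\<lambda>n. some_shape (real n) (m n) (K n) [])"
  have m: "0 < m n" and mass: "1 - \<epsilon> / 2 \<le> weight_sum p (real n) (m n) (K n) (F n)" for n
    using mKb unfolding m_def K_def F_def by blast+
  have F: "finite (F n)" "F n \<subseteq> shapes (m n) (K n)" for n
    unfolding F_def by (rule finite_good_shapes, rule good_shapes_sub)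
  have GF: "G n \<subseteq> F n" for n by (auto simp: G_def)
  then have G: "finite (G n)" "G n \<subseteq> shapes (m n) (K n)" for n
    using F finite_subset by blast+
  have shF: "sh n (F n) \<in> events" "1 - \<epsilon> / 2 \<le> prob (sh n (F n))" for n
    using prob_some_shape[of "[]", OF _ F[of n] _ m[of n], of "real n"] mass[of n] unfolding sh_def by auto
  have shG: "sh n (G n) \<in> events" "prob (sh n (G n)) = weight_sum p (real n) (m n) (K n) (G n)" for n
    using prob_some_shape[of "[]", OF _ G[of n] _ m[of n], of "real n"] unfolding sh_def by auto
  \<comment> \<open>A shape with saturated ball is found, or no shape of \<open>F n\<close> at all.
    Almost surely this holds for all large \<open>n\<close>.\<close>
  let ?D = "\<lambda>n. sh n (G n) \<union> (space P - sh n (F n))"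
  let ?L = "\<Union>N. \<Inter>n\<in>{N..}. ?D n"
  have D: "?D n \<in> events" for n using shF(1) shG(1) by blast
  have "\<exists>n. 1 - \<epsilon> \<le> weight_sum p (real n) (m n) (K n) (G n)"
  proof (rule ccontr)
    assume "\<nexists>n. 1 - \<epsilon> \<le> weight_sum p (real n) (m n) (K n) (G n)"
    then have less: "weight_sum p (real n) (m n) (K n) (G n) < 1 - \<epsilon>" for n by (simp add: not_le)
    have "prob (?D n) \<le> 1 - \<epsilon> / 2" for n
    proof -
      have "prob (?D n) \<le> prob (sh n (G n)) + prob (space P - sh n (F n))"
        using shF(1) shG(1) by (intro measure_Un_le) auto
      also have "prob (space P - sh n (F n)) \<le> \<epsilon> / 2" using prob_compl[OF shF(1)] shF(2)[of n] by simp
      finally show ?thesis using less[of n] shG(2)[of n] by linarith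
    qed
    then have "\<exists>\<^sub>F n in sequentially. prob (?D n) \<le> 1 - \<epsilon> / 2"
      by (intro frequently_sequentially[THEN iffD2]) auto
    note L = prob_liminf_le[OF D this]
    have "AE \<omega> in P. \<omega> \<in> ?L"
      using AE_nice AE_saturated
    proof eventually_elim
      case (elim \<omega>)
      have sp: "\<omega> \<in> space P" using elim by (simp add: nice_def)
      have "\<forall>\<^sub>F N in sequentially. \<omega> \<in> ?D N"
      proof (rule eventually_mono[OF ball_saturated[OF elim(1), of R]])
        fix u assume "u \<in> tree_verts" then show "\<not> unsaturated \<omega> u u" using elim(2) by blast
      next
        fix N assume N: "\<forall>m K S D. 0 < m \<longrightarrow> cell_tree m K S \<longrightarrow> good_tree R K S \<longrightarrow>
          \<omega> \<in> shape_event (real N) m K [] S D \<longrightarrow> saturated_ball R S D"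
        show "\<omega> \<in> ?D N"
        proof (cases "\<omega> \<in> sh N (F N)")
          case True
          then obtain S D where SD: "(S, D) \<in> F N" "\<omega> \<in> shape_event (real N) (m N) (K N) [] S D"
            unfolding sh_def some_shape_def by blast
          then have "saturated_ball R S D" using N m[of N] unfolding F_def good_shapes_def by blast
          then have "(S, D) \<in> G N" using SD(1) by (simp add: G_def)
          then show ?thesis using SD(2) unfolding sh_def some_shape_def by blast
        qed (use sp in blast)
      qed
      then show ?case unfolding eventually_sequentially by blast
    qed
    then have "prob ?L = 1" using L(1) by (intro prob_eq_1[THEN iffD2])
    then show False using L(2) \<epsilon> by simp
  qed
  then obtain n where n: "1 - \<epsilon> \<le> weight_sum p (real n) (m n) (K n) (G n)" by blast
  have "determining R t (real n) (m n) (K n) (G n)"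
    unfolding determining_def using m G True by (auto simp: G_def F_def good_shapes_def)
  then show ?thesis using n by blast
qed

lemma root_ball_iso:
  assumes n: "nice \<omega>" and F: "determining R t T m K F" and SD: "(S, D) \<in> F"
    and \<omega>: "\<omega> \<in> shape_event T m K [] S D"
  shows "rooted_iso (neighborhood R (component (rdcp_graph pwit (\<lambda>i. d i \<omega>) (\<lambda>e. X e \<omega>) t) []) []) [] H v \<longleftrightarrow>
    rooted_iso (cell_ball R S D) [] H v"
proof -
  have nil: "[] \<in> tree_verts" by simp
  have T: "0 \<le> T" "ereal T \<le> t" "0 < m" and S: "cell_tree m K S" and g: "good_tree R K S"
    and sat: "t \<le> ereal T \<or> saturated_ball R S D"
    using F SD unfolding determining_def shapes_def by blast+
  have A: "is_rdcp_edge_set (edges pwit) (\<lambda>v. d v \<omega>) (\<lambda>e. X e \<omega>) (added \<omega> [])"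
    using added_rdcp[OF n nil] by (simp add: below_root)
  have sg: "simple_graph pwit" "[] \<in> verts pwit"
    unfolding simple_graph_def by (fastforce simp: pwit_def)+
  have gr: "rdcp_graph pwit (\<lambda>i. d i \<omega>) (\<lambda>e. X e \<omega>) t = (verts pwit, {e \<in> added \<omega> []. ereal (X e \<omega>) \<le> t})"
    by (simp add: rdcp_graph_def added_def below_root)
  have "simple_graph (verts pwit, {e \<in> added \<omega> []. ereal (X e \<omega>) \<le> t})"
    using sg(1) A unfolding simple_graph_def is_rdcp_edge_set_def by auto
  from neighborhood_component[OF this]
  show ?thesis
    unfolding gr
    using rooted_iso_explored[OF S g shape_root_explored[OF n T(1,3) S \<omega>] T(1,2) A sg sat] by simp
qed

end

text \<open>Pairs of events that decide \<open>Q\<close> cover almost the whole space. In the limit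
  \<open>Q\<close> agrees almost surely with a countable union of events, so it is measurable in the
  completion, and then any deciding pair bounds its measure.\<close>

lemma (in prob_space) completion_measure_approx:
  assumes approx: "\<And>\<epsilon>. 0 < \<epsilon> \<Longrightarrow> \<exists>A\<in>events. \<exists>B\<in>events. (AE \<omega> in M. (\<omega> \<in> A \<longrightarrow> Q \<omega>) \<and> (\<omega> \<in> B \<longrightarrow> \<not> Q \<omega>)) \<and>
      1 - \<epsilon> \<le> prob (A \<union> B)"
    and A: "A \<in> events" and B: "B \<in> events" and AB: "AE \<omega> in M. (\<omega> \<in> A \<longrightarrow> Q \<omega>) \<and> (\<omega> \<in> B \<longrightarrow> \<not> Q \<omega>)"
  shows "prob A \<le> measure (completion M) {\<omega> \<in> space M. Q \<omega>}"
    and "measure (completion M) {\<omega> \<in> space M. Q \<omega>} \<le> 1 - prob B"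
proof -
  interpret C: prob_space "completion M" by (rule prob_space_completion)
  let ?Q = "{\<omega> \<in> space M. Q \<omega>}"
  have "\<forall>n::nat. \<exists>AB. fst AB \<in> events \<and> snd AB \<in> events \<and>
      (AE \<omega> in M. (\<omega> \<in> fst AB \<longrightarrow> Q \<omega>) \<and> (\<omega> \<in> snd AB \<longrightarrow> \<not> Q \<omega>)) \<and> 1 - inverse (real (Suc n)) \<le> prob (fst AB \<union> snd AB)"
  proof
    fix n :: nat
    obtain A B where "A \<in> events" "B \<in> events" "AE \<omega> in M. (\<omega> \<in> A \<longrightarrow> Q \<omega>) \<and> (\<omega> \<in> B \<longrightarrow> \<not> Q \<omega>)"
      "1 - inverse (real (Suc n)) \<le> prob (A \<union> B)"
      using approx[of "inverse (real (Suc n))"] by auto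
    then show "\<exists>AB. fst AB \<in> events \<and> snd AB \<in> events \<and>
      (AE \<omega> in M. (\<omega> \<in> fst AB \<longrightarrow> Q \<omega>) \<and> (\<omega> \<in> snd AB \<longrightarrow> \<not> Q \<omega>)) \<and> 1 - inverse (real (Suc n)) \<le> prob (fst AB \<union> snd AB)"
      by (intro exI[of _ "(A, B)"]) simp
  qed
  from choice[OF this] obtain AB where AB': "\<And>n. fst (AB n) \<in> events" "\<And>n. snd (AB n) \<in> events"
    "\<And>n. AE \<omega> in M. (\<omega> \<in> fst (AB n) \<longrightarrow> Q \<omega>) \<and> (\<omega> \<in> snd (AB n) \<longrightarrow> \<not> Q \<omega>)"
    "\<And>n::nat. 1 - inverse (real (Suc n)) \<le> prob (fst (AB n) \<union> snd (AB n))"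
    by blast
  have "AE \<omega> in M. \<omega> \<in> (\<Union>n. fst (AB n)) \<union> (\<Union>n. snd (AB n))"
  proof (rule AE_small_exceptions)
    fix \<eta> :: real assume \<eta>: "0 < \<eta>"
    have "\<forall>\<^sub>F n in sequentially. inverse (real (Suc n)) < \<eta>"
      using \<eta> LIMSEQ_inverse_real_of_nat by (intro order_tendstoD(2)) auto
    then obtain n where n: "inverse (real (Suc n)) < \<eta>" by (auto dest: eventually_happens)
    let ?E = "space M - (fst (AB n) \<union> snd (AB n))"
    have ev: "fst (AB n) \<union> snd (AB n) \<in> events" using AB'(1,2) by blast
    have "prob ?E \<le> \<eta>" using prob_compl[OF ev] AB'(4)[of n] n by linarith
    moreover have "AE \<omega> in M. \<omega> \<in> (\<Union>n. fst (AB n)) \<union> (\<Union>n. snd (AB n)) \<or> \<omega> \<in> ?E"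
      by (intro AE_I2) blast
    ultimately show "\<exists>E\<in>events. prob E \<le> \<eta> \<and> (AE \<omega> in M. \<omega> \<in> (\<Union>n. fst (AB n)) \<union> (\<Union>n. snd (AB n)) \<or> \<omega> \<in> E)"
      using ev by (intro bexI[of _ ?E]) auto
  qed
  moreover have "AE \<omega> in M. \<forall>n. (\<omega> \<in> fst (AB n) \<longrightarrow> Q \<omega>) \<and> (\<omega> \<in> snd (AB n) \<longrightarrow> \<not> Q \<omega>)"
    by (rule AE_all_countable[THEN iffD2]) (use AB'(3) in blast)
  ultimately have "AE \<omega> in M. \<omega> \<in> (\<Union>n. fst (AB n)) \<longleftrightarrow> \<omega> \<in> ?Q"
    using AE_space by eventually_elim blast
  then have "AE \<omega> in completion M. \<omega> \<in> (\<Union>n. fst (AB n)) \<longleftrightarrow> \<omega> \<in> ?Q" by (rule AE_completion)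
  then have Q: "?Q \<in> sets (completion M)"
    by (rule completion.in_sets_AE) (use AB'(1) in auto)
  have AB2: "AE \<omega> in completion M. (\<omega> \<in> A \<longrightarrow> Q \<omega>) \<and> (\<omega> \<in> B \<longrightarrow> \<not> Q \<omega>)" using AB by (rule AE_completion)
  have sp: "AE \<omega> in completion M. \<omega> \<in> space M" using AE_space[of "completion M"] by simp
  have "prob A = measure (completion M) A" using A by simp
  also have "\<dots> \<le> measure (completion M) ?Q"
  proof (rule C.finite_measure_mono_AE[OF _ Q])
    show "AE \<omega> in completion M. \<omega> \<in> A \<longrightarrow> \<omega> \<in> ?Q" using AB2 sp by eventually_elim blast
  qed
  finally show "prob A \<le> measure (completion M) ?Q" .
  have "measure (completion M) ?Q \<le> measure (completion M) (space M - B)"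
  proof (rule C.finite_measure_mono_AE)
    show "AE \<omega> in completion M. \<omega> \<in> ?Q \<longrightarrow> \<omega> \<in> space M - B" using AB2 sp by eventually_elim blast
    show "space M - B \<in> sets (completion M)" using B by (intro sets_completionI_sets) auto
  qed
  also have "\<dots> = prob (space M - B)" using B by (intro measure_completion) auto
  also have "\<dots> = 1 - prob B" by (rule prob_compl[OF B])
  finally show "measure (completion M) ?Q \<le> 1 - prob B" .
qed

text \<open>A shape in \<open>F\<close> decides the ball around its vertex. Shapes with the right
  ball bound \<open>Z\<close> from below and the others bound it from above, so lower bounds for
  frequencies serve both sides.\<close>

lemma iso_frequency_bounds:
  fixes G :: "'v graph" and H :: "nat graph"
    and d :: "'v \<Rightarrow> nat" and X :: "'v set \<Rightarrow> real" and v :: nat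
  assumes G: "simple_graph G" "finite (verts G)" "verts G \<noteq> {}"
    and T: "0 \<le> T" "ereal T \<le> t" and F: "finite F" "F \<subseteq> shapes m K"
    and good: "\<And>S D. (S, D) \<in> F \<Longrightarrow> good_tree R K S \<and> (t \<le> ereal T \<or> saturated_ball R S D)"
  defines "Z \<equiv> (\<Sum>w\<in>verts G. of_bool (rooted_iso (neighborhood R (rdcp_graph G d X t) w) w H v)) / real (card (verts G))"
  shows "freq_sum T m K G d X {(S, D) \<in> F. rooted_iso (cell_ball R S D) [] H v} \<le> Z"
    and "freq_sum T m K G d X {(S, D) \<in> F. \<not> rooted_iso (cell_ball R S D) [] H v} \<le> 1 - Z"
proof -
  let ?I = "\<lambda>w. rooted_iso (neighborhood R (rdcp_graph G d X t) w) w H v"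
  let ?h = "\<lambda>w S D. has_shape T m K (edges G) d X w S D"
  have iso: "?I w \<longleftrightarrow> rooted_iso (cell_ball R S D) [] H v" if w: "w \<in> verts G" and SD: "(S, D) \<in> F" and h: "?h w S D" for w S D
  proof -
    obtain \<phi> where ex: "explored T m K (edges G) d X w S D \<phi>" using h unfolding has_shape_def by blast
    have S: "cell_tree m K S" using SD F by (auto simp: shapes_def)
    have A: "is_rdcp_edge_set (edges G) d X (rdcp_edges (edges G) d X)"
      by (intro is_rdcp_edge_set_rdcp_edges finite_edges G)
    show ?thesis
      using rooted_iso_explored[OF S _ ex T A G(1) w, where H = H and v = v] good[OF SD] by (simp add: rdcp_graph_def)
  qed
  have N: "0 < real (card (verts G))" using G by (simp add: card_gt_0_iff)
  let ?F1 = "{(S, D) \<in> F. rooted_iso (cell_ball R S D) [] H v}"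
  let ?F0 = "{(S, D) \<in> F. \<not> rooted_iso (cell_ball R S D) [] H v}"
  have F1: "finite ?F1" "?F1 \<subseteq> shapes m K" and F0: "finite ?F0" "?F0 \<subseteq> shapes m K"
    using F by (auto intro: finite_subset[of _ F])
  have 1: "(\<Sum>w\<in>verts G. of_bool (\<exists>(S, D)\<in>?F1. ?h w S D)) \<le> (\<Sum>w\<in>verts G. of_bool (?I w) :: real)"
    using iso by (intro sum_mono) auto
  have 0: "(\<Sum>w\<in>verts G. of_bool (\<exists>(S, D)\<in>?F0. ?h w S D)) \<le> (\<Sum>w\<in>verts G. 1 - of_bool (?I w) :: real)"
    using iso by (intro sum_mono) auto
  show "freq_sum T m K G d X ?F1 \<le> Z"
    unfolding freq_sum_eq[OF F1 T(1)] Z_def using 1 N by (intro divide_right_mono) auto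
  have "freq_sum T m K G d X ?F0 \<le> (\<Sum>w\<in>verts G. 1 - of_bool (?I w)) / real (card (verts G))"
    unfolding freq_sum_eq[OF F0 T(1)] using 0 N by (intro divide_right_mono) auto
  also have "\<dots> = 1 - Z" using N by (simp add: Z_def sum_subtractf diff_divide_distrib)
  finally show "freq_sum T m K G d X ?F0 \<le> 1 - Z" .
qed

theorem theorem1p12:
  fixes G :: "nat \<Rightarrow> 'v graph" and r :: "nat \<Rightarrow> real"
    and p :: "nat pmf" and t :: ereal
    and M :: "nat \<Rightarrow> 'w measure"
    and d :: "nat \<Rightarrow> 'v \<Rightarrow> 'w \<Rightarrow> nat" and X :: "nat \<Rightarrow> 'v set \<Rightarrow> 'w \<Rightarrow> real"
    and P :: "'q measure"
    and d_inf :: "nat list \<Rightarrow> 'q \<Rightarrow> nat" and X_inf :: "nat list set \<Rightarrow> 'q \<Rightarrow> real"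
  assumes "high_degree_almost_regular G r"
    and "pmf p 0 = 0"
    and "0 \<le> t"
    and "\<And>n. 0 < r n \<Longrightarrow> rdcp_input_exponential (M n) p (1 / r n) (G n) (d n) (X n)"
    and "rdcp_input_pwit P p d_inf X_inf"
  shows "converges_locally_in_probability
           M (\<lambda>n \<omega>. rdcp_graph (G n) (\<lambda>v. d n v \<omega>) (\<lambda>e. X n e \<omega>) t)
           (completion P)
           (\<lambda>\<omega>. component (rdcp_graph pwit (\<lambda>i. d_inf i \<omega>) (\<lambda>e. X_inf e \<omega>) t) [])
           (\<lambda>_. [])"
proof -
  interpret Q: pwit_process P p d_inf X_inf by unfold_locales fact
  obtain W \<alpha> where "typical_vertices G W r \<alpha>" using typical_vertices_exist[OF assms(1)] .
  then interpret V: typical_vertices G W r \<alpha> .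
  have inp: "\<forall>n. 0 < r n \<longrightarrow> rdcp_input_exponential (M n) p (1 / r n) (G n) (d n) (X n)"
    using assms(4) by blast
  show ?thesis
    unfolding converges_locally_in_probability_def converges_in_probability_to_const_def
  proof (intro allI impI)
    fix H :: "nat graph" and v R and \<delta> :: real
    assume \<delta>: "0 < \<delta>"
    define Z where "Z = (\<lambda>n \<omega>. (\<Sum>w\<in>verts (rdcp_graph (G n) (\<lambda>v. d n v \<omega>) (\<lambda>e. X n e \<omega>) t).
        of_bool (rooted_iso (neighborhood R (rdcp_graph (G n) (\<lambda>v. d n v \<omega>) (\<lambda>e. X n e \<omega>) t) w) w H v)) /
        real (card (verts (rdcp_graph (G n) (\<lambda>v. d n v \<omega>) (\<lambda>e. X n e \<omega>) t))))"
    let ?Q = "\<lambda>\<omega>. rooted_iso (neighborhood R (component (rdcp_graph pwit (\<lambda>i. d_inf i \<omega>) (\<lambda>e. X_inf e \<omega>) t) []) []) [] H v"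
    define c where "c = measure (completion P) {\<omega> \<in> space P. ?Q \<omega>}"
    let ?F1 = "\<lambda>F. {(S, D) \<in> F. rooted_iso (cell_ball R S D) [] H v}"
    let ?F0 = "\<lambda>F. {(S, D) \<in> F. \<not> rooted_iso (cell_ball R S D) [] H v}"
    have split: "finite (?F1 F)" "?F1 F \<subseteq> shapes m K" "finite (?F0 F)" "?F0 F \<subseteq> shapes m K"
        "?F1 F \<inter> ?F0 F = {}" "?F1 F \<union> ?F0 F = F" if "Q.determining R t T m K F" for T m K F
      using that unfolding Q.determining_def by (auto intro: finite_subset[of _ F])
    have ev: "Q.some_shape T m K [] (?F1 F) \<in> Q.events" "Q.some_shape T m K [] (?F0 F) \<in> Q.events"
        "Q.prob (Q.some_shape T m K [] (?F1 F)) = weight_sum p T m K (?F1 F)"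
        "Q.prob (Q.some_shape T m K [] (?F0 F)) = weight_sum p T m K (?F0 F)"
        "Q.prob (Q.some_shape T m K [] (?F1 F) \<union> Q.some_shape T m K [] (?F0 F)) = weight_sum p T m K F"
      if F: "Q.determining R t T m K F" for T m K F
    proof -
      have T: "0 \<le> T" "0 < m" and FF: "finite F" "F \<subseteq> shapes m K" using F unfolding Q.determining_def by blast+
      have nil: "[] \<in> tree_verts" by simp
      show "Q.some_shape T m K [] (?F1 F) \<in> Q.events" "Q.some_shape T m K [] (?F0 F) \<in> Q.events"
        "Q.prob (Q.some_shape T m K [] (?F1 F)) = weight_sum p T m K (?F1 F)"
        "Q.prob (Q.some_shape T m K [] (?F0 F)) = weight_sum p T m K (?F0 F)"
        using Q.prob_some_shape[OF nil split(1,2)[OF F] T] Q.prob_some_shape[OF nil split(3,4)[OF F] T] by blast+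
      have "Q.some_shape T m K [] (?F1 F) \<union> Q.some_shape T m K [] (?F0 F) = Q.some_shape T m K [] F"
        unfolding Q.some_shape_def by blast
      then show "Q.prob (Q.some_shape T m K [] (?F1 F) \<union> Q.some_shape T m K [] (?F0 F)) = weight_sum p T m K F"
        using Q.prob_some_shape(2)[OF nil FF T] by simp
    qed
    have AE: "AE \<omega> in P. (\<omega> \<in> Q.some_shape T m K [] (?F1 F) \<longrightarrow> ?Q \<omega>) \<and> (\<omega> \<in> Q.some_shape T m K [] (?F0 F) \<longrightarrow> \<not> ?Q \<omega>)"
      if F: "Q.determining R t T m K F" for T m K F
      using Q.AE_nice
    proof eventually_elim
      case (elim \<omega>)
      show ?case
      proof (intro conjI impI)
        assume "\<omega> \<in> Q.some_shape T m K [] (?F1 F)"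
        then obtain S D where "(S, D) \<in> F" "rooted_iso (cell_ball R S D) [] H v" "\<omega> \<in> Q.shape_event T m K [] S D"
          unfolding Q.some_shape_def by auto
        then show "?Q \<omega>" using Q.root_ball_iso[OF elim F, where H = H and v = v] by simp
      next
        assume "\<omega> \<in> Q.some_shape T m K [] (?F0 F)"
        then obtain S D where "(S, D) \<in> F" "\<not> rooted_iso (cell_ball R S D) [] H v" "\<omega> \<in> Q.shape_event T m K [] S D"
          unfolding Q.some_shape_def by auto
        then show "\<not> ?Q \<omega>" using Q.root_ball_iso[OF elim F, where H = H and v = v] by simp
      qed
    qed
    have c: "weight_sum p T m K (?F1 F) \<le> c" "c \<le> 1 - weight_sum p T m K (?F0 F)"
      if F: "Q.determining R t T m K F" for T m K F
    proof -
      \<comment> \<open>Families of weight close to \<open>1\<close> settle the measurability of the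
        limit event; the bounds for \<open>c\<close> are then those of the given
        \<open>F\<close>.\<close>
      have approx: "\<exists>A\<in>Q.events. \<exists>B\<in>Q.events. (AE \<omega> in P. (\<omega> \<in> A \<longrightarrow> ?Q \<omega>) \<and> (\<omega> \<in> B \<longrightarrow> \<not> ?Q \<omega>)) \<and>
          1 - \<epsilon> \<le> Q.prob (A \<union> B)" if \<epsilon>: "0 < \<epsilon>" for \<epsilon>
      proof -
        obtain T m K F where F: "Q.determining R t T m K F" "1 - \<epsilon> \<le> weight_sum p T m K F"
          using Q.determining_shapes_exist[OF assms(3) \<epsilon>] by blast
        show ?thesis
        proof (intro bexI conjI)
          show "1 - \<epsilon> \<le> Q.prob (Q.some_shape T m K [] (?F1 F) \<union> Q.some_shape T m K [] (?F0 F))"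
            using F(2) ev(5)[OF F(1)] by simp
        qed (rule AE[OF F(1)] ev(1,2)[OF F(1)])+
      qed
      show "weight_sum p T m K (?F1 F) \<le> c" "c \<le> 1 - weight_sum p T m K (?F0 F)"
        using Q.completion_measure_approx[OF approx ev(1,2)[OF F] AE[OF F]] ev(3,4)[OF F] unfolding c_def by simp_all
    qed
    have "(\<lambda>n. measure (M n) {\<omega> \<in> space (M n). \<delta> < \<bar>Z n \<omega> - c\<bar>}) \<longlonglongrightarrow> 0"
    proof (rule order_tendstoI)
      fix \<kappa> :: real assume "\<kappa> < 0"
      then show "\<forall>\<^sub>F n in sequentially. \<kappa> < measure (M n) {\<omega> \<in> space (M n). \<delta> < \<bar>Z n \<omega> - c\<bar>}"
        by (intro always_eventually allI) (meson less_le_trans measure_nonneg)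
    next
      fix \<kappa> :: real assume \<kappa>: "0 < \<kappa>"
      \<comment> \<open>The bound \<open>\<delta> / 2\<close> controls the mass outside
        \<open>F\<close>. The two deviation bounds
        \<open>11 * \<epsilon> / (\<delta> / 2)\<^sup>2\<close> add up to
        \<open>88 * \<epsilon> / \<delta>\<^sup>2\<close>, and \<open>176\<close> makes this at most
        \<open>\<kappa> / 2\<close>.\<close>
      define \<epsilon> where "\<epsilon> = min (min 1 (\<delta> / 2)) (\<kappa> * \<delta>\<^sup>2 / 176)"
      have \<epsilon>: "0 < \<epsilon>" "\<epsilon> \<le> 1" "\<epsilon> \<le> \<delta> / 2" "\<epsilon> \<le> \<kappa> * \<delta>\<^sup>2 / 176" using \<delta> \<kappa> by (auto simp: \<epsilon>_def)
      obtain T m K F where F: "Q.determining R t T m K F" and mass: "1 - \<epsilon> \<le> weight_sum p T m K F"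
        using Q.determining_shapes_exist[OF assms(3) \<epsilon>(1)] by blast
      have T: "0 \<le> T" "ereal T \<le> t" and FF: "finite F" "F \<subseteq> shapes m K"
        and good: "\<And>S D. (S, D) \<in> F \<Longrightarrow> good_tree R K S \<and> (t \<le> ereal T \<or> saturated_ball R S D)"
        using F unfolding Q.determining_def by blast+
      note sp = split[OF F]
      have sum: "weight_sum p T m K F = weight_sum p T m K (?F1 F) + weight_sum p T m K (?F0 F)"
        unfolding weight_sum_def using sp by (subst sp(6)[symmetric], intro sum.union_disjoint) auto
      have \<delta>2: "0 < \<delta> / 2" using \<delta> by simp
      have m1: "1 - \<epsilon> \<le> weight_sum p T m K (?F1 F \<union> ?F0 F)" "1 - \<epsilon> \<le> weight_sum p T m K (?F0 F \<union> ?F1 F)"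
        using mass sp(6) by (simp_all add: Un_commute)
      have sp5: "?F0 F \<inter> ?F1 F = {}" using sp(5) by blast
      have ev1: "\<forall>\<^sub>F n in sequentially. 1 \<le> r n" using V.r_lim unfolding filterlim_at_top by blast
      have ev2: "\<forall>\<^sub>F n in sequentially. 1 \<le> real (card (verts (G n)))"
        using V.card_lim unfolding filterlim_at_top by blast
      show "\<forall>\<^sub>F n in sequentially. measure (M n) {\<omega> \<in> space (M n). \<delta> < \<bar>Z n \<omega> - c\<bar>} < \<kappa>"
        using V.freq_sum_concentration[OF inp T(1) \<epsilon>(1,2) \<delta>2 sp(1,2,3,4,5) m1(1)]
          V.freq_sum_concentration[OF inp T(1) \<epsilon>(1,2) \<delta>2 sp(3,4,1,2) sp5 m1(2)] ev1 ev2
      proof eventually_elim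
        case (elim n)
        then have rn: "0 < r n" by simp
        interpret Mn: prob_space "M n" using inp rn by (simp add: rdcp_input_exponential_def)
        let ?f = "\<lambda>F \<omega>. freq_sum T m K (G n) (\<lambda>v. d n v \<omega>) (\<lambda>e. X n e \<omega>) F"
        let ?B = "\<lambda>F. {\<omega> \<in> space (M n). ?f F \<omega> < weight_sum p T m K F - \<delta> / 2}"
        have [measurable]: "?f (?F1 F) \<in> borel_measurable (M n)" "?f (?F0 F) \<in> borel_measurable (M n)"
          using borel_measurable_freq_sum[OF inp[rule_format, OF rn] V.finite_verts V.simple] sp by blast+
        have B: "?B (?F1 F) \<in> Mn.events" "?B (?F0 F) \<in> Mn.events" by measurable
        have ne: "verts (G n) \<noteq> {}" using elim(4) by auto
        \<comment> \<open>Let \<open>w1\<close> and \<open>w0\<close> be the weights of the two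
          parts of \<open>F\<close>. Off the bad events, \<open>Z\<close> lies between
          \<open>w1 - \<delta> / 2\<close> and \<open>1 - w0 + \<delta> / 2\<close>. Since
          \<open>c\<close> lies between \<open>w1\<close> and \<open>1 - w0\<close>, which differ by
          at most \<open>\<epsilon> \<le> \<delta> / 2\<close>, the distance from \<open>Z\<close>
          to \<open>c\<close> is at most \<delta>.\<close>
        have "{\<omega> \<in> space (M n). \<delta> < \<bar>Z n \<omega> - c\<bar>} \<subseteq> ?B (?F1 F) \<union> ?B (?F0 F)"
        proof
          fix \<omega> assume \<omega>: "\<omega> \<in> {\<omega> \<in> space (M n). \<delta> < \<bar>Z n \<omega> - c\<bar>}"
          have "?f (?F1 F) \<omega> \<le> Z n \<omega>" "?f (?F0 F) \<omega> \<le> 1 - Z n \<omega>"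
            using iso_frequency_bounds[OF V.simple V.finite_verts ne T FF good, where H = H and v = v]
            unfolding Z_def by (simp_all add: rdcp_graph_def)
          then show "\<omega> \<in> ?B (?F1 F) \<union> ?B (?F0 F)"
            using \<omega> c[OF F] sum mass \<epsilon>(3) by (auto simp: abs_if split: if_splits)
        qed
        then have "Mn.prob {\<omega> \<in> space (M n). \<delta> < \<bar>Z n \<omega> - c\<bar>} \<le> Mn.prob (?B (?F1 F) \<union> ?B (?F0 F))"
          using B by (intro Mn.finite_measure_mono) auto
        also have "\<dots> \<le> Mn.prob (?B (?F1 F)) + Mn.prob (?B (?F0 F))" using B by (intro measure_Un_le)
        also have "\<dots> \<le> 2 * (11 * \<epsilon> / (\<delta> / 2)\<^sup>2)" using elim(1,2) by simp
        also have "\<dots> = 88 * \<epsilon> / \<delta>\<^sup>2" using \<delta> by (simp add: power2_eq_square field_simps)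
        also have "\<dots> \<le> \<kappa> / 2" using \<epsilon>(4) \<delta> by (simp add: field_simps)
        also have "\<dots> < \<kappa>" using \<kappa> by simp
        finally show ?case .
      qed
    qed
    then show "(\<lambda>n. measure (M n) {\<omega> \<in> space (M n). \<delta> <
        \<bar>(\<Sum>w\<in>verts (rdcp_graph (G n) (\<lambda>v. d n v \<omega>) (\<lambda>e. X n e \<omega>) t).
        of_bool (rooted_iso (neighborhood R (rdcp_graph (G n) (\<lambda>v. d n v \<omega>) (\<lambda>e. X n e \<omega>) t) w) w H v)) /
        real (card (verts (rdcp_graph (G n) (\<lambda>v. d n v \<omega>) (\<lambda>e. X n e \<omega>) t))) -
        measure (completion P) {\<omega> \<in> space (completion P). ?Q \<omega>}\<bar>}) \<longlonglongrightarrow> 0"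
      unfolding Z_def c_def by simp
  qed
qed

end
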